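(* The three-dimensional analogue of Turbiner's conjecture is false in general: there exists a second-order Lie algebraic operator $\mathcal H_0$ on $\mathbb R^3$, generated by the Lie algebra $\mathfrak a_3$ of infinitesimal affine transformations of $\mathbb R^3$ (spanned by the operators $\partial_{x},\partial_y,\partial_z$ and $x^i\partial_{x^j}$, $1\le i,j\le 3$, with $(x^1,x^2,x^3)=(x,y,z)$), such that 1. $\mathcal H_0$ is gauge equivalent to a Schr\"odinger operator $\mathcal H$; 2. the contravariant metric induced by $\mathcal H_0$ has identically vanishing Riemannian curvature tensor where it is positive definite; 3. the Schr\"odinger equation $\mathcal H\psi=E\psi$ cannot be solved, even partially, by separation of variables. Moreover the generating operators act in a primitive way, i.e. they admit no invariant foliation.
   Context: An operator is Lie algebraic (of second order), generated by a Lie algebra of first order operators with basis $T_1,\dots,T_m$, if it has the form $\sum_{i,j} C^{ij}T_iT_j+\sum_k L^kT_k$ with real constants $C^{ij}=C^{ji}$, $L^k$. The contravariant metric induced by a second order operator is, up to a constant normalization factor, the symmetric tensor $g^{(ij)}$ of coefficients of its second order part; it may degenerate along a proper analytic subset, and $\Delta$ denotes the Laplace-Beltrami operator of the metric where it is non-degenerate. A Schr\"odinger operator is (up to normalization) $-\Delta+U$ with $U$ a function. Two operators are gauge equivalent if one is $e^{\mu}\circ(\cdot)\circ e^{-\mu}$ applied to the other, for some function $\mu$. Turbiner's conjecture (as reformulated by Milson) states in dimension two: if the symbol of a Lie algebraic Schr\"odinger operator $H$ engenders a Euclidean geometry (zero curvature), then the spectral equation $H\psi=E\psi$ can be solved by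 a separation of variables; the three-dimensional analogue is the same statement on a three-dimensional manifold. Separation of variables is understood with respect to the eleven orthogonal coordinate systems of Euclidean $3$-space in which the Schr\"odinger equation can be separated: Cartesian, circular cylinder, elliptic cylinder, parabolic cylinder, spherical, conical, parabolic, prolate spheroidal, oblate spheroidal, paraboloidal and ellipsoidal coordinates. Partial separation means that the equation separates into two equations, one involving only one variable and the other involving the remaining variables. *)

theory Defs
  imports "HOL-Analysis.Analysis"
begin

type_synonym pt = "real^3"
type_synonym scalar_field = "pt \<Rightarrow> real"
type_synonym vector_field = "pt \<Rightarrow> pt"
type_synonym operator = "scalar_field \<Rightarrow> scalar_field"

section \<open>Smooth functions and differential operators\<close>

definition pd :: "3 \<Rightarrow> operator" where
  "pd i f x = frechet_derivative f (at x) (axis i 1)"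

text \<open>The predicates below are meant for open sets \<open>S\<close>.\<close>

primrec Ck_on :: "nat \<Rightarrow> pt set \<Rightarrow> scalar_field \<Rightarrow> bool" where
  "Ck_on 0 S f \<longleftrightarrow> continuous_on S f"
| "Ck_on (Suc k) S f \<longleftrightarrow> (\<forall>x\<in>S. f differentiable (at x)) \<and> (\<forall>i. Ck_on k S (pd i f))"

definition smooth_on :: "pt set \<Rightarrow> scalar_field \<Rightarrow> bool" where
  "smooth_on S f \<longleftrightarrow> (\<forall>k. Ck_on k S f)"

definition smooth_map_on :: "pt set \<Rightarrow> vector_field \<Rightarrow> bool" where
  "smooth_map_on S X \<longleftrightarrow> (\<forall>i. smooth_on S (\<lambda>x. X x $ i))"

definition diff_op :: "(pt \<Rightarrow> real^3^3) \<Rightarrow> vector_field \<Rightarrow> scalar_field \<Rightarrow> operator" where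
  "diff_op a b c f x =
     (\<Sum>i\<in>UNIV. \<Sum>j\<in>UNIV. a x $ i $ j * pd i (pd j f) x)
     + (\<Sum>i\<in>UNIV. b x $ i * pd i f x) + c x * f x"

definition vf_op :: "vector_field \<Rightarrow> operator" where
  "vf_op X f x = (\<Sum>i\<in>UNIV. X x $ i * pd i f x)"

definition bracket :: "vector_field \<Rightarrow> vector_field \<Rightarrow> vector_field" where
  "bracket X Y = (\<lambda>x. \<chi> k. vf_op X (\<lambda>z. Y z $ k) x - vf_op Y (\<lambda>z. X z $ k) x)"

section \<open>Lie algebraic operators and the affine algebra\<close>

definition lie_algebraic_op ::
  "('t::finite \<Rightarrow> operator) \<Rightarrow> ('t \<Rightarrow> 't \<Rightarrow> real) \<Rightarrow> ('t \<Rightarrow> real) \<Rightarrow> operator" where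
  "lie_algebraic_op T C L f x =
     (\<Sum>i\<in>UNIV. \<Sum>j\<in>UNIV. C i j * T i (T j f) x) + (\<Sum>k\<in>UNIV. L k * T k f x)"

text \<open>The twelve affine vector fields: \<open>Inl j\<close> is the translation in direction \<open>j\<close>,
  \<open>Inr (i, j)\<close> is \<open>x\<^sup>i\<close> times that translation.\<close>

fun affine_field :: "3 + 3 \<times> 3 \<Rightarrow> vector_field" where
  "affine_field (Inl j) x = axis j 1"
| "affine_field (Inr (i, j)) x = (x $ i) *\<^sub>R axis j 1"

definition gauge_equivalent_on :: "pt set \<Rightarrow> operator \<Rightarrow> operator \<Rightarrow> bool" where
  "gauge_equivalent_on S P Q \<longleftrightarrow>
     (\<exists>\<mu>. smooth_on S \<mu> \<and>
        (\<forall>f. smooth_on S f \<longrightarrow>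
           (\<forall>x\<in>S. Q f x = exp (\<mu> x) * P (\<lambda>z. exp (- \<mu> z) * f z) x)))"

section \<open>The metric of a second order operator\<close>

text \<open>Throughout, \<open>G\<close> is a contravariant metric.  It is normalized so that minus the
  Laplace-Beltrami operator of \<open>G\<close> induces \<open>G\<close>.\<close>

definition induces_metric :: "operator \<Rightarrow> (pt \<Rightarrow> real^3^3) \<Rightarrow> bool" where
  "induces_metric P G \<longleftrightarrow>
     (\<forall>x. transpose (G x) = G x) \<and>
     (\<exists>b c. \<forall>f. smooth_on UNIV f \<longrightarrow> P f = diff_op (\<lambda>x. - G x) b c f)"

definition pos_def :: "real^3^3 \<Rightarrow> bool" where
  "pos_def A \<longleftrightarrow> transpose A = A \<and> (\<forall>v. v \<noteq> 0 \<longrightarrow> v \<bullet> (A *v v) > 0)"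

definition pos_region :: "(pt \<Rightarrow> real^3^3) \<Rightarrow> pt set" where
  "pos_region G = {x. pos_def (G x)}"

definition nondeg_region :: "(pt \<Rightarrow> real^3^3) \<Rightarrow> pt set" where
  "nondeg_region G = {x. det (G x) \<noteq> 0}"

definition covariant :: "(pt \<Rightarrow> real^3^3) \<Rightarrow> pt \<Rightarrow> real^3^3" where
  "covariant G x = matrix_inv (G x)"

definition christoffel :: "(pt \<Rightarrow> real^3^3) \<Rightarrow> 3 \<Rightarrow> 3 \<Rightarrow> 3 \<Rightarrow> scalar_field" where
  "christoffel G k i j x =
     (1/2) * (\<Sum>l\<in>UNIV. G x $ k $ l *
        (pd i (\<lambda>z. covariant G z $ j $ l) x + pd j (\<lambda>z. covariant G z $ i $ l) x
         - pd l (\<lambda>z. covariant G z $ i $ j) x))"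

definition riemann :: "(pt \<Rightarrow> real^3^3) \<Rightarrow> 3 \<Rightarrow> 3 \<Rightarrow> 3 \<Rightarrow> 3 \<Rightarrow> scalar_field" where
  "riemann G l i j k x =
     pd j (christoffel G l i k) x - pd k (christoffel G l i j) x
     + (\<Sum>m\<in>UNIV. christoffel G l j m x * christoffel G m i k x
                 - christoffel G l k m x * christoffel G m i j x)"

definition laplace_beltrami :: "(pt \<Rightarrow> real^3^3) \<Rightarrow> operator" where
  "laplace_beltrami G f x =
     (let vol = (\<lambda>z. sqrt \<bar>det (covariant G z)\<bar>) in
      (1 / vol x) *
      (\<Sum>i\<in>UNIV. pd i (\<lambda>z. vol z * (\<Sum>j\<in>UNIV. G z $ i $ j * pd j f z)) x))"

definition schroedinger_op :: "(pt \<Rightarrow> real^3^3) \<Rightarrow> scalar_field \<Rightarrow> operator" where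
  "schroedinger_op G U f x = - laplace_beltrami G f x + U x * f x"

section \<open>Separation of variables\<close>

definition depends_only :: "3 set \<Rightarrow> (pt \<Rightarrow> 'a) \<Rightarrow> bool" where
  "depends_only B h \<longleftrightarrow> (\<forall>u v. (\<forall>i\<in>B. u $ i = v $ i) \<longrightarrow> h u = h v)"

definition second_order_op_in :: "3 set \<Rightarrow> operator \<Rightarrow> bool" where
  "second_order_op_in B L \<longleftrightarrow>
     (\<exists>a b c. depends_only B a \<and> depends_only B b \<and> depends_only B c \<and>
        (\<forall>u i j. i \<notin> B \<or> j \<notin> B \<longrightarrow> a u $ i $ j = 0) \<and>
        (\<forall>u i. i \<notin> B \<longrightarrow> b u $ i = 0) \<and>
        L = diff_op a b c)"

text \<open>Separation of the equation \<open>P \<psi> = 0\<close> on \<open>W\<close>, in the coordinates \<open>u\<close>, according to a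
  partition \<open>\<B>\<close> of the three variables.  On products \<open>\<psi> = (\<Prod>B\<in>\<B>. A B) \<circ> u\<close> the equation is
  a combination, with nowhere vanishing multipliers \<open>F B\<close>, of the separated equations
  \<open>L B (A B) + (\<Sum>m. k m * s B m) * A B = 0\<close>, the one for \<open>B\<close> involving only the variables in
  \<open>B\<close>.  The \<open>card \<B> - 1\<close> numbers \<open>k m\<close> are the separation constants; they are arbitrary,
  and they enter the separated equations independently.  For the blocks \<open>{i}\<close> and
  \<open>- {i}\<close> this amounts to \<open>F * P (A * B) = B * L1 A + A * L2 B\<close>; for three singletons it is
  the separation of Staeckel type, which is needed for the ellipsoidal and paraboloidal
  systems.\<close>

definition separates_into ::
  "3 set set \<Rightarrow> operator \<Rightarrow> (pt \<Rightarrow> pt) \<Rightarrow> pt set \<Rightarrow> bool" where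
  "separates_into \<B> P u W \<longleftrightarrow>
     (\<exists>L s F.
        (\<forall>B\<in>\<B>. second_order_op_in B (L B)) \<and>
        (\<forall>B\<in>\<B>. \<forall>m. depends_only B (s B m)) \<and>
        (\<forall>x\<in>W. \<forall>B\<in>\<B>. F B x \<noteq> 0) \<and>
        (\<forall>x\<in>W. \<forall>k :: nat \<Rightarrow> real.
           (\<forall>B\<in>\<B>. (\<Sum>m<card \<B> - 1. k m * s B m (u x)) = 0) \<longrightarrow>
           (\<forall>m<card \<B> - 1. k m = 0)) \<and>
        (\<forall>A k. (\<forall>B\<in>\<B>. smooth_on UNIV (A B) \<and> depends_only B (A B)) \<longrightarrow>
           (\<forall>x\<in>W. P (\<lambda>z. \<Prod>B\<in>\<B>. A B (u z)) x =
              (\<Sum>B\<in>\<B>. F B x *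
                 (L B (A B) (u x) + (\<Sum>m<card \<B> - 1. k m * s B m (u x)) * A B (u x)) *
                 (\<Prod>B'\<in>\<B> - {B}. A B' (u x))))))"

definition separates_completely :: "operator \<Rightarrow> (pt \<Rightarrow> pt) \<Rightarrow> pt set \<Rightarrow> bool" where
  "separates_completely P u W \<longleftrightarrow> separates_into {{1}, {2}, {3}} P u W"

definition separates_partially :: "operator \<Rightarrow> (pt \<Rightarrow> pt) \<Rightarrow> pt set \<Rightarrow> bool" where
  "separates_partially P u W \<longleftrightarrow> (\<exists>i. separates_into {{i}, - {i}} P u W)"

text \<open>\<open>separation_system \<Omega> \<Psi>\<close>: \<open>\<Psi>\<close> expresses the Cartesian coordinates through the curvilinear
  ones, which range over \<open>\<Omega>\<close>.  Only one octant is covered where square roots occur; the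
  position of the system in space is left to the choice of the Cartesian coordinates
  below.\<close>

inductive separation_system :: "pt set \<Rightarrow> (pt \<Rightarrow> pt) \<Rightarrow> bool" where
  cartesian:
    "separation_system UNIV (\<lambda>u. u)"
| circular_cylinder:
    "separation_system {u. u$1 > 0}
       (\<lambda>u. vector [u$1 * cos (u$2), u$1 * sin (u$2), u$3])"
| elliptic_cylinder:
    "d > 0 \<Longrightarrow> separation_system {u. u$1 > 0}
       (\<lambda>u. vector [d * cosh (u$1) * cos (u$2), d * sinh (u$1) * sin (u$2), u$3])"
| parabolic_cylinder:
    "separation_system {u. u$1 > 0}
       (\<lambda>u. vector [((u$1)\<^sup>2 - (u$2)\<^sup>2) / 2, u$1 * u$2, u$3])"
| spherical:
    "separation_system {u. u$1 > 0 \<and> 0 < u$2 \<and> u$2 < pi}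
       (\<lambda>u. vector [u$1 * sin (u$2) * cos (u$3), u$1 * sin (u$2) * sin (u$3), u$1 * cos (u$2)])"
| conical:
    "a < b \<Longrightarrow> b < c \<Longrightarrow>
     separation_system {u. u$1 > 0 \<and> a < u$2 \<and> u$2 < b \<and> b < u$3 \<and> u$3 < c}
       (\<lambda>u. vector [u$1 * sqrt ((u$2 - a) * (u$3 - a) / ((b - a) * (c - a))),
                    u$1 * sqrt ((u$2 - b) * (u$3 - b) / ((a - b) * (c - b))),
                    u$1 * sqrt ((u$2 - c) * (u$3 - c) / ((a - c) * (b - c)))])"
| parabolic:
    "separation_system {u. u$1 > 0 \<and> u$2 > 0}
       (\<lambda>u. vector [u$1 * u$2 * cos (u$3), u$1 * u$2 * sin (u$3), ((u$1)\<^sup>2 - (u$2)\<^sup>2) / 2])"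
| prolate_spheroidal:
    "d > 0 \<Longrightarrow> separation_system {u. u$1 > 0 \<and> 0 < u$2 \<and> u$2 < pi}
       (\<lambda>u. vector [d * sinh (u$1) * sin (u$2) * cos (u$3),
                    d * sinh (u$1) * sin (u$2) * sin (u$3),
                    d * cosh (u$1) * cos (u$2)])"
| oblate_spheroidal:
    "d > 0 \<Longrightarrow> separation_system {u. u$1 > 0 \<and> 0 < u$2 \<and> u$2 < pi}
       (\<lambda>u. vector [d * cosh (u$1) * sin (u$2) * cos (u$3),
                    d * cosh (u$1) * sin (u$2) * sin (u$3),
                    d * sinh (u$1) * cos (u$2)])"
| paraboloidal:
    "a < b \<Longrightarrow>
     separation_system {u. u$1 < a \<and> a < u$2 \<and> u$2 < b \<and> b < u$3}
       (\<lambda>u. vector [2 * sqrt ((b - u$1) * (b - u$2) * (u$3 - b) / (b - a)),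
                    2 * sqrt ((a - u$1) * (u$2 - a) * (u$3 - a) / (b - a)),
                    a + b - u$1 - u$2 - u$3])"
| ellipsoidal:
    "a < b \<Longrightarrow> b < c \<Longrightarrow>
     separation_system {u. a < u$1 \<and> u$1 < b \<and> b < u$2 \<and> u$2 < c \<and> c < u$3}
       (\<lambda>u. vector [sqrt ((u$1 - a) * (u$2 - a) * (u$3 - a) / ((b - a) * (c - a))),
                    sqrt ((u$1 - b) * (u$2 - b) * (u$3 - b) / ((a - b) * (c - b))),
                    sqrt ((u$1 - c) * (u$2 - c) * (u$3 - c) / ((a - c) * (b - c)))])"

definition cartesian_chart :: "(pt \<Rightarrow> real^3^3) \<Rightarrow> pt set \<Rightarrow> (pt \<Rightarrow> pt) \<Rightarrow> bool" where
  "cartesian_chart G W y \<longleftrightarrow>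
     open W \<and> W \<noteq> {} \<and> W \<subseteq> pos_region G \<and> smooth_map_on W y \<and> inj_on y W \<and>
     (\<forall>x\<in>W. \<forall>a b.
        (\<Sum>i\<in>UNIV. \<Sum>j\<in>UNIV. G x $ i $ j * pd i (\<lambda>z. y z $ a) x * pd j (\<lambda>z. y z $ b) x)
        = (if a = b then 1 else 0))"

definition separation_chart :: "(pt \<Rightarrow> real^3^3) \<Rightarrow> pt set \<Rightarrow> (pt \<Rightarrow> pt) \<Rightarrow> bool" where
  "separation_chart G W u \<longleftrightarrow>
     (\<exists>y \<Omega> \<Psi>. cartesian_chart G W y \<and> separation_system \<Omega> \<Psi> \<and>
        smooth_map_on W u \<and> u ` W \<subseteq> \<Omega> \<and> (\<forall>x\<in>W. \<Psi> (u x) = y x))"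

text \<open>Separability is a local notion here: a single nonempty open set on which the equation
  separates completely or partially is enough.\<close>

definition solvable_by_separation ::
  "(pt \<Rightarrow> real^3^3) \<Rightarrow> operator \<Rightarrow> real \<Rightarrow> bool" where
  "solvable_by_separation G H E \<longleftrightarrow>
     (\<exists>W u. separation_chart G W u \<and>
        (separates_completely (\<lambda>\<psi> x. H \<psi> x - E * \<psi> x) u W \<or>
         separates_partially (\<lambda>\<psi> x. H \<psi> x - E * \<psi> x) u W))"

section \<open>Primitive actions\<close>

text \<open>A foliation is represented by its tangent distribution \<open>D\<close>: locally the leaves are the
  level sets of a submersion \<open>(f 0, \<dots>, f (r - 1))\<close>, where \<open>r\<close> is the codimension.\<close>

definition foliation_on :: "pt set \<Rightarrow> nat \<Rightarrow> (pt \<Rightarrow> pt set) \<Rightarrow> bool" where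
  "foliation_on W r D \<longleftrightarrow>
     (\<forall>p\<in>W. \<exists>V f. open V \<and> p \<in> V \<and> V \<subseteq> W \<and>
        (\<forall>m<r. smooth_on V (f m)) \<and>
        (\<forall>q\<in>V. D q = {v. \<forall>m<r. frechet_derivative (f m) (at q) v = 0} \<and> dim (D q) = 3 - r))"

definition invariant_distribution_on :: "pt set \<Rightarrow> vector_field \<Rightarrow> (pt \<Rightarrow> pt set) \<Rightarrow> bool" where
  "invariant_distribution_on W T D \<longleftrightarrow>
     (\<forall>V X. open V \<and> V \<subseteq> W \<and> smooth_map_on V X \<and> (\<forall>q\<in>V. X q \<in> D q) \<longrightarrow>
        (\<forall>q\<in>V. bracket T X q \<in> D q))"

definition acts_primitively :: "('t \<Rightarrow> vector_field) \<Rightarrow> bool" where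
  "acts_primitively T \<longleftrightarrow>
     (\<nexists>W r D. open W \<and> W \<noteq> {} \<and> r \<in> {1, 2} \<and> foliation_on W r D \<and>
        (\<forall>t. invariant_distribution_on W (T t) D))"

end

(* HEADER *)
theory Submission
  imports Defs "HOL-Complex_Analysis.Conformal_Mappings"
begin

section \<open>Partial derivatives and smoothness\<close>

text \<open>The operator is the trigonometric Calogero-Sutherland Hamiltonian of the root system D3,
  written in invariant coordinates. Let \<open>y\<close> be Cartesian coordinates,
  \<open>c_a = cos y_a\<close>, and let \<open>x = orbit_map y\<close> consist of the elementary
  symmetric functions of the \<open>c_a\<close>. The products of the gradients of the
  \<open>x^i\<close> are polynomials in \<open>x\<close> of degree at most two
  (\<open>orbit_jac_gram\<close>); they form the matrix \<open>cometric\<close>, which is therefore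
  flat where it is nondegenerate. In \<open>y\<close> the Schroedinger operator is
  \<open>- Delta + (sum over b of 1 / sin^2 (b . y)) - 20\<close>, where \<open>b\<close> runs over
  the six half roots \<open>(e_a + e_b) / 2\<close> and \<open>(e_a - e_b) / 2\<close>. It
  annihilates \<open>|disc|\<close>, where \<open>disc\<close> is the squared Vandermonde product of
  the \<open>c_a\<close>, and conjugation by this function turns it into an operator without zeroth
  order term whose first order coefficients have degree one (\<open>gauge_hamiltonian\<close>).
  Quadratic expressions in the affine fields produce coefficients of just these degrees
  (\<open>hamiltonian_eq\<close>). Flatness is proved algebraically
  (\<open>riemann_cometric\<close>): the contravariant Christoffel symbols are polynomial, and
  metric compatibility, symmetry and zero curvature become polynomial identities.

  Suppose that the equation separates on some open set. Every Cartesian chart is locally inverse to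
  \<open>orbit_map\<close> composed with a motion (\<open>orbit_map_onto_pos_region\<close>,
  \<open>local_isometry_affine\<close>, \<open>cartesian_chart_inverse\<close>), so the potential
  becomes a function \<open>V\<close> of a Euclidean variable \<open>q\<close>, with rotated vectors
  \<open>b\<close> and shifted phases. Comparison of symbols (\<open>separation_symbol\<close>)
  gives \<open>V - E\<close> the form of a sum of \<open>f_i(u_i) |grad u_i|^2\<close>, or of two
  such terms, one for each block, if the separation is partial. For a suitable weight
  \<open>w\<close> (\<open>1\<close>, the squared radius, the squared distance from an axis, or
  \<open>u_i - u_j\<close>) the product \<open>w (V - E)\<close> is a sum of a function free of
  \<open>u_j\<close> and one free of \<open>u_i\<close>, so a mixed derivative vanishes
  (\<open>mixed_derivative\<close>). In Cartesian terms this is an equation of Bertrand-Darboux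
  type, \<open>[Hess V, K] + L . grad V = 0\<close>, with \<open>K\<close> a polynomial matrix
  diagonal in the coordinate frame: of rank one for translations, dilations and rotations
  (\<open>no_rank_one_tensor\<close>), and with the confocal coordinates as eigenvalues in the
  ellipsoidal and paraboloidal systems (\<open>no_confocal_separation\<close>). The remaining
  partial separations fail because a ratio of scale factors depends on the variable that is split
  off (\<open>partial_form_ratio\<close>).

  The potential admits no such \<open>K\<close>. On the line \<open>q + s b_j\<close> the term of
  \<open>b_j\<close> has fourth order poles at infinitely many \<open>s\<close>, with the commutator
  of \<open>b_j b_j^T\<close> and \<open>K\<close> in the leading coefficient. This commutator is
  polynomial on the line, hence zero, and \<open>b_j\<close> is an eigenvector of \<open>K\<close>
  at generic \<open>q\<close>. The \<open>b_j\<close> span and are sufficiently non-orthogonal, so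
  \<open>K\<close> is a multiple of the identity there (\<open>scalar_at_generic_point\<close>),
  which none of the matrices above is.

  Primitivity: if \<open>X\<close> is tangent to an invariant foliation and nonzero at
  \<open>p\<close>, its brackets with \<open>d_j\<close> and \<open>x^i d_j\<close> combine to
  \<open>X^i(p) d_j\<close>, so every direction is tangent
  (\<open>acts_primitively_affine\<close>).\<close>

lemma pd_eq: "(f has_derivative f') (at x) \<Longrightarrow> pd i f x = f' (axis i 1)"
  unfolding pd_def by (metis frechet_derivative_at)

lemma sum_axis[simp]: "(\<Sum>j\<in>UNIV. axis i 1 $ j * h j) = (h i :: real)"
proof -
  have "(\<Sum>j\<in>UNIV. axis i 1 $ j * h j) = (\<Sum>j\<in>UNIV. if j = i then h j else 0)"
    by (rule sum.cong) (auto simp: axis_def)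
  then show ?thesis by simp
qed

lemma frechet_derivative_pd:
  assumes "f differentiable (at x)"
  shows "frechet_derivative f (at x) v = (\<Sum>i\<in>UNIV. v $ i * pd i f x)"
proof -
  have "(f has_derivative frechet_derivative f (at x)) (at x)"
    using assms frechet_derivative_works by blast
  then have lin: "linear (frechet_derivative f (at x))"
    by (rule has_derivative_linear)
  have "v = (\<Sum>i\<in>UNIV. v $ i *\<^sub>R axis i 1)"
    by (simp add: vec_eq_iff axis_def if_distrib cong: if_cong)
  then have "frechet_derivative f (at x) v
      = frechet_derivative f (at x) (\<Sum>i\<in>UNIV. v $ i *\<^sub>R axis i 1)"
    by simp
  also have "\<dots> = (\<Sum>i\<in>UNIV. v $ i * pd i f x)"
    using lin by (simp add: linear_sum linear_cmul pd_def)
  finally show ?thesis .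
qed

lemma has_derivative_pd:
  assumes "f differentiable (at x)"
  shows "(f has_derivative (\<lambda>v. \<Sum>i\<in>UNIV. v $ i * pd i f x)) (at x)"
  using assms unfolding frechet_derivative_works frechet_derivative_pd[OF assms, abs_def] .

lemma pd_cong:
  assumes "open S" "x \<in> S" "\<And>z. z \<in> S \<Longrightarrow> f z = g z"
  shows "pd i f x = pd i g x"
proof -
  have "((f has_derivative D) (at x)) = ((g has_derivative D) (at x))" for D
    using has_derivative_transform_within_open[OF _ assms(1,2), of f D UNIV g]
      has_derivative_transform_within_open[OF _ assms(1,2), of g D UNIV f] assms(3) by auto
  then show ?thesis unfolding pd_def frechet_derivative_def by simp
qed

lemma differentiable_cong:
  assumes "open S" "x \<in> S" "\<And>z. z \<in> S \<Longrightarrow> f z = g z"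
  shows "f differentiable (at x) \<longleftrightarrow> g differentiable (at x)"
  unfolding differentiable_def
  using has_derivative_transform_within_open[OF _ assms(1,2), of f _ UNIV g]
      has_derivative_transform_within_open[OF _ assms(1,2), of g _ UNIV f] assms(3) by auto

lemma differentiable_component[simp]: "(\<lambda>x. x $ i :: real) differentiable (at (x :: pt))"
  by (intro bounded_linear_imp_differentiable bounded_linear_vec_nth)

lemma pd_const[simp]: "pd i (\<lambda>x. c) x = 0"
  by (rule pd_eq[where f'="\<lambda>_. 0", simplified]) (auto intro: derivative_eq_intros)

lemma pd_component[simp]: "pd i (\<lambda>x. x $ j) x = (if i = j then 1 else 0)"
  by (subst pd_eq[OF bounded_linear_imp_has_derivative[OF bounded_linear_vec_nth]])
     (auto simp: axis_def)

context
  fixes f g :: scalar_field and x :: pt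
  assumes f: "f differentiable (at x)" and g: "g differentiable (at x)"
begin

lemma pd_add: "pd i (\<lambda>x. f x + g x) x = pd i f x + pd i g x"
  using has_derivative_add[OF has_derivative_pd[OF f] has_derivative_pd[OF g]]
  by (subst pd_eq, assumption) simp

lemma pd_diff: "pd i (\<lambda>x. f x - g x) x = pd i f x - pd i g x"
  using has_derivative_diff[OF has_derivative_pd[OF f] has_derivative_pd[OF g]]
  by (subst pd_eq, assumption) simp

lemma pd_mult: "pd i (\<lambda>x. f x * g x) x = f x * pd i g x + pd i f x * g x"
  using has_derivative_mult[OF has_derivative_pd[OF f] has_derivative_pd[OF g]]
  by (subst pd_eq, assumption) simp

end

lemma pd_chain:
  assumes f: "f differentiable (at x)" and h: "(h has_real_derivative h') (at (f x))"
  shows "pd i (\<lambda>x. h (f x)) x = h' * pd i f x"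
proof -
  have "((\<lambda>x. h (f x)) has_derivative (\<lambda>v. h' * (\<Sum>i\<in>UNIV. v $ i * pd i f x))) (at x)"
    using has_derivative_compose[OF has_derivative_pd[OF f], of h "(*) h'"] h
    by (simp add: has_field_derivative_def)
  from pd_eq[OF this] show ?thesis by simp
qed

lemma pd_minus:
  "f differentiable (at x) \<Longrightarrow> pd i (\<lambda>x. - f x) x = - pd i f x"
  using pd_chain[of f x uminus "-1" i, OF _ DERIV_minus[OF DERIV_ident]] by simp

lemma pd_cmult:
  "f differentiable (at x) \<Longrightarrow> pd i (\<lambda>x. c * f x) x = c * pd i f x"
  by (subst pd_mult) auto

lemma pd_power:
  assumes "f differentiable (at x)"
  shows "pd i (\<lambda>x. f x ^ n) x = of_nat n * f x ^ (n - 1) * pd i f x"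
  by (rule pd_chain[OF assms]) (auto intro!: derivative_eq_intros)

lemma pd_inverse:
  assumes "f differentiable (at x)" "f x \<noteq> 0"
  shows "pd i (\<lambda>x. inverse (f x)) x = - (inverse (f x))\<^sup>2 * pd i f x"
  by (rule pd_chain[OF assms(1)])
     (use assms(2) in \<open>auto intro!: derivative_eq_intros simp: power2_eq_square\<close>)

lemma pd_sum:
  assumes "finite I" "\<And>j. j \<in> I \<Longrightarrow> f j differentiable (at x)"
  shows "pd i (\<lambda>x. \<Sum>j\<in>I. f j x) x = (\<Sum>j\<in>I. pd i (f j) x)"
  using assms
  by (induction rule: finite_induct) (auto simp: pd_add)

text \<open>Derivatives at points of an open set depend only on the values in the set, so a formula
  valid only on \<open>S\<close> may replace the function before it is differentiated again.\<close>

lemma Ck_on_cong: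
  assumes "open S" "\<And>z. z \<in> S \<Longrightarrow> f z = g z"
  shows "Ck_on k S f \<longleftrightarrow> Ck_on k S g"
  using assms(2)
proof (induction k arbitrary: f g)
  case 0 then show ?case by (simp cong: continuous_on_cong)
next
  case (Suc k)
  have "Ck_on k S (pd i f) = Ck_on k S (pd i g)" for i
    by (rule Suc.IH) (use Suc.prems pd_cong[OF assms(1)] in blast)
  moreover have "f differentiable (at z) \<longleftrightarrow> g differentiable (at z)" if "z \<in> S" for z
    by (rule differentiable_cong[OF assms(1) that]) (use Suc.prems in blast)
  ultimately show ?case by auto
qed

lemma Ck_on_Suc: "Ck_on (Suc k) S f \<Longrightarrow> Ck_on k S f"
proof (induction k arbitrary: f)
  case 0
  then show ?case
    by (auto intro!: continuous_at_imp_continuous_on differentiable_imp_continuous_within)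
qed auto

lemma Ck_on_subset: "Ck_on k S f \<Longrightarrow> T \<subseteq> S \<Longrightarrow> Ck_on k T f"
  by (induction k arbitrary: f) (auto intro: continuous_on_subset)

lemma Ck_on_const: "Ck_on k S (\<lambda>x. c)"
proof (induction k arbitrary: c)
  case (Suc k)
  have "pd i (\<lambda>x. c) = (\<lambda>x. 0)" for i by (rule ext) simp
  with Suc show ?case by simp
qed simp

lemma Ck_on_component: "Ck_on k S (\<lambda>x. x $ i)"
proof (cases k)
  case (Suc n)
  have "pd j (\<lambda>x. x $ i) = (\<lambda>x. if j = i then 1 else 0)" for j by (rule ext) simp
  with Suc show ?thesis by (simp add: Ck_on_const)
qed (auto intro: continuous_intros)

lemma Ck_on_add:
  assumes "open S" "Ck_on k S f" "Ck_on k S g"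
  shows "Ck_on k S (\<lambda>x. f x + g x)"
  using assms(2,3)
proof (induction k arbitrary: f g)
  case (Suc k)
  have "Ck_on k S (\<lambda>x. pd i f x + pd i g x)" for i using Suc by simp
  moreover have "pd i (\<lambda>x. f x + g x) z = pd i f z + pd i g z" if "z \<in> S" for z i
    using Suc that by (simp add: pd_add)
  ultimately have "Ck_on k S (pd i (\<lambda>x. f x + g x))" for i
    by (subst Ck_on_cong[OF assms(1)])
  then show ?case using Suc by simp
qed (auto intro: continuous_intros)

lemma Ck_on_mult:
  assumes "open S" "Ck_on k S f" "Ck_on k S g"
  shows "Ck_on k S (\<lambda>x. f x * g x)"
  using assms(2,3)
proof (induction k arbitrary: f g)
  case (Suc k)
  have "Ck_on k S f" "Ck_on k S g" using Suc.prems by (auto intro: Ck_on_Suc)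
  then have "Ck_on k S (\<lambda>x. f x * pd i g x + pd i f x * g x)" for i
    using Suc by (auto intro!: Ck_on_add assms(1))
  moreover have "pd i (\<lambda>x. f x * g x) z = f z * pd i g z + pd i f z * g z" if "z \<in> S" for z i
    using Suc that by (simp add: pd_mult)
  ultimately have "Ck_on k S (pd i (\<lambda>x. f x * g x))" for i
    by (subst Ck_on_cong[OF assms(1)])
  then show ?case using Suc by simp
qed (auto intro: continuous_intros)

lemma Ck_on_inverse:
  assumes "open S" "Ck_on k S f" "\<And>z. z \<in> S \<Longrightarrow> f z \<noteq> 0"
  shows "Ck_on k S (\<lambda>x. inverse (f x))"
  using assms(2)
proof (induction k)
  case (Suc k)
  have "Ck_on k S f" using Suc.prems by (auto intro: Ck_on_Suc)
  then have "Ck_on k S (\<lambda>x. (- 1) * (inverse (f x) * inverse (f x) * pd i f x))" for i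
    using Suc by (intro Ck_on_mult Ck_on_const assms(1)) auto
  moreover have "pd i (\<lambda>x. inverse (f x)) z = (- 1) * (inverse (f z) * inverse (f z) * pd i f z)"
    if "z \<in> S" for z i
    using Suc that assms(3) by (simp add: pd_inverse power2_eq_square)
  ultimately have "Ck_on k S (pd i (\<lambda>x. inverse (f x)))" for i
    by (subst Ck_on_cong[OF assms(1)])
  then show ?case using Suc assms(3) by (auto intro: differentiable_inverse)
qed (use assms in \<open>auto intro: continuous_intros\<close>)

lemma smooth_on_subset: "smooth_on S f \<Longrightarrow> T \<subseteq> S \<Longrightarrow> smooth_on T f"
  unfolding smooth_on_def using Ck_on_subset by blast

lemma smooth_on_const[simp]: "smooth_on S (\<lambda>x. c)"
  and smooth_on_component[simp]: "smooth_on S (\<lambda>x. x $ i)"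
  unfolding smooth_on_def by (auto intro: Ck_on_const Ck_on_component)

lemma smooth_on_cong:
  "open S \<Longrightarrow> (\<And>z. z \<in> S \<Longrightarrow> f z = g z) \<Longrightarrow> smooth_on S f \<longleftrightarrow> smooth_on S g"
  unfolding smooth_on_def using Ck_on_cong by blast

lemma smooth_on_differentiable: "smooth_on S f \<Longrightarrow> x \<in> S \<Longrightarrow> f differentiable (at x)"
  unfolding smooth_on_def by (metis Ck_on.simps(2))

lemma smooth_on_pd: "smooth_on S f \<Longrightarrow> smooth_on S (pd i f)"
  unfolding smooth_on_def by (metis Ck_on.simps(2))

text \<open>Meant for \<open>ln \<bar>disc x\<bar>\<close>, whose first derivatives are rational
  functions.\<close>

lemma smooth_onI_pd:
  "(\<And>x. x \<in> S \<Longrightarrow> f differentiable (at x)) \<Longrightarrow> (\<And>i. smooth_on S (pd i f)) \<Longrightarrow> smooth_on S f"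
  unfolding smooth_on_def
proof
  fix k
  assume *: "\<And>x. x \<in> S \<Longrightarrow> f differentiable (at x)" "\<And>i. \<forall>k. Ck_on k S (pd i f)"
  then have "Ck_on (Suc k) S f" by simp
  then show "Ck_on k S f" by (rule Ck_on_Suc)
qed

lemma smooth_on_imp_continuous_on: "smooth_on S f \<Longrightarrow> continuous_on S f"
  unfolding smooth_on_def by (metis Ck_on.simps(1))

context
  fixes S :: "pt set"
  assumes S: "open S"
begin

lemma smooth_on_add: "smooth_on S f \<Longrightarrow> smooth_on S g \<Longrightarrow> smooth_on S (\<lambda>x. f x + g x)"
  and smooth_on_mult: "smooth_on S f \<Longrightarrow> smooth_on S g \<Longrightarrow> smooth_on S (\<lambda>x. f x * g x)"
  and smooth_on_inverse:
    "smooth_on S f \<Longrightarrow> (\<And>z. z \<in> S \<Longrightarrow> f z \<noteq> 0) \<Longrightarrow> smooth_on S (\<lambda>x. inverse (f x))"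
  unfolding smooth_on_def using S by (auto intro: Ck_on_add Ck_on_mult Ck_on_inverse)

lemma smooth_on_minus: "smooth_on S f \<Longrightarrow> smooth_on S (\<lambda>x. - f x)"
  using smooth_on_mult[of "\<lambda>_. - 1" f] by simp

lemma smooth_on_diff: "smooth_on S f \<Longrightarrow> smooth_on S g \<Longrightarrow> smooth_on S (\<lambda>x. f x - g x)"
  using smooth_on_add[of f "\<lambda>x. - g x"] by (simp add: smooth_on_minus)

lemma smooth_on_power: "smooth_on S f \<Longrightarrow> smooth_on S (\<lambda>x. f x ^ n)"
  by (induction n) (auto intro: smooth_on_mult)

lemma smooth_on_divide:
  "smooth_on S f \<Longrightarrow> smooth_on S g \<Longrightarrow> (\<And>z. z \<in> S \<Longrightarrow> g z \<noteq> 0) \<Longrightarrow> smooth_on S (\<lambda>x. f x / g x)"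
  using smooth_on_mult[of f "\<lambda>x. inverse (g x)"] by (simp add: smooth_on_inverse divide_inverse)

end

lemmas smooth_intros = smooth_on_add smooth_on_mult smooth_on_minus smooth_on_diff
  smooth_on_power smooth_on_divide smooth_on_inverse smooth_on_pd

lemma UNIV_3_all: "(\<forall>i::3. P i) \<longleftrightarrow> P 1 \<and> P 2 \<and> P 3"
  by (metis exhaust_3)

section \<open>The metric\<close>

text \<open>The coordinates \<open>x\<close> are the elementary symmetric functions of \<open>c\<^sub>a = cos y\<^sub>a\<close>, and
  \<open>cometric\<close> is the matrix of the products of the gradients with respect to \<open>y\<close>, that is,
  \<open>\<Sum>a. (1 - c\<^sub>a\<^sup>2) * (\<partial>x\<^sup>i/\<partial>c\<^sub>a) * (\<partial>x\<^sup>j/\<partial>c\<^sub>a)\<close>.\<close>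

definition cometric :: "pt \<Rightarrow> real^3^3" where
  "cometric x = vector [
     vector [3 + 2 * x$2 - x$1 * x$1, 2 * x$1 + 3 * x$3 - x$1 * x$2, x$2 - x$1 * x$3],
     vector [2 * x$1 + 3 * x$3 - x$1 * x$2,
       2 * x$1 * x$1 - 2 * x$2 - 2 * x$2 * x$2 + 2 * x$1 * x$3,
       x$1 * x$2 - 3 * x$3 - 2 * x$2 * x$3],
     vector [x$2 - x$1 * x$3, x$1 * x$2 - 3 * x$3 - 2 * x$2 * x$3,
       x$2 * x$2 - 2 * x$1 * x$3 - 3 * x$3 * x$3]]"

text \<open>The contravariant Christoffel symbols \<open>- (\<Sum>m. G\<^sup>i\<^sup>m \<Gamma>\<^sup>j\<^sub>m\<^sub>k)\<close>, indexed as \<open>$ k $ i $ j\<close>; they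
  are given by the invariant forms \<open>\<Sum>a. (\<partial>x\<^sup>i/\<partial>y\<^sub>a) d(\<partial>x\<^sup>j/\<partial>y\<^sub>a)\<close> and hence are polynomial.\<close>

definition contra_christoffel :: "pt \<Rightarrow> real^3^3^3" where
  "contra_christoffel x = vector [
     vector [vector [- x$1, 2, 0], vector [- x$2, 2 * x$1 + x$3, 0], vector [- x$3, x$2, - x$3]],
     vector [vector [1, - x$1, 1], vector [0, - 1 - 2 * x$2, x$1], vector [0, - 2 * x$3, x$2]],
     vector [vector [0, 2, - x$1], vector [1, x$1, - 2 - 2 * x$2],
       vector [0, - 1, - x$1 - 3 * x$3]]]"

lemmas differentiable_simps = differentiable_add differentiable_diff differentiable_mult
  differentiable_minus differentiable_power differentiable_sum
lemmas pd_simps = pd_add pd_diff pd_mult pd_minus pd_power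

lemma cometric_sym: "cometric x $ i $ j = cometric x $ j $ i"
proof -
  have "\<forall>i j. cometric x $ i $ j = cometric x $ j $ i"
    by (simp add: forall_3 cometric_def)
  then show ?thesis by blast
qed

lemma cometric_differentiable[simp]: "(\<lambda>z. cometric z $ i $ j) differentiable (at x)"
proof -
  have "\<forall>i j. (\<lambda>z. cometric z $ i $ j) differentiable (at x)"
    by (simp add: forall_3 cometric_def differentiable_simps)
  then show ?thesis by blast
qed

lemma contra_differentiable[simp]: "(\<lambda>z. contra_christoffel z $ k $ i $ j) differentiable (at x)"
proof -
  have "\<forall>k i j. (\<lambda>z. contra_christoffel z $ k $ i $ j) differentiable (at x)"
    by (simp add: forall_3 contra_christoffel_def differentiable_simps)
  then show ?thesis by blast
qed

text \<open>This is compatibility of the connection with the metric. In contravariant form it is,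
  like the next two identities, free of denominators and checked by expansion.\<close>

lemma pd_cometric:
  "pd k (\<lambda>z. cometric z $ i $ j) x
   = contra_christoffel x $ k $ i $ j + contra_christoffel x $ k $ j $ i"
proof -
  have "\<forall>k i j. pd k (\<lambda>z. cometric z $ i $ j) x
   = contra_christoffel x $ k $ i $ j + contra_christoffel x $ k $ j $ i"
    by (simp add: forall_3 contra_christoffel_def cometric_def differentiable_simps pd_simps)
  then show ?thesis by blast
qed

text \<open>Absence of torsion: once both lower indices of the Christoffel symbol are raised, its
  symmetry is this exchange of \<open>i\<close> and \<open>j\<close>.\<close>

lemma contra_torsion_free:
  "(\<Sum>s\<in>UNIV. cometric x $ i $ s * contra_christoffel x $ s $ j $ k)
   = (\<Sum>s\<in>UNIV. cometric x $ j $ s * contra_christoffel x $ s $ i $ k)"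
proof -
  have "\<forall>i j k. (\<Sum>s\<in>UNIV. cometric x $ i $ s * contra_christoffel x $ s $ j $ k)
   = (\<Sum>s\<in>UNIV. cometric x $ j $ s * contra_christoffel x $ s $ i $ k)"
    by (simp add: forall_3 sum_3 contra_christoffel_def cometric_def algebra_simps)
  then show ?thesis by blast
qed

text \<open>Vanishing of the curvature with two lower indices raised. The symbols are affine in
  \<open>x\<close>, so the derivatives on the right are constants.\<close>

lemma contra_flat:
  "(\<Sum>s\<in>UNIV. contra_christoffel x $ j $ s $ i * contra_christoffel x $ s $ n $ l)
   - (\<Sum>s\<in>UNIV. contra_christoffel x $ s $ n $ i * contra_christoffel x $ j $ s $ l)
   = (\<Sum>k\<in>UNIV. cometric x $ n $ k * (pd j (\<lambda>z. contra_christoffel z $ k $ i $ l) x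
        - pd k (\<lambda>z. contra_christoffel z $ j $ i $ l) x))"
proof -
  have "\<forall>j i n l. (\<Sum>s\<in>UNIV. contra_christoffel x $ j $ s $ i * contra_christoffel x $ s $ n $ l)
   - (\<Sum>s\<in>UNIV. contra_christoffel x $ s $ n $ i * contra_christoffel x $ j $ s $ l)
   = (\<Sum>k\<in>UNIV. cometric x $ n $ k * (pd j (\<lambda>z. contra_christoffel z $ k $ i $ l) x
        - pd k (\<lambda>z. contra_christoffel z $ j $ i $ l) x))"
    by (simp add: forall_3 sum_3 contra_christoffel_def cometric_def differentiable_simps pd_simps)
       (simp add: algebra_simps)
  then show ?thesis by blast
qed

section \<open>Flatness\<close>

text \<open>The adjugate, spelled out so that the entries of the inverse metric are visibly
  polynomials divided by \<open>det\<close>.\<close>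

definition adj3 :: "real^3^3 \<Rightarrow> real^3^3" where
  "adj3 A = vector [
     vector [A$2$2 * A$3$3 - A$2$3 * A$3$2, A$1$3 * A$3$2 - A$1$2 * A$3$3,
       A$1$2 * A$2$3 - A$1$3 * A$2$2],
     vector [A$2$3 * A$3$1 - A$2$1 * A$3$3, A$1$1 * A$3$3 - A$1$3 * A$3$1,
       A$1$3 * A$2$1 - A$1$1 * A$2$3],
     vector [A$2$1 * A$3$2 - A$2$2 * A$3$1, A$1$2 * A$3$1 - A$1$1 * A$3$2,
       A$1$1 * A$2$2 - A$1$2 * A$2$1]]"

lemma mult_adj3: "A ** adj3 A = det A *\<^sub>R mat 1"
  by (simp add: vec_eq_iff forall_3 matrix_matrix_mult_def sum_3 adj3_def det_3 mat_def)
     (simp add: algebra_simps)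

lemma matrix_inv_inverse:
  fixes A :: "real^'n^'n"
  assumes "det A \<noteq> 0"
  shows "A ** matrix_inv A = mat 1" "matrix_inv A ** A = mat 1"
proof -
  have "\<exists>B. A ** B = mat 1 \<and> B ** A = mat 1"
    using assms invertible_det_nz[of A] by (simp add: invertible_def)
  then show "A ** matrix_inv A = mat 1" "matrix_inv A ** A = mat 1"
    unfolding matrix_inv_def by (metis (mono_tags, lifting) someI_ex)+
qed

lemma matrix_inv_adj3:
  fixes A :: "real^3^3"
  assumes "det A \<noteq> 0"
  shows "matrix_inv A $ i $ j = adj3 A $ i $ j / det A"
proof -
  have "adj3 A = (matrix_inv A ** A) ** adj3 A"
    by (simp add: matrix_inv_inverse[OF assms])
  also have "\<dots> = matrix_inv A ** (det A *\<^sub>R mat 1)"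
    by (simp add: matrix_mul_assoc[symmetric] mult_adj3)
  also have "\<dots> $ i $ j = det A * matrix_inv A $ i $ j"
    by (simp add: matrix_matrix_mult_def mat_def if_distrib cong: if_cong)
  finally show ?thesis using assms by simp
qed

lemma det_cometric_differentiable[simp]: "(\<lambda>z. det (cometric z)) differentiable (at x)"
  unfolding det_3 by (simp add: differentiable_simps)

lemma open_nondeg_region: "open (nondeg_region cometric)"
proof -
  have "continuous_on UNIV (\<lambda>z. det (cometric z))"
    by (auto intro!: continuous_at_imp_continuous_on differentiable_imp_continuous_within)
  then show ?thesis
    unfolding nondeg_region_def by (rule open_Collect_neq) auto
qed

text \<open>A positive definite form has trivial kernel.\<close>

lemma pos_region_subset: "pos_region G \<subseteq> nondeg_region G"
proof
  fix x assume "x \<in> pos_region G"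
  then have pd: "v \<noteq> 0 \<Longrightarrow> v \<bullet> (G x *v v) > 0" for v
    by (simp add: pos_region_def pos_def_def)
  have "inj ((*v) (G x))"
    using pd by (metis inner_zero_right less_irrefl matrix_left_invertible_injective
        matrix_left_invertible_ker)
  then have "det (G x) \<noteq> 0"
    by (metis det_nz_iff_inj matrix_of_matrix_vector_mul matrix_vector_mul_linear)
  then show "x \<in> nondeg_region G" by (simp add: nondeg_region_def)
qed

lemma covariant_inverse:
  assumes "x \<in> nondeg_region G"
  shows "covariant G x ** G x = mat 1" "G x ** covariant G x = mat 1"
  using assms by (auto simp: covariant_def nondeg_region_def matrix_inv_inverse)

lemma covariant_sums:
  assumes "x \<in> nondeg_region G"
  shows "(\<Sum>s\<in>UNIV. covariant G x $ i $ s * G x $ s $ j) = (if i = j then 1 else 0)"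
    and "(\<Sum>s\<in>UNIV. G x $ i $ s * covariant G x $ s $ j) = (if i = j then 1 else 0)"
  using covariant_inverse[OF assms] unfolding matrix_matrix_mult_def mat_def vec_eq_iff by auto

lemma covariant_differentiable:
  assumes "x \<in> nondeg_region cometric"
  shows "(\<lambda>z. covariant cometric z $ i $ j) differentiable (at x)"
proof -
  have "(\<lambda>z. adj3 (cometric z) $ i $ j) differentiable (at x)"
  proof -
    have "\<forall>i j. (\<lambda>z. adj3 (cometric z) $ i $ j) differentiable (at x)"
      by (simp add: adj3_def forall_3 differentiable_simps)
    then show ?thesis by blast
  qed
  then have "(\<lambda>z. adj3 (cometric z) $ i $ j / det (cometric z)) differentiable (at x)"
    using assms by (intro differentiable_divide) (auto simp: nondeg_region_def)
  moreover have "covariant cometric z $ i $ j = adj3 (cometric z) $ i $ j / det (cometric z)"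
    if "z \<in> nondeg_region cometric" for z
    using that by (simp add: covariant_def nondeg_region_def matrix_inv_adj3)
  ultimately show ?thesis
    using differentiable_cong[OF open_nondeg_region assms] by (metis (no_types, lifting))
qed

lemma covariant_cometric_sym:
  assumes "x \<in> nondeg_region cometric"
  shows "covariant cometric x $ i $ j = covariant cometric x $ j $ i"
proof -
  have "transpose (cometric x) = cometric x"
    by (simp add: transpose_def vec_eq_iff cometric_sym)
  then have "transpose (covariant cometric x) ** cometric x = mat 1"
    using covariant_inverse(2)[OF assms] by (metis matrix_transpose_mul transpose_mat)
  then have "transpose (covariant cometric x) = covariant cometric x"
    using covariant_inverse[OF assms] by (metis matrix_mul_assoc matrix_mul_lid matrix_mul_rid)
  then show ?thesis
    by (simp add: transpose_def vec_eq_iff)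
qed

text \<open>Transfers the polynomial identities, which hold for raised indices, to the tensors
  themselves.\<close>

lemma raise_cancel:
  assumes "x \<in> nondeg_region G" "\<And>n. (\<Sum>k\<in>UNIV. G x $ n $ k * f k) = 0"
  shows "f k = 0"
proof -
  have "G x *v (\<chi> k. f k) = 0"
    using assms(2) by (simp add: matrix_vector_mult_def vec_eq_iff)
  then have "(\<chi> k. f k) = 0"
    using covariant_inverse(1)[OF assms(1)]
    by (metis matrix_vector_mul_assoc matrix_vector_mul_lid matrix_vector_mult_0_right)
  then show ?thesis by (simp add: vec_eq_iff)
qed

text \<open>\<open>half_lowered x k i l\<close> is \<open>- \<Gamma>\<^sup>l\<^sub>k\<^sub>i\<close>.\<close>

definition half_lowered :: "pt \<Rightarrow> 3 \<Rightarrow> 3 \<Rightarrow> 3 \<Rightarrow> real" where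
  "half_lowered x k i l =
     (\<Sum>s\<in>UNIV. covariant cometric x $ i $ s * contra_christoffel x $ k $ s $ l)"

lemma half_lowered_raise:
  assumes "x \<in> nondeg_region cometric"
  shows "(\<Sum>i\<in>UNIV. cometric x $ n $ i * half_lowered x k i l) = contra_christoffel x $ k $ n $ l"
proof -
  have "(\<Sum>i\<in>UNIV. cometric x $ n $ i * half_lowered x k i l)
      = (\<Sum>s\<in>UNIV. (\<Sum>i\<in>UNIV. cometric x $ n $ i * covariant cometric x $ i $ s)
          * contra_christoffel x $ k $ s $ l)"
    unfolding half_lowered_def sum_distrib_left sum_distrib_right
    by (subst sum.swap) (simp add: mult.assoc)
  also have "\<dots> = contra_christoffel x $ k $ n $ l"
    by (simp add: covariant_sums(2)[OF assms] if_distrib[of "\<lambda>a. a * _"] cong: if_cong)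
  finally show ?thesis .
qed

text \<open>With both lower indices raised the claim is \<open>contra_torsion_free\<close>; the
  metric is then cancelled twice.\<close>

lemma half_lowered_sym:
  assumes "x \<in> nondeg_region cometric"
  shows "half_lowered x k i l = half_lowered x i k l"
proof -
  define d where "d k i = half_lowered x k i l - half_lowered x i k l" for k i
  have 1: "(\<Sum>k\<in>UNIV. cometric x $ m $ k * (\<Sum>i\<in>UNIV. cometric x $ n $ i * d k i)) = 0" for m n
  proof -
    have "(\<Sum>k\<in>UNIV. cometric x $ m $ k * (\<Sum>i\<in>UNIV. cometric x $ n $ i * d k i))
       = (\<Sum>k\<in>UNIV. cometric x $ m $ k * (\<Sum>i\<in>UNIV. cometric x $ n $ i * half_lowered x k i l))
        - (\<Sum>k\<in>UNIV. cometric x $ m $ k * (\<Sum>i\<in>UNIV. cometric x $ n $ i * half_lowered x i k l))"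
      by (simp add: d_def right_diff_distrib sum_subtractf)
    also have "(\<Sum>k\<in>UNIV. cometric x $ m $ k * (\<Sum>i\<in>UNIV. cometric x $ n $ i * half_lowered x i k l))
      = (\<Sum>i\<in>UNIV. cometric x $ n $ i * (\<Sum>k\<in>UNIV. cometric x $ m $ k * half_lowered x i k l))"
      unfolding sum_distrib_left by (subst sum.swap) (simp add: mult.left_commute)
    finally show ?thesis
      by (simp add: half_lowered_raise[OF assms] contra_torsion_free[of x m n l])
  qed
  have "(\<Sum>i\<in>UNIV. cometric x $ n $ i * d k i) = 0" for n k
    by (rule raise_cancel[OF assms]) (rule 1)
  then have "d k i = 0" for k i
    using raise_cancel[OF assms, of "d k"] by blast
  then show ?thesis by (simp add: d_def)
qed

section \<open>The Levi-Civita connection of \<open>cometric\<close> and its curvature\<close>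

lemma pd_covariant_raw:
  assumes "x \<in> nondeg_region cometric"
  shows "pd m (\<lambda>z. covariant cometric z $ i $ j) x
    = - (\<Sum>a\<in>UNIV. \<Sum>b\<in>UNIV. covariant cometric x $ i $ a * pd m (\<lambda>z. cometric z $ a $ b) x
        * covariant cometric x $ b $ j)"
proof -
  let ?K = "covariant cometric"
  have eq: "(\<Sum>a\<in>UNIV. pd m (\<lambda>z. ?K z $ i $ a) x * cometric x $ a $ b)
      = - (\<Sum>a\<in>UNIV. ?K x $ i $ a * pd m (\<lambda>z. cometric z $ a $ b) x)" for b
  proof -
    have "pd m (\<lambda>z. \<Sum>a\<in>UNIV. ?K z $ i $ a * cometric z $ a $ b) x
        = pd m (\<lambda>z. if i = b then 1 else 0) x"
      by (rule pd_cong[OF open_nondeg_region assms]) (rule covariant_sums(1))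
    moreover have "pd m (\<lambda>z. \<Sum>a\<in>UNIV. ?K z $ i $ a * cometric z $ a $ b) x
      = (\<Sum>a\<in>UNIV. ?K x $ i $ a * pd m (\<lambda>z. cometric z $ a $ b) x)
       + (\<Sum>a\<in>UNIV. pd m (\<lambda>z. ?K z $ i $ a) x * cometric x $ a $ b)"
      using covariant_differentiable[OF assms]
      by (subst pd_sum) (auto simp: pd_mult sum.distrib)
    ultimately show ?thesis by simp
  qed
  have "pd m (\<lambda>z. ?K z $ i $ j) x
     = (\<Sum>a\<in>UNIV. pd m (\<lambda>z. ?K z $ i $ a) x * (\<Sum>b\<in>UNIV. cometric x $ a $ b * ?K x $ b $ j))"
    by (simp add: covariant_sums(2)[OF assms] if_distrib cong: if_cong)
  also have "\<dots> = (\<Sum>b\<in>UNIV. (\<Sum>a\<in>UNIV. pd m (\<lambda>z. ?K z $ i $ a) x * cometric x $ a $ b) * ?K x $ b $ j)"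
    unfolding sum_distrib_left sum_distrib_right
    by (subst sum.swap) (simp add: mult.assoc)
  also have "\<dots> = - (\<Sum>b\<in>UNIV. \<Sum>a\<in>UNIV. ?K x $ i $ a * pd m (\<lambda>z. cometric z $ a $ b) x * ?K x $ b $ j)"
    unfolding eq by (simp add: sum_negf sum_distrib_right)
  finally show ?thesis by (subst sum.swap) 
qed

text \<open>Metric compatibility with lower indices: each of the two summands of
  \<open>pd_cometric\<close> contracts to \<open>half_lowered\<close>.\<close>

lemma pd_covariant:
  assumes "x \<in> nondeg_region cometric"
  shows "pd m (\<lambda>z. covariant cometric z $ i $ j) x
    = - ((\<Sum>b\<in>UNIV. half_lowered x m i b * covariant cometric x $ b $ j)
        + (\<Sum>b\<in>UNIV. half_lowered x m j b * covariant cometric x $ b $ i))"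
proof -
  let ?K = "covariant cometric x" and ?A = "contra_christoffel x $ m"
  have "(\<Sum>a\<in>UNIV. \<Sum>b\<in>UNIV. ?K $ i $ a * (?A $ a $ b + ?A $ b $ a) * ?K $ b $ j)
     = (\<Sum>a\<in>UNIV. \<Sum>b\<in>UNIV. ?K $ i $ a * ?A $ a $ b * ?K $ b $ j)
      + (\<Sum>a\<in>UNIV. \<Sum>b\<in>UNIV. ?K $ j $ b * ?A $ b $ a * ?K $ a $ i)"
    unfolding sum.distrib[symmetric]
    using covariant_cometric_sym[OF assms] by (intro sum.cong refl) (simp add: algebra_simps)
  also have "(\<Sum>a\<in>UNIV. \<Sum>b\<in>UNIV. ?K $ i $ a * ?A $ a $ b * ?K $ b $ j)
     = (\<Sum>b\<in>UNIV. half_lowered x m i b * ?K $ b $ j)"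
    unfolding half_lowered_def sum_distrib_right by (rule sum.swap)
  also have "(\<Sum>a\<in>UNIV. \<Sum>b\<in>UNIV. ?K $ j $ b * ?A $ b $ a * ?K $ a $ i)
     = (\<Sum>b\<in>UNIV. half_lowered x m j b * ?K $ b $ i)"
    unfolding half_lowered_def sum_distrib_right ..
  finally show ?thesis
    by (simp add: pd_covariant_raw[OF assms] pd_cometric)
qed

lemma christoffel_cometric:
  assumes "x \<in> nondeg_region cometric"
  shows "christoffel cometric l i k x = - half_lowered x k i l"
proof -
  define C where "C i j l = (\<Sum>b\<in>UNIV. half_lowered x i j b * covariant cometric x $ b $ l)" for i j l
  have sym: "C i j l = C j i l" for i j l
    unfolding C_def using half_lowered_sym[OF assms] by simp
  \<comment> \<open>Koszul's cancellation: \<open>C\<close> is symmetric in its first two arguments,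
    so of the six terms four cancel and two agree.\<close>
  have "pd i (\<lambda>z. covariant cometric z $ k $ m) x + pd k (\<lambda>z. covariant cometric z $ i $ m) x
      - pd m (\<lambda>z. covariant cometric z $ i $ k) x = - 2 * C k i m" for m
    unfolding pd_covariant[OF assms] C_def[symmetric]
    using sym[of i m k] sym[of k m i] sym[of i k m] by simp
  then have "christoffel cometric l i k x = - (\<Sum>m\<in>UNIV. cometric x $ l $ m * C k i m)"
    by (simp add: christoffel_def mult.left_commute[of _ 2] sum_distrib_left[symmetric] sum_negf)
  also have "(\<Sum>m\<in>UNIV. cometric x $ l $ m * C k i m)
     = (\<Sum>b\<in>UNIV. half_lowered x k i b * (\<Sum>m\<in>UNIV. covariant cometric x $ b $ m * cometric x $ m $ l))"
    unfolding C_def sum_distrib_left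
    by (subst sum.swap) (intro sum.cong refl, simp add: cometric_sym[of x l])
  also have "\<dots> = half_lowered x k i l"
    by (simp add: covariant_sums(1)[OF assms] if_distrib cong: if_cong)
  finally show ?thesis .
qed

text \<open>The first sum is a product of two Christoffel symbols and cancels against the quadratic
  part of the curvature; the second is the part that \<open>contra_flat\<close> controls.\<close>

lemma pd_christoffel_cometric:
  assumes "x \<in> nondeg_region cometric"
  shows "pd j (christoffel cometric l i k) x
    = (\<Sum>b\<in>UNIV. half_lowered x j i b * half_lowered x k b l)
      + (\<Sum>s\<in>UNIV. covariant cometric x $ i $ s *
          ((\<Sum>b\<in>UNIV. contra_christoffel x $ j $ b $ s * half_lowered x k b l)
           - pd j (\<lambda>z. contra_christoffel z $ k $ s $ l) x))"
proof -
  let ?K = "covariant cometric" and ?A = "contra_christoffel" and ?B = "half_lowered x"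
  have "pd j (christoffel cometric l i k) x
      = pd j (\<lambda>z. - (\<Sum>s\<in>UNIV. ?K z $ i $ s * ?A z $ k $ s $ l)) x"
    by (rule pd_cong[OF open_nondeg_region assms]) (simp add: christoffel_cometric half_lowered_def)
  also have "\<dots> = - (\<Sum>s\<in>UNIV. ?K x $ i $ s * pd j (\<lambda>z. ?A z $ k $ s $ l) x)
      - (\<Sum>s\<in>UNIV. pd j (\<lambda>z. ?K z $ i $ s) x * ?A x $ k $ s $ l)"
    using covariant_differentiable[OF assms]
    by (subst pd_minus, simp add: differentiable_simps, subst pd_sum)
       (auto simp: pd_mult sum.distrib differentiable_simps)
  also have "(\<Sum>s\<in>UNIV. pd j (\<lambda>z. ?K z $ i $ s) x * ?A x $ k $ s $ l)
     = - (\<Sum>s\<in>UNIV. (\<Sum>b\<in>UNIV. ?B j i b * ?K x $ b $ s) * ?A x $ k $ s $ l)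
       - (\<Sum>s\<in>UNIV. (\<Sum>b\<in>UNIV. ?B j s b * ?K x $ b $ i) * ?A x $ k $ s $ l)"
    unfolding pd_covariant[OF assms]
    by (simp add: sum_negf sum_subtractf left_diff_distrib)
  also have "(\<Sum>s\<in>UNIV. (\<Sum>b\<in>UNIV. ?B j i b * ?K x $ b $ s) * ?A x $ k $ s $ l)
     = (\<Sum>b\<in>UNIV. ?B j i b * ?B k b l)"
    unfolding half_lowered_def[of x k] sum_distrib_left sum_distrib_right
    by (subst sum.swap) (simp add: mult.assoc)
  also have "(\<Sum>s\<in>UNIV. (\<Sum>b\<in>UNIV. ?B j s b * ?K x $ b $ i) * ?A x $ k $ s $ l)
     = (\<Sum>s\<in>UNIV. ?K x $ i $ s * (\<Sum>b\<in>UNIV. ?A x $ j $ b $ s * ?B k b l))"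
  proof -
    have "(\<Sum>b\<in>UNIV. ?A x $ j $ b $ s * ?B k b l) = (\<Sum>b\<in>UNIV. ?B j b s * ?A x $ k $ b $ l)" for s
      unfolding half_lowered_def sum_distrib_left sum_distrib_right
      using covariant_cometric_sym[OF assms] by (subst sum.swap) (simp add: ac_simps)
    then show ?thesis
      using covariant_cometric_sym[OF assms]
      by (subst sum_distrib_right) (subst sum.swap, simp add: sum_distrib_left sum_distrib_right ac_simps)
  qed
  finally show ?thesis
    by (simp add: right_diff_distrib sum_subtractf)
qed

lemma riemann_cometric:
  assumes "x \<in> nondeg_region cometric"
  shows "riemann cometric l i j k x = 0"
proof -
  let ?K = "covariant cometric x" and ?A = "contra_christoffel" and ?B = "half_lowered x"
  define T where "T j k s = (\<Sum>b\<in>UNIV. ?A x $ j $ b $ s * ?B k b l)" for j k s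
  \<comment> \<open>What remains of the curvature when the quadratic terms have cancelled and the
    factor \<open>?K $ i $ s\<close> is split off. Raising \<open>k\<close> turns it into the
    difference of the two sides of \<open>contra_flat\<close>.\<close>
  define X where "X j k s = T j k s - T k j s
    - (pd j (\<lambda>z. ?A z $ k $ s $ l) x - pd k (\<lambda>z. ?A z $ j $ s $ l) x)" for j k s
  have X: "X j k s = 0" for s
  proof (rule raise_cancel[OF assms, where f="\<lambda>k. X j k s"])
    fix n
    have 1: "(\<Sum>k\<in>UNIV. cometric x $ n $ k * T j k s) = (\<Sum>b\<in>UNIV. ?A x $ j $ b $ s * ?A x $ b $ n $ l)"
    proof -
      have "(\<Sum>k\<in>UNIV. cometric x $ n $ k * T j k s)
        = (\<Sum>b\<in>UNIV. ?A x $ j $ b $ s * (\<Sum>k\<in>UNIV. cometric x $ n $ k * ?B b k l))"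
        unfolding T_def sum_distrib_left half_lowered_sym[OF assms, of _ _ l]
        by (subst sum.swap) (simp add: mult.left_commute half_lowered_sym[OF assms, of _ _ l])
      then show ?thesis by (simp add: half_lowered_raise[OF assms])
    qed
    have 2: "(\<Sum>k\<in>UNIV. cometric x $ n $ k * T k j s) = (\<Sum>k\<in>UNIV. ?A x $ k $ n $ s * ?A x $ j $ k $ l)"
    proof -
      have "(\<Sum>k\<in>UNIV. cometric x $ n $ k * T k j s)
        = (\<Sum>b\<in>UNIV. (\<Sum>k\<in>UNIV. cometric x $ n $ k * ?A x $ k $ b $ s) * ?B j b l)"
        unfolding T_def sum_distrib_left sum_distrib_right
        by (subst sum.swap) (simp add: mult.assoc)
      also have "\<dots> = (\<Sum>b\<in>UNIV. (\<Sum>k\<in>UNIV. cometric x $ b $ k * ?A x $ k $ n $ s) * ?B j b l)"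
        by (simp only: contra_torsion_free[of x n])
      also have "\<dots> = (\<Sum>k\<in>UNIV. ?A x $ k $ n $ s * (\<Sum>b\<in>UNIV. cometric x $ k $ b * ?B j b l))"
        unfolding sum_distrib_left sum_distrib_right
        by (subst sum.swap) (simp add: ac_simps cometric_sym[of x])
      finally show ?thesis by (simp add: half_lowered_raise[OF assms])
    qed
    show "(\<Sum>k\<in>UNIV. cometric x $ n $ k * X j k s) = 0"
      using contra_flat[of x j s n l] unfolding 1[symmetric] 2[symmetric]
      by (simp add: X_def right_diff_distrib sum_subtractf)
  qed
  have BB: "(\<Sum>m\<in>UNIV. christoffel cometric l j m x * christoffel cometric m i k x)
      = (\<Sum>b\<in>UNIV. ?B k i b * ?B j b l)" for j k
    by (simp add: christoffel_cometric[OF assms] half_lowered_sym[OF assms, of _ j] mult.commute)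
  have "riemann cometric l i j k x = (\<Sum>s\<in>UNIV. ?K $ i $ s * X j k s)"
    unfolding riemann_def sum_subtractf BB pd_christoffel_cometric[OF assms]
    by (simp add: X_def T_def right_diff_distrib sum_subtractf)
  then show ?thesis by (simp add: X)
qed

section \<open>The Lie algebraic operator and its Schroedinger form\<close>

text \<open>The discriminant of \<open>z^3 - x1 z^2 + x2 z - x3\<close>, that is, the product of the
  squared differences of the \<open>c_a\<close>.\<close>

definition disc :: scalar_field where
  "disc x = x$1 * x$1 * x$2 * x$2 - 4 * x$2 * x$2 * x$2 - 4 * x$1 * x$1 * x$1 * x$3
     + 18 * x$1 * x$2 * x$3 - 27 * x$3 * x$3"

text \<open>The product of the \<open>1 - c_a^2\<close>, from the values of the cubic at
  \<open>1\<close> and \<open>-1\<close>.\<close>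

definition wall :: scalar_field where
  "wall x = (1 + x$2) * (1 + x$2) - (x$1 + x$3) * (x$1 + x$3)"

definition disc_grad :: vector_field where
  "disc_grad x = vector [
     2 * x$1 * x$2 * x$2 - 12 * x$1 * x$1 * x$3 + 18 * x$2 * x$3,
     2 * x$1 * x$1 * x$2 - 12 * x$2 * x$2 + 18 * x$1 * x$3,
     - 4 * x$1 * x$1 * x$1 + 18 * x$1 * x$2 - 54 * x$3]"

text \<open>The metric gradient of \<open>ln \<bar>disc\<bar>\<close>; see
  \<open>cometric_disc\<close>.\<close>

definition disc_log_grad :: vector_field where
  "disc_log_grad x = vector [- 4 * x$1, - 6 - 6 * x$2, - 2 * x$1 - 6 * x$3]"

text \<open>In flat coordinates this is the sum of \<open>1 / sin^2\<close> over the half roots,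
  minus 20; see \<open>potential_orbit_map\<close>. The constant is the squared length of
  \<open>(4, 2, 0)\<close>, the sum of the positive roots, and makes \<open>|disc|\<close> a
  solution with eigenvalue zero.\<close>

definition potential :: scalar_field where
  "potential x = (36 * x$2 * x$2 - 108 * x$3 * x$3 - 4 * x$2 * x$2 * x$2 + 36 * x$1 * x$2 * x$3
     - 24 * x$1 * x$1 * x$2 - 4 * x$1 * x$1 * x$1 * x$3 + 4 * x$1 * x$1 * x$1 * x$1) / disc x - 20"

text \<open>First order coefficients of \<open>- Delta - 2 grad (ln |disc|) . grad\<close>, the
  operator to which the Schroedinger operator is gauge equivalent.\<close>

definition drift :: vector_field where
  "drift x = vector [9 * x$1, 12 + 14 * x$2, 4 * x$1 + 15 * x$3]"

text \<open>An entry \<open>(r, a, b)\<close> stands for \<open>r\<close> times the symmetrized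
  product of the generators \<open>a\<close> and \<open>b\<close>, which makes the coefficient
  matrix symmetric by construction.\<close>

definition sym_coeff :: "(real \<times> 't \<times> 't) list \<Rightarrow> 't \<Rightarrow> 't \<Rightarrow> real" where
  "sym_coeff cs i j = (\<Sum>(r, a, b)\<leftarrow>cs.
     r / 2 * ((if i = a then 1 else 0) * (if j = b then 1 else 0)
       + (if i = b then 1 else 0) * (if j = a then 1 else 0)))"

definition lin_coeff :: "(real \<times> 't) list \<Rightarrow> 't \<Rightarrow> real" where
  "lin_coeff ls k = (\<Sum>(r, a)\<leftarrow>ls. r * (if k = a then 1 else 0))"

lemma sym_coeff_sym: "sym_coeff cs i j = sym_coeff cs j i"
  unfolding sym_coeff_def
  by (intro arg_cong[where f=sum_list] map_cong refl) (auto simp: algebra_simps)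

lemma lie_algebraic_op_coeff:
  "lie_algebraic_op T (sym_coeff cs) (lin_coeff ls) f x =
     (\<Sum>(r, a, b)\<leftarrow>cs. r / 2 * (T a (T b f) x + T b (T a f) x)) + (\<Sum>(r, a)\<leftarrow>ls. r * T a f x)"
proof -
  have "(\<Sum>i\<in>UNIV. \<Sum>j\<in>UNIV. sym_coeff cs i j * T i (T j f) x)
      = (\<Sum>(r, a, b)\<leftarrow>cs. r / 2 * (T a (T b f) x + T b (T a f) x))"
  proof (induction cs)
    case Nil
    then show ?case by (simp add: sym_coeff_def)
  next
    case (Cons c cs)
    obtain r a b where c: "c = (r, a, b)" by (cases c)
    have "sym_coeff (c # cs) i j * T i (T j f) x
        = r / 2 * ((if i = a then if j = b then T i (T j f) x else 0 else 0)
            + (if i = b then if j = a then T i (T j f) x else 0 else 0))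
          + sym_coeff cs i j * T i (T j f) x" for i j
      by (simp add: c sym_coeff_def algebra_simps)
    then have "(\<Sum>i\<in>UNIV. \<Sum>j\<in>UNIV. sym_coeff (c # cs) i j * T i (T j f) x)
      = r / 2 * ((\<Sum>i\<in>UNIV. \<Sum>j\<in>UNIV. if i = a then if j = b then T i (T j f) x else 0 else 0)
            + (\<Sum>i\<in>UNIV. \<Sum>j\<in>UNIV. if i = b then if j = a then T i (T j f) x else 0 else 0))
          + (\<Sum>i\<in>UNIV. \<Sum>j\<in>UNIV. sym_coeff cs i j * T i (T j f) x)"
      by (simp only: sum.distrib sum_distrib_left[symmetric])
    moreover have "(\<Sum>i\<in>UNIV. \<Sum>j\<in>UNIV. if i = a then if j = b then T i (T j f) x else 0 else 0)
      = T a (T b f) x" for a b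
    proof -
      have "(\<Sum>j\<in>UNIV. if i = a then if j = b then T i (T j f) x else 0 else 0)
        = (if i = a then T i (T b f) x else 0)" for i
        by simp
      then show ?thesis by simp
    qed
    ultimately show ?case
      by (simp add: c Cons.IH)
  qed
  moreover have "(\<Sum>k\<in>UNIV. lin_coeff ls k * T k f x) = (\<Sum>(r, a)\<leftarrow>ls. r * T a f x)"
  proof (induction ls)
    case (Cons c ls)
    obtain r a where c: "c = (r, a)" by (cases c)
    have "lin_coeff (c # ls) k * T k f x
        = (if k = a then r * T k f x else 0) + lin_coeff ls k * T k f x" for k
      by (simp add: c lin_coeff_def algebra_simps)
    then show ?case
      by (simp add: sum.distrib Cons.IH c)
  qed (simp add: lin_coeff_def)
  ultimately show ?thesis
    by (simp add: lie_algebraic_op_def)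
qed

text \<open>Every entry of \<open>- cometric\<close> has degree at most two, so it splits into
  products of two affine coefficients. The composition also creates first order terms, which
  \<open>lin_terms\<close> corrects to \<open>drift\<close>.\<close>

definition quad_terms :: "(real \<times> (3 + 3 \<times> 3) \<times> (3 + 3 \<times> 3)) list" where
  "quad_terms =
    [(-3, Inl 1, Inl 1), (-2, Inr (2, 1), Inl 1), (1, Inr (1, 1), Inr (1, 1)),
     (-4, Inr (1, 1), Inl 2), (-6, Inr (3, 1), Inl 2), (2, Inr (1, 1), Inr (2, 2)),
     (-2, Inr (2, 1), Inl 3), (2, Inr (1, 1), Inr (3, 3)),
     (-2, Inr (1, 2), Inr (1, 2)), (2, Inr (2, 2), Inl 2), (2, Inr (2, 2), Inr (2, 2)),
     (-2, Inr (1, 2), Inr (3, 2)),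
     (-2, Inr (1, 2), Inr (2, 3)), (6, Inr (3, 2), Inl 3), (4, Inr (2, 2), Inr (3, 3)),
     (-1, Inr (2, 3), Inr (2, 3)), (2, Inr (1, 3), Inr (3, 3)), (3, Inr (3, 3), Inr (3, 3))]"

definition lin_terms :: "(real \<times> (3 + 3 \<times> 3)) list" where
  "lin_terms = [(8, Inr (1, 1)), (8, Inl 2), (12, Inr (2, 2)), (4, Inr (1, 3)), (12, Inr (3, 3))]"

abbreviation hamiltonian :: operator where
  "hamiltonian \<equiv>
     lie_algebraic_op (\<lambda>t. vf_op (affine_field t)) (sym_coeff quad_terms) (lin_coeff lin_terms)"

section \<open>The Lie algebraic operator as a differential operator\<close>

lemma vf_op_affine:
  "vf_op (affine_field (Inl j)) f = pd j f"
  "vf_op (affine_field (Inr (i, j))) f = (\<lambda>x. x $ i * pd j f x)"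
  by (auto simp: vf_op_def fun_eq_iff mult.assoc sum_distrib_left[symmetric])

text \<open>The symmetrized products yield both orders of each mixed derivative with equal
  coefficients, matching the symmetric matrix \<open>cometric\<close>.\<close>

lemma hamiltonian_eq:
  assumes "\<And>j. pd j f differentiable (at x)"
  shows "hamiltonian f x = diff_op (\<lambda>x. - cometric x) drift (\<lambda>_. 0) f x"
  unfolding lie_algebraic_op_coeff
  using assms
  by (simp add: quad_terms_def lin_terms_def vf_op_affine pd_mult diff_op_def sum_3
      cometric_def drift_def)
     (simp add: field_simps)

lemma induces_metric_hamiltonian: "induces_metric hamiltonian cometric"
proof -
  have "hamiltonian f = diff_op (\<lambda>x. - cometric x) drift (\<lambda>_. 0) f" if "smooth_on UNIV f" for f
    using that by (intro ext hamiltonian_eq) (auto intro: smooth_on_differentiable smooth_on_pd)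
  then show ?thesis
    unfolding induces_metric_def
    by (auto simp: transpose_def vec_eq_iff cometric_sym)
qed

text \<open>The metric is the Gram matrix of the Jacobian of \<open>orbit_map\<close>, whose squared
  determinant is the squared Vandermonde product of the cosines times the product of the
  \<open>sin^2 y_a\<close>.\<close>

lemma det_cometric: "det (cometric x) = disc x * wall x"
  by (simp add: det_3 cometric_def disc_def wall_def) (simp add: algebra_simps)

lemma pd_disc: "pd j disc x = disc_grad x $ j"
proof -
  have "\<forall>j. pd j disc x = disc_grad x $ j"
    unfolding disc_def[abs_def] disc_grad_def
    by (simp add: forall_3 differentiable_simps pd_simps)
  then show ?thesis by blast
qed

lemma disc_differentiable[simp]: "disc differentiable (at x)"
  unfolding disc_def[abs_def] by (simp add: differentiable_simps)

lemma wall_differentiable[simp]: "wall differentiable (at x)"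
  unfolding wall_def[abs_def] by (simp add: differentiable_simps)

lemma disc_grad_differentiable[simp]: "(\<lambda>z. disc_grad z $ j) differentiable (at x)"
proof -
  have "\<forall>j. (\<lambda>z. disc_grad z $ j) differentiable (at x)"
    unfolding disc_grad_def by (simp add: forall_3 differentiable_simps)
  then show ?thesis by blast
qed

text \<open>The metric gradient of \<open>disc\<close> is divisible by \<open>disc\<close>, hence
  the logarithmic gradient is polynomial, and so are the first order terms after the gauge
  transformation. The same happens for \<open>wall\<close> below.\<close>

lemma cometric_disc:
  "(\<Sum>j\<in>UNIV. cometric x $ i $ j * disc_grad x $ j) = disc_log_grad x $ i * disc x"
proof -
  have "\<forall>i. (\<Sum>j\<in>UNIV. cometric x $ i $ j * disc_grad x $ j) = disc_log_grad x $ i * disc x"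
    by (simp add: forall_3 sum_3 cometric_def disc_grad_def disc_log_grad_def disc_def)
       (simp add: algebra_simps)
  then show ?thesis by blast
qed

lemma cometric_wall:
  "(\<Sum>j\<in>UNIV. cometric x $ i $ j * pd j wall x)
   = (vector [- 2 * x$1, - 4 * x$2, - 6 * x$3] :: pt) $ i * wall x"
proof -
  have "\<forall>i. (\<Sum>j\<in>UNIV. cometric x $ i $ j * pd j wall x)
   = (vector [- 2 * x$1, - 4 * x$2, - 6 * x$3] :: pt) $ i * wall x"
    unfolding wall_def[abs_def]
    by (simp add: forall_3 sum_3 cometric_def differentiable_simps pd_simps)
       (simp add: algebra_simps)
  then show ?thesis by blast
qed

lemma DERIV_inverse_sqrt_abs:
  assumes "t \<noteq> (0::real)"
  shows "((\<lambda>t. 1 / sqrt \<bar>t\<bar>) has_real_derivative - (1 / sqrt \<bar>t\<bar>) / (2 * t)) (at t)"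
proof (cases "t > 0")
  case True
  have "((\<lambda>t. 1 / sqrt t) has_real_derivative - (1 / sqrt t) / (2 * t)) (at t)"
    using True by (auto intro!: derivative_eq_intros simp: field_simps power2_eq_square)
  then show ?thesis
    using True by (subst DERIV_cong_ev[OF refl _ refl, where g="\<lambda>t. 1 / sqrt t"])
      (auto intro!: eventually_nhds_in_open[of "{0<..}", THEN eventually_mono])
next
  case False
  have "((\<lambda>t. 1 / sqrt (- t)) has_real_derivative - (1 / sqrt (- t)) / (2 * t)) (at t)"
    using False assms by (auto intro!: derivative_eq_intros simp: field_simps power2_eq_square)
  then show ?thesis
    using False assms by (subst DERIV_cong_ev[OF refl _ refl, where g="\<lambda>t. 1 / sqrt (- t)"])
      (auto intro!: eventually_nhds_in_open[of "{..<0}", THEN eventually_mono])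
qed

text \<open>The volume density is \<open>|disc * wall|\<close> to the power \<open>-1/2\<close>, so
  contracting its logarithmic gradient with the metric gives half the negative sum of the two
  polynomial fields above. The divergence of the metric supplies the rest.\<close>

lemma laplace_beltrami_cometric:
  assumes x: "x \<in> nondeg_region cometric" and f: "\<And>j. pd j f differentiable (at x)"
  shows "laplace_beltrami cometric f x = (\<Sum>i\<in>UNIV. \<Sum>j\<in>UNIV. cometric x $ i $ j * pd i (pd j f) x)
     - x$1 * pd 1 f x - 2 * x$2 * pd 2 f x - 3 * x$3 * pd 3 f x"
proof -
  define vol where "vol z = sqrt \<bar>det (covariant cometric z)\<bar>" for z
  define d where "d z = disc z * wall z" for z
  define h where "h t = 1 / sqrt \<bar>t\<bar>" for t :: real
  have dx: "d x \<noteq> 0" using x by (simp add: d_def nondeg_region_def det_cometric)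
  have vol: "vol z = h (d z)" if "z \<in> nondeg_region cometric" for z
  proof -
    have "det (covariant cometric z) * det (cometric z) = 1"
      using covariant_inverse(1)[OF that] by (metis det_mul det_I)
    then have "det (covariant cometric z) = 1 / d z"
      by (metis d_def det_cometric mult_zero_right nonzero_eq_divide_eq zero_neq_one)
    then show ?thesis by (simp add: vol_def h_def real_sqrt_divide)
  qed
  have dd: "d differentiable (at x)"
    unfolding d_def[abs_def] by (simp add: differentiable_simps)
  have h: "(h has_real_derivative - h (d x) / (2 * d x)) (at (d x))"
    unfolding h_def using DERIV_inverse_sqrt_abs[OF dx] by simp
  have hd: "(\<lambda>z. h (d z)) differentiable (at x)"
    using has_derivative_compose[OF has_derivative_pd[OF dd], of h] h
    unfolding has_field_derivative_def differentiable_def by blast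
  have volx: "vol x \<noteq> 0" using dx vol[OF x] by (simp add: h_def)
  have pdh: "pd i (\<lambda>z. h (d z)) x = - (vol x / (2 * d x)) * pd i d x" for i
    unfolding vol[OF x] by (subst pd_chain[OF dd h]) simp
  have G: "(\<Sum>i\<in>UNIV. pd i (\<lambda>z. h (d z)) x * cometric x $ i $ j)
      = - (vol x / 2) * ((vector [- 2 * x$1, - 4 * x$2, - 6 * x$3] :: pt) $ j + disc_log_grad x $ j)" for j
  proof -
    have "(\<Sum>i\<in>UNIV. pd i d x * cometric x $ i $ j)
      = disc x * (\<Sum>i\<in>UNIV. cometric x $ j $ i * pd i wall x)
        + wall x * (\<Sum>i\<in>UNIV. cometric x $ j $ i * disc_grad x $ i)"
      unfolding sum_distrib_left d_def[abs_def]
      by (simp add: pd_mult pd_disc cometric_sym[of x j] sum.distrib[symmetric] algebra_simps)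
    also have "\<dots> = d x * ((vector [- 2 * x$1, - 4 * x$2, - 6 * x$3] :: pt) $ j + disc_log_grad x $ j)"
      unfolding cometric_wall cometric_disc d_def by (simp add: algebra_simps)
    finally have *: "(\<Sum>i\<in>UNIV. pd i d x * cometric x $ i $ j)
       = d x * ((vector [- 2 * x$1, - 4 * x$2, - 6 * x$3] :: pt) $ j + disc_log_grad x $ j)" .
    have "(\<Sum>i\<in>UNIV. pd i (\<lambda>z. h (d z)) x * cometric x $ i $ j)
       = - (vol x / (2 * d x)) * (\<Sum>i\<in>UNIV. pd i d x * cometric x $ i $ j)"
      unfolding pdh sum_distrib_left by (simp add: mult.assoc)
    then show ?thesis unfolding * using dx by simp
  qed
  have 1: "pd i (\<lambda>z. vol z * (\<Sum>j\<in>UNIV. cometric z $ i $ j * pd j f z)) x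
     = vol x * (\<Sum>j\<in>UNIV. cometric x $ i $ j * pd i (pd j f) x
          + pd i (\<lambda>z. cometric z $ i $ j) x * pd j f x)
       + (\<Sum>j\<in>UNIV. pd i (\<lambda>z. h (d z)) x * cometric x $ i $ j * pd j f x)" for i
  proof -
    have "pd i (\<lambda>z. vol z * (\<Sum>j\<in>UNIV. cometric z $ i $ j * pd j f z)) x
       = pd i (\<lambda>z. h (d z) * (\<Sum>j\<in>UNIV. cometric z $ i $ j * pd j f z)) x"
      by (rule pd_cong[OF open_nondeg_region x]) (simp add: vol)
    also have "\<dots> = h (d x) * pd i (\<lambda>z. \<Sum>j\<in>UNIV. cometric z $ i $ j * pd j f z) x
        + pd i (\<lambda>z. h (d z)) x * (\<Sum>j\<in>UNIV. cometric x $ i $ j * pd j f x)"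
      using f by (intro pd_mult[OF hd]) (simp add: differentiable_simps)
    also have "pd i (\<lambda>z. \<Sum>j\<in>UNIV. cometric z $ i $ j * pd j f z) x
       = (\<Sum>j\<in>UNIV. cometric x $ i $ j * pd i (pd j f) x
          + pd i (\<lambda>z. cometric z $ i $ j) x * pd j f x)"
      using f by (subst pd_sum) (auto simp: pd_mult differentiable_simps)
    finally show ?thesis
      by (simp add: vol[OF x] sum_distrib_left mult.assoc)
  qed
  have 2: "(\<Sum>i\<in>UNIV. \<Sum>j\<in>UNIV. pd i (\<lambda>z. h (d z)) x * cometric x $ i $ j * pd j f x)
     = - (vol x / 2) * (\<Sum>j\<in>UNIV. ((vector [- 2 * x$1, - 4 * x$2, - 6 * x$3] :: pt) $ j
          + disc_log_grad x $ j) * pd j f x)"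
    by (subst sum.swap, simp only: sum_distrib_right[symmetric] G)
       (simp only: sum_distrib_left mult.assoc)
  have "laplace_beltrami cometric f x
    = (\<Sum>i\<in>UNIV. \<Sum>j\<in>UNIV. cometric x $ i $ j * pd i (pd j f) x
          + pd i (\<lambda>z. cometric z $ i $ j) x * pd j f x)
      - (1 / 2) * (\<Sum>j\<in>UNIV. ((vector [- 2 * x$1, - 4 * x$2, - 6 * x$3] :: pt) $ j
          + disc_log_grad x $ j) * pd j f x)"
    unfolding laplace_beltrami_def Let_def vol_def[symmetric] 1 sum.distrib[of "\<lambda>i. vol x * _ i"] 2
    using volx by (simp add: sum_distrib_left[symmetric] field_simps)
  then show ?thesis
    by (simp add: pd_cometric sum_3 contra_christoffel_def disc_log_grad_def algebra_simps)
qed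

section \<open>The gauge transformation\<close>

lemma disc_nz: "x \<in> nondeg_region cometric \<Longrightarrow> disc x \<noteq> 0"
  by (simp add: nondeg_region_def det_cometric)

lemma smooth_disc: "smooth_on (nondeg_region cometric) disc"
  unfolding disc_def[abs_def] by (intro smooth_intros open_nondeg_region) simp_all

lemma smooth_potential: "smooth_on (nondeg_region cometric) potential"
  unfolding potential_def[abs_def]
  by (intro smooth_intros open_nondeg_region smooth_disc) (simp_all add: disc_nz)

lemma DERIV_ln_abs:
  assumes "t \<noteq> (0::real)"
  shows "((\<lambda>t. ln \<bar>t\<bar>) has_real_derivative 1 / t) (at t)"
proof (cases "t > 0")
  case True
  then show ?thesis
    by (subst DERIV_cong_ev[OF refl _ refl, where g=ln])
      (auto intro!: eventually_nhds_in_open[of "{0<..}", THEN eventually_mono] derivative_eq_intros)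
next
  case False
  then show ?thesis
    using assms by (subst DERIV_cong_ev[OF refl _ refl, where g="\<lambda>t. ln (- t)"])
      (auto intro!: eventually_nhds_in_open[of "{..<0}", THEN eventually_mono] derivative_eq_intros)
qed

lemma smooth_ln_disc: "smooth_on (nondeg_region cometric) (\<lambda>x. ln \<bar>disc x\<bar>)"
proof (rule smooth_onI_pd)
  fix x assume x: "x \<in> nondeg_region cometric"
  show "(\<lambda>x. ln \<bar>disc x\<bar>) differentiable (at x)"
    using has_derivative_compose[OF has_derivative_pd[OF disc_differentiable], of "\<lambda>t. ln \<bar>t\<bar>"]
      DERIV_ln_abs[OF disc_nz[OF x]]
    unfolding has_field_derivative_def differentiable_def by blast
next
  fix i
  have "smooth_on (nondeg_region cometric) (\<lambda>x. pd i disc x / disc x)"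
    by (intro smooth_intros open_nondeg_region smooth_disc disc_nz)
  moreover have "pd i (\<lambda>x. ln \<bar>disc x\<bar>) x = pd i disc x / disc x"
    if "x \<in> nondeg_region cometric" for x
    using pd_chain[OF disc_differentiable DERIV_ln_abs[OF disc_nz[OF that]]] by simp
  ultimately show "smooth_on (nondeg_region cometric) (pd i (\<lambda>x. ln \<bar>disc x\<bar>))"
    using smooth_on_cong[OF open_nondeg_region] by (metis (no_types, lifting))
qed

text \<open>With \<open>\<mu> = ln |disc|\<close> the operator is
  \<open>- Delta - 2 grad \<mu> . grad\<close>. Conjugation by \<open>exp \<mu>\<close> cancels the
  first order part beyond the Laplacian and leaves the zeroth order term
  \<open>Delta \<mu> + |grad \<mu>|^2\<close>, which is \<open>potential\<close>.\<close>

lemma gauge_hamiltonian: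
  "gauge_equivalent_on (nondeg_region cometric) hamiltonian (schroedinger_op cometric potential)"
  unfolding gauge_equivalent_on_def
proof (intro exI[of _ "\<lambda>x. ln \<bar>disc x\<bar>"] conjI smooth_ln_disc allI impI ballI)
  fix f x
  assume f: "smooth_on (nondeg_region cometric) f" and x: "x \<in> nondeg_region cometric"
  let ?S = "nondeg_region cometric"
  define e where "e z = exp (- ln \<bar>disc z\<bar>)" for z
  define r where "r j z = disc_grad z $ j / disc z" for j z
  note S = open_nondeg_region
  have e: "e z = 1 / \<bar>disc z\<bar>" if "z \<in> ?S" for z
    using disc_nz[OF that] by (simp add: e_def exp_minus inverse_eq_divide)
  have mu: "((\<lambda>z. ln \<bar>disc z\<bar>) differentiable (at z))" if "z \<in> ?S" for z
    by (rule smooth_on_differentiable[OF smooth_ln_disc that])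
  have pd_mu: "pd j (\<lambda>z. ln \<bar>disc z\<bar>) z = r j z" if "z \<in> ?S" for z j
    using pd_chain[OF disc_differentiable DERIV_ln_abs[OF disc_nz[OF that]]]
    by (simp add: r_def pd_disc)
  have e_diff: "e differentiable (at z)" if "z \<in> ?S" for z
  proof -
    have "(\<lambda>z. exp (- ln \<bar>disc z\<bar>)) differentiable (at z)"
      using has_derivative_exp[OF has_derivative_minus[OF has_derivative_pd[OF mu[OF that]]]]
      unfolding differentiable_def by blast
    then show ?thesis by (simp add: e_def[abs_def])
  qed
  have pd_e: "pd j e z = - r j z * e z" if "z \<in> ?S" for z j
  proof -
    have "((\<lambda>t. exp (- t)) has_real_derivative - exp (- t)) (at t)" for t :: real
      by (auto intro!: derivative_eq_intros)
    from pd_chain[OF mu[OF that] this] show ?thesis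
      by (simp add: e_def[abs_def] pd_mu[OF that])
  qed
  have r_diff: "r j differentiable (at z)" if "z \<in> ?S" for z j
    unfolding r_def[abs_def] using disc_nz[OF that] by (intro differentiable_divide) auto
  have pd_r: "pd i (r j) x = pd i (\<lambda>z. disc_grad z $ j) x / disc x - r i x * r j x" for i j
  proof -
    have "pd i (r j) x = pd i (\<lambda>z. disc_grad z $ j * inverse (disc z)) x"
      by (simp add: r_def[abs_def] divide_inverse)
    also have "\<dots> = disc_grad x $ j * (- (inverse (disc x))\<^sup>2 * disc_grad x $ i)
        + pd i (\<lambda>z. disc_grad z $ j) x * inverse (disc x)"
      using disc_nz[OF x] by (subst pd_mult) (auto simp: pd_inverse pd_disc differentiable_inverse)
    finally show ?thesis
      by (simp add: r_def divide_inverse power2_eq_square mult.commute mult.left_commute)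
  qed
  have f_diff: "f differentiable (at z)" "pd j f differentiable (at z)" if "z \<in> ?S" for z j
    using that f by (auto intro: smooth_on_differentiable smooth_on_pd)
  define g where "g z = exp (- ln \<bar>disc z\<bar>) * f z" for z
  have g: "g = (\<lambda>z. e z * f z)" by (simp add: g_def[abs_def] e_def)
  have pd_g: "pd j g z = e z * (pd j f z - r j z * f z)" if "z \<in> ?S" for z j
    using that by (simp add: g pd_mult e_diff f_diff pd_e algebra_simps)
  have pd_g_diff: "pd j g differentiable (at x)" for j
  proof (subst differentiable_cong[OF S x])
    show "pd j g z = e z * (pd j f z - r j z * f z)" if "z \<in> ?S" for z
      using pd_g[OF that] .
    show "(\<lambda>z. e z * (pd j f z - r j z * f z)) differentiable (at x)"
      using x by (simp add: differentiable_simps e_diff f_diff r_diff)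
  qed
  have pd_pd_g: "pd i (pd j g) x = e x * (pd i (pd j f) x - r j x * pd i f x - r i x * pd j f x
      + (2 * r i x * r j x - pd i (\<lambda>z. disc_grad z $ j) x / disc x) * f x)" for i j
  proof -
    have "pd i (pd j g) x = pd i (\<lambda>z. e z * (pd j f z - r j z * f z)) x"
      by (rule pd_cong[OF S x]) (rule pd_g)
    also have "\<dots> = e x * (pd i (pd j f) x - (r j x * pd i f x + pd i (r j) x * f x))
        - r i x * e x * (pd j f x - r j x * f x)"
      using x by (simp add: pd_mult pd_diff differentiable_simps e_diff f_diff r_diff pd_e)
    finally show ?thesis
      unfolding pd_r by (simp add: algebra_simps)
  qed
  let ?G = "cometric x"
  have Gr: "(\<Sum>j\<in>UNIV. ?G $ i $ j * r j x) = disc_log_grad x $ i" for i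
    using cometric_disc[of x i] disc_nz[OF x]
    by (simp add: r_def sum_divide_distrib[symmetric])
  have Gr': "(\<Sum>i\<in>UNIV. ?G $ i $ j * r i x) = disc_log_grad x $ j" for j
    using Gr[of j] by (simp add: cometric_sym[of x j])
  have U: "(\<Sum>i\<in>UNIV. \<Sum>j\<in>UNIV. ?G $ i $ j * (pd i (\<lambda>z. disc_grad z $ j) x / disc x))
      - 2 * (\<Sum>i\<in>UNIV. disc_log_grad x $ i * r i x) - (\<Sum>i\<in>UNIV. drift x $ i * r i x) = potential x"
  proof -
    \<comment> \<open>Multiplied by \<open>disc\<close>, the claim is polynomial; \<open>20\<close>
      is split off because \<open>(potential x + 20) * disc x\<close> is the numerator in the
      definition.\<close>
    have "(\<Sum>i\<in>UNIV. \<Sum>j\<in>UNIV. ?G $ i $ j * pd i (\<lambda>z. disc_grad z $ j) x)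
      - 2 * (\<Sum>i\<in>UNIV. disc_log_grad x $ i * disc_grad x $ i)
      - (\<Sum>i\<in>UNIV. drift x $ i * disc_grad x $ i) = (potential x + 20) * disc x - 20 * disc x"
      using disc_nz[OF x]
      by (simp add: potential_def disc_grad_def sum_3 differentiable_simps pd_simps cometric_def
          disc_log_grad_def drift_def disc_def) (simp add: algebra_simps)
    then have "(\<Sum>i\<in>UNIV. \<Sum>j\<in>UNIV. ?G $ i $ j * pd i (\<lambda>z. disc_grad z $ j) x) / disc x
      - 2 * (\<Sum>i\<in>UNIV. disc_log_grad x $ i * disc_grad x $ i) / disc x
      - (\<Sum>i\<in>UNIV. drift x $ i * disc_grad x $ i) / disc x = potential x"
      using disc_nz[OF x] by (simp add: field_simps)
    then show ?thesis
      by (simp add: r_def flip: sum_divide_distrib)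
  qed
  have "(\<Sum>i\<in>UNIV. \<Sum>j\<in>UNIV. ?G $ i $ j * pd i (pd j g) x)
    = e x * ((\<Sum>i\<in>UNIV. \<Sum>j\<in>UNIV. ?G $ i $ j * pd i (pd j f) x)
       - (\<Sum>i\<in>UNIV. (\<Sum>j\<in>UNIV. ?G $ i $ j * r j x) * pd i f x)
       - (\<Sum>j\<in>UNIV. (\<Sum>i\<in>UNIV. ?G $ i $ j * r i x) * pd j f x)
       + (2 * (\<Sum>i\<in>UNIV. (\<Sum>j\<in>UNIV. ?G $ i $ j * r j x) * r i x)
       - (\<Sum>i\<in>UNIV. \<Sum>j\<in>UNIV. ?G $ i $ j * (pd i (\<lambda>z. disc_grad z $ j) x / disc x))) * f x)"
    unfolding pd_pd_g by (simp only: sum_3) (simp add: algebra_simps)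
  then have "hamiltonian g x = e x * (- (\<Sum>i\<in>UNIV. \<Sum>j\<in>UNIV. ?G $ i $ j * pd i (pd j f) x)
       + 2 * (\<Sum>i\<in>UNIV. disc_log_grad x $ i * pd i f x) + (\<Sum>i\<in>UNIV. drift x $ i * pd i f x)
       + potential x * f x)"
    unfolding hamiltonian_eq[OF pd_g_diff] diff_op_def Gr Gr' U[symmetric]
    by (simp add: sum_negf pd_g[OF x] sum_3) (simp add: algebra_simps)
  moreover have "- (x$1 * pd 1 f x) - 2 * x$2 * pd 2 f x - 3 * x$3 * pd 3 f x
     = - 2 * (\<Sum>i\<in>UNIV. disc_log_grad x $ i * pd i f x) - (\<Sum>i\<in>UNIV. drift x $ i * pd i f x)"
    by (simp add: sum_3 disc_log_grad_def drift_def algebra_simps)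
  ultimately have "hamiltonian g x = e x * schroedinger_op cometric potential f x"
    using x f_diff by (simp add: schroedinger_op_def laplace_beltrami_cometric)
  then show "schroedinger_op cometric potential f x
     = exp (ln \<bar>disc x\<bar>) * hamiltonian (\<lambda>z. exp (- ln \<bar>disc z\<bar>) * f z) x"
    by (simp add: g_def[abs_def] e_def exp_minus)
qed

lemma pos_region_nonempty: "pos_region cometric \<noteq> {}"
proof -
  \<comment> \<open>The cubic of this point has the roots \<open>0\<close>, \<open>1/2\<close> and
    \<open>-1/2\<close>: distinct and between \<open>-1\<close> and \<open>1\<close>.\<close>
  define x :: pt where "x = vector [0, - 1 / 4, 0]"
  have q: "v \<bullet> (cometric x *v v) = 5 / 2 * (v$1 - v$3 / 10)\<^sup>2 + 3 / 8 * (v$2)\<^sup>2 + 3 / 80 * (v$3)\<^sup>2" for v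
    by (simp add: inner_vec_def matrix_vector_mult_def sum_3 cometric_def x_def power2_eq_square)
       (simp add: field_simps)
  have "v \<bullet> (cometric x *v v) > 0" if "v \<noteq> 0" for v
  proof (rule ccontr)
    assume "\<not> v \<bullet> (cometric x *v v) > 0"
    then have "5 / 2 * (v$1 - v$3 / 10)\<^sup>2 + 3 / 8 * (v$2)\<^sup>2 + 3 / 80 * (v$3)\<^sup>2 \<le> 0"
      by (simp add: q)
    moreover have "(v$1 - v$3 / 10)\<^sup>2 \<ge> 0" "(v$2)\<^sup>2 \<ge> 0" "(v$3)\<^sup>2 \<ge> 0" by simp_all
    ultimately have "(v$1 - v$3 / 10)\<^sup>2 = 0 \<and> (v$2)\<^sup>2 = 0 \<and> (v$3)\<^sup>2 = 0"
      by linarith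
    then show False using that by (simp add: vec_eq_iff forall_3)
  qed
  then have "x \<in> pos_region cometric"
    by (simp add: pos_region_def pos_def_def transpose_def vec_eq_iff cometric_sym)
  then show ?thesis by blast
qed

section \<open>Primitivity of the affine action\<close>

lemma smooth_map_on_cross3:
  assumes "open V" "\<And>i. smooth_on V (\<lambda>q. g q $ i)" "\<And>i. smooth_on V (\<lambda>q. h q $ i)"
  shows "smooth_map_on V (\<lambda>q. cross3 (g q) (h q))"
proof -
  have "\<forall>i. smooth_on V (\<lambda>q. cross3 (g q) (h q) $ i)"
    unfolding cross3_def by (simp add: forall_3 smooth_intros assms)
  then show ?thesis by (simp add: smooth_map_on_def)
qed

text \<open>The coefficient is frozen at \<open>p\<close>, so the derivatives of \<open>X\<close>
  cancel between the two brackets and only the component \<open>X p $ i\<close> survives.\<close>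

lemma bracket_affine_at:
  "p $ i *\<^sub>R bracket (affine_field (Inl j)) X p - bracket (affine_field (Inr (i, j))) X p
    = X p $ i *\<^sub>R axis j 1"
proof -
  have 1: "vf_op X (\<lambda>z. z $ i * axis j 1 $ k) p = X p $ i * axis j 1 $ k" for k
  proof -
    have "pd m (\<lambda>z. z $ i * axis j 1 $ k) p = (if m = i then axis j 1 $ k else 0)" for m
      by (subst pd_mult) auto
    then have "vf_op X (\<lambda>z. z $ i * axis j 1 $ k) p
        = (\<Sum>m\<in>UNIV. X p $ m * (if m = i then axis j 1 $ k else 0))"
      by (simp only: vf_op_def)
    then show ?thesis by (simp add: if_distrib cong: if_cong)
  qed
  have 2: "vf_op X (\<lambda>z. axis j 1 $ k) p = 0" for k
    by (simp add: vf_op_def)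
  show ?thesis
    unfolding vec_eq_iff bracket_def by (simp add: 1 2 vf_op_affine)
qed

lemma cross3_axes_eq_0: "(\<And>a. cross3 v (axis a 1) = 0) \<Longrightarrow> v = 0"
proof -
  assume *: "\<And>a. cross3 v (axis a 1) = 0"
  have "cross3 v (axis 1 1) = 0" "cross3 v (axis 2 1) = 0" using * by blast+
  then show "v = 0"
    by (simp add: cross3_def vec_eq_iff forall_3 axis_def)
qed

text \<open>A field \<open>X\<close> tangent to the foliation with \<open>X p $ i\<close> nonzero
  puts every \<open>axis j 1\<close> into \<open>D p\<close>, by \<open>bracket_affine_at\<close>.
  Then \<open>D p\<close> is the whole space, against the codimension.\<close>

lemma acts_primitively_affine: "acts_primitively affine_field"
  unfolding acts_primitively_def
proof (intro notI, elim exE conjE)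
  fix W r D
  assume W: "open W" "W \<noteq> {}" and r: "r \<in> {1, 2 :: nat}" and fol: "foliation_on W r D"
    and inv: "\<forall>t. invariant_distribution_on W (affine_field t) D"
  obtain p where "p \<in> W" using W by blast
  then obtain V f where V: "open V" "p \<in> V" "V \<subseteq> W" and f: "\<And>m. m < r \<Longrightarrow> smooth_on V (f m)"
    and D: "\<And>q. q \<in> V \<Longrightarrow> D q = {v. \<forall>m<r. frechet_derivative (f m) (at q) v = 0}"
    and dim: "\<And>q. q \<in> V \<Longrightarrow> dim (D q) = 3 - r"
    using fol[unfolded foliation_on_def, rule_format, OF \<open>p \<in> W\<close>] by blast
  define g :: "nat \<Rightarrow> pt \<Rightarrow> pt" where "g m q = (\<chi> i. pd i (f m) q)" for m q
  have D': "D q = {v. \<forall>m<r. g m q \<bullet> v = 0}" if "q \<in> V" for q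
  proof -
    have "frechet_derivative (f m) (at q) v = g m q \<bullet> v" if "m < r" for m v
      using frechet_derivative_pd[OF smooth_on_differentiable[OF f[OF that] \<open>q \<in> V\<close>]]
      by (simp add: g_def inner_vec_def mult.commute)
    then show ?thesis using D[OF that] by auto
  qed
  have smooth_g: "smooth_on V (\<lambda>q. g m q $ i)" if "m < r" for m i
    using smooth_on_pd[OF f[OF that]] by (simp add: g_def)
  have sub: "subspace (D p)"
    unfolding D'[OF V(2)] subspace_def by (auto simp: inner_add_right)
  have not_hyperplane: "\<not> {v. w \<bullet> v = 0} \<subseteq> D p" if "w \<noteq> 0" "r = 2" for w
    using dim_subset[of "{v. w \<bullet> v = 0}" "D p"] dim_hyperplane[OF that(1)] dim[OF V(2)] that
    by auto
  \<comment> \<open>Smooth tangent fields come from cross products: the gradient with a suitable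
    axis in codimension one, the two gradients with each other in codimension two.\<close>
  have "\<exists>X. smooth_map_on V X \<and> (\<forall>q\<in>V. X q \<in> D q) \<and> X p \<noteq> 0"
  proof (cases "r = 1")
    case True
    have "g 0 p \<noteq> 0"
    proof
      assume "g 0 p = 0"
      then have "D p = UNIV" using D'[OF V(2)] True by simp
      then show False using dim[OF V(2)] True by simp
    qed
    then obtain a where a: "cross3 (g 0 p) (axis a 1) \<noteq> 0"
      using cross3_axes_eq_0 by blast
    have "smooth_map_on V (\<lambda>q. cross3 (g 0 q) (axis a 1))"
      using smooth_g True V(1) by (intro smooth_map_on_cross3) auto
    moreover have "cross3 (g 0 q) (axis a 1) \<in> D q" if "q \<in> V" for q
      using D'[OF that] True by (simp add: dot_cross_self)
    ultimately show ?thesis using a by blast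
  next
    case False
    then have r2: "r = 2" using r by auto
    have "cross3 (g 0 p) (g 1 p) \<noteq> 0"
    proof
      assume "cross3 (g 0 p) (g 1 p) = 0"
      then have col: "g 0 p = 0 \<or> g 1 p = 0 \<or> (\<exists>c. g 1 p = c *\<^sub>R g 0 p)"
        unfolding cross_eq_0 collinear_lemma .
      have Dp: "D p = {v. g 0 p \<bullet> v = 0 \<and> g 1 p \<bullet> v = 0}"
        unfolding D'[OF V(2)] r2 by (auto simp: less_2_cases_iff)
      have "\<exists>w. w \<noteq> 0 \<and> {v. w \<bullet> v = 0} \<subseteq> D p"
      proof (cases "g 0 p = 0")
        case True
        show ?thesis
        proof (cases "g 1 p = 0")
          case True
          with \<open>g 0 p = 0\<close> show ?thesis unfolding Dp by (intro exI[of _ "axis 1 1"]) simp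
        next
          case False
          with True show ?thesis unfolding Dp by (intro exI[of _ "g 1 p"]) simp
        qed
      next
        case False
        with col show ?thesis unfolding Dp by (intro exI[of _ "g 0 p"]) auto
      qed
      then show False using not_hyperplane r2 by blast
    qed
    moreover have "smooth_map_on V (\<lambda>q. cross3 (g 0 q) (g 1 q))"
      using smooth_g r2 V(1) by (intro smooth_map_on_cross3) auto
    moreover have "cross3 (g 0 q) (g 1 q) \<in> D q" if "q \<in> V" for q
      using D'[OF that] r2 by (auto simp: dot_cross_self less_2_cases_iff)
    ultimately show ?thesis by blast
  qed
  then obtain X where X: "smooth_map_on V X" "\<And>q. q \<in> V \<Longrightarrow> X q \<in> D q" "X p \<noteq> 0" by blast
  then obtain i where i: "X p $ i \<noteq> 0" by (auto simp: vec_eq_iff)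
  have br: "bracket (affine_field t) X p \<in> D p" for t
    using inv V X(1,2) unfolding invariant_distribution_on_def by blast
  have "axis j 1 \<in> D p" for j
  proof -
    have "X p $ i *\<^sub>R axis j 1 \<in> D p"
      unfolding bracket_affine_at[symmetric]
      using br sub by (intro subspace_diff subspace_scale) auto
    then have "(1 / X p $ i) *\<^sub>R (X p $ i *\<^sub>R axis j 1) \<in> D p"
      using sub by (rule subspace_scale[rotated])
    then show ?thesis using i by simp
  qed
  then have "Basis \<subseteq> D p" by (auto simp: Basis_vec_def)
  then have "D p = UNIV" using sub span_Basis span_minimal by blast
  then show False using dim[OF V(2)] r by auto
qed

section \<open>Poles of trigonometric potentials\<close>

text \<open>Restrictions of entire functions to the real line. The class is closed under sums and
  products, contains sines, cosines and polynomials, and obeys the identity theorem.\<close>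

definition entire_on_line :: "(real \<Rightarrow> real) \<Rightarrow> bool" where
  "entire_on_line f \<longleftrightarrow> (\<exists>F. F holomorphic_on UNIV \<and> (\<forall>s. F (of_real s) = of_real (f s)))"

section \<open>Entire functions and polynomials on a line\<close>

lemma entire_on_line_const: "entire_on_line (\<lambda>s. c)"
  unfolding entire_on_line_def by (intro exI[of _ "\<lambda>_. of_real c"]) auto

lemma entire_on_line_ident: "entire_on_line (\<lambda>s. s)"
  unfolding entire_on_line_def by (intro exI[of _ "\<lambda>z. z"]) (auto intro: holomorphic_intros)

lemma entire_on_line_add:
  assumes "entire_on_line f" "entire_on_line g"
  shows "entire_on_line (\<lambda>s. f s + g s)"
proof -
  obtain F G where "F holomorphic_on UNIV" "\<forall>s. F (of_real s) = of_real (f s)"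
    "G holomorphic_on UNIV" "\<forall>s. G (of_real s) = of_real (g s)"
    using assms unfolding entire_on_line_def by blast
  then show ?thesis
    unfolding entire_on_line_def
    by (intro exI[of _ "\<lambda>z. F z + G z"]) (auto intro: holomorphic_intros)
qed

lemma entire_on_line_mult:
  assumes "entire_on_line f" "entire_on_line g"
  shows "entire_on_line (\<lambda>s. f s * g s)"
proof -
  obtain F G where "F holomorphic_on UNIV" "\<forall>s. F (of_real s) = of_real (f s)"
    "G holomorphic_on UNIV" "\<forall>s. G (of_real s) = of_real (g s)"
    using assms unfolding entire_on_line_def by blast
  then show ?thesis
    unfolding entire_on_line_def
    by (intro exI[of _ "\<lambda>z. F z * G z"]) (auto intro: holomorphic_intros)
qed

lemma entire_on_line_power: "entire_on_line f \<Longrightarrow> entire_on_line (\<lambda>s. f s ^ n)"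
  by (induction n) (simp_all add: entire_on_line_const entire_on_line_mult)

lemma entire_on_line_sum:
  "(\<And>i. i \<in> I \<Longrightarrow> entire_on_line (f i)) \<Longrightarrow> entire_on_line (\<lambda>s. \<Sum>i\<in>I. f i s)"
  by (induction I rule: infinite_finite_induct)
     (simp_all add: entire_on_line_const entire_on_line_add)

lemma entire_on_line_prod:
  "(\<And>i. i \<in> I \<Longrightarrow> entire_on_line (f i)) \<Longrightarrow> entire_on_line (\<lambda>s. \<Prod>i\<in>I. f i s)"
  by (induction I rule: infinite_finite_induct)
     (simp_all add: entire_on_line_const entire_on_line_mult)

lemma entire_on_line_sin: "entire_on_line (\<lambda>s. sin (c + s * r))"
  unfolding entire_on_line_def
  by (intro exI[of _ "\<lambda>z. sin (of_real c + z * of_real r)"])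
     (auto intro!: holomorphic_intros simp flip: sin_of_real)

lemma entire_on_line_cos: "entire_on_line (\<lambda>s. cos (c + s * r))"
  unfolding entire_on_line_def
  by (intro exI[of _ "\<lambda>z. cos (of_real c + z * of_real r)"])
     (auto intro!: holomorphic_intros simp flip: cos_of_real)

lemma polynomial_on_line:
  assumes "real_polynomial_function p"
  obtains a n where "\<And>s. p (q + s *\<^sub>R v) = (\<Sum>i\<le>n. a i * s ^ i)"
proof -
  have "polynomial_function (\<lambda>s::real. q + s *\<^sub>R v)"
    by (intro polynomial_function_add polynomial_function_const polynomial_function_bounded_linear
        bounded_linear_scaleR_left)
  then have "real_polynomial_function (p \<circ> (\<lambda>s. q + s *\<^sub>R v))"
    using assms by (rule real_polynomial_function_compose)
  then obtain a n where "p \<circ> (\<lambda>s. q + s *\<^sub>R v) = (\<lambda>s. \<Sum>i\<le>n. a i * s ^ i)"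
    unfolding real_polynomial_function_iff_sum by blast
  then show ?thesis using that[of a n] by (simp add: fun_eq_iff)
qed

lemma entire_on_line_polynomial:
  assumes "real_polynomial_function p"
  shows "entire_on_line (\<lambda>s. p (q + s *\<^sub>R v))"
proof -
  obtain a n where "\<And>s. p (q + s *\<^sub>R v) = (\<Sum>i\<le>n. a i * s ^ i)"
    using polynomial_on_line[OF assms] by blast
  then have "(\<lambda>s. p (q + s *\<^sub>R v)) = (\<lambda>s. \<Sum>i\<le>n. a i * s ^ i)" by blast
  moreover have "entire_on_line (\<lambda>s. \<Sum>i\<le>n. a i * s ^ i)"
    by (intro entire_on_line_sum entire_on_line_mult[OF entire_on_line_const]
        entire_on_line_power[OF entire_on_line_ident])
  ultimately show ?thesis by simp
qed

text \<open>Identity theorem for the entire extension, whose zeros accumulate at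
  \<open>0\<close>.\<close>

lemma entire_on_line_zero:
  assumes f: "entire_on_line f" and e: "e > 0" "\<And>s. \<bar>s\<bar> < e \<Longrightarrow> f s = 0"
  shows "f s = 0"
proof -
  obtain F where F: "F holomorphic_on UNIV" "\<forall>s. F (of_real s) = of_real (f s)"
    using f unfolding entire_on_line_def by blast
  have "0 islimpt (of_real ` {s. \<bar>s\<bar> < e} :: complex set)"
    unfolding islimpt_approachable
  proof (intro allI impI)
    fix r :: real assume "r > 0"
    then have "\<bar>min e r / 2\<bar> < e" "\<bar>min e r / 2\<bar> < r" "min e r / 2 \<noteq> 0"
      using e(1) by auto
    then show "\<exists>x'\<in>of_real ` {s. \<bar>s\<bar> < e}. x' \<noteq> (0::complex) \<and> dist x' 0 < r"
      by (intro bexI[of _ "of_real (min e r / 2)"] imageI)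
         (simp_all add: dist_norm del: of_real_divide)
  qed
  moreover have "F z = 0" if "z \<in> of_real ` {s. \<bar>s\<bar> < e}" for z
    using that F(2) e(2) by (elim imageE) simp
  ultimately have "F (of_real s) = 0"
    by (rule analytic_continuation[OF F(1) open_UNIV connected_UNIV subset_UNIV UNIV_I _ _ UNIV_I])
  then show ?thesis using F(2) by simp
qed

text \<open>On the line \<open>p\<close> is a polynomial in \<open>s\<close> with infinitely many
  roots; \<open>s = 0\<close> gives the value at \<open>q\<close>.\<close>

lemma polynomial_zero:
  fixes p :: "pt \<Rightarrow> real"
  assumes p: "real_polynomial_function p" and inf: "infinite {s. p (q + s *\<^sub>R v) = 0}"
  shows "p q = 0"
proof -
  obtain a n where a: "\<And>s. p (q + s *\<^sub>R v) = (\<Sum>i\<le>n. a i * s ^ i)"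
    using polynomial_on_line[OF p] by blast
  have "infinite {s. (\<Sum>i\<le>n. a i * s ^ i) = 0}" using inf unfolding a .
  then have "\<forall>i\<le>n. a i = 0" using polyfun_finite_roots[of a n] by auto
  then show ?thesis using a[of 0] by simp
qed

text \<open>Each zero set is closed without interior, so \<open>N\<close> is shrunk to a smaller
  nonempty open set, one index at a time.\<close>

lemma nonvanishing_point:
  fixes g :: "'i \<Rightarrow> pt"
  assumes "finite I" "\<And>i. i \<in> I \<Longrightarrow> g i \<noteq> 0" "open N" "N \<noteq> {}"
  shows "\<exists>q\<in>N. \<forall>i\<in>I. sin (g i \<bullet> q + e i) \<noteq> 0"
  using assms(1,3,4,2)
proof (induction arbitrary: N rule: finite_induct)
  case (insert i I)
  define M where "M = {q \<in> N. sin (g i \<bullet> q + e i) \<noteq> 0}"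
  have "open {q. sin (g i \<bullet> q + e i) \<noteq> 0}"
    by (intro open_Collect_neq continuous_intros)
  then have "open M"
    unfolding M_def Collect_conj_eq using insert.prems(1) by (simp add: open_Int)
  moreover have "M \<noteq> {}"
  proof
    assume "M = {}"
    then have z: "\<And>q. q \<in> N \<Longrightarrow> sin (g i \<bullet> q + e i) = 0" by (auto simp: M_def)
    obtain q where q: "q \<in> N" using insert.prems(2) by blast
    then obtain r where r: "r > 0" "ball q r \<subseteq> N"
      using insert.prems(1) open_contains_ball by blast
    define n where "n = norm (g i)"
    have n: "n > 0" using insert.prems(3) by (simp add: n_def)
    \<comment> \<open>Moving along \<open>g i\<close> changes the phase at the rate
      \<open>n^2\<close>, so a sine vanishing near \<open>s = 0\<close> would vanish at every phase,
      also at \<open>pi / 2\<close>.\<close>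
    have near: "sin ((g i \<bullet> q + e i) + s * n\<^sup>2) = 0" if "\<bar>s\<bar> < r / n" for s
    proof -
      have "q + s *\<^sub>R g i \<in> N"
        using that r n by (auto simp: dist_norm n_def field_simps intro!: subsetD[OF r(2)])
      from z[OF this] show ?thesis
        by (simp add: inner_add_right n_def power2_norm_eq_inner algebra_simps)
    qed
    have "r / n > 0" using r n by simp
    from entire_on_line_zero[OF entire_on_line_sin this near]
    have "sin ((g i \<bullet> q + e i) + s * n\<^sup>2) = 0" for s .
    from this[of "(pi / 2 - (g i \<bullet> q + e i)) / n\<^sup>2"] show False
      using n by simp
  qed
  ultimately obtain q where "q \<in> M" "\<forall>i\<in>I. sin (g i \<bullet> q + e i) \<noteq> 0"
    using insert.IH[of M] insert.prems(3) by auto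
  then show ?case unfolding M_def by auto
qed auto


text \<open>For symmetric \<open>K\<close> this is an entry of the matrix commutator of
  \<open>v v^T\<close> and \<open>K\<close>. All entries vanish when \<open>K v\<close> is parallel
  to \<open>v\<close>.\<close>

definition commutator :: "real^3^3 \<Rightarrow> pt \<Rightarrow> 3 \<Rightarrow> 3 \<Rightarrow> real" where
  "commutator K v k l = v $ k * (K *v v) $ l - (K *v v) $ k * v $ l"

section \<open>The pole argument\<close>

lemma polynomial_commutator:
  assumes "\<And>k l. real_polynomial_function (\<lambda>q. K q $ k $ l)"
  shows "real_polynomial_function (\<lambda>q. commutator (K q) v k l)"
  unfolding commutator_def matrix_vector_mult_def
  by (simp add: sum_3) (intro real_polynomial_function.intros(2-4) real_polynomial_function_diff assms)

lemma polynomial_inner: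
  assumes "\<And>i. real_polynomial_function (\<lambda>q. L q $ i)"
  shows "real_polynomial_function (\<lambda>q. L q \<bullet> v)"
  unfolding inner_vec_def inner_real_def
  by (intro real_polynomial_function_sum finite real_polynomial_function.intros(2,4) assms)

text \<open>\<open>hess_grad b d K \<Lambda>\<close> is \<open>[Hess V, K] + \<Lambda> \<bullet> grad V\<close> for \<open>V q = (\<Sum>i\<in>I. 1 / sin\<^sup>2 (b i \<bullet> q + d i))\<close>.\<close>

definition hess_grad ::
  "'i set \<Rightarrow> ('i \<Rightarrow> pt) \<Rightarrow> ('i \<Rightarrow> real) \<Rightarrow> (pt \<Rightarrow> real^3^3) \<Rightarrow> (pt \<Rightarrow> 3 \<Rightarrow> 3 \<Rightarrow> pt) \<Rightarrow> pt \<Rightarrow> 3 \<Rightarrow> 3 \<Rightarrow> real" where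
  "hess_grad I b d K L q k l =
     (\<Sum>i\<in>I. (2 + 4 * (cos (b i \<bullet> q + d i))\<^sup>2) / sin (b i \<bullet> q + d i) ^ 4 * commutator (K q) (b i) k l
        - 2 * cos (b i \<bullet> q + d i) / sin (b i \<bullet> q + d i) ^ 3 * (L q k l \<bullet> b i))"

text \<open>Along the line through \<open>q\<close> in the direction \<open>b j\<close> the \<open>j\<close>-th term has infinitely many poles,
  and the genericity assumption keeps the other terms finite at every fourth of them.  The
  coefficient of the leading pole is a polynomial on the line, and so it vanishes.\<close>

lemma commutator_zero_generic:
  fixes b :: "'i \<Rightarrow> pt"
  assumes I: "finite I" and N: "open N" "q \<in> N"
    and K: "\<And>k l. real_polynomial_function (\<lambda>q. K q $ k $ l)"
    and L: "\<And>k l i. real_polynomial_function (\<lambda>q. L q k l $ i)"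
    and zero: "\<And>q. q \<in> N \<Longrightarrow> hess_grad I b d K L q k l = 0"
    and sin: "\<And>q i. q \<in> N \<Longrightarrow> i \<in> I \<Longrightarrow> sin (b i \<bullet> q + d i) \<noteq> 0"
    and j: "j \<in> I" "b j \<bullet> b j = 1 / 2"
    and quarter: "\<And>i. i \<in> I \<Longrightarrow> \<exists>m::int. b i \<bullet> b j = m / 4"
    and generic: "\<And>i. i \<in> I \<Longrightarrow> i \<noteq> j \<Longrightarrow>
      sin ((b i - (2 * (b i \<bullet> b j)) *\<^sub>R b j) \<bullet> q + (d i - 2 * (b i \<bullet> b j) * d j)) \<noteq> 0"
  shows "commutator (K q) (b j) k l = 0"
proof -
  define ph where "ph i s = (b i \<bullet> q + d i) + s * (b i \<bullet> b j)" for i s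
  have ph: "b i \<bullet> (q + s *\<^sub>R b j) + d i = ph i s" for i s
    by (simp add: ph_def inner_add_right)
  define P where "P i s = (\<Prod>i'\<in>I - {i}. sin (ph i' s) ^ 4)" for i s
  define A where "A i s = commutator (K (q + s *\<^sub>R b j)) (b i) k l" for i s
  define B where "B i s = L (q + s *\<^sub>R b j) k l \<bullet> b i" for i s
  \<comment> \<open>The function \<open>hess_grad\<close> along the line, multiplied by all
    \<open>sin^4\<close> factors: the poles are cleared and the result extends to an entire
    function.\<close>
  define num where "num s = (\<Sum>i\<in>I. (2 + 4 * (cos (ph i s) * cos (ph i s))) * (P i s * A i s)
      + (- 2) * (cos (ph i s) * (sin (ph i s) * (P i s * B i s))))" for s
  have eA: "entire_on_line (A i)" for i
    unfolding A_def[abs_def] by (rule entire_on_line_polynomial) (rule polynomial_commutator[OF K])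
  have eB: "entire_on_line (B i)" for i
    unfolding B_def[abs_def] by (rule entire_on_line_polynomial) (rule polynomial_inner[OF L])
  have es: "entire_on_line (\<lambda>s. sin (ph i s))" and ec: "entire_on_line (\<lambda>s. cos (ph i s))" for i
    unfolding ph_def by (rule entire_on_line_sin, rule entire_on_line_cos)
  have eP: "entire_on_line (P i)" for i
    unfolding P_def[abs_def] by (intro entire_on_line_prod entire_on_line_power es)
  have "entire_on_line num"
    unfolding num_def[abs_def]
    by (intro entire_on_line_sum entire_on_line_add[OF
          entire_on_line_mult[OF entire_on_line_add[OF entire_on_line_const
             entire_on_line_mult[OF entire_on_line_const entire_on_line_mult[OF ec ec]]]
            entire_on_line_mult[OF eP eA]]
          entire_on_line_mult[OF entire_on_line_const entire_on_line_mult[OF ec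
            entire_on_line_mult[OF es entire_on_line_mult[OF eP eB]]]]])
  moreover obtain e where e: "e > 0" "ball q e \<subseteq> N"
    using N open_contains_ball by blast
  have bj: "norm (b j) > 0" using j(2) by auto
  moreover have "num s = 0" if "\<bar>s\<bar> < e / norm (b j)" for s
  proof -
    have in_N: "q + s *\<^sub>R b j \<in> N"
      using that e bj by (auto simp: dist_norm field_simps intro!: subsetD[OF e(2)])
    have nz: "sin (ph i s) \<noteq> 0" if "i \<in> I" for i
      using sin[OF in_N that] by (simp add: ph)
    define T where "T = (\<Prod>i\<in>I. sin (ph i s) ^ 4)"
    have T: "T = sin (ph i s) ^ 4 * P i s" if "i \<in> I" for i
      unfolding T_def P_def by (rule prod.remove[OF I that])
    have "num s = T * hess_grad I b d K L (q + s *\<^sub>R b j) k l"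
      unfolding num_def hess_grad_def ph sum_distrib_left
    proof (rule sum.cong[OF refl])
      fix i assume "i \<in> I"
      show "(2 + 4 * (cos (ph i s) * cos (ph i s))) * (P i s * A i s)
          + (- 2) * (cos (ph i s) * (sin (ph i s) * (P i s * B i s)))
        = T * ((2 + 4 * (cos (ph i s))\<^sup>2) / sin (ph i s) ^ 4 * commutator (K (q + s *\<^sub>R b j)) (b i) k l
           - 2 * cos (ph i s) / sin (ph i s) ^ 3 * (L (q + s *\<^sub>R b j) k l \<bullet> b i))"
        unfolding T[OF \<open>i \<in> I\<close>] A_def[symmetric] B_def[symmetric]
        using nz[OF \<open>i \<in> I\<close>] by (simp add: field_simps power2_eq_square power3_eq_cube power4_eq_xxxx)
    qed
    then show ?thesis using zero[OF in_N] by simp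
  qed
  moreover have "e / norm (b j) > 0" using e(1) bj by simp
  ultimately have num: "num s = 0" for s
    using entire_on_line_zero by blast
  \<comment> \<open>Since \<open>b j\<close> has squared length \<open>1/2\<close>, phase
    \<open>j\<close> equals \<open>4 n pi\<close> here. The other inner products are quarters of
    integers, so the other phases take their generic value up to a multiple of
    \<open>2 pi\<close>.\<close>
  define pole where "pole n = 2 * (4 * of_int n * pi - (b j \<bullet> q + d j))" for n :: int
  have A0: "A j (pole n) = 0" for n
  proof -
    have phj: "ph j (pole n) = 2 * of_int (2 * n) * pi"
      by (simp add: ph_def pole_def j(2) field_simps)
    have sj: "sin (ph j (pole n)) = 0" and cj: "cos (ph j (pole n)) = 1"
      unfolding phj by (metis sin_int_2pin mult.commute mult.left_commute, metis cos_int_2pin mult.commute mult.left_commute)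
    have Pz: "P i (pole n) = 0" if "i \<noteq> j" for i
      unfolding P_def using I j(1) that sj by (intro prod_zero) (auto intro!: bexI[of _ j])
    have Pj: "P j (pole n) \<noteq> 0"
    proof -
      have "sin (ph i (pole n)) \<noteq> 0" if "i \<in> I" "i \<noteq> j" for i
      proof -
        from quarter[OF that(1)] obtain m :: int where m: "b i \<bullet> b j = m / 4" by blast
        define x where "x = (b i - (2 * (b i \<bullet> b j)) *\<^sub>R b j) \<bullet> q + (d i - 2 * (b i \<bullet> b j) * d j)"
        have "ph i (pole n) = x + 2 * pi * of_int (n * m)"
          by (simp add: x_def ph_def pole_def m inner_diff_left field_simps)
        moreover have "sin (x + 2 * pi * of_int (n * m)) = sin x"
          by (simp only: sin_add sin_int_2pin cos_int_2pin)
        ultimately show ?thesis using generic[OF that] by (simp add: x_def)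
      qed
      then show ?thesis unfolding P_def using I by simp
    qed
    \<comment> \<open>All other summands contain the vanishing factor
      \<open>sin (ph j (pole n)) ^ 4\<close>, and \<open>2 + 4 * cos^2\<close> is
      \<open>6\<close>.\<close>
    have "num (pole n) = 6 * (P j (pole n) * A j (pole n))"
      unfolding num_def
      by (subst sum.remove[OF I j(1)]) (simp add: Pz sj cj)
    then show ?thesis using num Pj by simp
  qed
  have "inj pole" by (auto simp: inj_def pole_def)
  then have "infinite (range pole)" by (simp add: finite_image_iff)
  moreover have "range pole \<subseteq> {s. A j s = 0}" using A0 by auto
  ultimately have "infinite {s. A j s = 0}" by (metis finite_subset)
  then show ?thesis
    unfolding A_def
    by (rule polynomial_zero[OF polynomial_commutator[OF K]])
qed


lemma eigenvector_if_commutator_zero: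
  assumes "\<And>k l. commutator K v k l = 0" "v \<noteq> 0"
  shows "K *v v = (((K *v v) \<bullet> v) / (v \<bullet> v)) *\<^sub>R v"
proof -
  have "(v \<bullet> v) * (K *v v) $ k = ((K *v v) \<bullet> v) * v $ k" for k
  proof -
    have "(v \<bullet> v) * (K *v v) $ k - ((K *v v) \<bullet> v) * v $ k = - (\<Sum>l\<in>UNIV. v $ l * commutator K v k l)"
      by (simp add: commutator_def inner_vec_def sum_3) (simp add: algebra_simps)
    then show ?thesis using assms(1) by simp
  qed
  then show ?thesis using assms(2) by (simp add: vec_eq_iff field_simps)
qed

text \<open>At a generic point all \<open>b j\<close> are eigenvectors of the symmetric matrix
  \<open>K q\<close>. Eigenvectors that are not orthogonal share their eigenvalue, so the family
  \<open>J\<close> has the eigenvalue of \<open>b j0\<close>, and it spans.\<close>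

lemma scalar_at_generic_point:
  fixes b :: "'i \<Rightarrow> pt" and K :: "pt \<Rightarrow> real^3^3"
  assumes I: "finite I" and N: "open N" "N \<noteq> {}"
    and K: "\<And>k l. real_polynomial_function (\<lambda>q. K q $ k $ l)"
    and L: "\<And>k l i. real_polynomial_function (\<lambda>q. L q k l $ i)"
    and zero: "\<And>q k l. q \<in> N \<Longrightarrow> hess_grad I b d K L q k l = 0"
    and sin: "\<And>q i. q \<in> N \<Longrightarrow> i \<in> I \<Longrightarrow> sin (b i \<bullet> q + d i) \<noteq> 0"
    and sym: "\<And>q. q \<in> N \<Longrightarrow> transpose (K q) = K q"
    and unit: "\<And>i. i \<in> I \<Longrightarrow> b i \<bullet> b i = 1 / 2"
    and quarter: "\<And>i j. i \<in> I \<Longrightarrow> j \<in> I \<Longrightarrow> \<exists>m::int. b i \<bullet> b j = m / 4"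
    and indep: "\<And>i j. i \<in> I \<Longrightarrow> j \<in> I \<Longrightarrow> i \<noteq> j \<Longrightarrow> b i \<noteq> (2 * (b i \<bullet> b j)) *\<^sub>R b j"
    and J: "J \<subseteq> I" "j0 \<in> J" "\<And>j. j \<in> J \<Longrightarrow> b j0 \<bullet> b j \<noteq> 0"
    and span: "\<And>v. (\<And>j. j \<in> J \<Longrightarrow> v \<bullet> b j = 0) \<Longrightarrow> v = 0"
  shows "\<exists>q\<in>N. \<exists>r. \<forall>v. K q *v v = r *\<^sub>R v"
proof -
  \<comment> \<open>Genericity concerns the components of \<open>b i\<close> orthogonal to
    \<open>b j\<close>; they are nonzero by \<open>indep\<close>, and the corresponding phases are
    constant along the line in the direction \<open>b j\<close>.\<close>
  define IJ where "IJ = {(i, j). i \<in> I \<and> j \<in> I \<and> i \<noteq> j}"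
  have "IJ \<subseteq> I \<times> I" by (auto simp: IJ_def)
  then have "finite IJ" using I by (meson finite_SigmaI finite_subset)
  then have "\<exists>q\<in>N. \<forall>p\<in>IJ. sin ((case p of (i, j) \<Rightarrow> b i - (2 * (b i \<bullet> b j)) *\<^sub>R b j) \<bullet> q
      + (case p of (i, j) \<Rightarrow> d i - 2 * (b i \<bullet> b j) * d j)) \<noteq> 0"
    by (rule nonvanishing_point) (use indep N in \<open>auto simp: IJ_def\<close>)
  then obtain q where q: "q \<in> N" and gen: "\<And>i j. i \<in> I \<Longrightarrow> j \<in> I \<Longrightarrow> i \<noteq> j \<Longrightarrow>
      sin ((b i - (2 * (b i \<bullet> b j)) *\<^sub>R b j) \<bullet> q + (d i - 2 * (b i \<bullet> b j) * d j)) \<noteq> 0"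
    unfolding IJ_def by fastforce
  have comm: "commutator (K q) (b j) k l = 0" if "j \<in> I" for j k l
    by (rule commutator_zero_generic[OF I N(1) q K L zero sin that unit[OF that]
          quarter[OF _ that] gen[OF _ that]])
  define r where "r j = ((K q *v b j) \<bullet> b j) / (b j \<bullet> b j)" for j
  have eig: "K q *v b j = r j *\<^sub>R b j" if "j \<in> I" for j
    unfolding r_def using comm[OF that] unit[OF that]
    by (intro eigenvector_if_commutator_zero) auto
  have self: "(K q *v v) \<bullet> w = v \<bullet> (K q *v w)" for v w
    using sym[OF q] by (metis dot_lmul_matrix transpose_matrix_vector inner_commute)
  have rj: "r j = r j0" if "j \<in> J" for j
  proof -
    have "r j0 * (b j0 \<bullet> b j) = r j * (b j0 \<bullet> b j)"
      using self[of "b j0" "b j"] eig[OF subsetD[OF J(1) that]] eig[OF subsetD[OF J(1,2)]]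
      by simp
    then show ?thesis using J(3)[OF that] by simp
  qed
  have "K q *v v = r j0 *\<^sub>R v" for v
  proof -
    have "K q *v v - r j0 *\<^sub>R v = 0"
    proof (rule span)
      fix j assume "j \<in> J"
      then show "(K q *v v - r j0 *\<^sub>R v) \<bullet> b j = 0"
        using eig[of j] rj[of j] J(1) by (auto simp: inner_diff_left self)
    qed
    then show ?thesis by simp
  qed
  then show ?thesis using q by blast
qed

section \<open>Flat coordinates\<close>

definition orbit_map :: "pt \<Rightarrow> pt" where
  "orbit_map y = vector [cos (y$1) + cos (y$2) + cos (y$3),
     cos (y$1) * cos (y$2) + cos (y$1) * cos (y$3) + cos (y$2) * cos (y$3),
     cos (y$1) * cos (y$2) * cos (y$3)]"

definition orbit_jac :: "pt \<Rightarrow> real^3^3" where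
  "orbit_jac y = vector [
     vector [- sin (y$1), - sin (y$2), - sin (y$3)],
     vector [- sin (y$1) * (cos (y$2) + cos (y$3)), - sin (y$2) * (cos (y$1) + cos (y$3)),
       - sin (y$3) * (cos (y$1) + cos (y$2))],
     vector [- sin (y$1) * (cos (y$2) * cos (y$3)), - sin (y$2) * (cos (y$1) * cos (y$3)),
       - sin (y$3) * (cos (y$1) * cos (y$2))]]"

section \<open>The Jacobian of \<open>orbit_map\<close>\<close>

lemma has_derivative_component:
  assumes "\<And>i. ((\<lambda>x. f x $ i) has_derivative (\<lambda>h. f' h $ i)) (at (x :: pt))"
  shows "(f has_derivative (f' :: pt \<Rightarrow> pt)) (at x)"
proof (rule has_derivative_componentwise_within[THEN iffD2], intro ballI)
  fix b :: pt assume "b \<in> Basis"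
  then obtain i where "b = axis i 1" by (auto simp: Basis_vec_def)
  then show "((\<lambda>x. f x \<bullet> b) has_derivative (\<lambda>x. f' x \<bullet> b)) (at x)"
    using assms[of i] by (simp add: inner_axis)
qed

lemma has_derivative_nth[derivative_intros]:
  "((\<lambda>x. x $ i) has_derivative (\<lambda>h. h $ i :: real)) (at (x :: pt) within S)"
  by (rule bounded_linear_imp_has_derivative) (rule bounded_linear_vec_nth)

lemma orbit_map_has_derivative: "(orbit_map has_derivative (\<lambda>h. orbit_jac y *v h)) (at y)"
proof (rule has_derivative_component)
  have "\<forall>i. ((\<lambda>x. orbit_map x $ i) has_derivative (\<lambda>h. (orbit_jac y *v h) $ i)) (at y)"
    unfolding forall_3 orbit_map_def orbit_jac_def matrix_vector_mult_def
    by (auto simp: sum_3 fun_eq_iff algebra_simps intro!: derivative_eq_intros)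
  then show "((\<lambda>x. orbit_map x $ i) has_derivative (\<lambda>h. (orbit_jac y *v h) $ i)) (at y)" for i
    by blast
qed

text \<open>Makes \<open>orbit_map\<close> a local isometry from Euclidean space where its Jacobian
  is regular. Each column of the Jacobian carries one sine, so only squares of sines occur and they
  become \<open>1 - cos^2\<close>.\<close>

lemma orbit_jac_gram: "orbit_jac y ** transpose (orbit_jac y) = cometric (orbit_map y)"
proof -
  have s: "sin a * sin a = 1 - cos a * cos a" for a :: real
    using sin_cos_squared_add[of a] by (simp add: power2_eq_square)
  have s': "sin a * (sin a * r) = (1 - cos a * cos a) * r" for a r :: real
    using s[of a] by (simp flip: mult.assoc)
  have "\<forall>i j. (orbit_jac y ** transpose (orbit_jac y)) $ i $ j = cometric (orbit_map y) $ i $ j"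
    unfolding forall_3 matrix_matrix_mult_def transpose_def
    by (simp add: orbit_jac_def orbit_map_def cometric_def sum_3)
       (simp add: algebra_simps s s')
  then show ?thesis by (simp add: vec_eq_iff)
qed

subsection \<open>The roots of the cubic\<close>

lemma cubic_has_root: "\<exists>c::real. c^3 - a * c^2 + b * c - d = 0"
proof -
  define p where "p s = s^3 - a * s^2 + b * s - d" for s
  define B where "B = 1 + \<bar>a\<bar> + \<bar>b\<bar> + \<bar>d\<bar>"
  have B1: "B \<ge> 1" by (simp add: B_def)
  have BB: "B \<le> B^2" using B1 by (simp add: power2_eq_square)
  have key: "\<bar>a\<bar> * B^2 + \<bar>b\<bar> * B + \<bar>d\<bar> \<le> B^3"
  proof -
    have "\<bar>b\<bar> * B \<le> \<bar>b\<bar> * B^2" using BB by (simp add: mult_left_mono)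
    moreover have "\<bar>d\<bar> \<le> \<bar>d\<bar> * B^2" using B1 BB mult_left_mono[of 1 "B^2" "\<bar>d\<bar>"] by simp
    moreover have "B^3 = \<bar>a\<bar> * B^2 + \<bar>b\<bar> * B^2 + \<bar>d\<bar> * B^2 + B^2"
      by (simp add: B_def power2_eq_square power3_eq_cube algebra_simps)
    moreover have "B^2 \<ge> 0" by simp
    ultimately show ?thesis by linarith
  qed
  have 1: "\<bar>a * B^2\<bar> = \<bar>a\<bar> * B^2" "\<bar>b * B\<bar> = \<bar>b\<bar> * B"
    using B1 by (simp_all add: abs_mult)
  have "p (- B) \<le> 0" "0 \<le> p B"
    using key 1 abs_ge_self[of "a * B^2"] abs_ge_minus_self[of "a * B^2"] abs_ge_self[of "b * B"]
      abs_ge_minus_self[of "b * B"] abs_ge_self[of d] abs_ge_minus_self[of d]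
    by (simp_all add: p_def)
  moreover have "continuous_on {- B..B} p" unfolding p_def[abs_def] by (intro continuous_intros)
  ultimately have "\<exists>c. - B \<le> c \<and> c \<le> B \<and> p c = 0" using B1 by (intro IVT') auto
  then show ?thesis by (auto simp: p_def)
qed

lemma pos_region_pos:
  assumes "x \<in> pos_region G" "v \<noteq> 0"
  shows "v \<bullet> (G x *v v) > 0"
  using assms by (simp add: pos_region_def pos_def_def)

text \<open>Evaluating the metric on a covector amounts to \<open>\<Sum>a. (1 - c\<^sub>a\<^sup>2) * (Q c\<^sub>a)\<^sup>2\<close> for a
  polynomial \<open>Q\<close> of degree at most two; here \<open>Q\<close> vanishes at the two other roots.\<close>

lemma root_bound:
  assumes x: "x \<in> pos_region cometric" and e: "x = vector [c + s, c * s + p, c * p]"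
  shows "\<bar>c\<bar> < 1"
proof -
  define v :: pt where "v = vector [c\<^sup>2, - c, 1]"
  have "v \<noteq> 0" by (simp add: v_def vec_eq_iff forall_3)
  from pos_region_pos[OF x this] have "0 < v \<bullet> (cometric x *v v)" .
  also have "v \<bullet> (cometric x *v v) = (1 - c\<^sup>2) * (c\<^sup>2 - s * c + p)\<^sup>2"
    by (simp add: e v_def inner_vec_def matrix_vector_mult_def sum_3 cometric_def)
       (simp add: algebra_simps power2_eq_square)
  finally have "c\<^sup>2 < 1"
    by (simp add: zero_less_mult_iff not_less[symmetric])
  then show ?thesis by (simp add: abs_square_less_1)
qed

text \<open>Here \<open>Q\<close> ranges over the multiples of \<open>z - c\<close>; the Gram determinant of this plane is
  \<open>(1 - c\<^sub>1\<^sup>2) * (1 - c\<^sub>2\<^sup>2) * ((c\<^sub>1 - c) * (c\<^sub>2 - c) * (c\<^sub>1 - c\<^sub>2))\<^sup>2\<close>, which is not positive for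
  complex conjugate \<open>c\<^sub>1\<close>, \<open>c\<^sub>2\<close>.\<close>

lemma roots_real:
  assumes x: "x \<in> pos_region cometric" and e: "x = vector [c + s, c * s + p, c * p]"
  shows "4 * p \<le> s\<^sup>2"
proof (rule ccontr)
  assume "\<not> 4 * p \<le> s\<^sup>2"
  then have neg: "s\<^sup>2 - 4 * p < 0" by simp
  \<comment> \<open>The covector \<open>b\<close> corresponds to the polynomial
    \<open>z - c\<close>, and \<open>a\<close> to \<open>z * (z - c)\<close>.\<close>
  define a b :: pt where "a = vector [s\<^sup>2 - p, - s, 1]" and "b = vector [s, - 1, 0]"
  define q where "q v w = v \<bullet> (cometric x *v w)" for v w
  have "b \<noteq> 0" by (simp add: b_def vec_eq_iff forall_3)
  then have bb: "q b b > 0" unfolding q_def by (rule pos_region_pos[OF x])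
  \<comment> \<open>Gram-Schmidt step cleared of denominators: \<open>q v v\<close> is
    \<open>q b b\<close> times the Gram determinant.\<close>
  define v where "v = q b b *\<^sub>R a - q a b *\<^sub>R b"
  have "v $ 3 \<noteq> 0" using bb by (simp add: v_def a_def b_def)
  then have "v \<noteq> 0" by auto
  then have "0 < q v v" unfolding q_def by (rule pos_region_pos[OF x])
  also have "q v v = q b b * (q a a * q b b - (q a b)\<^sup>2)"
  proof -
    have sym: "q b a = q a b"
      unfolding q_def inner_vec_def matrix_vector_mult_def
      by (simp add: sum_3 cometric_sym[of x 2 1] cometric_sym[of x 3 1] cometric_sym[of x 3 2])
         (simp add: algebra_simps)
    have "q v v = q b b * q b b * q a a - 2 * (q a b * q b b * q a b) + q a b * q a b * q b b"
    proof -
      have lin: "q (r *\<^sub>R u - t *\<^sub>R w) z = r * q u z - t * q w z"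
        "q z (r *\<^sub>R u - t *\<^sub>R w) = r * q z u - t * q z w" for r t u w z
        by (simp_all add: q_def inner_diff_left matrix_vector_mult_diff_distrib
            matrix_vector_mult_scaleR inner_diff_right)
      show ?thesis unfolding v_def lin by (simp add: sym algebra_simps)
    qed
    then show ?thesis by (simp add: power2_eq_square algebra_simps)
  qed
  finally have "0 < q a a * q b b - (q a b)\<^sup>2"
    using bb by (simp add: zero_less_mult_iff)
  also have "q a a * q b b - (q a b)\<^sup>2
      = ((1 + p)\<^sup>2 - s\<^sup>2) * (c\<^sup>2 - s * c + p)\<^sup>2 * (s\<^sup>2 - 4 * p)"
    by (simp add: q_def e a_def b_def inner_vec_def matrix_vector_mult_def sum_3 cometric_def)
       (simp add: algebra_simps power2_eq_square)
  finally have "((1 + p)\<^sup>2 - s\<^sup>2) * (c\<^sup>2 - s * c + p)\<^sup>2 < 0"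
    using neg by (simp add: zero_less_mult_iff)
  moreover have "(1 + p)\<^sup>2 - s\<^sup>2 \<ge> 0"
  proof -
    have "(1 + p)\<^sup>2 - 4 * p = (1 - p)\<^sup>2" by (simp add: power2_eq_square algebra_simps)
    then show ?thesis using neg zero_le_power2[of "1 - p"] by linarith
  qed
  ultimately show False
    by (metis mult_nonneg_nonneg not_less zero_le_power2)
qed

text \<open>Positivity of the metric forces the cubic with coefficients \<open>x\<close> to have
  three real roots inside \<open>(-1, 1)\<close>; their arccosines form a preimage.\<close>

lemma orbit_map_onto_pos_region:
  assumes x: "x \<in> pos_region cometric"
  shows "\<exists>y. orbit_map y = x"
proof -
  obtain c where c: "c^3 - x$1 * c^2 + x$2 * c - x$3 = 0" using cubic_has_root by blast
  \<comment> \<open>The cofactor of the root \<open>c\<close> is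
    \<open>z^2 - s z + p\<close>.\<close>
  define s p where "s = x$1 - c" and "p = x$2 - c * s"
  have e: "x = vector [c + s, c * s + p, c * p]"
    using c by (simp add: vec_eq_iff forall_3 s_def p_def power2_eq_square power3_eq_cube algebra_simps)
  define h where "h = sqrt (s\<^sup>2 - 4 * p)"
  have h2: "h * h = s\<^sup>2 - 4 * p"
    using roots_real[OF x e] by (simp add: h_def)
  define a b where "a = (s + h) / 2" and "b = (s - h) / 2"
  have ab: "s = a + b" "p = a * b"
    using h2 by (simp_all add: a_def b_def field_simps power2_eq_square)
  have "x = vector [a + (c + b), a * (c + b) + c * b, a * (c * b)]"
    "x = vector [b + (c + a), b * (c + a) + c * a, b * (c * a)]"
    unfolding e ab by (simp_all add: vec_eq_iff forall_3 algebra_simps)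
  then have "\<bar>a\<bar> < 1" "\<bar>b\<bar> < 1" "\<bar>c\<bar> < 1"
    using root_bound[OF x] e by blast+
  then have "orbit_map (vector [arccos a, arccos b, arccos c]) = x"
    by (simp add: orbit_map_def e ab vec_eq_iff forall_3 cos_arccos_abs algebra_simps)
  then show ?thesis by blast
qed


subsection \<open>The potential in flat coordinates\<close>

text \<open>Half the D3 root \<open>e_j + e_k\<close> or \<open>e_j - e_k\<close>. The first
  component of the index names the missing axis, and addition in the type \<open>3\<close> is
  cyclic.\<close>

definition half_root :: "3 \<times> bool \<Rightarrow> pt" where
  "half_root r = (1 / 2) *\<^sub>R (axis (fst r + 1) 1 + (if snd r then 1 else - 1) *\<^sub>R axis (fst r + 2) 1)"

lemma half_root_simps:
  "half_root (1, True) = vector [0, 1/2, 1/2]" "half_root (1, False) = vector [0, 1/2, - (1/2)]"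
  "half_root (2, True) = vector [1/2, 0, 1/2]" "half_root (2, False) = vector [- (1/2), 0, 1/2]"
  "half_root (3, True) = vector [1/2, 1/2, 0]" "half_root (3, False) = vector [1/2, - (1/2), 0]"
  by (simp_all add: half_root_def vec_eq_iff forall_3 axis_def)

lemma forall_half_root:
  "(\<forall>r. P (half_root r)) \<longleftrightarrow>
     P (vector [0, 1/2, 1/2]) \<and> P (vector [0, 1/2, - (1/2)]) \<and> P (vector [1/2, 0, 1/2])
     \<and> P (vector [- (1/2), 0, 1/2]) \<and> P (vector [1/2, 1/2, 0]) \<and> P (vector [1/2, - (1/2), 0])"
  unfolding split_paired_All forall_3 all_bool_eq half_root_simps by blast

lemma sum_half_root:
  "(\<Sum>r\<in>UNIV. f (half_root r)) =
     f (vector [0, 1/2, 1/2]) + f (vector [0, 1/2, - (1/2)]) + f (vector [1/2, 0, 1/2])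
     + f (vector [- (1/2), 0, 1/2]) + f (vector [1/2, 1/2, 0]) + (f (vector [1/2, - (1/2), 0]) :: real)"
proof -
  have "(\<Sum>r\<in>UNIV. f (half_root r)) = (\<Sum>i\<in>UNIV. \<Sum>s\<in>UNIV. f (half_root (i, s)))"
    by (simp add: sum.cartesian_product del: UNIV_bool)
  then show ?thesis
    by (simp add: sum_3 UNIV_bool half_root_simps)
qed

text \<open>With \<open>a = (u + v) / 2\<close> and \<open>b = (u - v) / 2\<close> one has
  \<open>cos u - cos v = - 2 sin a sin b\<close> and
  \<open>1 - cos u cos v = sin^2 a + sin^2 b\<close>.\<close>

lemma pair_potential:
  fixes u v :: real
  assumes "cos u \<noteq> cos v"
  shows "sin ((u + v) / 2) \<noteq> 0" "sin ((u - v) / 2) \<noteq> 0"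
    "1 / (sin ((u + v) / 2))\<^sup>2 + 1 / (sin ((u - v) / 2))\<^sup>2 = 4 * (1 - cos u * cos v) / (cos u - cos v)\<^sup>2"
proof -
  define a b where "a = (u + v) / 2" and "b = (u - v) / 2"
  have uv: "u = a + b" "v = a - b" by (simp_all add: a_def b_def field_simps)
  have prod: "cos u - cos v = - 2 * (sin a * sin b)"
    unfolding uv by (simp add: cos_add cos_diff)
  then have nz: "sin a \<noteq> 0" "sin b \<noteq> 0" using assms by auto
  have sum: "1 - cos u * cos v = (sin a)\<^sup>2 + (sin b)\<^sup>2"
  proof -
    have "cos u * cos v = (cos a)\<^sup>2 * (cos b)\<^sup>2 - (sin a)\<^sup>2 * (sin b)\<^sup>2"
      unfolding uv by (simp add: cos_add cos_diff power2_eq_square algebra_simps)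
    also have "\<dots> = (1 - (sin a)\<^sup>2) * (1 - (sin b)\<^sup>2) - (sin a)\<^sup>2 * (sin b)\<^sup>2"
      by (simp add: cos_squared_eq)
    finally show ?thesis by (simp add: algebra_simps)
  qed
  show "sin ((u + v) / 2) \<noteq> 0" "sin ((u - v) / 2) \<noteq> 0" using nz by (simp_all add: a_def b_def)
  show "1 / (sin ((u + v) / 2))\<^sup>2 + 1 / (sin ((u - v) / 2))\<^sup>2 = 4 * (1 - cos u * cos v) / (cos u - cos v)\<^sup>2"
    unfolding a_def[symmetric] b_def[symmetric] prod sum
    using nz by (simp add: field_simps power2_eq_square)
qed

lemma disc_orbit_map:
  "disc (orbit_map y) =
     ((cos (y$1) - cos (y$2)) * (cos (y$1) - cos (y$3)) * (cos (y$2) - cos (y$3)))\<^sup>2"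
  by (simp add: disc_def orbit_map_def) (simp add: algebra_simps power2_eq_square)

text \<open>The half roots come in three pairs, \<open>pair_potential\<close> turns each pair into a
  rational function of two cosines, and the common denominator of the three is
  \<open>disc\<close>.\<close>

lemma potential_orbit_map:
  assumes "disc (orbit_map y) \<noteq> 0"
  shows "potential (orbit_map y) = (\<Sum>r\<in>UNIV. 1 / (sin (half_root r \<bullet> y))\<^sup>2) - 20"
    and "sin (half_root r \<bullet> y) \<noteq> 0"
proof -
  define a b c where "a = cos (y$1)" "b = cos (y$2)" "c = cos (y$3)"
  note abc = this
  have ne: "a \<noteq> b" "a \<noteq> c" "b \<noteq> c" using assms unfolding disc_orbit_map abc by auto
  note pp = pair_potential(3)[of "y$2" "y$3"] pair_potential(3)[of "y$3" "y$1"]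
    pair_potential(3)[of "y$1" "y$2"]
  have half: "v / 2 + u / 2 = (v + u) / 2" "v / 2 - u / 2 = (v - u) / 2" for u v :: real
    by (simp_all add: field_simps)
  have "(\<Sum>r\<in>UNIV. 1 / (sin (half_root r \<bullet> y))\<^sup>2)
     = 4 * (1 - b * c) / (b - c)\<^sup>2 + 4 * (1 - c * a) / (c - a)\<^sup>2 + 4 * (1 - a * b) / (a - b)\<^sup>2"
    using pp ne unfolding abc[symmetric] sum_half_root[of "\<lambda>r. 1 / (sin (r \<bullet> y))\<^sup>2"]
    by (simp add: inner_vec_def sum_3 half add.commute[of "y$1 / 2" "y$3 / 2"] add.commute[of "y$1" "y$3"])
  also have "\<dots> = potential (orbit_map y) + 20"
  proof -
    have D: "disc (orbit_map y) = ((a - b) * (a - c) * (b - c))\<^sup>2"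
      unfolding disc_orbit_map abc ..
    define x where "x = orbit_map y"
    have num: "36 * x$2 * x$2 - 108 * x$3 * x$3 - 4 * x$2 * x$2 * x$2 + 36 * x$1 * x$2 * x$3
       - 24 * x$1 * x$1 * x$2 - 4 * x$1 * x$1 * x$1 * x$3 + 4 * x$1 * x$1 * x$1 * x$1
      = 4 * (1 - b * c) * ((a - b) * (a - c))\<^sup>2 + 4 * (1 - c * a) * ((a - b) * (b - c))\<^sup>2
        + 4 * (1 - a * b) * ((a - c) * (b - c))\<^sup>2"
      by (simp add: x_def orbit_map_def abc[symmetric]) (simp add: algebra_simps power2_eq_square)
    have "potential (orbit_map y) + 20 =
       (4 * (1 - b * c) * ((a - b) * (a - c))\<^sup>2 + 4 * (1 - c * a) * ((a - b) * (b - c))\<^sup>2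
        + 4 * (1 - a * b) * ((a - c) * (b - c))\<^sup>2) / ((a - b) * (a - c) * (b - c))\<^sup>2"
      unfolding potential_def x_def[symmetric] D[folded x_def] num by simp
    also have "\<dots> = 4 * (1 - b * c) / (b - c)\<^sup>2 + 4 * (1 - c * a) / (c - a)\<^sup>2 + 4 * (1 - a * b) / (a - b)\<^sup>2"
      using ne by (simp add: add_divide_distrib power_mult_distrib power2_commute[of c a])
    finally show ?thesis by simp
  qed
  finally show "potential (orbit_map y) = (\<Sum>r\<in>UNIV. 1 / (sin (half_root r \<bullet> y))\<^sup>2) - 20" by simp
  have "\<forall>r. sin (half_root r \<bullet> y) \<noteq> 0"
    unfolding forall_half_root[of "\<lambda>v. sin (v \<bullet> y) \<noteq> 0"]
    using pair_potential(1,2)[of "y$2" "y$3"] pair_potential(1,2)[of "y$3" "y$1"]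
      pair_potential(1,2)[of "y$1" "y$2"] ne unfolding abc[symmetric]
    by (simp add: inner_vec_def sum_3 half add.commute[of "y$1 / 2" "y$3 / 2"] add.commute[of "y$1" "y$3"])
  then show "sin (half_root r \<bullet> y) \<noteq> 0" by blast
qed

subsection \<open>Cartesian charts\<close>

lemma orthogonal_matrix_norm:
  fixes A :: "real^3^3"
  assumes "orthogonal_matrix A"
  shows "norm (A *v h) = norm h"
  using assms orthogonal_transformation_matrix[of "(*v) A"]
  by (simp add: orthogonal_transformation_norm)

text \<open>Mean value inequality on a convex set, with operator norm at most one.\<close>

lemma isometric_derivative_Lipschitz:
  fixes f :: "pt \<Rightarrow> pt"
  assumes "\<And>y. y \<in> ball c r \<Longrightarrow> (f has_derivative f' y) (at y)"
    and "\<And>y h. y \<in> ball c r \<Longrightarrow> norm (f' y h) = norm h"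
    and "p \<in> ball c r" "q \<in> ball c r"
  shows "norm (f p - f q) \<le> norm (p - q)"
proof -
  have "norm (f p - f q) \<le> 1 * norm (p - q)"
  proof (rule differentiable_bound[of "ball c r" f f'])
    show "(f has_derivative f' y) (at y within ball c r)" if "y \<in> ball c r" for y
      using assms(1)[OF that] has_derivative_at_withinI by blast
    show "onorm (f' y) \<le> 1" if "y \<in> ball c r" for y
      by (rule onorm_bound) (simp_all add: assms(2)[OF that])
  qed (use assms in auto)
  then show ?thesis by simp
qed

text \<open>A local isometry and its inverse do not increase distances, so it preserves them, and
  differentiating the polarized identity once shows that it is affine.\<close>

lemma local_isometry_affine:
  fixes z :: "pt \<Rightarrow> pt" and M :: "pt \<Rightarrow> real^3^3"
  assumes V: "open V" "y0 \<in> V"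
    and der: "\<And>y. y \<in> V \<Longrightarrow> (z has_derivative (\<lambda>h. M y *v h)) (at y)"
    and cont: "\<And>i j. continuous_on V (\<lambda>y. M y $ i $ j)"
    and orth: "\<And>y. y \<in> V \<Longrightarrow> orthogonal_matrix (M y)"
  shows "\<exists>N. open N \<and> y0 \<in> N \<and> N \<subseteq> V \<and> (\<forall>y\<in>N. z y = z y0 + M y0 *v (y - y0))"
proof -
  define T where "T = transpose (M y0)"
  have T: "T ** M y0 = mat 1" "M y0 ** T = mat 1"
    using orth[OF V(2)] by (auto simp: T_def orthogonal_matrix_def)
  define f' where "f' y = Blinfun (\<lambda>h. M y *v h)" for y
  have f': "blinfun_apply (f' y) = (\<lambda>h. M y *v h)" for y
    unfolding f'_def by (rule bounded_linear_Blinfun_apply) (simp add: linear_conv_bounded_linear[symmetric])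
  have blT: "blinfun_apply (Blinfun (\<lambda>h. T *v h)) = (\<lambda>h. T *v h)"
    by (rule bounded_linear_Blinfun_apply) (simp add: linear_conv_bounded_linear[symmetric])
  have cont_f': "continuous_on V f'"
  proof (rule continuous_on_blinfun_componentwise)
    fix i :: pt assume "i \<in> Basis"
    then obtain j where j: "i = axis j 1" by (auto simp: Basis_vec_def)
    have "blinfun_apply (f' y) i = (\<chi> k. M y $ k $ j)" for y
      by (simp add: f' j matrix_vector_mult_def vec_eq_iff axis_def if_distrib cong: if_cong)
    moreover have "continuous_on V (\<lambda>y. \<chi> k. M y $ k $ j)"
      using cont by (intro continuous_on_vec_lambda) auto
    ultimately show "continuous_on V (\<lambda>x. blinfun_apply (f' x) i)" by simp
  qed
  have inv_f': "Blinfun (\<lambda>h. T *v h) o\<^sub>L f' y0 = id_blinfun"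
  proof (rule blinfun_eqI)
    fix h
    show "blinfun_apply (Blinfun (\<lambda>h. T *v h) o\<^sub>L f' y0) h
        = blinfun_apply id_blinfun h"
      by (simp add: f' blT matrix_vector_mul_assoc T)
  qed
  have der_f': "(z has_derivative blinfun_apply (f' y)) (at y)" if "y \<in> V" for y
    using der[OF that] by (simp add: f')
  \<comment> \<open>The local inverse supplies the opposite distance estimate, its derivative being
    isometric too.\<close>
  obtain U' V' g g' where U': "open U'" "U' \<subseteq> V" "y0 \<in> U'" and V': "open V'" "z y0 \<in> V'"
    and hom: "homeomorphism U' V' z g"
    and g: "\<And>y. y \<in> V' \<Longrightarrow> (g has_derivative (g' y)) (at y)"
      "\<And>y. y \<in> V' \<Longrightarrow> g' y = inv (blinfun_apply (f' (g y)))"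
      "\<And>y. y \<in> V' \<Longrightarrow> bij (blinfun_apply (f' (g y)))"
    by (rule inverse_function_theorem[OF V(1) der_f' cont_f' V(2) inv_f'], assumption) (rule that; simp)
  obtain e where e: "e > 0" "ball (z y0) e \<subseteq> V'" using V' by (rule openE)
  have "continuous_on U' z" using hom by (simp add: homeomorphism_def)
  then have "open (U' \<inter> z -` ball (z y0) e)"
    using U'(1) by (simp add: continuous_open_preimage)
  moreover have "y0 \<in> U' \<inter> z -` ball (z y0) e"
    using U'(3) e(1) by simp
  ultimately obtain r where r: "r > 0" "ball y0 r \<subseteq> U' \<inter> z -` ball (z y0) e"
    by (rule openE)
  have iso_g: "norm (g' y h) = norm h" if "y \<in> V'" for y h
  proof -
    have "g y \<in> V" using hom that U'(2) by (auto simp: homeomorphism_def)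
    moreover have "M (g y) *v (g' y h) = h"
      using g(2,3)[OF that] unfolding f' by (simp add: bij_is_surj surj_f_inv_f)
    ultimately show ?thesis
      using orthogonal_matrix_norm[OF orth, of "g y" "g' y h"] by simp
  qed
  have dist: "norm (z p - z q) = norm (p - q)" if "p \<in> ball y0 r" "q \<in> ball y0 r" for p q
  proof (rule antisym)
    show "norm (z p - z q) \<le> norm (p - q)"
    proof (rule isometric_derivative_Lipschitz[of y0 r z "\<lambda>y h. M y *v h"])
      fix y assume "y \<in> ball y0 r"
      then have "y \<in> V" using r(2) U'(2) by blast
      then show "(z has_derivative (*v) (M y)) (at y)" "norm (M y *v h) = norm h" for h
        using der orthogonal_matrix_norm[OF orth] by auto
    qed (use that in auto)
    have "g (z p) = p" "g (z q) = q" "z p \<in> ball (z y0) e" "z q \<in> ball (z y0) e"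
      using hom r(2) that by (auto simp: homeomorphism_def)
    then show "norm (p - q) \<le> norm (z p - z q)"
      using isometric_derivative_Lipschitz[of "z y0" e g g' "z p" "z q"] g(1) iso_g subsetD[OF e(2)]
      by simp
  qed
  have inner: "(z p - z y0) \<bullet> (z q - z y0) = (p - y0) \<bullet> (q - y0)"
    if "p \<in> ball y0 r" "q \<in> ball y0 r" for p q
  proof -
    have pol: "2 * ((a :: pt) \<bullet> b) = (norm a)\<^sup>2 + (norm b)\<^sup>2 - (norm (a - b))\<^sup>2" for a b
      by (simp add: power2_norm_eq_inner inner_diff_left inner_diff_right inner_commute)
    have c: "y0 \<in> ball y0 r" using r(1) by simp
    have "2 * ((z p - z y0) \<bullet> (z q - z y0)) = 2 * ((p - y0) \<bullet> (q - y0))"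
      unfolding pol using dist[OF that(1) c] dist[OF that(2) c] dist[OF that] by simp
    then show ?thesis by simp
  qed
  have "z p = z y0 + M y0 *v (p - y0)" if "p \<in> ball y0 r" for p
  proof -
    \<comment> \<open>Both sides of the polarized identity are differentiated in \<open>q\<close> at
      \<open>y0\<close>.\<close>
    have D: "(z p - z y0) \<bullet> (M y0 *v h) = (p - y0) \<bullet> h" for h
    proof -
      have "((\<lambda>q. (z p - z y0) \<bullet> (z q - z y0)) has_derivative (\<lambda>h. (z p - z y0) \<bullet> (M y0 *v h))) (at y0)"
        by (intro bounded_linear.has_derivative[OF bounded_linear_inner_right]
            has_derivative_diff[OF der[OF V(2)] has_derivative_const, simplified])
      moreover have "((\<lambda>q. (z p - z y0) \<bullet> (z q - z y0)) has_derivative (\<lambda>h. (p - y0) \<bullet> h)) (at y0)"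
      proof (rule has_derivative_transform_within_open[where f="\<lambda>q. (p - y0) \<bullet> (q - y0)" and s="ball y0 r"])
        show "((\<lambda>q. (p - y0) \<bullet> (q - y0)) has_derivative (\<lambda>h. (p - y0) \<bullet> h)) (at y0)"
          by (intro bounded_linear.has_derivative[OF bounded_linear_inner_right]
              has_derivative_diff[OF has_derivative_ident has_derivative_const, simplified])
      qed (use r(1) inner[OF that] in auto)
      ultimately have "(\<lambda>h. (z p - z y0) \<bullet> (M y0 *v h)) = (\<lambda>h. (p - y0) \<bullet> h)"
        by (rule has_derivative_unique)
      then show ?thesis by (rule fun_cong)
    qed
    have "(z p - z y0 - M y0 *v (p - y0)) \<bullet> w = 0" for w
    proof -
      define h where "h = T *v w"
      have w: "w = M y0 *v h"
        by (simp add: h_def matrix_vector_mul_assoc T)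
      have "(M y0 *v (p - y0)) \<bullet> (M y0 *v h) = (p - y0) \<bullet> h"
        using orth[OF V(2)] orthogonal_transformation_matrix[of "(*v) (M y0)"]
        by (simp add: orthogonal_transformation_def)
      then show ?thesis using D[of h] by (simp add: w inner_diff_left)
    qed
    then have "z p - z y0 - M y0 *v (p - y0) = 0" by (metis inner_eq_zero_iff)
    then show ?thesis by (simp add: algebra_simps)
  qed
  moreover have "y0 \<in> ball y0 r" "ball y0 r \<subseteq> V" using r U'(2) by auto
  ultimately show ?thesis by (intro exI[of _ "ball y0 r"] conjI ballI open_ball)
qed

definition chart_jac :: "(pt \<Rightarrow> pt) \<Rightarrow> pt \<Rightarrow> real^3^3" where
  "chart_jac Y x = (\<chi> a i. pd i (\<lambda>z. Y z $ a) x)"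

lemma has_derivative_smooth_map:
  assumes "smooth_map_on W Y" "x \<in> W"
  shows "(Y has_derivative (\<lambda>h. chart_jac Y x *v h)) (at x)"
proof (rule has_derivative_component)
  fix a
  have "(\<lambda>z. Y z $ a) differentiable (at x)"
    using assms by (auto simp: smooth_map_on_def intro: smooth_on_differentiable)
  from has_derivative_pd[OF this]
  show "((\<lambda>z. Y z $ a) has_derivative (\<lambda>h. (chart_jac Y x *v h) $ a)) (at x)"
    by (simp add: matrix_vector_mult_def chart_jac_def mult.commute)
qed

lemma orbit_map_continuous: "continuous_on S orbit_map"
  by (rule continuous_at_imp_continuous_on)
     (use has_derivative_continuous orbit_map_has_derivative in blast)

lemma orbit_jac_continuous: "continuous_on S (\<lambda>y. orbit_jac y $ i $ j)"
proof -
  have "\<forall>i j. continuous_on S (\<lambda>y. orbit_jac y $ i $ j)"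
    unfolding forall_3 orbit_jac_def by (simp add: continuous_intros)
  then show ?thesis by blast
qed

text \<open>The hypothesis is \<open>J G J^T = 1\<close> for the chart, and \<open>G\<close> is
  \<open>orbit_jac\<close> times its transpose, so the product of the two Jacobians has orthonormal
  rows.\<close>

lemma chart_jac_orthogonal:
  assumes "\<And>a b. (\<Sum>i\<in>UNIV. \<Sum>j\<in>UNIV. cometric (orbit_map y) $ i $ j
      * pd i (\<lambda>z. Y z $ a) (orbit_map y) * pd j (\<lambda>z. Y z $ b) (orbit_map y)) = (if a = b then 1 else 0)"
  shows "orthogonal_matrix (chart_jac Y (orbit_map y) ** orbit_jac y)"
proof -
  let ?x = "orbit_map y"
  define J where "J = chart_jac Y ?x"
  define M where "M = J ** orbit_jac y"
  have "M ** transpose M = J ** (cometric ?x ** transpose J)"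
    unfolding M_def matrix_transpose_mul orbit_jac_gram[symmetric] matrix_mul_assoc ..
  also have "\<dots> = mat 1"
  proof -
    have "(J ** (cometric ?x ** transpose J)) $ a $ b = (mat 1 :: real^3^3) $ a $ b" for a b
    proof -
      have "(J ** (cometric ?x ** transpose J)) $ a $ b
         = (\<Sum>i\<in>UNIV. \<Sum>j\<in>UNIV. cometric ?x $ i $ j * J $ a $ i * J $ b $ j)"
        by (simp add: matrix_matrix_mult_def transpose_def sum_distrib_left ac_simps)
      also have "\<dots> = (mat 1 :: real^3^3) $ a $ b"
        using assms[of a b] by (simp add: J_def chart_jac_def mat_def)
      finally show ?thesis .
    qed
    then show ?thesis by (simp add: vec_eq_iff)
  qed
  finally have right: "M ** transpose M = mat 1" .
  then have "transpose M ** M = mat 1"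
    by (rule matrix_left_right_inverse[THEN iffD1])
  with right show ?thesis
    unfolding orthogonal_matrix_def M_def J_def by (intro conjI)
qed

text \<open>Every Cartesian chart is locally inverse to \<open>orbit_map\<close> composed with a Euclidean motion.\<close>

lemma cartesian_chart_inverse:
  assumes "cartesian_chart cometric W Y"
  obtains R :: "real^3^3" and t N where "orthogonal_matrix R" "open N" "N \<noteq> {}"
    "\<And>q. q \<in> N \<Longrightarrow> orbit_map (R *v q + t) \<in> W"
    "\<And>q. q \<in> N \<Longrightarrow> Y (orbit_map (R *v q + t)) = q"
proof -
  have W: "open W" "W \<noteq> {}" "W \<subseteq> pos_region cometric" and Y: "smooth_map_on W Y"
    and iso: "\<And>x a b. x \<in> W \<Longrightarrow>
        (\<Sum>i\<in>UNIV. \<Sum>j\<in>UNIV. cometric x $ i $ j * pd i (\<lambda>z. Y z $ a) x * pd j (\<lambda>z. Y z $ b) x)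
        = (if a = b then 1 else 0)"
    using assms by (auto simp: cartesian_chart_def)
  obtain x0 where x0: "x0 \<in> W" using W by blast
  then obtain y0 where y0: "orbit_map y0 = x0" using W(3) orbit_map_onto_pos_region by blast
  define V where "V = orbit_map -` W"
  have V: "open V" "y0 \<in> V"
    using open_vimage[OF W(1) orbit_map_continuous] x0 y0 by (simp_all add: V_def)
  define M where "M y = chart_jac Y (orbit_map y) ** orbit_jac y" for y
  have in_W: "orbit_map y \<in> W" if "y \<in> V" for y using that by (simp add: V_def)
  have der: "((\<lambda>y. Y (orbit_map y)) has_derivative (\<lambda>h. M y *v h)) (at y)" if "y \<in> V" for y
    using has_derivative_compose[OF orbit_map_has_derivative has_derivative_smooth_map[OF Y in_W[OF that]]]
    by (simp add: M_def matrix_vector_mul_assoc)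
  have cont: "continuous_on V (\<lambda>y. M y $ a $ j)" for a j
  proof -
    have "continuous_on V (\<lambda>y. chart_jac Y (orbit_map y) $ a $ i)" for i
    proof -
      have "smooth_on W (\<lambda>z. Y z $ a)" using Y by (simp add: smooth_map_on_def)
      then have "continuous_on W (\<lambda>x. chart_jac Y x $ a $ i)"
        by (simp add: chart_jac_def smooth_on_imp_continuous_on smooth_on_pd)
      then show ?thesis
        by (rule continuous_on_compose2[OF _ orbit_map_continuous]) (simp add: V_def)
    qed
    then show ?thesis
      unfolding M_def matrix_matrix_mult_def vec_lambda_beta
      by (intro continuous_on_sum continuous_on_mult orbit_jac_continuous)
  qed
  have orth: "orthogonal_matrix (M y)" if "y \<in> V" for y
    unfolding M_def by (rule chart_jac_orthogonal) (rule iso[OF in_W[OF that]])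
  obtain N where N: "open N" "y0 \<in> N" "N \<subseteq> V"
    and aff: "\<forall>y\<in>N. Y (orbit_map y) = Y x0 + M y0 *v (y - y0)"
    using local_isometry_affine[OF V der cont orth] unfolding y0 by blast
  \<comment> \<open>The motion inverse to the affine map that sends \<open>y\<close> to
    \<open>Y (orbit_map y)\<close>.\<close>
  define R where "R = transpose (M y0)"
  define t where "t = y0 - R *v (Y x0)"
  have R: "orthogonal_matrix R" "R ** M y0 = mat 1" "M y0 ** R = mat 1"
    using orth[OF V(2)] by (auto simp: R_def orthogonal_matrix_def)
  define N' where "N' = (\<lambda>q. R *v q + t) -` N"
  have "open N'"
    unfolding N'_def by (intro continuous_open_vimage N continuous_intros)
  moreover have "Y x0 \<in> N'" using N(2) by (simp add: N'_def t_def)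
  moreover have "orbit_map (R *v q + t) \<in> W" if "q \<in> N'" for q
    using that N(3) by (auto simp: N'_def V_def)
  moreover have "Y (orbit_map (R *v q + t)) = q" if "q \<in> N'" for q
  proof -
    have "Y (orbit_map (R *v q + t)) = Y x0 + M y0 *v (R *v q + t - y0)"
      using aff that by (simp add: N'_def)
    also have "R *v q + t - y0 = R *v (q - Y x0)"
      by (simp add: t_def matrix_vector_mult_diff_distrib)
    finally show ?thesis by (simp add: matrix_vector_mul_assoc R)
  qed
  ultimately show ?thesis by (intro that[OF R(1)]) auto
qed

section \<open>Consequences of separation\<close>

abbreviation shifted_op :: "real \<Rightarrow> operator" where
  "shifted_op E \<equiv> \<lambda>\<psi> x. schroedinger_op cometric potential \<psi> x - E * \<psi> x"

definition grad_sq :: "(pt \<Rightarrow> pt) \<Rightarrow> 3 \<Rightarrow> pt \<Rightarrow> real" where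
  "grad_sq u i x = (\<Sum>a\<in>UNIV. \<Sum>b\<in>UNIV.
     cometric x $ a $ b * pd a (\<lambda>z. u z $ i) x * pd b (\<lambda>z. u z $ i) x)"

lemma shifted_op_one:
  assumes "x \<in> nondeg_region cometric"
  shows "shifted_op E (\<lambda>z. 1) x = potential x - E"
proof -
  have "pd j (\<lambda>z. 1) = (\<lambda>z. 0)" for j by (rule ext) simp
  then show ?thesis
    using assms by (simp add: schroedinger_op_def laplace_beltrami_cometric)
qed

text \<open>The second commutator with the multiplication by \<open>u\<^sub>i\<close> isolates the symbol.\<close>

lemma shifted_op_symbol:
  assumes W: "open W" "W \<subseteq> nondeg_region cometric" and f: "smooth_on W f" and x: "x \<in> W"
  shows "shifted_op E (\<lambda>z. (f z)\<^sup>2) x - 2 * f x * shifted_op E f x + (f x)\<^sup>2 * shifted_op E (\<lambda>z. 1) x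
    = - 2 * (\<Sum>a\<in>UNIV. \<Sum>b\<in>UNIV. cometric x $ a $ b * pd a f x * pd b f x)"
proof -
  have f1: "f differentiable (at z)" "pd j f differentiable (at z)" if "z \<in> W" for z j
    using that f by (auto intro: smooth_on_differentiable smooth_on_pd)
  have sq: "pd j (\<lambda>z. (f z)\<^sup>2) z = 2 * (f z * pd j f z)" if "z \<in> W" for z j
    using f1[OF that] by (simp add: pd_power)
  have f2: "pd j (\<lambda>z. (f z)\<^sup>2) differentiable (at x)" for j
    using x f1 by (subst differentiable_cong[OF W(1) x sq]) (simp_all add: differentiable_simps)
  have sq2: "pd i (pd j (\<lambda>z. (f z)\<^sup>2)) x = 2 * (f x * pd i (pd j f) x + pd i f x * pd j f x)" for i j
  proof -
    have "pd i (pd j (\<lambda>z. (f z)\<^sup>2)) x = pd i (\<lambda>z. 2 * (f z * pd j f z)) x"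
      by (rule pd_cong[OF W(1) x]) (rule sq)
    also have "\<dots> = 2 * (f x * pd i (pd j f) x + pd i f x * pd j f x)"
      using f1[OF x] by (simp add: pd_mult differentiable_simps)
    finally show ?thesis .
  qed
  have xn: "x \<in> nondeg_region cometric" using W x by blast
  show ?thesis
    unfolding shifted_op_one[OF xn]
    unfolding schroedinger_op_def laplace_beltrami_cometric[OF xn f2]
      laplace_beltrami_cometric[OF xn f1(2)[OF x]] sq2 sq[OF x]
    by (simp add: sum_3 power2_eq_square) (simp add: algebra_simps)
qed

lemma diff_op_one: "diff_op a b c (\<lambda>v. 1) w = c w"
proof -
  have "pd j (\<lambda>v. 1) = (\<lambda>v. 0)" for j by (rule ext) simp
  then show ?thesis by (simp add: diff_op_def)
qed

text \<open>The same second commutator, for a separated operator and one of its own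
  coordinates.\<close>

lemma diff_op_symbol:
  "diff_op a b c (\<lambda>v. (v $ i)\<^sup>2) w - 2 * w $ i * diff_op a b c (\<lambda>v. v $ i) w
     + (w $ i)\<^sup>2 * diff_op a b c (\<lambda>v. 1) w = 2 * a w $ i $ i"
proof -
  have 1: "pd j (\<lambda>v. v $ i) = (\<lambda>v. if j = i then 1 else 0)" for j by (rule ext) simp
  have 2: "pd j (\<lambda>v. (v $ i)\<^sup>2) = (\<lambda>v. if j = i then 2 * v $ i else 0)" for j
    by (rule ext) (simp add: pd_power)
  have 3: "pd k (\<lambda>v. if j = i then 2 * v $ i else 0) w = (if j = i then if k = i then 2 else 0 else 0)" for k j
    by (simp add: pd_cmult)
  have 4: "pd k (\<lambda>v. if j = i then 1 else 0) w = 0" for k j by simp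
  have "(\<Sum>k\<in>UNIV. \<Sum>j\<in>UNIV. a w $ k $ j * (if j = i then if k = i then 2 else 0 else 0)) = 2 * a w $ i $ i"
  proof -
    have "(\<Sum>j\<in>UNIV. a w $ k $ j * (if j = i then if k = i then 2 else 0 else 0))
       = (if k = i then 2 * a w $ i $ i else 0)" for k
      by (simp add: if_distrib cong: if_cong)
    then show ?thesis by simp
  qed
  moreover have "(\<Sum>k\<in>UNIV. b w $ k * (if k = i then 2 * w $ i else 0)) = 2 * b w $ i * w $ i"
    "(\<Sum>k\<in>UNIV. b w $ k * (if k = i then 1 else 0)) = b w $ i"
    by (simp_all add: if_distrib cong: if_cong)
  ultimately show ?thesis
    unfolding diff_op_one unfolding diff_op_def 1 2 3 4
    by (simp add: algebra_simps power2_eq_square)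
qed

text \<open>The equation is tested on the functions \<open>1\<close>, \<open>u_i\<close> and
  \<open>u_i^2\<close>. The constant yields the potential, and the second commutator yields the
  squared gradient of \<open>u_i\<close> as a multiple of the symbol of the separated
  operator.\<close>

lemma separation_symbol:
  assumes sep: "separates_into BB (shifted_op E) u W" and BB: "finite BB"
    and W: "open W" "W \<subseteq> nondeg_region cometric" and u: "smooth_map_on W u"
  obtains F a c where "\<And>B. B \<in> BB \<Longrightarrow> depends_only B (a B)" "\<And>B. B \<in> BB \<Longrightarrow> depends_only B (c B)"
    "\<And>x. x \<in> W \<Longrightarrow> potential x - E = (\<Sum>B\<in>BB. F B x * c B (u x))"
    "\<And>x B i. x \<in> W \<Longrightarrow> B \<in> BB \<Longrightarrow> i \<in> B \<Longrightarrow> grad_sq u i x = - (F B x * a B (u x) $ i $ i)"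
proof -
  obtain L s F where L: "\<forall>B\<in>BB. second_order_op_in B (L B)"
    and eq: "\<forall>A k. (\<forall>B\<in>BB. smooth_on UNIV (A B) \<and> depends_only B (A B)) \<longrightarrow>
           (\<forall>x\<in>W. shifted_op E (\<lambda>z. \<Prod>B\<in>BB. A B (u z)) x =
              (\<Sum>B\<in>BB. F B x *
                 (L B (A B) (u x) + (\<Sum>m<card BB - 1. k m * s B m (u x)) * A B (u x)) *
                 (\<Prod>B'\<in>BB - {B}. A B' (u x))))"
    using sep unfolding separates_into_def by (elim exE conjE) (rule that; assumption)
  \<comment> \<open>All separation constants are set to zero.\<close>
  have eq0: "shifted_op E (\<lambda>z. \<Prod>B\<in>BB. A B (u z)) x =
      (\<Sum>B\<in>BB. F B x * L B (A B) (u x) * (\<Prod>B'\<in>BB - {B}. A B' (u x)))"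
    if "\<forall>B\<in>BB. smooth_on UNIV (A B) \<and> depends_only B (A B)" "x \<in> W" for A x
    using eq[THEN spec[of _ A], THEN spec[of _ "\<lambda>_. 0"], THEN mp, OF that(1), THEN bspec, OF that(2)]
    by simp
  have ex: "\<exists>a b c. depends_only B a \<and> depends_only B c \<and> L B = diff_op a b c" if "B \<in> BB" for B
    using L[THEN bspec, OF that] unfolding second_order_op_in_def by (elim exE conjE) (intro exI conjI)
  have "\<exists>a. \<forall>B\<in>BB. \<exists>b c. depends_only B (a B) \<and> depends_only B c \<and> L B = diff_op (a B) b c"
    by (rule bchoice) (use ex in simp)
  then obtain a where "\<forall>B\<in>BB. \<exists>b c. depends_only B (a B) \<and> depends_only B c \<and> L B = diff_op (a B) b c" ..
  from bchoice[OF this] obtain b where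
    "\<forall>B\<in>BB. \<exists>c. depends_only B (a B) \<and> depends_only B c \<and> L B = diff_op (a B) (b B) c" ..
  from bchoice[OF this] obtain c where abc0:
    "\<forall>B\<in>BB. depends_only B (a B) \<and> depends_only B (c B) \<and> L B = diff_op (a B) (b B) (c B)" ..
  have abc: "depends_only B (a B)" "depends_only B (c B)" "L B = diff_op (a B) (b B) (c B)"
    if "B \<in> BB" for B
    using abc0[THEN bspec, OF that] by simp_all
  have one: "potential x - E = (\<Sum>B\<in>BB. F B x * c B (u x))" if "x \<in> W" for x
  proof -
    have "shifted_op E (\<lambda>z. 1) x = (\<Sum>B\<in>BB. F B x * L B (\<lambda>v. 1) (u x))"
      using eq0[of "\<lambda>B v. 1" x] that by (simp add: depends_only_def)
    also have "\<dots> = (\<Sum>B\<in>BB. F B x * c B (u x))"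
      by (rule sum.cong) (simp_all add: abc(3) diff_op_one)
    finally show ?thesis unfolding shifted_op_one[OF subsetD[OF W(2) that]] .
  qed
  have sym: "grad_sq u i x = - (F B x * a B (u x) $ i $ i)"
    if x: "x \<in> W" and B: "B \<in> BB" "i \<in> B" for x B i
  proof -
    \<comment> \<open>The other blocks act on the constant function, so together they multiply by
      \<open>r\<close> and drop out of the second commutator.\<close>
    define r where "r = (\<Sum>B'\<in>BB - {B}. F B' x * c B' (u x))"
    have pw: "shifted_op E (\<lambda>z. f (u z $ i)) x = F B x * L B (\<lambda>v. f (v $ i)) (u x) + r * f (u x $ i)"
      if f: "smooth_on UNIV (\<lambda>v. f (v $ i))" for f :: "real \<Rightarrow> real"
    proof -
      define A where "A B' = (if B' = B then (\<lambda>v :: pt. f (v $ i)) else (\<lambda>v. 1))" for B'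
      have A: "\<forall>B\<in>BB. smooth_on UNIV (A B) \<and> depends_only B (A B)"
        using f B by (auto simp: A_def depends_only_def)
      have prod: "(\<Prod>B'\<in>BB. A B' w) = f (w $ i)" for w
        by (subst prod.remove[OF BB B(1)]) (simp add: A_def)
      have "shifted_op E (\<lambda>z. f (u z $ i)) x
         = (\<Sum>B\<in>BB. F B x * L B (A B) (u x) * (\<Prod>B'\<in>BB - {B}. A B' (u x)))"
        using eq0[OF A x] unfolding prod .
      also have "\<dots> = F B x * L B (A B) (u x) * (\<Prod>B'\<in>BB - {B}. A B' (u x))
         + (\<Sum>B''\<in>BB - {B}. F B'' x * L B'' (A B'') (u x) * (\<Prod>B'\<in>BB - {B''}. A B' (u x)))"
        by (rule sum.remove[OF BB B(1)])
      also have "(\<Prod>B'\<in>BB - {B}. A B' (u x)) = 1" by (simp add: A_def)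
      also have "(\<Sum>B''\<in>BB - {B}. F B'' x * L B'' (A B'') (u x) * (\<Prod>B'\<in>BB - {B''}. A B' (u x)))
         = (\<Sum>B''\<in>BB - {B}. F B'' x * c B'' (u x) * f (u x $ i))"
      proof (rule sum.cong[OF refl])
        fix B'' assume B'': "B'' \<in> BB - {B}"
        have "(\<Prod>B'\<in>BB - {B''}. A B' (u x)) = f (u x $ i)"
        proof -
          have "(\<Prod>B'\<in>BB. A B' (u x)) = A B'' (u x) * (\<Prod>B'\<in>BB - {B''}. A B' (u x))"
            using B'' BB by (intro prod.remove) auto
          moreover have "A B'' (u x) = 1" using B'' by (simp add: A_def)
          ultimately show ?thesis using prod[of "u x"] by simp
        qed
        moreover have "L B'' (A B'') (u x) = c B'' (u x)"
          using B'' by (simp add: A_def abc(3) diff_op_one)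
        ultimately show "F B'' x * L B'' (A B'') (u x) * (\<Prod>B'\<in>BB - {B''}. A B' (u x))
            = F B'' x * c B'' (u x) * f (u x $ i)" by simp
      qed
      finally show ?thesis by (simp add: r_def A_def sum_distrib_right)
    qed
    have ui: "smooth_on W (\<lambda>z. u z $ i)" using u by (simp add: smooth_map_on_def)
    have "- 2 * grad_sq u i x = F B x * (2 * a B (u x) $ i $ i)"
      unfolding diff_op_symbol[of "a B" "b B" "c B" i "u x", symmetric] abc(3)[OF B(1), symmetric]
        grad_sq_def shifted_op_symbol[OF W ui x, of E, symmetric]
      using pw[of "\<lambda>t. t\<^sup>2"] pw[of "\<lambda>t. t"] pw[of "\<lambda>t. 1"]
      by (simp add: smooth_on_power power2_eq_square[of "u x $ i"] algebra_simps)
    then show ?thesis by linarith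
  qed
  show ?thesis by (rule that[of a c F]) (fact abc(1) abc(2) one sym)+
qed

section \<open>Separated coordinates for the trigonometric potential\<close>

lemma orthogonal_to_basis_zero:
  fixes T :: "3 \<Rightarrow> pt"
  assumes "\<And>i. T i \<noteq> 0" "\<And>i j. i \<noteq> j \<Longrightarrow> T i \<bullet> T j = 0" "\<And>i. w \<bullet> T i = 0"
  shows "w = 0"
proof (rule ccontr)
  assume w: "w \<noteq> 0"
  have inj: "inj T"
    using assms(1,2) by (metis injI inner_eq_zero_iff)
  have "pairwise orthogonal (insert w (range T))"
    using assms(2,3) by (auto simp: pairwise_insert pairwise_def orthogonal_def inner_commute) metis
  moreover have "0 \<notin> insert w (range T)" using assms(1) w by (metis imageE insertE)
  ultimately have "independent (insert w (range T))"
    by (rule pairwise_orthogonal_independent)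
  then have "card (insert w (range T)) \<le> 3" using independent_bound by fastforce
  moreover have "w \<notin> range T" using assms(3) w by (metis imageE inner_eq_zero_iff)
  ultimately show False using card_image[OF inj] by simp
qed

lemma parallel_if_orthogonal:
  fixes T :: "3 \<Rightarrow> pt"
  assumes T: "\<And>i. T i \<noteq> 0" "\<And>i j. i \<noteq> j \<Longrightarrow> T i \<bullet> T j = 0"
    and m: "\<And>j. j \<noteq> i \<Longrightarrow> m \<bullet> T j = 0"
  shows "m = ((m \<bullet> T i) / (T i \<bullet> T i)) *\<^sub>R T i"
proof -
  define c where "c = (m \<bullet> T i) / (T i \<bullet> T i)"
  have "m - c *\<^sub>R T i = 0"
  proof (rule orthogonal_to_basis_zero[of T, OF T])
    fix j
    show "(m - c *\<^sub>R T i) \<bullet> T j = 0"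
      using m[of j] T(1)[of i] T(2)[of i j] by (cases "j = i") (simp_all add: c_def inner_diff_left)
  qed
  then show ?thesis by (simp add: c_def)
qed

text \<open>The potential after a Euclidean motion, with rotated half roots \<open>b\<close> and
  phases \<open>d\<close>. The last four assumptions are the properties of the half roots that enter
  the pole argument; \<open>star\<close> expresses irreducibility.\<close>

locale trig_potential =
  fixes b :: "'i::finite \<Rightarrow> pt" and d :: "'i \<Rightarrow> real" and N :: "pt set"
  assumes N: "open N" "N \<noteq> {}"
    and sin_nz: "\<And>q r. q \<in> N \<Longrightarrow> sin (b r \<bullet> q + d r) \<noteq> 0"
    and unit: "\<And>r. b r \<bullet> b r = 1 / 2"
    and quarter: "\<And>r s. \<exists>m::int. b r \<bullet> b s = m / 4"
    and indep: "\<And>r s. r \<noteq> s \<Longrightarrow> b r \<noteq> (2 * (b r \<bullet> b s)) *\<^sub>R b s"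
    and star: "\<exists>J j0. j0 \<in> J \<and> (\<forall>j\<in>J. b j0 \<bullet> b j \<noteq> 0) \<and> (\<forall>w. (\<forall>j\<in>J. w \<bullet> b j = 0) \<longrightarrow> w = 0)"
begin

definition pot :: "pt \<Rightarrow> real" where
  "pot q = (\<Sum>r\<in>UNIV. 1 / (sin (b r \<bullet> q + d r))\<^sup>2) - 20"

text \<open>First derivative of \<open>1 / sin^2\<close> at the phase of \<open>r\<close>;
  \<open>f2\<close> is the second one. Thus \<open>gr\<close> is the differential of
  \<open>pot\<close> and \<open>he\<close> its Hessian form.\<close>

definition f1 :: "pt \<Rightarrow> 'i \<Rightarrow> real" where
  "f1 q r = - 2 * cos (b r \<bullet> q + d r) / sin (b r \<bullet> q + d r) ^ 3"

definition f2 :: "pt \<Rightarrow> 'i \<Rightarrow> real" where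
  "f2 q r = (2 + 4 * (cos (b r \<bullet> q + d r))\<^sup>2) / sin (b r \<bullet> q + d r) ^ 4"

definition gr :: "pt \<Rightarrow> pt \<Rightarrow> real" where
  "gr q w = (\<Sum>r\<in>UNIV. f1 q r * (b r \<bullet> w))"

definition he :: "pt \<Rightarrow> pt \<Rightarrow> pt \<Rightarrow> real" where
  "he q w w' = (\<Sum>r\<in>UNIV. f2 q r * (b r \<bullet> w) * (b r \<bullet> w'))"

lemma DERIV_phase:
  assumes "(c has_vector_derivative w) (at t)"
  shows "((\<lambda>t. b r \<bullet> c t + d r) has_real_derivative b r \<bullet> w) (at t)"
  using bounded_linear.has_vector_derivative[OF bounded_linear_inner_right[of "b r"] assms]
  by (auto simp: has_real_derivative_iff_has_vector_derivative intro!: derivative_eq_intros)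

lemma DERIV_pot:
  assumes c: "(c has_vector_derivative w) (at t)" and N: "c t \<in> N"
  shows "((\<lambda>t. pot (c t)) has_real_derivative gr (c t) w) (at t)"
proof -
  have "((\<lambda>t. 1 / (sin (b r \<bullet> c t + d r))\<^sup>2) has_real_derivative f1 (c t) r * (b r \<bullet> w)) (at t)" for r
  proof -
    define ph where "ph t = b r \<bullet> c t + d r" for t
    have "sin (ph t) \<noteq> 0" using sin_nz[OF N, of r] by (simp add: ph_def)
    moreover have "(ph has_real_derivative b r \<bullet> w) (at t)"
      using DERIV_phase[OF c, of r] by (simp add: ph_def[abs_def])
    ultimately have "((\<lambda>t. 1 / (sin (ph t))\<^sup>2) has_real_derivative
        (- 2 * cos (ph t) / sin (ph t) ^ 3) * (b r \<bullet> w)) (at t)"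
      by (auto intro!: derivative_eq_intros simp: field_simps eval_nat_numeral)
    then show ?thesis by (simp add: f1_def ph_def)
  qed
  then have "((\<lambda>t. \<Sum>r\<in>UNIV. 1 / (sin (b r \<bullet> c t + d r))\<^sup>2) has_real_derivative
      (\<Sum>r\<in>UNIV. f1 (c t) r * (b r \<bullet> w))) (at t)"
    by (intro DERIV_sum)
  from DERIV_diff[OF this DERIV_const, of 20] show ?thesis
    unfolding pot_def gr_def by simp
qed

lemma DERIV_gr:
  assumes c: "(c has_vector_derivative w) (at t)" and N: "c t \<in> N"
    and T: "(T has_vector_derivative T') (at t)"
  shows "((\<lambda>t. gr (c t) (T t)) has_real_derivative he (c t) w (T t) + gr (c t) T') (at t)"
proof -
  have 1: "((\<lambda>t. f1 (c t) r) has_real_derivative f2 (c t) r * (b r \<bullet> w)) (at t)" for r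
  proof -
    define ph where "ph t = b r \<bullet> c t + d r" for t
    have s: "sin (ph t) \<noteq> 0" using sin_nz[OF N, of r] by (simp add: ph_def)
    have ph: "(ph has_real_derivative b r \<bullet> w) (at t)"
      using DERIV_phase[OF c, of r] by (simp add: ph_def[abs_def])
    have main: "((\<lambda>t. - 2 * cos (ph t) / sin (ph t) ^ 3) has_real_derivative
        (2 * sin (ph t) * sin (ph t) ^ 3 + 6 * cos (ph t) * cos (ph t) * (sin (ph t))\<^sup>2) / (sin (ph t) ^ 3 * sin (ph t) ^ 3)
          * (b r \<bullet> w)) (at t)"
      using s ph by (auto intro!: derivative_eq_intros simp: field_simps)
    have val: "(2 * sin (ph t) * sin (ph t) ^ 3 + 6 * cos (ph t) * cos (ph t) * (sin (ph t))\<^sup>2) / (sin (ph t) ^ 3 * sin (ph t) ^ 3)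
       = f2 (c t) r"
    proof -
      have "2 * (sin (ph t))\<^sup>2 + 6 * (cos (ph t))\<^sup>2 = 2 + 4 * (cos (ph t))\<^sup>2"
        by (simp add: sin_squared_eq)
      then have "f2 (c t) r = (2 * (sin (ph t))\<^sup>2 + 6 * (cos (ph t))\<^sup>2) / sin (ph t) ^ 4"
        by (simp add: f2_def ph_def)
      then show ?thesis
        using s by (simp add: field_simps eval_nat_numeral)
    qed
    show ?thesis using main unfolding val by (simp add: f1_def ph_def)
  qed
  have "((\<lambda>t. b r \<bullet> T t) has_real_derivative b r \<bullet> T') (at t)" for r
    using bounded_linear.has_vector_derivative[OF bounded_linear_inner_right[of "b r"] T]
    by (simp add: has_real_derivative_iff_has_vector_derivative)
  from DERIV_mult[OF 1 this]
  have "((\<lambda>t. \<Sum>r\<in>UNIV. f1 (c t) r * (b r \<bullet> T t)) has_real_derivative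
    (\<Sum>r\<in>UNIV. f2 (c t) r * (b r \<bullet> w) * (b r \<bullet> T t) + (b r \<bullet> T') * f1 (c t) r)) (at t)"
    by (intro DERIV_sum)
  then show ?thesis
    by (simp add: gr_def he_def sum.distrib mult.commute)
qed

lemma hess_grad_eq:
  "hess_grad UNIV b d K L q k l = (\<Sum>r\<in>UNIV. f2 q r * commutator (K q) (b r) k l + f1 q r * (L q k l \<bullet> b r))"
  by (simp add: hess_grad_def f1_def f2_def)

text \<open>The contradiction in which every separation ends: a solution of the Bertrand-Darboux
  type equation must be scalar somewhere.\<close>

lemma no_commuting_tensor:
  assumes "\<And>k l. real_polynomial_function (\<lambda>q. K q $ k $ l)"
    and "\<And>k l i. real_polynomial_function (\<lambda>q. L q k l $ i)"
    and "\<And>q k l. q \<in> N \<Longrightarrow> hess_grad UNIV b d K L q k l = 0"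
    and "\<And>q. q \<in> N \<Longrightarrow> transpose (K q) = K q"
    and "\<And>q r. q \<in> N \<Longrightarrow> \<exists>w. K q *v w \<noteq> r *\<^sub>R w"
  shows False
proof -
  obtain J j0 where J: "j0 \<in> J" "\<And>j. j \<in> J \<Longrightarrow> b j0 \<bullet> b j \<noteq> 0"
    "\<And>w. (\<And>j. j \<in> J \<Longrightarrow> w \<bullet> b j = 0) \<Longrightarrow> w = 0"
    using star by (elim exE conjE) (rule that; blast)
  have "\<exists>q\<in>N. \<exists>r. \<forall>v. K q *v v = r *\<^sub>R v"
    by (rule scalar_at_generic_point[OF finite N assms(1-3) sin_nz assms(4) unit quarter indep
          subset_UNIV J])
  then show False using assms(5) by blast
qed

end

section \<open>Rank one tensors and coordinate frames\<close>

lemma exists_orthogonal_vector: "\<exists>w::pt. w \<noteq> 0 \<and> z \<bullet> w = 0"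
proof (cases "z $ 1 = 0 \<and> z $ 2 = 0")
  case True
  then show ?thesis
    by (intro exI[of _ "axis 1 1"]) (simp add: inner_axis)
next
  case False
  have "(vector [- z $ 2, z $ 1, 0] :: pt) \<noteq> 0" using False by (auto simp: vec_eq_iff forall_3)
  then show ?thesis
    by (intro exI[of _ "vector [- z $ 2, z $ 1, 0]"]) (simp add: inner_vec_def sum_3)
qed

definition outer :: "pt \<Rightarrow> real^3^3" where
  "outer z = (\<chi> i j. z $ i * z $ j)"

lemma outer_mult: "outer z *v w = (z \<bullet> w) *\<^sub>R z"
  by (simp add: outer_def matrix_vector_mult_def vec_eq_iff inner_vec_def sum_distrib_left ac_simps)

lemma transpose_outer: "transpose (r *\<^sub>R outer z) = r *\<^sub>R outer z"
  by (simp add: outer_def transpose_def vec_eq_iff mult.commute)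

lemma outer_not_scalar:
  assumes "z \<noteq> 0" "s \<noteq> 0"
  shows "\<exists>w. (s *\<^sub>R outer z) *v w \<noteq> r *\<^sub>R w"
proof (rule ccontr)
  assume "\<not> ?thesis"
  then have *: "(s *\<^sub>R outer z) *v w = r *\<^sub>R w" for w by blast
  have e: "(s *\<^sub>R outer z) *v w = (s * (z \<bullet> w)) *\<^sub>R z" for w
    by (simp add: outer_mult flip: scaleR_matrix_vector_assoc)
  obtain w :: pt where "w \<noteq> 0" "z \<bullet> w = 0" using exists_orthogonal_vector by blast
  then have "r = 0" using *[of w] e[of w] by simp
  then have "(s * (z \<bullet> z)) *\<^sub>R z = 0" using *[of z] e[of z] by simp
  then show False using assms by simp
qed

text \<open>Coordinates \<open>v\<close> on \<open>N\<close> with inverse \<open>Psi\<close>;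
  \<open>G i\<close> is the gradient of the \<open>i\<close>-th coordinate and \<open>T i\<close>
  the tangent vector of its coordinate line. Of \<open>Psi\<close> only derivatives along coordinate
  lines are recorded.\<close>

locale separated_potential = trig_potential b d N
  for b :: "'i::finite \<Rightarrow> pt" and d :: "'i \<Rightarrow> real" and N :: "pt set" +
  fixes E :: real and Psi v :: "pt \<Rightarrow> pt" and G :: "3 \<Rightarrow> pt \<Rightarrow> pt" and T :: "3 \<Rightarrow> pt \<Rightarrow> pt"
  assumes Psi_v: "\<And>q. q \<in> N \<Longrightarrow> Psi (v q) = q"
    and G: "\<And>q i. q \<in> N \<Longrightarrow> ((\<lambda>q. v q $ i) has_derivative (\<lambda>w. G i q \<bullet> w)) (at q)"
    and T: "\<And>p i. p \<in> v ` N \<Longrightarrow> ((\<lambda>s. Psi (p + s *\<^sub>R axis i 1)) has_vector_derivative T i p) (at 0)"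
begin

definition Om where "Om = v ` N"

lemma Psi_Om: "p \<in> Om \<Longrightarrow> Psi p \<in> N" and v_Psi: "p \<in> Om \<Longrightarrow> v (Psi p) = p"
  using Psi_v by (auto simp: Om_def)

lemma v_continuous: "continuous_on N v"
proof -
  have "continuous_on N (\<lambda>q. v q $ i)" for i
    using G has_derivative_continuous continuous_at_imp_continuous_on by blast
  then have "continuous_on N (\<lambda>q. \<chi> i. v q $ i)" by (intro continuous_on_vec_lambda)
  then show ?thesis by simp
qed

text \<open>The chart \<open>v\<close> has the left inverse \<open>Psi\<close> and is continuous, so
  invariance of domain applies.\<close>

lemma open_Om: "open Om"
  unfolding Om_def
  by (rule invariance_of_domain[OF v_continuous N(1)]) (metis Psi_v inj_onI)

lemma Om_nonempty: "Om \<noteq> {}" using N by (simp add: Om_def)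

lemma in_Om_near:
  assumes "p \<in> Om"
  obtains e where "e > 0" "\<And>s t i j. \<bar>s\<bar> < e \<Longrightarrow> \<bar>t\<bar> < e \<Longrightarrow> p + s *\<^sub>R axis i 1 + t *\<^sub>R axis j 1 \<in> Om"
    "\<And>s i. \<bar>s\<bar> < e \<Longrightarrow> p + s *\<^sub>R axis i 1 \<in> Om"
proof -
  obtain r where r: "r > 0" "ball p r \<subseteq> Om" using open_Om assms by (rule openE)
  have 1: "p + s *\<^sub>R axis i 1 + t *\<^sub>R axis j 1 \<in> Om" if "\<bar>s\<bar> < r / 2" "\<bar>t\<bar> < r / 2" for s t i j
  proof -
    have "norm (s *\<^sub>R axis i 1 + t *\<^sub>R (axis j 1 :: pt)) < r"
      using norm_triangle_ineq[of "s *\<^sub>R axis i 1" "t *\<^sub>R (axis j 1 :: pt)"] that by simp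
    then have "dist p (p + s *\<^sub>R axis i 1 + t *\<^sub>R axis j 1) < r"
      by (simp add: dist_norm algebra_simps norm_minus_commute[of _ 0]
          flip: norm_minus_cancel[of "s *\<^sub>R axis i 1 + t *\<^sub>R (axis j 1 :: pt)"])
    then show ?thesis using r(2) by auto
  qed
  have 2: "p + s *\<^sub>R axis i 1 \<in> Om" if "\<bar>s\<bar> < r / 2" for s i
    using 1[OF that, of 0 i i] r(1) by simp
  show ?thesis using that[of "r / 2"] 1 2 r(1) by auto
qed

lemma G_T:
  assumes "p \<in> Om"
  shows "G i (Psi p) \<bullet> T j p = (if i = j then 1 else 0)"
proof -
  have q: "Psi p \<in> N" by (rule Psi_Om[OF assms])
  have "((\<lambda>s. Psi (p + s *\<^sub>R axis j 1)) has_derivative (\<lambda>h. h *\<^sub>R T j p)) (at 0)"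
    using T[of p j] assms by (simp add: Om_def has_vector_derivative_def)
  moreover have "((\<lambda>q. v q $ i) has_derivative (\<lambda>w. G i (Psi p) \<bullet> w)) (at (Psi (p + 0 *\<^sub>R axis j 1)))"
    using G[OF q] by simp
  ultimately have "((\<lambda>s. v (Psi (p + s *\<^sub>R axis j 1)) $ i) has_derivative (\<lambda>h. G i (Psi p) \<bullet> (h *\<^sub>R T j p))) (at 0)"
    by (rule has_derivative_compose)
  then have D: "((\<lambda>s. v (Psi (p + s *\<^sub>R axis j 1)) $ i) has_real_derivative G i (Psi p) \<bullet> T j p) (at 0)"
    by (simp add: has_field_derivative_def mult.commute[of _ "G i (Psi p) \<bullet> T j p"])
  obtain e where e: "e > 0" "\<And>s. \<bar>s\<bar> < e \<Longrightarrow> p + s *\<^sub>R axis j 1 \<in> Om"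
    using in_Om_near[OF assms] by metis
  have ev: "\<forall>\<^sub>F s in nhds 0. v (Psi (p + s *\<^sub>R axis j 1)) $ i = p $ i + s * (axis j 1 :: pt) $ i"
    unfolding eventually_nhds_metric using e v_Psi by (intro exI[of _ e]) (simp add: dist_norm)
  have "((\<lambda>s. p $ i + s * (axis j 1 :: pt) $ i) has_real_derivative (axis j 1 :: pt) $ i) (at 0)"
    by (auto intro!: derivative_eq_intros)
  then have "((\<lambda>s. v (Psi (p + s *\<^sub>R axis j 1)) $ i) has_real_derivative (axis j 1 :: pt) $ i) (at 0)"
    using DERIV_cong_ev[OF refl ev refl] by simp
  from DERIV_unique[OF D this] show ?thesis by (simp add: axis_def)
qed

lemma T_nz: "p \<in> Om \<Longrightarrow> T i p \<noteq> 0"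
  using G_T[of p i i] by auto

text \<open>In an orthogonal frame each dual vector is parallel to its frame vector, with reciprocal
  length.\<close>

lemma G_norm:
  assumes p: "p \<in> Om" and orth: "\<And>i j. i \<noteq> j \<Longrightarrow> T i p \<bullet> T j p = 0"
  shows "G i (Psi p) \<bullet> G i (Psi p) = 1 / (T i p \<bullet> T i p)"
proof -
  have "G i (Psi p) = ((G i (Psi p) \<bullet> T i p) / (T i p \<bullet> T i p)) *\<^sub>R T i p"
    by (rule parallel_if_orthogonal[where T="\<lambda>i. T i p"]) (use T_nz[OF p] orth G_T[OF p] in auto)
  then have "G i (Psi p) = (1 / (T i p \<bullet> T i p)) *\<^sub>R T i p"
    using G_T[OF p, of i i] by simp
  then have "G i (Psi p) \<bullet> G i (Psi p) = (1 / (T i p \<bullet> T i p)) * (G i (Psi p) \<bullet> T i p)"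
    by (metis inner_commute inner_scaleR_left)
  then show ?thesis using G_T[OF p, of i i] by simp
qed

text \<open>The mixed second difference of \<open>w * (V - E)\<close> vanishes, so its mixed derivative does.\<close>

lemma mixed_derivative:
  assumes u: "u \<in> Om"
    and T2: "((\<lambda>t. T i (u + t *\<^sub>R axis j 1)) has_vector_derivative T2) (at 0)"
    and wi: "\<And>p. p \<in> Om \<Longrightarrow> ((\<lambda>s. w (p + s *\<^sub>R axis i 1)) has_real_derivative wi p) (at 0)"
    and wj: "((\<lambda>s. w (u + s *\<^sub>R axis j 1)) has_real_derivative wj) (at 0)"
    and wij: "((\<lambda>s. wi (u + s *\<^sub>R axis j 1)) has_real_derivative 0) (at 0)"
    and al: "depends_only (- {j}) al" and be: "depends_only (- {i}) be"
    and sum: "\<And>p. p \<in> Om \<Longrightarrow> w p * (pot (Psi p) - E) = al p + be p"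
  shows "wi u * gr (Psi u) (T j u) + wj * gr (Psi u) (T i u)
    + w u * (he (Psi u) (T j u) (T i u) + gr (Psi u) T2) = 0"
proof -
  obtain e where e: "e > 0" "\<And>s t. \<bar>s\<bar> < e \<Longrightarrow> \<bar>t\<bar> < e \<Longrightarrow> u + t *\<^sub>R axis j 1 + s *\<^sub>R axis i 1 \<in> Om"
    "\<And>t. \<bar>t\<bar> < e \<Longrightarrow> u + t *\<^sub>R axis j 1 \<in> Om" "\<And>t. \<bar>t\<bar> < e \<Longrightarrow> u + t *\<^sub>R axis i 1 \<in> Om"
    using in_Om_near[OF u] by metis
  define D where "D p = wi p * (pot (Psi p) - E) + w p * gr (Psi p) (T i p)" for p
  have D: "((\<lambda>s. w (p + s *\<^sub>R axis i 1) * (pot (Psi (p + s *\<^sub>R axis i 1)) - E)) has_real_derivative D p) (at 0)"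
    if p: "p \<in> Om" for p
  proof -
    have "((\<lambda>s. pot (Psi (p + s *\<^sub>R axis i 1))) has_real_derivative gr (Psi (p + 0 *\<^sub>R axis i 1)) (T i p)) (at 0)"
      using T[of p i] p Psi_Om[OF p] by (intro DERIV_pot) (simp_all add: Om_def)
    then show ?thesis
      using wi[OF p] by (auto intro!: derivative_eq_intros simp: D_def)
  qed
  \<comment> \<open>A step in direction \<open>j\<close> leaves \<open>al\<close> unchanged and
    shifts \<open>be\<close> by an amount independent of \<open>s\<close>, so the derivative in
    direction \<open>i\<close> is not affected.\<close>
  have const: "D (u + t *\<^sub>R axis j 1) = D u" if t: "\<bar>t\<bar> < e" for t
  proof -
    define p where "p = u + t *\<^sub>R axis j 1"
    have p: "p \<in> Om" using e(3)[OF t] by (simp add: p_def)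
    have "w (p + s *\<^sub>R axis i 1) * (pot (Psi (p + s *\<^sub>R axis i 1)) - E)
       = w (u + s *\<^sub>R axis i 1) * (pot (Psi (u + s *\<^sub>R axis i 1)) - E) + (be p - be u)"
      if s: "\<bar>s\<bar> < e" for s
    proof -
      have 1: "al (p + s *\<^sub>R axis i 1) = al (u + s *\<^sub>R axis i 1)"
        using al unfolding depends_only_def by (auto simp: p_def axis_def)
      have 2: "be (p + s *\<^sub>R axis i 1) = be p" "be (u + s *\<^sub>R axis i 1) = be u"
        using be unfolding depends_only_def by (auto simp: axis_def)
      show ?thesis
        using sum[OF e(2)[OF s t, folded p_def]] sum[OF e(4)[OF s]] 1 2 by simp
    qed
    then have ev: "\<forall>\<^sub>F s in nhds 0. w (p + s *\<^sub>R axis i 1) * (pot (Psi (p + s *\<^sub>R axis i 1)) - E)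
       = w (u + s *\<^sub>R axis i 1) * (pot (Psi (u + s *\<^sub>R axis i 1)) - E) + (be p - be u)"
      unfolding eventually_nhds_metric using e(1) by (intro exI[of _ e]) (simp add: dist_norm)
    have "((\<lambda>s. w (u + s *\<^sub>R axis i 1) * (pot (Psi (u + s *\<^sub>R axis i 1)) - E) + (be p - be u))
        has_real_derivative D u + 0) (at 0)"
      by (rule DERIV_add[OF D[OF u] DERIV_const])
    then have "((\<lambda>s. w (p + s *\<^sub>R axis i 1) * (pot (Psi (p + s *\<^sub>R axis i 1)) - E))
        has_real_derivative D u) (at 0)"
      using DERIV_cong_ev[OF refl ev refl] by simp
    from DERIV_unique[OF D[OF p] this] show ?thesis by (simp add: p_def)
  qed
  have "((\<lambda>t. D (u + t *\<^sub>R axis j 1)) has_real_derivative 0) (at 0)"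
  proof -
    have ev: "\<forall>\<^sub>F t in nhds 0. D (u + t *\<^sub>R axis j 1) = D u"
      unfolding eventually_nhds_metric using e(1) const by (intro exI[of _ e]) (simp add: dist_norm)
    show ?thesis using DERIV_cong_ev[OF refl ev refl] DERIV_const by blast
  qed
  moreover have "((\<lambda>t. D (u + t *\<^sub>R axis j 1)) has_real_derivative
     wi u * gr (Psi u) (T j u) + wj * gr (Psi u) (T i u)
       + w u * (he (Psi u) (T j u) (T i u) + gr (Psi u) T2)) (at 0)"
  proof -
    have c: "((\<lambda>t. Psi (u + t *\<^sub>R axis j 1)) has_vector_derivative T j u) (at 0)"
      "Psi (u + 0 *\<^sub>R axis j 1) \<in> N"
      using T[of u j] u Psi_Om[OF u] by (simp_all add: Om_def)
    show ?thesis
      unfolding D_def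
      using wij wj DERIV_pot[OF c] DERIV_gr[OF c T2]
      by (auto intro!: derivative_eq_intros)
  qed
  ultimately show ?thesis by (rule DERIV_unique[symmetric])
qed

end

text \<open>The generator of the rotations about the third axis.\<close>

definition rot :: "pt \<Rightarrow> pt" where
  "rot z = vector [- z $ 2, z $ 1, 0]"

lemma bounded_linear_rot: "bounded_linear rot"
proof -
  have "linear rot" by (rule linearI) (simp_all add: rot_def vec_eq_iff forall_3)
  then show ?thesis by (simp add: linear_conv_bounded_linear)
qed

lemma depends_only_mono: "depends_only A f \<Longrightarrow> A \<subseteq> B \<Longrightarrow> depends_only B f"
  unfolding depends_only_def by blast

lemma polynomial_nth: "real_polynomial_function (\<lambda>q :: pt. q $ i)"
  by (rule real_polynomial_function.intros(1)) (rule bounded_linear_vec_nth)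

lemmas polynomial_intros = real_polynomial_function.intros(2-4) real_polynomial_function_diff
  real_polynomial_function_minus polynomial_nth

lemma ex_parallel_if_orthogonal:
  fixes T :: "3 \<Rightarrow> pt"
  assumes "\<And>i. T i \<noteq> 0" "\<And>i j. i \<noteq> j \<Longrightarrow> T i \<bullet> T j = 0" "\<And>j. j \<noteq> i \<Longrightarrow> m \<bullet> T j = 0"
  shows "\<exists>c. m = c *\<^sub>R T i"
  by (rule exI) (rule parallel_if_orthogonal[of T, OF assms])

context trig_potential
begin

lemma he_eq: "he q w w' = (\<Sum>r\<in>UNIV. (f2 q r * (b r \<bullet> w)) *\<^sub>R b r) \<bullet> w'"
  by (simp add: he_def inner_sum_left)

lemma he_sym: "he q w w' = he q w' w"
  by (simp add: he_def ac_simps)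

lemma he_scale: "he q w (c *\<^sub>R w') = c * he q w w'"
  by (simp add: he_eq)

lemma gr_eq: "gr q w = (\<Sum>r\<in>UNIV. f1 q r *\<^sub>R b r) \<bullet> w"
  by (simp add: gr_def inner_sum_left)

lemma gr_scale: "gr q (c *\<^sub>R w) = c * gr q w"
  by (simp add: gr_eq)

text \<open>The tensor \<open>s * z z\<^sup>T\<close> commutes with the Hessian up to terms of first order, once the
  vector \<open>s * Hess V z\<close> plus such terms is parallel to \<open>z\<close>.\<close>

lemma no_rank_one_tensor:
  assumes z: "\<And>i. real_polynomial_function (\<lambda>q. z q $ i)" "\<And>q. q \<in> N \<Longrightarrow> z q \<noteq> 0"
    and s: "real_polynomial_function s" "\<And>q. q \<in> N \<Longrightarrow> s q \<noteq> 0"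
    and A: "\<And>i k. real_polynomial_function (\<lambda>q. A q i $ k)"
    and par: "\<And>q. q \<in> N \<Longrightarrow> \<exists>c. (\<chi> k. s q * he q (z q) (axis k 1) + gr q (A q k)) = c *\<^sub>R z q"
  shows False
proof (rule no_commuting_tensor)
  let ?K = "\<lambda>q. s q *\<^sub>R outer (z q)" and ?L = "\<lambda>q k l. z q $ l *\<^sub>R A q k - z q $ k *\<^sub>R A q l"
  show "real_polynomial_function (\<lambda>q. ?K q $ k $ l)" for k l
    by (simp add: outer_def) (intro polynomial_intros s z)
  show "real_polynomial_function (\<lambda>q. ?L q k l $ i)" for k l i
    by simp (intro polynomial_intros A z)
  show "transpose (?K q) = ?K q" for q by (rule transpose_outer)
  show "\<exists>w. ?K q *v w \<noteq> r *\<^sub>R w" if "q \<in> N" for q r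
    by (rule outer_not_scalar[OF z(2) s(2)]) (rule that)+
  show "hess_grad UNIV b d ?K ?L q k l = 0" if q: "q \<in> N" for q k l
  proof -
    define m where "m = (\<chi> k. s q * he q (z q) (axis k 1) + gr q (A q k))"
    obtain c where c: "m = c *\<^sub>R z q" using par[OF q] by (auto simp: m_def)
    have m: "m $ k = (\<Sum>r\<in>UNIV. s q * (f2 q r * (b r \<bullet> z q) * b r $ k) + f1 q r * (b r \<bullet> A q k))" for k
      by (simp add: m_def he_def gr_def inner_axis sum_distrib_left sum.distrib)
    have comm: "commutator (?K q) w k l = s q * (w \<bullet> z q) * (w $ k * z q $ l - w $ l * z q $ k)" for w
      by (simp add: commutator_def outer_mult inner_commute algebra_simps flip: scaleR_matrix_vector_assoc)
    \<comment> \<open>The left side antisymmetrizes \<open>m z^T\<close>, so it vanishes when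
      \<open>m\<close> is parallel to \<open>z\<close>.\<close>
    have "hess_grad UNIV b d ?K ?L q k l = z q $ l * m $ k - z q $ k * m $ l"
      unfolding hess_grad_eq m sum_distrib_left sum_subtractf[symmetric]
      by (intro sum.cong refl)
         (simp add: comm inner_diff_left inner_diff_right inner_commute[of _ "b _"] algebra_simps)
    then show ?thesis by (simp add: c)
  qed
qed

end

context separated_potential
begin

section \<open>Separation along translations, dilations and rotations\<close>

lemma T_vec:
  assumes "p \<in> Om"
  shows "((\<lambda>s. Psi (p + s *\<^sub>R axis i 1)) has_vector_derivative T i p) (at 0)"
  using T assms by (simp add: Om_def)

lemma in_N_param: "q \<in> N \<Longrightarrow> v q \<in> Om" by (simp add: Om_def)

text \<open>With weight \<open>1\<close> and constant \<open>n\<close> the mixed derivatives say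
  that \<open>Hess V n\<close> is orthogonal to the other frame vectors, hence parallel to
  \<open>n\<close>; the tensor is \<open>n n^T\<close>.\<close>

lemma no_translation_separation:
  assumes orth: "\<And>p i j. p \<in> Om \<Longrightarrow> i \<noteq> j \<Longrightarrow> T i p \<bullet> T j p = 0"
    and n: "T i = (\<lambda>p. n)"
    and al: "depends_only {i} al" and be: "depends_only (- {i}) be"
    and sum: "\<And>p. p \<in> Om \<Longrightarrow> pot (Psi p) - E = al p + be p"
  shows False
proof (rule no_rank_one_tensor[of "\<lambda>_. n" "\<lambda>_. 1" "\<lambda>_ _. 0"])
  show "n \<noteq> 0" if "q \<in> N" for q
    using T_nz[OF in_N_param[OF that], of i] by (simp add: n)
  show "\<exists>c. (\<chi> k. 1 * he q n (axis k 1) + gr q 0) = c *\<^sub>R n" if q: "q \<in> N" for q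
  proof -
    define u where "u = v q"
    have u: "u \<in> Om" "Psi u = q" using q Psi_v by (auto simp: u_def Om_def)
    define m where "m = (\<Sum>r\<in>UNIV. (f2 q r * (b r \<bullet> n)) *\<^sub>R b r)"
    have "m \<bullet> T j u = 0" if j: "j \<noteq> i" for j
    proof -
      have "0 * gr (Psi u) (T j u) + 0 * gr (Psi u) (T i u)
          + 1 * (he (Psi u) (T j u) (T i u) + gr (Psi u) 0) = 0"
      proof (rule mixed_derivative[of u i j 0 "\<lambda>_. 1" "\<lambda>_. 0" 0 al be])
        show "depends_only (- {j}) al" by (rule depends_only_mono[OF al]) (use j in auto)
      qed (use u be sum n in \<open>auto intro!: derivative_eq_intros\<close>)
      then show ?thesis
        by (simp add: u gr_def he_sym[of q "T j u" n] he_eq[of q n] m_def n)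
    qed
    then have "\<exists>c. m = c *\<^sub>R T i u"
      by (intro ex_parallel_if_orthogonal[where T="\<lambda>i. T i u"] T_nz orth u)
    moreover have "(\<chi> k. 1 * he q n (axis k 1) + gr q 0) = m"
      by (simp add: vec_eq_iff he_eq gr_def m_def inner_axis)
    ultimately show ?thesis by (auto simp: n)
  qed
qed (simp_all add: polynomial_intros)

text \<open>With weight \<open>r^2\<close> the vector \<open>Hess V q + 3 grad V\<close> is parallel
  to \<open>q\<close>. Two of the three gradients come from differentiating \<open>r^2\<close>, the
  third from differentiating the unit vector \<open>q / r\<close>.\<close>

lemma no_radial_separation:
  assumes orth: "\<And>p i j. p \<in> Om \<Longrightarrow> i \<noteq> j \<Longrightarrow> T i p \<bullet> T j p = 0"
    and radial: "T 1 = (\<lambda>p. (1 / p $ 1) *\<^sub>R Psi p)" "\<And>p. p \<in> Om \<Longrightarrow> p $ 1 > 0"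
    and al: "depends_only {1} al" and be: "depends_only (- {1}) be"
    and sum: "\<And>p. p \<in> Om \<Longrightarrow> (p $ 1)\<^sup>2 * (pot (Psi p) - E) = al p + be p"
  shows False
proof (rule no_rank_one_tensor[of "\<lambda>q. q" "\<lambda>_. 1" "\<lambda>_ k. 3 *\<^sub>R axis k 1"])
  show "q \<noteq> 0" if "q \<in> N" for q
    using T_nz[OF in_N_param[OF that], of 1] that by (auto simp: radial Psi_v)
  show "\<exists>c. (\<chi> k. 1 * he q q (axis k 1) + gr q (3 *\<^sub>R axis k 1)) = c *\<^sub>R q" if q: "q \<in> N" for q
  proof -
    define u where "u = v q"
    have u: "u \<in> Om" "Psi u = q" using q Psi_v by (auto simp: u_def Om_def)
    have r: "u $ 1 > 0" using radial(2)[OF u(1)] .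
    define m where "m = (\<Sum>r\<in>UNIV. (f2 q r * (b r \<bullet> q)) *\<^sub>R b r) + 3 *\<^sub>R (\<Sum>r\<in>UNIV. f1 q r *\<^sub>R b r)"
    have "m \<bullet> T j u = 0" if j: "j \<noteq> 1" for j
    proof -
      have "2 * u $ 1 * gr (Psi u) (T j u) + 0 * gr (Psi u) (T 1 u)
          + (u $ 1)\<^sup>2 * (he (Psi u) (T j u) (T 1 u) + gr (Psi u) ((1 / u $ 1) *\<^sub>R T j u)) = 0"
      proof (rule mixed_derivative[of u 1 j _ "\<lambda>p. (p $ 1)\<^sup>2" "\<lambda>p. 2 * p $ 1" 0 al be])
        show "depends_only (- {j}) al" by (rule depends_only_mono[OF al]) (use j in auto)
        have "((\<lambda>t. (1 / u $ 1) *\<^sub>R Psi (u + t *\<^sub>R axis j 1)) has_vector_derivative (1 / u $ 1) *\<^sub>R T j u) (at 0)"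
          using bounded_linear.has_vector_derivative[OF bounded_linear_scaleR_right T_vec[OF u(1)]] .
        moreover have "axis j 1 $ 1 = (0 :: real)" using j by (simp add: axis_def)
        ultimately show "((\<lambda>t. T 1 (u + t *\<^sub>R axis j 1)) has_vector_derivative (1 / u $ 1) *\<^sub>R T j u) (at 0)"
          by (simp add: radial)
      qed (use u be sum j in \<open>auto intro!: derivative_eq_intros simp: axis_def\<close>)
      moreover have "(u $ 1)\<^sup>2 * (1 / u $ 1 * x) = u $ 1 * x" for x
        using r by (simp add: power2_eq_square)
      ultimately have "(u $ 1) * (he q (T j u) q + 3 * gr q (T j u)) = 0"
        by (simp add: u radial gr_scale he_scale distrib_left)
      then have "he q (T j u) q + 3 * gr q (T j u) = 0"
        using r by simp
      then show ?thesis
        by (simp add: he_sym[of q "T j u" q] he_eq[of q q] gr_eq m_def inner_add_left)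
    qed
    then have "\<exists>c. m = c *\<^sub>R T 1 u"
      by (intro ex_parallel_if_orthogonal[where T="\<lambda>i. T i u"] T_nz orth u)
    then obtain c where "m = c *\<^sub>R T 1 u" ..
    moreover have "(\<chi> k. 1 * he q q (axis k 1) + gr q (3 *\<^sub>R axis k 1)) = m"
      by (simp add: vec_eq_iff he_eq gr_eq m_def inner_axis)
    moreover have "T 1 u = (1 / u $ 1) *\<^sub>R q" by (simp add: radial u)
    ultimately show ?thesis by (intro exI[of _ "c * (1 / u $ 1)"]) simp
  qed
qed (simp_all add: polynomial_intros axis_def)

text \<open>The weight is the squared distance from the axis, which is constant along
  \<open>rot\<close>; its derivatives in the other directions produce the first order correction
  \<open>A\<close>.\<close>

lemma no_rotational_separation:
  assumes orth: "\<And>p i j. p \<in> Om \<Longrightarrow> i \<noteq> j \<Longrightarrow> T i p \<bullet> T j p = 0"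
    and rot: "T i = (\<lambda>p. rot (Psi p))"
    and al: "depends_only {i} al" and be: "depends_only (- {i}) be"
    and sum: "\<And>p. p \<in> Om \<Longrightarrow> ((Psi p $ 1)\<^sup>2 + (Psi p $ 2)\<^sup>2) * (pot (Psi p) - E) = al p + be p"
  shows False
proof -
  define P :: "pt \<Rightarrow> pt" where "P q = vector [q $ 1, q $ 2, 0]" for q
  define w :: "pt \<Rightarrow> real" where "w q = q $ 1 * q $ 1 + q $ 2 * q $ 2" for q
  define A where "A q k = (2 * P q $ k) *\<^sub>R rot q + w q *\<^sub>R rot (axis k 1)" for q k
  have rot0: "rot q = 0 \<longleftrightarrow> w q = 0" for q
    by (simp add: rot_def w_def vec_eq_iff forall_3 sum_squares_eq_zero_iff) auto
  have nz: "rot q \<noteq> 0" if "q \<in> N" for q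
    using T_nz[OF in_N_param[OF that], of i] that by (simp add: rot Psi_v)
  show False
  proof (rule no_rank_one_tensor[of rot w A])
    show "rot q \<noteq> 0" "w q \<noteq> 0" if "q \<in> N" for q using nz[OF that] rot0 by auto
    show "real_polynomial_function (\<lambda>q. rot q $ i)" for i
    proof -
      have "\<forall>i. real_polynomial_function (\<lambda>q. rot q $ i)"
        by (simp add: forall_3 rot_def polynomial_intros)
      then show ?thesis by blast
    qed
    then show "real_polynomial_function (\<lambda>q. A q i $ k)" for i k
    proof -
      have "\<forall>i. real_polynomial_function (\<lambda>q. P q $ i)"
        by (simp add: forall_3 P_def polynomial_intros)
      then show ?thesis
        using \<open>\<And>i. real_polynomial_function (\<lambda>q. rot q $ i)\<close>
        unfolding A_def w_def by (simp add: polynomial_intros)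
    qed
    show "real_polynomial_function w" unfolding w_def[abs_def] by (intro polynomial_intros)
    show "\<exists>c. (\<chi> k. w q * he q (rot q) (axis k 1) + gr q (A q k)) = c *\<^sub>R rot q" if q: "q \<in> N" for q
    proof -
      define u where "u = v q"
      have u: "u \<in> Om" "Psi u = q" using q Psi_v by (auto simp: u_def Om_def)
      define m where "m = (\<chi> k. w q * he q (rot q) (axis k 1) + gr q (A q k))"
      have m: "m \<bullet> x = w q * he q (rot q) x + 2 * (P q \<bullet> x) * gr q (rot q) + w q * gr q (rot x)" for x
      proof -
        have "rot x = (\<Sum>k\<in>UNIV. x $ k *\<^sub>R rot (axis k 1))"
          by (simp add: rot_def vec_eq_iff forall_3 sum_3 axis_def)
        then have 1: "gr q (rot x) = (\<Sum>k\<in>UNIV. x $ k * gr q (rot (axis k 1)))"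
          by (simp add: gr_eq inner_sum_right)
        have 2: "he q (rot q) x = (\<Sum>k\<in>UNIV. he q (rot q) (axis k 1) * x $ k)"
          unfolding he_eq by (simp add: inner_axis inner_vec_def[of _ x])
        have 3: "gr q (A q k) = 2 * P q $ k * gr q (rot q) + w q * gr q (rot (axis k 1))" for k
          by (simp add: A_def gr_eq inner_add_right)
        show ?thesis
          unfolding m_def 1 2 inner_vec_def[of _ x] 3 by (simp add: sum_3 algebra_simps)
      qed
      have "m \<bullet> T j u = 0" if j: "j \<noteq> i" for j
      proof -
        have comp: "((\<lambda>s. Psi (p + s *\<^sub>R axis i' 1) $ k) has_real_derivative T i' p $ k) (at 0)"
          if "p \<in> Om" for p i' k
          using bounded_linear.has_vector_derivative[OF bounded_linear_vec_nth T_vec[OF that]]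
          by (simp add: has_real_derivative_iff_has_vector_derivative)
        have dw: "((\<lambda>s. (Psi (p + s *\<^sub>R axis i' 1) $ 1)\<^sup>2 + (Psi (p + s *\<^sub>R axis i' 1) $ 2)\<^sup>2)
            has_real_derivative 2 * (P (Psi p) \<bullet> T i' p)) (at 0)" if "p \<in> Om" for p i'
          using comp[OF that, of i' 1] comp[OF that, of i' 2]
          by (auto intro!: derivative_eq_intros simp: P_def inner_vec_def sum_3)
        have "0 * gr (Psi u) (T j u) + (2 * (P (Psi u) \<bullet> T j u)) * gr (Psi u) (T i u)
            + ((Psi u $ 1)\<^sup>2 + (Psi u $ 2)\<^sup>2) * (he (Psi u) (T j u) (T i u) + gr (Psi u) (rot (T j u))) = 0"
        proof (rule mixed_derivative[of u i j _ "\<lambda>p. (Psi p $ 1)\<^sup>2 + (Psi p $ 2)\<^sup>2" "\<lambda>_. 0" _ al be])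
          show "depends_only (- {j}) al" by (rule depends_only_mono[OF al]) (use j in auto)
          show "((\<lambda>t. T i (u + t *\<^sub>R axis j 1)) has_vector_derivative rot (T j u)) (at 0)"
            unfolding rot by (rule bounded_linear.has_vector_derivative[OF bounded_linear_rot T_vec[OF u(1)]])
          show "((\<lambda>s. (Psi (p + s *\<^sub>R axis i 1) $ 1)\<^sup>2 + (Psi (p + s *\<^sub>R axis i 1) $ 2)\<^sup>2)
            has_real_derivative 0) (at 0)" if "p \<in> Om" for p
          proof -
            have "P (Psi p) \<bullet> T i p = 0" by (simp add: P_def rot rot_def inner_vec_def sum_3)
            then show ?thesis using dw[OF that, of i] by simp
          qed
        qed (use u be sum dw in auto)
        then show ?thesis
          unfolding m by (simp add: u rot he_sym[of q "T j u"] w_def power2_eq_square algebra_simps)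
      qed
      then have "\<exists>c. m = c *\<^sub>R T i u"
        by (intro ex_parallel_if_orthogonal[where T="\<lambda>i. T i u"] T_nz orth u)
      then show ?thesis by (simp add: rot u m_def)
    qed
  qed
qed

section \<open>Separation in confocal coordinates\<close>

lemma eigenvectors_orthogonal:
  fixes K :: "real^3^3"
  assumes "transpose K = K" "K *v x = r *\<^sub>R x" "K *v y = s *\<^sub>R y" "r \<noteq> s"
  shows "x \<bullet> y = 0"
proof -
  have "(K *v x) \<bullet> y = x \<bullet> (K *v y)"
    using assms(1) by (metis dot_lmul_matrix transpose_matrix_vector inner_commute)
  then show ?thesis using assms by simp
qed

text \<open>The second derivatives of \<open>V\<close> with respect to distinct coordinates vanish after
  correction by \<open>3 * M\<close>, where \<open>M\<close> is the diagonal matrix of \<open>de k * \<partial>\<^sub>k V\<close>.  Hence the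
  corrected Hessian is diagonal in the eigenbasis \<open>T\<close> of \<open>K\<close>, and commutes with \<open>K\<close>.\<close>

lemma no_confocal_separation:
  fixes K :: "pt \<Rightarrow> real^3^3" and de :: "pt \<Rightarrow> 3 \<Rightarrow> real"
  assumes K: "\<And>k l. real_polynomial_function (\<lambda>q. K q $ k $ l)" "\<And>q. transpose (K q) = K q"
    and eig: "\<And>p i. p \<in> Om \<Longrightarrow> K (Psi p) *v T i p = p $ i *\<^sub>R T i p"
    and distinct: "\<And>p i j. p \<in> Om \<Longrightarrow> i \<noteq> j \<Longrightarrow> p $ i \<noteq> p $ j"
    and T2: "\<And>p i j. p \<in> Om \<Longrightarrow> i \<noteq> j \<Longrightarrow> ((\<lambda>t. T i (p + t *\<^sub>R axis j 1))
        has_vector_derivative (\<chi> k. de (Psi p) k * T i p $ k * T j p $ k)) (at 0)"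
    and diff: "\<And>p i j. p \<in> Om \<Longrightarrow> i \<noteq> j \<Longrightarrow>
        T j p - T i p = (2 * (p $ i - p $ j)) *\<^sub>R (\<chi> k. de (Psi p) k * T i p $ k * T j p $ k)"
    and sum: "\<And>i j. i \<noteq> j \<Longrightarrow> \<exists>al be. depends_only (- {j}) al \<and> depends_only (- {i}) be \<and>
        (\<forall>p\<in>Om. (p $ i - p $ j) * (pot (Psi p) - E) = al p + be p)"
    and L: "\<And>k l i. real_polynomial_function (\<lambda>q. L q k l $ i)"
      "\<And>q k l w. q \<in> N \<Longrightarrow> L q k l \<bullet> w = 3 * (w $ k * de q k - w $ l * de q l) * K q $ k $ l"
    and off: "\<And>q. q \<in> N \<Longrightarrow> \<exists>k l. k \<noteq> l \<and> K q $ k $ l \<noteq> 0"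
  shows False
proof (rule no_commuting_tensor[of K L])
  show "\<exists>w. K q *v w \<noteq> r *\<^sub>R w" if q: "q \<in> N" for q r
  proof -
    obtain k l where kl: "k \<noteq> l" "K q $ k $ l \<noteq> 0" using off[OF q] by blast
    have "(K q *v axis l 1) $ k = K q $ k $ l"
      by (simp add: matrix_vector_mult_def axis_def if_distrib cong: if_cong)
    moreover have "(r *\<^sub>R (axis l 1 :: pt)) $ k = 0" using kl(1) by (simp add: axis_def)
    ultimately show ?thesis using kl(2) by metis
  qed
  show "hess_grad UNIV b d K L q k l = 0" if q: "q \<in> N" for q k l
  proof -
    define u where "u = v q"
    have u: "u \<in> Om" "Psi u = q" using q Psi_v by (auto simp: u_def Om_def)
    have orth: "T i u \<bullet> T j u = 0" if "i \<noteq> j" for i j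
      using eigenvectors_orthogonal[OF K(2) eig[OF u(1)] eig[OF u(1)] distinct[OF u(1) that]] .
    define g where "g k = (\<Sum>r\<in>UNIV. f1 q r * b r $ k)" for k
    define M :: "real^3^3" where "M = (\<chi> k l. (\<Sum>r\<in>UNIV. f2 q r * b r $ k * b r $ l)
        + (if k = l then 3 * de q k * g k else 0))"
    have M: "(M *v x) \<bullet> y = he q x y + 3 * gr q (\<chi> k. de q k * x $ k * y $ k)" for x y
    proof -
      have 1: "(M *v x) $ k = (\<Sum>r\<in>UNIV. f2 q r * (b r \<bullet> x) * b r $ k) + 3 * de q k * g k * x $ k" for k
      proof -
        have "(M *v x) $ k = (\<Sum>l\<in>UNIV. (\<Sum>r\<in>UNIV. f2 q r * b r $ k * b r $ l) * x $ l)
            + (\<Sum>l\<in>UNIV. (if k = l then 3 * de q k * g k else 0) * x $ l)"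
          by (simp add: M_def matrix_vector_mult_def distrib_right sum.distrib)
        also have "(\<Sum>l\<in>UNIV. (\<Sum>r\<in>UNIV. f2 q r * b r $ k * b r $ l) * x $ l)
           = (\<Sum>r\<in>UNIV. f2 q r * (b r \<bullet> x) * b r $ k)"
          unfolding sum_distrib_right inner_vec_def sum_distrib_left inner_real_def
          by (subst sum.swap) (simp add: ac_simps)
        finally show ?thesis by (simp add: if_distrib[of "\<lambda>a. a * _"] cong: if_cong)
      qed
      have "(M *v x) \<bullet> y = (\<Sum>k\<in>UNIV. (\<Sum>r\<in>UNIV. f2 q r * (b r \<bullet> x) * b r $ k) * y $ k)
          + (\<Sum>k\<in>UNIV. 3 * de q k * g k * x $ k * y $ k)"
        by (simp add: inner_vec_def[of _ y] 1 distrib_right sum.distrib)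
      also have "(\<Sum>k\<in>UNIV. (\<Sum>r\<in>UNIV. f2 q r * (b r \<bullet> x) * b r $ k) * y $ k) = he q x y"
        unfolding he_def inner_vec_def[of _ y] sum_distrib_right sum_distrib_left inner_real_def
        by (subst sum.swap) (simp add: mult.assoc)
      also have "(\<Sum>k\<in>UNIV. 3 * de q k * g k * x $ k * y $ k) = 3 * gr q (\<chi> k. de q k * x $ k * y $ k)"
        unfolding gr_def g_def inner_vec_def sum_distrib_right sum_distrib_left inner_real_def
        by (subst sum.swap) (simp add: ac_simps)
      finally show ?thesis .
    qed
    have MT: "\<exists>c. M *v T i u = c *\<^sub>R T i u" for i
    proof (rule ex_parallel_if_orthogonal[where T="\<lambda>i. T i u"])
      fix j assume ji: "j \<noteq> i"
      then have ij: "i \<noteq> j" by simp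
      obtain al be where ab: "depends_only (- {j}) al" "depends_only (- {i}) be"
        "\<forall>p\<in>Om. (p $ i - p $ j) * (pot (Psi p) - E) = al p + be p"
        using sum[OF ij] by blast
      define x where "x = (\<chi> k. de (Psi u) k * T i u $ k * T j u $ k)"
      have "1 * gr (Psi u) (T j u) + (- 1) * gr (Psi u) (T i u)
          + (u $ i - u $ j) * (he (Psi u) (T j u) (T i u) + gr (Psi u) x) = 0"
        by (rule mixed_derivative[of u i j x "\<lambda>p. p $ i - p $ j" "\<lambda>_. 1" "- 1" al be])
           (use u ij ab T2[OF u(1) ij] in \<open>auto intro!: derivative_eq_intros simp: axis_def x_def\<close>)
      \<comment> \<open>The hypothesis \<open>diff\<close>, an Euler-Poisson-Darboux relation, turns
        the first order terms into two further copies of \<open>gr q x\<close>; this is the source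
        of the factor 3.\<close>
      moreover have "gr q (T j u) - gr q (T i u) = 2 * (u $ i - u $ j) * gr q x"
        using arg_cong[OF diff[OF u(1) ij], of "gr q"]
        by (simp add: gr_eq inner_diff_right x_def[symmetric])
      ultimately have "(u $ i - u $ j) * (he q (T j u) (T i u) + 3 * gr q x) = 0"
        by (simp add: u algebra_simps)
      then have "he q (T j u) (T i u) + 3 * gr q x = 0"
        using distinct[OF u(1) ij] by simp
      then show "(M *v T i u) \<bullet> T j u = 0"
        by (simp add: M he_sym[of q "T j u"] x_def u)
    qed (use T_nz[OF u(1)] orth in auto)
    \<comment> \<open>Both matrices are diagonal in the frame and therefore commute; the entries of
      their commutator are the values of \<open>hess_grad\<close>.\<close>
    have "(M *v (K q *v T i u)) - (K q *v (M *v T i u)) = 0" for i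
    proof -
      obtain c where c: "M *v T i u = c *\<^sub>R T i u" using MT by blast
      have "K q *v T i u = u $ i *\<^sub>R T i u" using eig[OF u(1), of i] by (simp add: u)
      then show ?thesis by (simp add: c matrix_vector_mult_scaleR)
    qed
    then have D: "(M ** K q - K q ** M) *v T i u = 0" for i
      by (simp add: matrix_vector_mult_diff_rdistrib matrix_vector_mul_assoc)
    have "row k (M ** K q - K q ** M) = 0" for k
    proof (rule orthogonal_to_basis_zero[where T="\<lambda>i. T i u"])
      show "row k (M ** K q - K q ** M) \<bullet> T i u = 0" for i
        using arg_cong[OF D[of i], of "\<lambda>x. x $ k"]
        by (simp add: row_def inner_vec_def matrix_vector_mult_def)
    qed (use T_nz[OF u(1)] orth in auto)
    then have "(M ** K q) $ k $ l = (K q ** M) $ k $ l"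
      by (simp add: row_def vec_eq_iff)
    moreover have "(M ** K q) $ k $ l = (\<Sum>r\<in>UNIV. f2 q r * (b r $ k * (K q *v b r) $ l)) + 3 * de q k * g k * K q $ k $ l"
    proof -
      have "(M ** K q) $ k $ l = (\<Sum>m\<in>UNIV. (\<Sum>r\<in>UNIV. f2 q r * b r $ k * b r $ m) * K q $ m $ l)
         + (\<Sum>m\<in>UNIV. (if k = m then 3 * de q k * g k else 0) * K q $ m $ l)"
        by (simp add: M_def matrix_matrix_mult_def distrib_right sum.distrib)
      also have "(\<Sum>m\<in>UNIV. (\<Sum>r\<in>UNIV. f2 q r * b r $ k * b r $ m) * K q $ m $ l)
         = (\<Sum>r\<in>UNIV. f2 q r * (b r $ k * (K q *v b r) $ l))"
      proof -
        have Ks: "K q $ m $ l = K q $ l $ m" for m l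
          using arg_cong[OF K(2)[of q], of "\<lambda>A. A $ l $ m"] by (simp add: transpose_def)
        show ?thesis
          unfolding matrix_vector_mult_def sum_distrib_right vec_lambda_beta sum_distrib_left Ks[of _ l]
          by (subst sum.swap) (simp add: ac_simps)
      qed
      finally show ?thesis by (simp add: if_distrib[of "\<lambda>a. a * _"] cong: if_cong)
    qed
    moreover have "(K q ** M) $ k $ l = (\<Sum>r\<in>UNIV. f2 q r * ((K q *v b r) $ k * b r $ l)) + 3 * de q l * g l * K q $ k $ l"
    proof -
      have "(K q ** M) $ k $ l = (\<Sum>m\<in>UNIV. K q $ k $ m * (\<Sum>r\<in>UNIV. f2 q r * b r $ m * b r $ l))
         + (\<Sum>m\<in>UNIV. K q $ k $ m * (if m = l then 3 * de q m * g m else 0))"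
        by (simp add: M_def matrix_matrix_mult_def distrib_left sum.distrib)
      also have "(\<Sum>m\<in>UNIV. K q $ k $ m * (\<Sum>r\<in>UNIV. f2 q r * b r $ m * b r $ l))
         = (\<Sum>r\<in>UNIV. f2 q r * ((K q *v b r) $ k * b r $ l))"
        unfolding matrix_vector_mult_def sum_distrib_right vec_lambda_beta sum_distrib_left
        by (subst sum.swap) (simp add: ac_simps)
      finally show ?thesis by (simp add: if_distrib cong: if_cong)
    qed
    moreover have "hess_grad UNIV b d K L q k l
      = (\<Sum>r\<in>UNIV. f2 q r * (b r $ k * (K q *v b r) $ l)) - (\<Sum>r\<in>UNIV. f2 q r * ((K q *v b r) $ k * b r $ l))
        + (3 * de q k * g k * K q $ k $ l - 3 * de q l * g l * K q $ k $ l)"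
      unfolding hess_grad_eq commutator_def L(2)[OF q] g_def sum_distrib_left sum_distrib_right
        sum_subtractf[symmetric] sum.distrib[symmetric]
      by (intro sum.cong refl) (simp add: algebra_simps)
    ultimately show ?thesis by simp
  qed
qed (use K L in auto)

end

section \<open>The form that separation forces on the potential\<close>

lemma third_index: "\<exists>k::3. k \<noteq> i \<and> k \<noteq> j"
proof (rule ccontr)
  assume "\<not> ?thesis"
  then have "UNIV = {i, j}" by auto
  moreover have "card {i, j} \<le> 2" by (simp add: card_insert_if)
  moreover have "card (UNIV :: 3 set) = 3" by simp
  ultimately show False by simp
qed

lemma sum_distinct_3:
  fixes f :: "3 \<Rightarrow> real"
  assumes "i \<noteq> j" "i \<noteq> k" "j \<noteq> k"
  shows "(\<Sum>m\<in>UNIV. f m) = f i + f j + f k"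
proof -
  have "\<forall>i j k. i \<noteq> j \<longrightarrow> i \<noteq> k \<longrightarrow> j \<noteq> k \<longrightarrow> (\<Sum>m\<in>UNIV. f m) = f i + f j + f k"
    by (simp add: forall_3 sum_3)
  then show ?thesis using assms by blast
qed

lemma compl_3: "- {1::3} = {2, 3}" "- {2::3} = {1, 3}" "- {3::3} = {1, 2}"
  using exhaust_3 by auto

lemma depends_only_combine:
  assumes "depends_only A f" "depends_only B g" "A \<subseteq> C" "B \<subseteq> C"
  shows "depends_only C (\<lambda>p. F (f p) (g p))"
  using assms unfolding depends_only_def by (metis subsetD)

lemma depends_only_const: "depends_only A (\<lambda>p. c)"
  by (simp add: depends_only_def)

context separated_potential
begin

definition gam :: "3 \<Rightarrow> pt \<Rightarrow> real" where
  "gam i p = G i (Psi p) \<bullet> G i (Psi p)"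

text \<open>The Staeckel form: \<open>gam i\<close> is the squared gradient of the
  \<open>i\<close>-th coordinate and \<open>f i\<close> depends on that coordinate alone.\<close>

definition complete_form :: bool where
  "complete_form \<longleftrightarrow> (\<exists>f. (\<forall>i. depends_only {i} (f i)) \<and>
     (\<forall>p\<in>Om. pot (Psi p) - E = (\<Sum>i\<in>UNIV. f i p * gam i p)))"

text \<open>The term of the two-variable block can be written with the squared gradient of either
  variable. The \<open>h j\<close> stand for the diagonal of its symbol; the common multiplier makes
  \<open>gam j\<close> proportional to \<open>h j\<close> within the block.\<close>

definition partial_form :: "3 \<Rightarrow> bool" where
  "partial_form i \<longleftrightarrow> (\<exists>f g h. depends_only {i} f \<and> (\<forall>j. depends_only (- {i}) (g j)) \<and>
     (\<forall>j. depends_only (- {i}) (h j)) \<and>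
     (\<forall>p\<in>Om. \<forall>j. j \<noteq> i \<longrightarrow> h j p \<noteq> 0 \<and> pot (Psi p) - E = f p * gam i p + g j p * gam j p) \<and>
     (\<forall>p\<in>Om. \<forall>j k. j \<noteq> i \<longrightarrow> k \<noteq> i \<longrightarrow> gam j p * h k p = gam k p * h j p))"

context
  assumes orth: "\<And>p i j. p \<in> Om \<Longrightarrow> i \<noteq> j \<Longrightarrow> T i p \<bullet> T j p = 0"
begin

lemma gam_eq: "p \<in> Om \<Longrightarrow> gam i p = 1 / (T i p \<bullet> T i p)"
  unfolding gam_def by (rule G_norm[OF _ orth])

lemma complete_formE:
  assumes complete_form
  obtains f where "\<forall>i. depends_only {i} (f i)"
    "\<forall>p\<in>Om. pot (Psi p) - E
       = f 1 p / (T 1 p \<bullet> T 1 p) + f 2 p / (T 2 p \<bullet> T 2 p) + f 3 p / (T 3 p \<bullet> T 3 p)"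
proof -
  obtain f where f: "\<forall>i. depends_only {i} (f i)"
    "\<forall>p\<in>Om. pot (Psi p) - E = (\<Sum>i\<in>UNIV. f i p * gam i p)"
    using assms unfolding complete_form_def by (elim exE conjE)
  show ?thesis
  proof (rule that[of f])
    show "\<forall>i. depends_only {i} (f i)" by (rule f(1))
    show "\<forall>p\<in>Om. pot (Psi p) - E
       = f 1 p / (T 1 p \<bullet> T 1 p) + f 2 p / (T 2 p \<bullet> T 2 p) + f 3 p / (T 3 p \<bullet> T 3 p)"
      using f(2) by (simp add: sum_3 gam_eq)
  qed
qed

lemma partial_formE:
  assumes "partial_form i" "j \<noteq> i"
  obtains f g where "depends_only {i} f" "depends_only (- {i}) g"
    "\<forall>p\<in>Om. pot (Psi p) - E = f p / (T i p \<bullet> T i p) + g p / (T j p \<bullet> T j p)"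
proof -
  obtain f g h where f: "depends_only {i} f" and g: "\<forall>j. depends_only (- {i}) (g j)"
    and e: "\<forall>p\<in>Om. \<forall>j. j \<noteq> i \<longrightarrow> h j p \<noteq> (0 :: real) \<and> pot (Psi p) - E = f p * gam i p + g j p * gam j p"
    using assms(1) unfolding partial_form_def by (elim exE conjE) (rule that; assumption)
  show ?thesis
  proof (rule that[OF f])
    show "depends_only (- {i}) (g j)" using g by blast
    show "\<forall>p\<in>Om. pot (Psi p) - E = f p / (T i p \<bullet> T i p) + g j p / (T j p \<bullet> T j p)"
      using e assms(2) by (simp add: gam_eq)
  qed
qed

text \<open>A block of two variables forces the ratio of the corresponding scale factors not to
  depend on the third variable.\<close>

lemma partial_form_ratio:
  assumes part: "partial_form i" and j: "j \<noteq> i" "k \<noteq> i" and p: "p \<in> Om" "p + s *\<^sub>R axis i 1 \<in> Om"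
  shows "(T j p \<bullet> T j p) * (T k (p + s *\<^sub>R axis i 1) \<bullet> T k (p + s *\<^sub>R axis i 1))
    = (T k p \<bullet> T k p) * (T j (p + s *\<^sub>R axis i 1) \<bullet> T j (p + s *\<^sub>R axis i 1))"
proof -
  obtain f g h where h: "\<forall>j. depends_only (- {i}) (h j)"
    and nz: "\<forall>p\<in>Om. \<forall>j. j \<noteq> i \<longrightarrow> h j p \<noteq> (0 :: real) \<and> pot (Psi p) - E = f p * gam i p + g j p * gam j p"
    and e: "\<forall>p\<in>Om. \<forall>j k. j \<noteq> i \<longrightarrow> k \<noteq> i \<longrightarrow> gam j p * h k p = gam k p * h j p"
    using part unfolding partial_form_def by (elim exE conjE) (rule that; assumption)
  define p' where "p' = p + s *\<^sub>R axis i 1"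
  have p': "p' \<in> Om" using p(2) by (simp add: p'_def)
  have hh: "h m p' = h m p" for m
    using h[THEN spec, of m] unfolding depends_only_def by (auto simp: p'_def axis_def)
  have *: "h k q / (T j q \<bullet> T j q) = h j q / (T k q \<bullet> T k q)" if "q \<in> Om" for q
    using e[THEN bspec, OF that] j by (simp add: gam_eq[OF that])
  have pos: "T m q \<bullet> T m q \<noteq> 0" if "q \<in> Om" for m q using T_nz[OF that, of m] by simp
  have 1: "h k p * (T k p \<bullet> T k p) = h j p * (T j p \<bullet> T j p)"
    using *[OF p(1)] pos[OF p(1), of j] pos[OF p(1), of k] by (simp add: field_simps)
  have 2: "h k p * (T k p' \<bullet> T k p') = h j p * (T j p' \<bullet> T j p')"
    using *[OF p'] pos[OF p', of j] pos[OF p', of k] by (simp add: field_simps hh)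
  have hk: "h k p \<noteq> 0" using nz[THEN bspec, OF p(1)] j by blast
  have "h k p * ((T j p \<bullet> T j p) * (T k p' \<bullet> T k p')) = (T j p \<bullet> T j p) * (h j p * (T j p' \<bullet> T j p'))"
    using 2 by (simp add: mult.left_commute)
  also have "\<dots> = (h j p * (T j p \<bullet> T j p)) * (T j p' \<bullet> T j p')" by simp
  also have "\<dots> = h k p * ((T k p \<bullet> T k p) * (T j p' \<bullet> T j p'))"
    unfolding 1[symmetric] by simp
  finally show ?thesis using hk by (simp add: p'_def)
qed

text \<open>The third coordinate is a Cartesian one and the other scale factors do not involve it,
  so either form splits \<open>V - E\<close> and \<open>no_translation_separation\<close>
  applies.\<close>

lemma cylinder_class:
  assumes T3: "T 3 = (\<lambda>p. axis 3 1)"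
    and dep: "depends_only {1, 2} (\<lambda>p. T 1 p \<bullet> T 1 p)" "depends_only {1, 2} (\<lambda>p. T 2 p \<bullet> T 2 p)"
    and form: "complete_form \<or> partial_form 3"
  shows False
  using form
proof
  assume complete_form
  then obtain f where f0: "\<forall>i. depends_only {i} (f i)"
    "\<forall>p\<in>Om. pot (Psi p) - E
       = f 1 p / (T 1 p \<bullet> T 1 p) + f 2 p / (T 2 p \<bullet> T 2 p) + f 3 p / (T 3 p \<bullet> T 3 p)"
    by (rule complete_formE)
  note f = f0[rule_format]
  show False
  proof (rule no_translation_separation[OF orth T3 f(1)])
    have "depends_only {1, 2} (\<lambda>p. f 1 p / (T 1 p \<bullet> T 1 p))" "depends_only {1, 2} (\<lambda>p. f 2 p / (T 2 p \<bullet> T 2 p))"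
      by (rule depends_only_combine[OF f(1) dep(1)] depends_only_combine[OF f(1) dep(2)]; simp)+
    then show "depends_only (- {3}) (\<lambda>p. f 1 p / (T 1 p \<bullet> T 1 p) + f 2 p / (T 2 p \<bullet> T 2 p))"
      unfolding compl_3 by (rule depends_only_combine) simp_all
  qed (simp_all add: f(2) T3)
next
  assume "partial_form 3"
  then obtain f g where fg0: "depends_only {3} f" "depends_only (- {3}) g"
    "\<forall>p\<in>Om. pot (Psi p) - E = f p / (T 3 p \<bullet> T 3 p) + g p / (T 1 p \<bullet> T 1 p)"
    by (rule partial_formE[where j=1]) simp_all
  note fg = fg0[rule_format]
  show False
  proof (rule no_translation_separation[OF orth T3 fg(1)])
    show "depends_only (- {3}) (\<lambda>p. g p / (T 1 p \<bullet> T 1 p))"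
      by (rule depends_only_combine[OF fg(2) dep(1)]) (simp_all add: compl_3)
  qed (simp_all add: fg(3) T3)
qed

text \<open>The angular scale factors are the radius times functions of the angles, so multiplying
  by the squared radius splits off the first variable.\<close>

lemma radial_class:
  assumes T1: "T 1 = (\<lambda>p. (1 / p $ 1) *\<^sub>R Psi p)" and pos: "\<And>p. p \<in> Om \<Longrightarrow> p $ 1 > 0"
    and unit: "\<And>p. p \<in> Om \<Longrightarrow> T 1 p \<bullet> T 1 p = 1"
    and dep: "depends_only {2, 3} e2" "depends_only {2, 3} e3"
    and norms: "\<And>p. p \<in> Om \<Longrightarrow> T 2 p \<bullet> T 2 p = (p $ 1)\<^sup>2 * e2 p"
      "\<And>p. p \<in> Om \<Longrightarrow> T 3 p \<bullet> T 3 p = (p $ 1)\<^sup>2 * e3 p"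
    and form: "complete_form \<or> partial_form 1"
  shows False
proof -
  have sq: "depends_only {1} (\<lambda>p :: pt. (p $ 1)\<^sup>2)" by (simp add: depends_only_def)
  have nz: "(p $ 1)\<^sup>2 \<noteq> 0" if "p \<in> Om" for p using pos[OF that] by simp
  show False
    using form
  proof
    assume complete_form
    then obtain f where f0: "\<forall>i. depends_only {i} (f i)"
      "\<forall>p\<in>Om. pot (Psi p) - E
         = f 1 p / (T 1 p \<bullet> T 1 p) + f 2 p / (T 2 p \<bullet> T 2 p) + f 3 p / (T 3 p \<bullet> T 3 p)"
      by (rule complete_formE)
    note f = f0[rule_format]
    show False
    proof (rule no_radial_separation[OF orth T1 pos])
      show "depends_only {1} (\<lambda>p. (p $ 1)\<^sup>2 * f 1 p)"
        by (rule depends_only_combine[OF sq f(1)]) simp_all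
      have "depends_only {2, 3} (\<lambda>p. f 2 p / e2 p)" "depends_only {2, 3} (\<lambda>p. f 3 p / e3 p)"
        by (rule depends_only_combine[OF f(1) dep(1)] depends_only_combine[OF f(1) dep(2)]; simp)+
      then show "depends_only (- {1}) (\<lambda>p. f 2 p / e2 p + f 3 p / e3 p)"
        unfolding compl_3 by (rule depends_only_combine) simp_all
      show "(p $ 1)\<^sup>2 * (pot (Psi p) - E) = (p $ 1)\<^sup>2 * f 1 p + (f 2 p / e2 p + f 3 p / e3 p)"
        if "p \<in> Om" for p
        unfolding f(2)[OF that] unit[OF that] norms[OF that] using nz[OF that]
        by (simp add: distrib_left)
    qed
  next
    assume "partial_form 1"
    then obtain f g where fg0: "depends_only {1} f" "depends_only (- {1}) g"
      "\<forall>p\<in>Om. pot (Psi p) - E = f p / (T 1 p \<bullet> T 1 p) + g p / (T 2 p \<bullet> T 2 p)"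
      by (rule partial_formE[where j=2]) simp_all
    note fg = fg0[rule_format]
    show False
    proof (rule no_radial_separation[OF orth T1 pos])
      show "depends_only {1} (\<lambda>p. (p $ 1)\<^sup>2 * f p)"
        by (rule depends_only_combine[OF sq fg(1)]) simp_all
      show "depends_only (- {1}) (\<lambda>p. g p / e2 p)"
        by (rule depends_only_combine[OF fg(2) dep(1)]) (simp_all add: compl_3)
      show "(p $ 1)\<^sup>2 * (pot (Psi p) - E) = (p $ 1)\<^sup>2 * f p + g p / e2 p" if "p \<in> Om" for p
        unfolding fg(3)[OF that] unit[OF that] norms[OF that] using nz[OF that]
        by (simp add: distrib_left)
    qed
  qed
qed

text \<open>No scale factor involves the angle \<open>i\<close>, and \<open>T i\<close> has as
  length the distance from the axis, so multiplying by its square splits off the angle.\<close>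

lemma rotational_class:
  assumes Ti: "T i = (\<lambda>p. rot (Psi p))"
    and dep: "\<And>j. depends_only (- {i}) (\<lambda>p. T j p \<bullet> T j p)"
    and form: "complete_form \<or> partial_form i"
  shows False
proof -
  have w: "(Psi p $ 1)\<^sup>2 + (Psi p $ 2)\<^sup>2 = T i p \<bullet> T i p" for p
    by (simp add: Ti rot_def inner_vec_def sum_3 power2_eq_square)
  have nz: "T i p \<bullet> T i p \<noteq> 0" if "p \<in> Om" for p using T_nz[OF that, of i] by simp
  have "\<exists>al be. depends_only {i} al \<and> depends_only (- {i}) be
    \<and> (\<forall>p\<in>Om. pot (Psi p) - E = al p / (T i p \<bullet> T i p) + be p)"
    using form
  proof
    assume complete_form
    then obtain f where f0: "\<forall>i. depends_only {i} (f i)"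
      "\<forall>p\<in>Om. pot (Psi p) - E
         = f 1 p / (T 1 p \<bullet> T 1 p) + f 2 p / (T 2 p \<bullet> T 2 p) + f 3 p / (T 3 p \<bullet> T 3 p)"
      by (rule complete_formE)
    note f = f0[rule_format]
    define be where "be p = (\<Sum>j\<in>- {i}. f j p / (T j p \<bullet> T j p))" for p
    have "depends_only (- {i}) be"
    proof -
      have "depends_only (- {i}) (\<lambda>p. f j p / (T j p \<bullet> T j p))" if "j \<in> - {i}" for j
        by (rule depends_only_combine[OF f(1) dep]) (use that in auto)
      then show ?thesis
        unfolding be_def[abs_def] depends_only_def by (intro allI impI sum.cong refl) blast
    qed
    moreover have "pot (Psi p) - E = f i p / (T i p \<bullet> T i p) + be p" if "p \<in> Om" for p
    proof -
      have "pot (Psi p) - E = (\<Sum>j\<in>UNIV. f j p / (T j p \<bullet> T j p))"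
        unfolding f(2)[OF that] by (simp add: sum_3)
      also have "\<dots> = f i p / (T i p \<bullet> T i p) + (\<Sum>j\<in>UNIV - {i}. f j p / (T j p \<bullet> T j p))"
        by (rule sum.remove) simp_all
      finally show ?thesis by (simp add: be_def Compl_eq_Diff_UNIV)
    qed
    ultimately show ?thesis by (intro exI[of _ "f i"] exI[of _ be] conjI ballI f(1))
  next
    assume part: "partial_form i"
    obtain j where j: "j \<noteq> i" using third_index by blast
    from part j obtain f g where fg0: "depends_only {i} f" "depends_only (- {i}) g"
      "\<forall>p\<in>Om. pot (Psi p) - E = f p / (T i p \<bullet> T i p) + g p / (T j p \<bullet> T j p)"
      by (rule partial_formE)
    note fg = fg0[rule_format]
    have "depends_only (- {i}) (\<lambda>p. g p / (T j p \<bullet> T j p))"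
      by (rule depends_only_combine[OF fg(2) dep]) simp_all
    then show ?thesis
      by (intro exI[of _ f] exI[of _ "\<lambda>p. g p / (T j p \<bullet> T j p)"] conjI ballI fg(1,3))
  qed
  then obtain al be where ab0: "depends_only {i} al" "depends_only (- {i}) be"
    "\<forall>p\<in>Om. pot (Psi p) - E = al p / (T i p \<bullet> T i p) + be p"
    by (elim exE conjE)
  note ab = ab0[rule_format]
  show False
  proof (rule no_rotational_separation[OF orth Ti ab(1)])
    show "depends_only (- {i}) (\<lambda>p. (T i p \<bullet> T i p) * be p)"
      by (rule depends_only_combine[OF dep ab(2)]) simp_all
    show "((Psi p $ 1)\<^sup>2 + (Psi p $ 2)\<^sup>2) * (pot (Psi p) - E) = al p + (T i p \<bullet> T i p) * be p"
      if "p \<in> Om" for p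
      unfolding w ab(3)[OF that] using nz[OF that] by (simp add: distrib_left)
  qed
qed

text \<open>The ratio of two scale factors contains \<open>(p_j - p_i) / (p_k - p_i)\<close> and so
  varies with \<open>p_i\<close>, which excludes partial separation. Multiplied by
  \<open>p_i - p_j\<close>, the Staeckel form splits by partial fractions.\<close>

lemma confocal_forms:
  assumes P: "\<And>i. depends_only {i} (P i)"
    and distinct: "\<And>p i j. p \<in> Om \<Longrightarrow> i \<noteq> j \<Longrightarrow> p $ i \<noteq> p $ j"
    and norms: "\<And>p i j k. p \<in> Om \<Longrightarrow> i \<noteq> j \<Longrightarrow> i \<noteq> k \<Longrightarrow> j \<noteq> k \<Longrightarrow>
       P i p \<noteq> 0 \<and> T i p \<bullet> T i p = (p $ i - p $ j) * (p $ i - p $ k) / P i p"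
  shows "\<not> partial_form i"
    and "complete_form \<Longrightarrow> i \<noteq> j \<Longrightarrow> \<exists>al be. depends_only (- {j}) al \<and> depends_only (- {i}) be \<and>
        (\<forall>p\<in>Om. (p $ i - p $ j) * (pot (Psi p) - E) = al p + be p)"
proof -
  show "\<not> partial_form i"
  proof
    assume part: "partial_form i"
    obtain j where "j \<noteq> i" using third_index by blast
    moreover obtain k where "k \<noteq> i" "k \<noteq> j" using third_index by blast
    ultimately have jk: "j \<noteq> i" "k \<noteq> i" "j \<noteq> k" by simp_all
    obtain p where p: "p \<in> Om" using Om_nonempty by blast
    obtain e where e: "e > 0" "\<And>s. \<bar>s\<bar> < e \<Longrightarrow> p + s *\<^sub>R axis i 1 \<in> Om"
      using in_Om_near[OF p] by metis
    define s where "s = e / 2"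
    define p' where "p' = p + s *\<^sub>R axis i 1"
    have p': "p' \<in> Om" using e by (simp add: p'_def s_def)
    have c1: "p' $ i = p $ i + s" "p' $ j = p $ j" "p' $ k = p $ k"
      using jk by (simp_all add: p'_def axis_def)
    have "P m p' = P m p" if "p' $ m = p $ m" for m
      using P[of m] that unfolding depends_only_def by blast
    then have c: "p' $ i = p $ i + s" "p' $ j = p $ j" "p' $ k = p $ k" "P j p' = P j p" "P k p' = P k p"
      using c1 by simp_all
    have "(T j p \<bullet> T j p) * (T k p' \<bullet> T k p') = (T k p \<bullet> T k p) * (T j p' \<bullet> T j p')"
      using partial_form_ratio[OF part jk(1,2) p] p' by (simp add: p'_def)
    moreover have n: "T j p \<bullet> T j p = (p $ j - p $ i) * (p $ j - p $ k) / P j p"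
      "T k p \<bullet> T k p = (p $ k - p $ i) * (p $ k - p $ j) / P k p"
      "T j p' \<bullet> T j p' = (p $ j - (p $ i + s)) * (p $ j - p $ k) / P j p"
      "T k p' \<bullet> T k p' = (p $ k - (p $ i + s)) * (p $ k - p $ j) / P k p" "P j p \<noteq> 0" "P k p \<noteq> 0"
      using norms[OF p, of j i k] norms[OF p, of k i j] norms[OF p', of j i k] norms[OF p', of k i j] jk
      by (simp_all add: c)
    ultimately have "((p $ j - p $ i) * (p $ j - p $ k)) * ((p $ k - (p $ i + s)) * (p $ k - p $ j)) / (P j p * P k p)
        = ((p $ k - p $ i) * (p $ k - p $ j)) * ((p $ j - (p $ i + s)) * (p $ j - p $ k)) / (P k p * P j p)"
      by (simp only: times_divide_times_eq)
    then have "((p $ j - p $ i) * (p $ k - (p $ i + s))) * ((p $ j - p $ k) * (p $ k - p $ j))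
        = ((p $ k - p $ i) * (p $ j - (p $ i + s))) * ((p $ j - p $ k) * (p $ k - p $ j))"
      using n(5,6) by (simp add: ac_simps)
    then have "(p $ j - p $ i) * (p $ k - (p $ i + s)) = (p $ k - p $ i) * (p $ j - (p $ i + s))"
      using distinct[OF p jk(3)] by simp
    then have "s * (p $ k - p $ j) = 0" by (simp add: algebra_simps)
    then show False using distinct[OF p jk(3)] e(1) by (simp add: s_def)
  qed
next
  assume complete_form and ij: "i \<noteq> j"
  then obtain f where f0: "\<forall>i. depends_only {i} (f i)"
    "\<forall>p\<in>Om. pot (Psi p) - E
       = f 1 p / (T 1 p \<bullet> T 1 p) + f 2 p / (T 2 p \<bullet> T 2 p) + f 3 p / (T 3 p \<bullet> T 3 p)"
    by - (rule complete_formE)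
  note f = f0[rule_format]
  obtain k where k: "k \<noteq> i" "k \<noteq> j" using third_index by blast
  define F where "F m p = f m p * P m p" for m p
  have F: "depends_only {m} (F m)" for m
    unfolding F_def[abs_def] by (rule depends_only_combine[OF f(1) P]) simp_all
  \<comment> \<open>Both functions involve the third variable \<open>k\<close>; they share its term
    according to \<open>(p_i - p_j) / ((p_i - p_k) (p_j - p_k)) = 1 / (p_j - p_k) - 1 / (p_i -
    p_k)\<close>.\<close>
  define al be where "al p = F i p / (p $ i - p $ k) + F k p / (p $ k - p $ i)"
    and "be p = - (F j p / (p $ j - p $ k) + F k p / (p $ k - p $ j))" for p
  have dep2: "depends_only (- {n}) (\<lambda>p. F m p / (p $ m - p $ k) + F k p / (p $ k - p $ m))"
    if "m \<noteq> n" "k \<noteq> n" for m n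
    unfolding depends_only_def
  proof (intro allI impI)
    fix u v :: pt assume *: "\<forall>i\<in>- {n}. u $ i = v $ i"
    have c: "u $ m = v $ m" "u $ k = v $ k" using * that by simp_all
    have Fc: "F m' u = F m' v" if "u $ m' = v $ m'" for m'
      using F[of m'] that unfolding depends_only_def by blast
    show "F m u / (u $ m - u $ k) + F k u / (u $ k - u $ m)
        = F m v / (v $ m - v $ k) + F k v / (v $ k - v $ m)"
      by (simp only: c Fc[OF c(1)] Fc[OF c(2)])
  qed
  have al: "depends_only (- {j}) al"
    unfolding al_def[abs_def] using dep2[OF ij k(2)] .
  have be: "depends_only (- {i}) be"
    unfolding be_def[abs_def]
    by (rule depends_only_combine[where F="\<lambda>x y. - x", OF dep2[of j i] depends_only_const[of "{}" 0]])
       (use ij k in auto)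
  have "(p $ i - p $ j) * (pot (Psi p) - E) = al p + be p" if p: "p \<in> Om" for p
  proof -
    have "pot (Psi p) - E = (\<Sum>m\<in>UNIV. f m p / (T m p \<bullet> T m p))"
      unfolding f(2)[OF p] by (simp add: sum_3)
    also have "\<dots> = f i p / (T i p \<bullet> T i p) + f j p / (T j p \<bullet> T j p) + f k p / (T k p \<bullet> T k p)"
      by (rule sum_distinct_3) (use ij k in auto)
    also have "\<dots> = F i p / ((p $ i - p $ j) * (p $ i - p $ k)) + F j p / ((p $ j - p $ i) * (p $ j - p $ k))
        + F k p / ((p $ k - p $ i) * (p $ k - p $ j))"
      using norms[OF p, of i j k] norms[OF p, of j i k] norms[OF p, of k i j] ij k(1,2)
      by (simp add: F_def)
    finally have e: "pot (Psi p) - E = F i p / ((p $ i - p $ j) * (p $ i - p $ k))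
        + F j p / ((p $ j - p $ i) * (p $ j - p $ k)) + F k p / ((p $ k - p $ i) * (p $ k - p $ j))" .
    define x y z where "x = p $ i - p $ j" and "y = p $ i - p $ k" and "z = p $ j - p $ k"
    have nz: "x \<noteq> 0" "y \<noteq> 0" "z \<noteq> 0" and rel: "y = x + z"
      using distinct[OF p ij] distinct[OF p, of i k] distinct[OF p, of j k] k(1,2)
      by (auto simp: x_def y_def z_def)
    have d: "p $ j - p $ i = - x" "p $ k - p $ i = - y" "p $ k - p $ j = - z"
      by (simp_all add: x_def y_def z_def)
    show ?thesis
    proof -
      have "x / (y * z) = 1 / z - 1 / y" using nz by (simp add: rel field_simps)
      moreover have "x * (F i p / (x * y) + F j p / ((- x) * z) + F k p / ((- y) * (- z)))
          = F i p / y - F j p / z + F k p * (x / (y * z))"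
        using nz(1) by (simp add: distrib_left right_diff_distrib mult.commute[of x "F k p"])
      ultimately show ?thesis
        unfolding e al_def be_def d x_def[symmetric] y_def[symmetric] z_def[symmetric]
        by (simp add: right_diff_distrib)
    qed
  qed
  then show "\<exists>al be. depends_only (- {j}) al \<and> depends_only (- {i}) be \<and>
      (\<forall>p\<in>Om. (p $ i - p $ j) * (pot (Psi p) - E) = al p + be p)"
    by (intro exI[of _ al] exI[of _ be] conjI ballI al be)
qed

end

end

section \<open>The eleven coordinate systems\<close>

text \<open>Depends on the coordinate system alone: the same frame refutes both forms for every
  placement of the potential and every energy.\<close>

definition obstructed :: "pt set \<Rightarrow> (pt \<Rightarrow> pt) \<Rightarrow> bool" where
  "obstructed \<Omega> Psi \<longleftrightarrow> (\<exists>T.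
     (\<forall>p\<in>\<Omega>. \<forall>i. ((\<lambda>s. Psi (p + s *\<^sub>R axis i 1)) has_vector_derivative T i p) (at 0)) \<and>
     (\<forall>(b :: 3 \<times> bool \<Rightarrow> pt) d N E v G. separated_potential b d N Psi v G T \<longrightarrow> v ` N \<subseteq> \<Omega> \<longrightarrow>
        \<not> separated_potential.complete_form b d N E Psi v G \<and>
        (\<forall>i. \<not> separated_potential.partial_form b d N E Psi v G i)))"

definition frame :: "(pt \<Rightarrow> pt) \<Rightarrow> (pt \<Rightarrow> pt) \<Rightarrow> (pt \<Rightarrow> pt) \<Rightarrow> 3 \<Rightarrow> pt \<Rightarrow> pt" where
  "frame T1 T2 T3 i = (if i = 1 then T1 else if i = 2 then T2 else T3)"

lemma frame_simps [simp]:
  "frame T1 T2 T3 1 = T1" "frame T1 T2 T3 2 = T2" "frame T1 T2 T3 3 = T3"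
  by (simp_all add: frame_def)

lemma has_vector_derivative_component:
  fixes f :: "real \<Rightarrow> pt"
  assumes "\<And>k. ((\<lambda>s. f s $ k) has_real_derivative f' $ k) (at t)"
  shows "(f has_vector_derivative f') (at t)"
  unfolding has_vector_derivative_def
proof (rule has_derivative_componentwise_within[THEN iffD2], intro ballI)
  fix e :: pt assume "e \<in> Basis"
  then obtain k where "e = axis k 1" by (auto simp: Basis_vec_def)
  then show "((\<lambda>x. f x \<bullet> e) has_derivative (\<lambda>x. (x *\<^sub>R f') \<bullet> e)) (at t)"
    using assms[of k] by (simp add: inner_axis has_field_derivative_def mult.commute[of _ "f' $ k"])
qed

lemma obstructedI:
  assumes "\<And>p i k. p \<in> \<Omega> \<Longrightarrow>
      ((\<lambda>s. Psi (p + s *\<^sub>R axis i 1) $ k) has_real_derivative T i p $ k) (at 0)"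
    and "\<And>(b :: 3 \<times> bool \<Rightarrow> pt) d N E v G. separated_potential b d N Psi v G T \<Longrightarrow> v ` N \<subseteq> \<Omega> \<Longrightarrow>
        \<not> separated_potential.complete_form b d N E Psi v G \<and>
        (\<forall>i. \<not> separated_potential.partial_form b d N E Psi v G i)"
  shows "obstructed \<Omega> Psi"
  unfolding obstructed_def
  by (intro exI[of _ T] conjI ballI allI impI has_vector_derivative_component)
     (use assms in auto)

text \<open>By the identity theorem the equality would hold for all \<open>s\<close>, while
  \<open>sin^2\<close> takes the values \<open>0\<close> and \<open>1\<close>. This and the next
  lemmas show that scale factors really vary.\<close>

lemma sin_sq_not_const:
  fixes a :: real
  assumes "e > 0" "\<And>s. \<bar>s\<bar> < e \<Longrightarrow> (sin (a + s))\<^sup>2 = (sin a)\<^sup>2"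
  shows False
proof -
  define f where "f s = sin (a + s * 1) * sin (a + s * 1) + - ((sin a)\<^sup>2)" for s
  have "entire_on_line f"
    unfolding f_def[abs_def]
    by (intro entire_on_line_add entire_on_line_mult entire_on_line_sin entire_on_line_const)
  moreover have "f s = 0" if "\<bar>s\<bar> < e" for s
    using assms(2)[OF that] by (simp add: f_def power2_eq_square)
  ultimately have *: "f s = 0" for s by (rule entire_on_line_zero[OF _ assms(1)])
  show False using *[of "- a"] *[of "pi / 2 - a"] by (simp add: f_def)
qed

lemma sq_shift_eq:
  fixes x :: real
  assumes "e > 0" "\<And>s. \<bar>s\<bar> < e \<Longrightarrow> (x + s)\<^sup>2 = x\<^sup>2"
  shows False
proof -
  \<comment> \<open>Opposite shifts are added to remove the linear term.\<close>
  have "(x + e / 2)\<^sup>2 + (x + - (e / 2))\<^sup>2 = x\<^sup>2 + x\<^sup>2"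
    using assms(2)[of "e / 2"] assms(2)[of "- (e / 2)"] assms(1) by simp
  then show False using assms(1) by (simp add: power2_eq_square algebra_simps)
qed

lemma sinh_sq_shift:
  assumes "e > 0" "x > (0 :: real)" "\<And>s. \<bar>s\<bar> < e \<Longrightarrow> (sinh (x + s))\<^sup>2 = (sinh x)\<^sup>2"
  shows False
proof -
  have "sinh (x + e / 2) = sinh x"
  proof (rule power2_eq_imp_eq)
    show "(sinh (x + e / 2))\<^sup>2 = (sinh x)\<^sup>2" by (rule assms(3)) (use assms(1) in simp)
  qed (use assms(1,2) in simp_all)
  then show False using assms(1) by simp
qed

lemma cosh_sq_shift:
  assumes "e > 0" "x > (0 :: real)" "\<And>s. \<bar>s\<bar> < e \<Longrightarrow> (cosh (x + s))\<^sup>2 = (cosh x)\<^sup>2"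
  shows False
  by (rule sinh_sq_shift[OF assms(1,2)]) (use assms(3) in \<open>simp add: cosh_square_eq\<close>)

context separated_potential
begin

lemma not_partial_form:
  assumes orth: "\<And>p i j. p \<in> Om \<Longrightarrow> i \<noteq> j \<Longrightarrow> T i p \<bullet> T j p = 0" and jk: "j \<noteq> i" "k \<noteq> i"
    and False: "\<And>p e. p \<in> Om \<Longrightarrow> e > 0 \<Longrightarrow> (\<And>s. \<bar>s\<bar> < e \<Longrightarrow> p + s *\<^sub>R axis i 1 \<in> Om) \<Longrightarrow>
      (\<And>s. \<bar>s\<bar> < e \<Longrightarrow> (T j p \<bullet> T j p) * (T k (p + s *\<^sub>R axis i 1) \<bullet> T k (p + s *\<^sub>R axis i 1))
        = (T k p \<bullet> T k p) * (T j (p + s *\<^sub>R axis i 1) \<bullet> T j (p + s *\<^sub>R axis i 1))) \<Longrightarrow> False"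
  shows "\<not> partial_form i"
proof
  assume part: "partial_form i"
  obtain p where p: "p \<in> Om" using Om_nonempty by blast
  obtain e where e: "e > 0" "\<And>s. \<bar>s\<bar> < e \<Longrightarrow> p + s *\<^sub>R axis i 1 \<in> Om"
    using in_Om_near[OF p] by metis
  show False
    by (rule False[OF p e]) (auto intro: partial_form_ratio[OF orth part jk p e(2)])
qed

end

lemma orth_3:
  assumes "T 1 \<bullet> T 2 = 0" "T 1 \<bullet> T 3 = 0" "T 2 \<bullet> T 3 = (0 :: real)" "i \<noteq> (j :: 3)"
  shows "T i \<bullet> T j = 0"
  using assms exhaust_3[of i] exhaust_3[of j] by (auto simp: inner_commute)

text \<open>Inner products in frames adapted to an axis of rotation: vectors in the meridian plane
  at angle \<open>t\<close>, and tangents to the circle of rotation.\<close>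

lemma inner_meridian:
  "vector [A * cos t, A * sin t, B] \<bullet> (vector [A' * cos t, A' * sin t, B'] :: pt) = A * A' + B * B'"
  "vector [A * cos t, A * sin t, B] \<bullet> (vector [- (C * sin t), C * cos t, 0] :: pt) = 0"
  "vector [- (C * sin t), C * cos t, 0] \<bullet> (vector [- (C * sin t), C * cos t, 0] :: pt) = C\<^sup>2"
proof -
  have *: "x * cos t * (y * cos t) + x * sin t * (y * sin t) = x * y" for x y
  proof -
    have "x * cos t * (y * cos t) + x * sin t * (y * sin t) = x * y * ((sin t)\<^sup>2 + (cos t)\<^sup>2)"
      by (simp only: power2_eq_square algebra_simps)
    then show ?thesis by simp
  qed
  show "vector [A * cos t, A * sin t, B] \<bullet> (vector [A' * cos t, A' * sin t, B'] :: pt) = A * A' + B * B'"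
    by (simp add: inner_vec_def sum_3 *)
  show "vector [A * cos t, A * sin t, B] \<bullet> (vector [- (C * sin t), C * cos t, 0] :: pt) = 0"
    by (simp add: inner_vec_def sum_3)
  show "vector [- (C * sin t), C * cos t, 0] \<bullet> (vector [- (C * sin t), C * cos t, 0] :: pt) = C\<^sup>2"
    using *[of C C] by (simp add: inner_vec_def sum_3 power2_eq_square)
qed

lemma depends_only_not_3:
  assumes "\<And>u v. u $ 1 = v $ 1 \<Longrightarrow> u $ 2 = v $ 2 \<Longrightarrow> f u = f v"
  shows "depends_only (- {3}) f"
  unfolding depends_only_def
proof (intro allI impI)
  fix u v :: pt assume *: "\<forall>i\<in>- {3}. u $ i = v $ i"
  have "u $ 1 = v $ 1" "u $ 2 = v $ 2" by (rule *[THEN bspec], simp)+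
  then show "f u = f v" by (rule assms)
qed

lemma depends_only_1:
  assumes "\<And>u v. u $ 1 = v $ 1 \<Longrightarrow> f u = f v" "1 \<in> B"
  shows "depends_only B f"
  unfolding depends_only_def
proof (intro allI impI)
  fix u v :: pt assume *: "\<forall>i\<in>B. u $ i = v $ i"
  show "f u = f v" by (rule assms(1), rule *[THEN bspec], rule assms(2))
qed

section \<open>The Cartesian and the cylindrical systems\<close>

lemma cartesian_obstructed: "obstructed UNIV (\<lambda>u. u)"
proof (rule obstructedI[where T="\<lambda>i p. axis i 1"])
  show "((\<lambda>s. (p + s *\<^sub>R axis i 1) $ k) has_real_derivative (axis i 1 :: pt) $ k) (at 0)" for p :: pt and i k
    by (auto intro!: derivative_eq_intros)
  fix b :: "3 \<times> bool \<Rightarrow> pt" and d N E v G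
  assume sp: "separated_potential b d N (\<lambda>u. u) v G (\<lambda>i p. axis i 1)"
  interpret separated_potential b d N E "\<lambda>u. u" v G "\<lambda>i p. axis i 1" by (rule sp)
  have orth: "axis i 1 \<bullet> (axis j 1 :: pt) = 0" if "i \<noteq> j" for i j
    using that by (simp add: inner_axis_axis)
  have "\<not> complete_form"
  proof
    assume c: complete_form
    show False
      by (rule cylinder_class[OF orth refl _ _ disjI1[OF c]]) (simp_all add: depends_only_const)
  qed
  moreover have "\<not> partial_form i" for i
  proof
    assume part: "partial_form i"
    obtain j where "j \<noteq> i" using third_index by blast
    from partial_formE[OF orth part this] obtain f g where "depends_only {i} f" "depends_only (- {i}) g"
      "\<forall>p\<in>Om. pot p - E = f p + g p" by auto
    then show False using no_translation_separation[OF orth refl] by blast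
  qed
  ultimately show "\<not> complete_form \<and> (\<forall>i. \<not> partial_form i)" by blast
qed

text \<open>The pattern for the systems with a symmetry: the frame \<open>?T\<close> is orthogonal
  with squared lengths \<open>n1\<close>, \<open>n2\<close>, \<open>n3\<close>; a symmetry class
  excludes complete separation and splitting off its own variable, and any other partial form
  contradicts the ratio condition.\<close>

lemma circular_cylinder_obstructed:
  "obstructed {u. u$1 > 0} (\<lambda>u. vector [u$1 * cos (u$2), u$1 * sin (u$2), u$3])"
proof (rule obstructedI[where T="frame (\<lambda>p. vector [cos (p$2), sin (p$2), 0]) (\<lambda>p. vector [- (p$1 * sin (p$2)), p$1 * cos (p$2), 0]) (\<lambda>p. axis 3 1)"])
  let ?Psi = "\<lambda>u::pt. vector [u$1 * cos (u$2), u$1 * sin (u$2), u$3] :: pt"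
  let ?T = "frame (\<lambda>p. vector [cos (p$2), sin (p$2), 0]) (\<lambda>p. vector [- (p$1 * sin (p$2)), p$1 * cos (p$2), 0]) (\<lambda>p. axis 3 1)"
  let ?Om = "{u. u$1 > 0}"
  show "((\<lambda>s. ?Psi (p + s *\<^sub>R axis i 1) $ k) has_real_derivative ?T i p $ k) (at 0)"
    if "p \<in> ?Om" for p :: pt and i k
  proof -
    have "\<forall>i k. ((\<lambda>s. ?Psi (p + s *\<^sub>R axis i 1) $ k) has_real_derivative ?T i p $ k) (at 0)"
      using that unfolding forall_3 by (auto simp: axis_def field_simps intro!: derivative_eq_intros)
    then show ?thesis by blast
  qed
  fix b :: "3 \<times> bool \<Rightarrow> pt" and d' N E v G
  assume sp: "separated_potential b d' N ?Psi v G ?T" and dom: "v ` N \<subseteq> ?Om"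
  interpret separated_potential b d' N E ?Psi v G ?T by (rule sp)
  have Om: "p \<in> ?Om" if "p \<in> Om" for p using that dom by (auto simp: Om_def)
  have o3: "?T 1 p \<bullet> ?T 2 p = 0" "?T 1 p \<bullet> ?T 3 p = 0" "?T 2 p \<bullet> ?T 3 p = 0" for p
    by (simp add: inner_vec_def sum_3 axis_def algebra_simps)+
  have orth: "?T i p \<bullet> ?T j p = 0" if "i \<noteq> j" for i j p
    by (rule orth_3[where T="\<lambda>i. ?T i p", OF o3 that])
  have n1: "?T 1 p \<bullet> ?T 1 p = 1" for p
    by (simp add: inner_vec_def sum_3 flip: power2_eq_square)
  have n2: "?T 2 p \<bullet> ?T 2 p = (p$1)\<^sup>2" for p
    by (simp add: inner_vec_def sum_3 cos_squared_eq power_mult_distrib algebra_simps flip: power2_eq_square)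
  have n3: "?T 3 p \<bullet> ?T 3 p = 1" for p
    by (simp add: inner_vec_def sum_3 axis_def)
  have c3: "\<not> (complete_form \<or> partial_form 3)"
    using cylinder_class[OF orth] unfolding n1 n2 by (auto simp: depends_only_def)
  have cr: "\<not> (complete_form \<or> partial_form 2)"
  proof
    assume form: "complete_form \<or> partial_form 2"
    show False
    proof (rule rotational_class[OF orth _ _ form])
      show "?T 2 = (\<lambda>p. rot (?Psi p))" by (rule ext, simp add: rot_def vec_eq_iff forall_3)
      show "depends_only (- {2}) (\<lambda>p. ?T j p \<bullet> ?T j p)" for j
        using exhaust_3[of j] by (elim disjE) (rule depends_only_1, simp only: n1 n2 n3, simp)+
    qed
  qed
  have p1: "\<not> partial_form 1"
  proof (rule not_partial_form[OF orth, of 2 1 3])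
    fix p e assume p: "p \<in> Om" and e: "e > 0" and near: "\<And>s. \<bar>s\<bar> < e \<Longrightarrow> p + s *\<^sub>R axis 1 1 \<in> Om"
      and r: "\<And>s. \<bar>s\<bar> < e \<Longrightarrow> (?T 2 p \<bullet> ?T 2 p) * (?T 3 (p + s *\<^sub>R axis 1 1) \<bullet> ?T 3 (p + s *\<^sub>R axis 1 1))
        = (?T 3 p \<bullet> ?T 3 p) * (?T 2 (p + s *\<^sub>R axis 1 1) \<bullet> ?T 2 (p + s *\<^sub>R axis 1 1))"
    show False
      by (rule sq_shift_eq[OF e, of "p$1"]) (use r in \<open>simp only: n2 n3, simp add: axis_def\<close>)
  qed simp_all
  show "\<not> complete_form \<and> (\<forall>i. \<not> partial_form i)"
    using c3 cr p1 by (simp add: forall_3)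
qed

lemma elliptic_cylinder_obstructed:
  assumes d: "d > 0"
  shows "obstructed {u. u$1 > 0} (\<lambda>u. vector [d * cosh (u$1) * cos (u$2), d * sinh (u$1) * sin (u$2), u$3])"
proof (rule obstructedI[where T="frame (\<lambda>p. vector [d * sinh (p$1) * cos (p$2), d * cosh (p$1) * sin (p$2), 0]) (\<lambda>p. vector [- (d * cosh (p$1) * sin (p$2)), d * sinh (p$1) * cos (p$2), 0]) (\<lambda>p. axis 3 1)"])
  let ?Psi = "\<lambda>u::pt. vector [d * cosh (u$1) * cos (u$2), d * sinh (u$1) * sin (u$2), u$3] :: pt"
  let ?T = "frame (\<lambda>p. vector [d * sinh (p$1) * cos (p$2), d * cosh (p$1) * sin (p$2), 0]) (\<lambda>p. vector [- (d * cosh (p$1) * sin (p$2)), d * sinh (p$1) * cos (p$2), 0]) (\<lambda>p. axis 3 1)"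
  let ?Om = "{u. u$1 > 0}"
  show "((\<lambda>s. ?Psi (p + s *\<^sub>R axis i 1) $ k) has_real_derivative ?T i p $ k) (at 0)"
    if "p \<in> ?Om" for p :: pt and i k
  proof -
    have "\<forall>i k. ((\<lambda>s. ?Psi (p + s *\<^sub>R axis i 1) $ k) has_real_derivative ?T i p $ k) (at 0)"
      using that unfolding forall_3 by (auto simp: axis_def field_simps intro!: derivative_eq_intros)
    then show ?thesis by blast
  qed
  fix b :: "3 \<times> bool \<Rightarrow> pt" and d' N E v G
  assume sp: "separated_potential b d' N ?Psi v G ?T" and dom: "v ` N \<subseteq> ?Om"
  interpret separated_potential b d' N E ?Psi v G ?T by (rule sp)
  have Om: "p \<in> ?Om" if "p \<in> Om" for p using that dom by (auto simp: Om_def)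
  have o3: "?T 1 p \<bullet> ?T 2 p = 0" "?T 1 p \<bullet> ?T 3 p = 0" "?T 2 p \<bullet> ?T 3 p = 0" for p
    by (simp add: inner_vec_def sum_3 axis_def algebra_simps)+
  have orth: "?T i p \<bullet> ?T j p = 0" if "i \<noteq> j" for i j p
    by (rule orth_3[where T="\<lambda>i. ?T i p", OF o3 that])
  have n1: "?T 1 p \<bullet> ?T 1 p = d\<^sup>2 * ((sinh (p$1))\<^sup>2 + (sin (p$2))\<^sup>2)" for p
    by (simp add: inner_vec_def sum_3 power_mult_distrib flip: power2_eq_square) (simp add: cos_squared_eq cosh_square_eq algebra_simps)
  have n2: "?T 2 p \<bullet> ?T 2 p = d\<^sup>2 * ((sinh (p$1))\<^sup>2 + (sin (p$2))\<^sup>2)" for p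
    by (simp add: inner_vec_def sum_3 power_mult_distrib flip: power2_eq_square) (simp add: cos_squared_eq cosh_square_eq algebra_simps)
  have n3: "?T 3 p \<bullet> ?T 3 p = 1" for p
    by (simp add: inner_vec_def sum_3 axis_def)
  have c3: "\<not> (complete_form \<or> partial_form 3)"
    using cylinder_class[OF orth] unfolding n1 n2 by (auto simp: depends_only_def)
  have p1: "\<not> partial_form 1"
  proof (rule not_partial_form[OF orth, of 2 1 3])
    fix p e assume p: "p \<in> Om" and e: "e > 0" and near: "\<And>s. \<bar>s\<bar> < e \<Longrightarrow> p + s *\<^sub>R axis 1 1 \<in> Om"
      and r: "\<And>s. \<bar>s\<bar> < e \<Longrightarrow> (?T 2 p \<bullet> ?T 2 p) * (?T 3 (p + s *\<^sub>R axis 1 1) \<bullet> ?T 3 (p + s *\<^sub>R axis 1 1))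
        = (?T 3 p \<bullet> ?T 3 p) * (?T 2 (p + s *\<^sub>R axis 1 1) \<bullet> ?T 2 (p + s *\<^sub>R axis 1 1))"
    show False
      by (rule sinh_sq_shift[OF e, of "p$1"]) (use r d Om[OF p] in \<open>simp_all only: n2 n3, simp_all add: axis_def\<close>)
  qed simp_all
  have p2: "\<not> partial_form 2"
  proof (rule not_partial_form[OF orth, of 1 2 3])
    fix p e assume p: "p \<in> Om" and e: "e > 0" and near: "\<And>s. \<bar>s\<bar> < e \<Longrightarrow> p + s *\<^sub>R axis 2 1 \<in> Om"
      and r: "\<And>s. \<bar>s\<bar> < e \<Longrightarrow> (?T 1 p \<bullet> ?T 1 p) * (?T 3 (p + s *\<^sub>R axis 2 1) \<bullet> ?T 3 (p + s *\<^sub>R axis 2 1))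
        = (?T 3 p \<bullet> ?T 3 p) * (?T 1 (p + s *\<^sub>R axis 2 1) \<bullet> ?T 1 (p + s *\<^sub>R axis 2 1))"
    show False
      by (rule sin_sq_not_const[OF e, of "p$2"]) (use r d in \<open>simp only: n1 n3, simp add: axis_def\<close>)
  qed simp_all
  show "\<not> complete_form \<and> (\<forall>i. \<not> partial_form i)"
    using c3 p1 p2 by (simp add: forall_3)
qed

lemma parabolic_cylinder_obstructed:
  "obstructed {u. u$1 > 0} (\<lambda>u. vector [((u$1)\<^sup>2 - (u$2)\<^sup>2) / 2, u$1 * u$2, u$3])"
proof (rule obstructedI[where T="frame (\<lambda>p. vector [p$1, p$2, 0]) (\<lambda>p. vector [- (p$2), p$1, 0]) (\<lambda>p. axis 3 1)"])
  let ?Psi = "\<lambda>u::pt. vector [((u$1)\<^sup>2 - (u$2)\<^sup>2) / 2, u$1 * u$2, u$3] :: pt"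
  let ?T = "frame (\<lambda>p. vector [p$1, p$2, 0]) (\<lambda>p. vector [- (p$2), p$1, 0]) (\<lambda>p. axis 3 1)"
  let ?Om = "{u. u$1 > 0}"
  show "((\<lambda>s. ?Psi (p + s *\<^sub>R axis i 1) $ k) has_real_derivative ?T i p $ k) (at 0)"
    if "p \<in> ?Om" for p :: pt and i k
  proof -
    have "\<forall>i k. ((\<lambda>s. ?Psi (p + s *\<^sub>R axis i 1) $ k) has_real_derivative ?T i p $ k) (at 0)"
      using that unfolding forall_3 by (auto simp: axis_def field_simps intro!: derivative_eq_intros)
    then show ?thesis by blast
  qed
  fix b :: "3 \<times> bool \<Rightarrow> pt" and d' N E v G
  assume sp: "separated_potential b d' N ?Psi v G ?T" and dom: "v ` N \<subseteq> ?Om"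
  interpret separated_potential b d' N E ?Psi v G ?T by (rule sp)
  have Om: "p \<in> ?Om" if "p \<in> Om" for p using that dom by (auto simp: Om_def)
  have o3: "?T 1 p \<bullet> ?T 2 p = 0" "?T 1 p \<bullet> ?T 3 p = 0" "?T 2 p \<bullet> ?T 3 p = 0" for p
    by (simp add: inner_vec_def sum_3 axis_def algebra_simps)+
  have orth: "?T i p \<bullet> ?T j p = 0" if "i \<noteq> j" for i j p
    by (rule orth_3[where T="\<lambda>i. ?T i p", OF o3 that])
  have n1: "?T 1 p \<bullet> ?T 1 p = (p$1)\<^sup>2 + (p$2)\<^sup>2" for p
    by (simp add: inner_vec_def sum_3 power2_eq_square)
  have n2: "?T 2 p \<bullet> ?T 2 p = (p$1)\<^sup>2 + (p$2)\<^sup>2" for p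
    by (simp add: inner_vec_def sum_3 power2_eq_square)
  have n3: "?T 3 p \<bullet> ?T 3 p = 1" for p
    by (simp add: inner_vec_def sum_3 axis_def)
  have c3: "\<not> (complete_form \<or> partial_form 3)"
    using cylinder_class[OF orth] unfolding n1 n2 by (auto simp: depends_only_def)
  have p1: "\<not> partial_form 1"
  proof (rule not_partial_form[OF orth, of 2 1 3])
    fix p e assume p: "p \<in> Om" and e: "e > 0" and near: "\<And>s. \<bar>s\<bar> < e \<Longrightarrow> p + s *\<^sub>R axis 1 1 \<in> Om"
      and r: "\<And>s. \<bar>s\<bar> < e \<Longrightarrow> (?T 2 p \<bullet> ?T 2 p) * (?T 3 (p + s *\<^sub>R axis 1 1) \<bullet> ?T 3 (p + s *\<^sub>R axis 1 1))
        = (?T 3 p \<bullet> ?T 3 p) * (?T 2 (p + s *\<^sub>R axis 1 1) \<bullet> ?T 2 (p + s *\<^sub>R axis 1 1))"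
    show False
      by (rule sq_shift_eq[OF e, of "p$1"]) (use r in \<open>simp only: n2 n3, simp add: axis_def\<close>)
  qed simp_all
  have p2: "\<not> partial_form 2"
  proof (rule not_partial_form[OF orth, of 1 2 3])
    fix p e assume p: "p \<in> Om" and e: "e > 0" and near: "\<And>s. \<bar>s\<bar> < e \<Longrightarrow> p + s *\<^sub>R axis 2 1 \<in> Om"
      and r: "\<And>s. \<bar>s\<bar> < e \<Longrightarrow> (?T 1 p \<bullet> ?T 1 p) * (?T 3 (p + s *\<^sub>R axis 2 1) \<bullet> ?T 3 (p + s *\<^sub>R axis 2 1))
        = (?T 3 p \<bullet> ?T 3 p) * (?T 1 (p + s *\<^sub>R axis 2 1) \<bullet> ?T 1 (p + s *\<^sub>R axis 2 1))"
    show False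
      by (rule sq_shift_eq[OF e, of "p$2"]) (use r in \<open>simp only: n1 n3, simp add: axis_def\<close>)
  qed simp_all
  show "\<not> complete_form \<and> (\<forall>i. \<not> partial_form i)"
    using c3 p1 p2 by (simp add: forall_3)
qed

section \<open>Systems with an axis of rotation\<close>

lemma parabolic_obstructed:
  "obstructed {u. u$1 > 0 \<and> u$2 > 0} (\<lambda>u. vector [u$1 * u$2 * cos (u$3), u$1 * u$2 * sin (u$3), ((u$1)\<^sup>2 - (u$2)\<^sup>2) / 2])"
proof (rule obstructedI[where T="frame (\<lambda>p. vector [p$2 * cos (p$3), p$2 * sin (p$3), p$1]) (\<lambda>p. vector [p$1 * cos (p$3), p$1 * sin (p$3), - (p$2)]) (\<lambda>p. vector [- (p$1 * p$2 * sin (p$3)), p$1 * p$2 * cos (p$3), 0])"])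
  let ?Psi = "\<lambda>u::pt. vector [u$1 * u$2 * cos (u$3), u$1 * u$2 * sin (u$3), ((u$1)\<^sup>2 - (u$2)\<^sup>2) / 2] :: pt"
  let ?T = "frame (\<lambda>p. vector [p$2 * cos (p$3), p$2 * sin (p$3), p$1]) (\<lambda>p. vector [p$1 * cos (p$3), p$1 * sin (p$3), - (p$2)]) (\<lambda>p. vector [- (p$1 * p$2 * sin (p$3)), p$1 * p$2 * cos (p$3), 0])"
  let ?Om = "{u. u$1 > 0 \<and> u$2 > 0}"
  show "((\<lambda>s. ?Psi (p + s *\<^sub>R axis i 1) $ k) has_real_derivative ?T i p $ k) (at 0)"
    if "p \<in> ?Om" for p :: pt and i k
  proof -
    have "\<forall>i k. ((\<lambda>s. ?Psi (p + s *\<^sub>R axis i 1) $ k) has_real_derivative ?T i p $ k) (at 0)"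
      using that unfolding forall_3 by (auto simp: axis_def field_simps intro!: derivative_eq_intros)
    then show ?thesis by blast
  qed
  fix b :: "3 \<times> bool \<Rightarrow> pt" and d' N E v G
  assume sp: "separated_potential b d' N ?Psi v G ?T" and dom: "v ` N \<subseteq> ?Om"
  interpret separated_potential b d' N E ?Psi v G ?T by (rule sp)
  have Om: "p \<in> ?Om" if "p \<in> Om" for p using that dom by (auto simp: Om_def)
  have o3: "?T 1 p \<bullet> ?T 2 p = 0" "?T 1 p \<bullet> ?T 3 p = 0" "?T 2 p \<bullet> ?T 3 p = 0" for p
    by (simp_all only: frame_simps inner_meridian) (simp_all add: algebra_simps)
  have orth: "?T i p \<bullet> ?T j p = 0" if "i \<noteq> j" for i j p
    by (rule orth_3[where T="\<lambda>i. ?T i p", OF o3 that])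
  have n1: "?T 1 p \<bullet> ?T 1 p = (p$1)\<^sup>2 + (p$2)\<^sup>2" for p
    by (simp only: frame_simps inner_meridian) (simp add: power2_eq_square)
  have n2: "?T 2 p \<bullet> ?T 2 p = (p$1)\<^sup>2 + (p$2)\<^sup>2" for p
    by (simp only: frame_simps inner_meridian) (simp add: power2_eq_square)
  have n3: "?T 3 p \<bullet> ?T 3 p = (p$1)\<^sup>2 * (p$2)\<^sup>2" for p
    by (simp only: frame_simps inner_meridian) (simp add: power2_eq_square)
  have cr: "\<not> (complete_form \<or> partial_form 3)"
  proof
    assume form: "complete_form \<or> partial_form 3"
    show False
    proof (rule rotational_class[OF orth _ _ form])
      show "?T 3 = (\<lambda>p. rot (?Psi p))" by (rule ext, simp add: rot_def vec_eq_iff forall_3)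
      show "depends_only (- {3}) (\<lambda>p. ?T j p \<bullet> ?T j p)" for j
        using exhaust_3[of j] by (elim disjE) (rule depends_only_not_3, simp only: n1 n2 n3)+
    qed
  qed
  have p1: "\<not> partial_form 1"
  proof (rule not_partial_form[OF orth, of 2 1 3])
    fix p e assume p: "p \<in> Om" and e: "e > 0" and near: "\<And>s. \<bar>s\<bar> < e \<Longrightarrow> p + s *\<^sub>R axis 1 1 \<in> Om"
      and r: "\<And>s. \<bar>s\<bar> < e \<Longrightarrow> (?T 2 p \<bullet> ?T 2 p) * (?T 3 (p + s *\<^sub>R axis 1 1) \<bullet> ?T 3 (p + s *\<^sub>R axis 1 1))
        = (?T 3 p \<bullet> ?T 3 p) * (?T 2 (p + s *\<^sub>R axis 1 1) \<bullet> ?T 2 (p + s *\<^sub>R axis 1 1))"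
    have "((p$1 + s)\<^sup>2 - (p$1)\<^sup>2) * ((p$2)\<^sup>2 * (p$2)\<^sup>2) = 0" if "\<bar>s\<bar> < e" for s
      using r[OF that] unfolding n2 n3 by (simp add: axis_def algebra_simps)
    then show False
      by (intro sq_shift_eq[OF e, of "p$1"]) (use Om[OF p] in simp)
  qed simp_all
  have p2: "\<not> partial_form 2"
  proof (rule not_partial_form[OF orth, of 1 2 3])
    fix p e assume p: "p \<in> Om" and e: "e > 0" and near: "\<And>s. \<bar>s\<bar> < e \<Longrightarrow> p + s *\<^sub>R axis 2 1 \<in> Om"
      and r: "\<And>s. \<bar>s\<bar> < e \<Longrightarrow> (?T 1 p \<bullet> ?T 1 p) * (?T 3 (p + s *\<^sub>R axis 2 1) \<bullet> ?T 3 (p + s *\<^sub>R axis 2 1))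
        = (?T 3 p \<bullet> ?T 3 p) * (?T 1 (p + s *\<^sub>R axis 2 1) \<bullet> ?T 1 (p + s *\<^sub>R axis 2 1))"
    have "((p$2 + s)\<^sup>2 - (p$2)\<^sup>2) * ((p$1)\<^sup>2 * (p$1)\<^sup>2) = 0" if "\<bar>s\<bar> < e" for s
      using r[OF that] unfolding n1 n3 by (simp add: axis_def algebra_simps)
    then show False
      by (intro sq_shift_eq[OF e, of "p$2"]) (use Om[OF p] in simp)
  qed simp_all
  show "\<not> complete_form \<and> (\<forall>i. \<not> partial_form i)"
    using cr p1 p2 by (simp add: forall_3)
qed

lemma spherical_obstructed:
  "obstructed {u. u$1 > 0 \<and> 0 < u$2 \<and> u$2 < pi} (\<lambda>u. vector [u$1 * sin (u$2) * cos (u$3), u$1 * sin (u$2) * sin (u$3), u$1 * cos (u$2)])"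
proof (rule obstructedI[where T="frame (\<lambda>p. (1 / p$1) *\<^sub>R vector [p$1 * sin (p$2) * cos (p$3), p$1 * sin (p$2) * sin (p$3), p$1 * cos (p$2)]) (\<lambda>p. vector [p$1 * cos (p$2) * cos (p$3), p$1 * cos (p$2) * sin (p$3), - (p$1 * sin (p$2))]) (\<lambda>p. vector [- (p$1 * sin (p$2) * sin (p$3)), p$1 * sin (p$2) * cos (p$3), 0])"])
  let ?Psi = "\<lambda>u::pt. vector [u$1 * sin (u$2) * cos (u$3), u$1 * sin (u$2) * sin (u$3), u$1 * cos (u$2)] :: pt"
  let ?T = "frame (\<lambda>p. (1 / p$1) *\<^sub>R vector [p$1 * sin (p$2) * cos (p$3), p$1 * sin (p$2) * sin (p$3), p$1 * cos (p$2)]) (\<lambda>p. vector [p$1 * cos (p$2) * cos (p$3), p$1 * cos (p$2) * sin (p$3), - (p$1 * sin (p$2))]) (\<lambda>p. vector [- (p$1 * sin (p$2) * sin (p$3)), p$1 * sin (p$2) * cos (p$3), 0])"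
  let ?Om = "{u. u$1 > 0 \<and> 0 < u$2 \<and> u$2 < pi}"
  have unit1: "?T 1 p = vector [sin (p$2) * cos (p$3), sin (p$2) * sin (p$3), cos (p$2)]" if "p \<in> ?Om" for p
    using that by (simp add: vec_eq_iff forall_3)
  show "((\<lambda>s. ?Psi (p + s *\<^sub>R axis i 1) $ k) has_real_derivative ?T i p $ k) (at 0)"
    if "p \<in> ?Om" for p :: pt and i k
  proof -
    have "\<forall>i k. ((\<lambda>s. ?Psi (p + s *\<^sub>R axis i 1) $ k) has_real_derivative ?T i p $ k) (at 0)"
      using that unfolding forall_3 by (auto simp: axis_def intro!: derivative_eq_intros)
    then show ?thesis by blast
  qed
  fix b :: "3 \<times> bool \<Rightarrow> pt" and d' N E v G
  assume sp: "separated_potential b d' N ?Psi v G ?T" and dom: "v ` N \<subseteq> ?Om"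
  interpret separated_potential b d' N E ?Psi v G ?T by (rule sp)
  have Om: "p \<in> ?Om" if "p \<in> Om" for p using that dom by (auto simp: Om_def)
  have o3: "?T 1 p \<bullet> ?T 2 p = 0" "?T 1 p \<bullet> ?T 3 p = 0" "?T 2 p \<bullet> ?T 3 p = 0" if "p \<in> Om" for p
    unfolding unit1[OF Om[OF that]]
    by (simp_all only: frame_simps inner_meridian) (simp_all add: algebra_simps)
  have orth: "?T i p \<bullet> ?T j p = 0" if "p \<in> Om" "i \<noteq> j" for i j p
    by (rule orth_3[where T="\<lambda>i. ?T i p", OF o3 that(2)]) (rule that(1))+
  have n1: "?T 1 p \<bullet> ?T 1 p = 1" if "p \<in> Om" for p
    unfolding unit1[OF Om[OF that]] inner_meridian using sin_cos_squared_add[of "p$2"] by (simp add: power2_eq_square)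
  have n2: "?T 2 p \<bullet> ?T 2 p = (p$1)\<^sup>2 * 1" for p
    using sin_cos_squared_add[of "p$2"] by (simp only: frame_simps inner_meridian) algebra
  have n3: "?T 3 p \<bullet> ?T 3 p = (p$1)\<^sup>2 * (sin (p$2))\<^sup>2" for p
    by (simp only: frame_simps inner_meridian power_mult_distrib)
  have cr: "\<not> (complete_form \<or> partial_form 1)"
  proof
    assume form: "complete_form \<or> partial_form 1"
    show False
    proof (rule radial_class[OF orth _ _ n1 _ _ n2 n3 form])
      show "?T 1 = (\<lambda>p. (1 / p$1) *\<^sub>R ?Psi p)" by simp
      show "p$1 > 0" if "p \<in> Om" for p using Om[OF that] by simp
    qed (auto simp: depends_only_def)
  qed
  have rotational: "\<not> partial_form 3"
  proof
    assume form: "partial_form 3"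
    show False
    proof (rule rotational_class[OF orth _ _ disjI2[OF form]])
      show "?T 3 = (\<lambda>p. rot (?Psi p))" by (rule ext, simp add: rot_def vec_eq_iff forall_3)
      \<comment> \<open>The property \<open>depends_only\<close> ranges over all points, also those
        with \<open>p $ 1 = 0\<close>, where the squared length is not \<open>1\<close>; this
        formula holds everywhere.\<close>
      have n1': "?T 1 p \<bullet> ?T 1 p = (1 / p$1) * ((1 / p$1) *
          ((p$1 * sin (p$2)) * (p$1 * sin (p$2)) + (p$1 * cos (p$2)) * (p$1 * cos (p$2))))" for p
        by (simp only: frame_simps inner_scaleR_left inner_scaleR_right inner_meridian)
      show "depends_only (- {3}) (\<lambda>p. ?T j p \<bullet> ?T j p)" for j
        using exhaust_3[of j] by (elim disjE) (rule depends_only_not_3, simp only: n1' n2 n3)+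
    qed
  qed
  have p2: "\<not> partial_form 2"
  proof (rule not_partial_form[OF orth, of 1 2 3])
    fix p e assume p: "p \<in> Om" and e: "e > 0" and near: "\<And>s. \<bar>s\<bar> < e \<Longrightarrow> p + s *\<^sub>R axis 2 1 \<in> Om"
      and r: "\<And>s. \<bar>s\<bar> < e \<Longrightarrow> (?T 1 p \<bullet> ?T 1 p) * (?T 3 (p + s *\<^sub>R axis 2 1) \<bullet> ?T 3 (p + s *\<^sub>R axis 2 1))
        = (?T 3 p \<bullet> ?T 3 p) * (?T 1 (p + s *\<^sub>R axis 2 1) \<bullet> ?T 1 (p + s *\<^sub>R axis 2 1))"
    have "(sin (p$2 + s))\<^sup>2 = (sin (p$2))\<^sup>2" if "\<bar>s\<bar> < e" for s
      using r[OF that] Om[OF p] unfolding n1[OF p] n1[OF near[OF that]] n3 by (simp add: axis_def)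
    then show False by (rule sin_sq_not_const[OF e])
  qed simp_all
  show "\<not> complete_form \<and> (\<forall>i. \<not> partial_form i)"
    using cr rotational p2 by (simp add: forall_3)
qed

lemma DERIV_hyperbolic:
  "(sinh has_real_derivative cosh x) (at x)" "(cosh has_real_derivative sinh x) (at x)"
  by (auto intro!: derivative_eq_intros)

text \<open>One product rule for all components of both spheroidal systems: \<open>\<alpha>\<close>,
  \<open>\<beta>\<close>, \<open>\<gamma>\<close> are the components of the direction, and a missing
  factor is the constant \<open>1\<close>.\<close>

lemma DERIV_product_shift:
  assumes f: "(f has_real_derivative f') (at x)" and g: "(g has_real_derivative g') (at y)"
    and h: "(h has_real_derivative h') (at z)"
  shows "((\<lambda>s. d * f (x + s * \<alpha>) * g (y + s * \<beta>) * h (z + s * \<gamma>)) has_real_derivative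
    d * (f' * \<alpha>) * g y * h z + d * f x * (g' * \<beta>) * h z + d * f x * g y * (h' * \<gamma>)) (at 0)"
proof -
  have shift: "((\<lambda>s. k (w + s * c)) has_real_derivative k' * c) (at 0)"
    if "(k has_real_derivative k') (at w)" for k' w c and k :: "real \<Rightarrow> real"
    by (rule DERIV_chain2[where g="\<lambda>s. w + s * c"]) (use that in \<open>auto intro!: derivative_eq_intros\<close>)
  have "((\<lambda>s. d * f (x + s * \<alpha>)) has_real_derivative d * (f' * \<alpha>)) (at 0)"
    by (rule DERIV_cmult[OF shift[OF f]])
  from DERIV_mult[OF DERIV_mult[OF this shift[OF g, of \<beta>]] shift[OF h, of \<gamma>]]
  show ?thesis by (simp add: algebra_simps)
qed

lemma prolate_spheroidal_obstructed:
  assumes d: "d > 0"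
  shows "obstructed {u. u$1 > 0 \<and> 0 < u$2 \<and> u$2 < pi} (\<lambda>u. vector [d * sinh (u$1) * sin (u$2) * cos (u$3), d * sinh (u$1) * sin (u$2) * sin (u$3), d * cosh (u$1) * cos (u$2)])"
proof (rule obstructedI[where T="frame (\<lambda>p. vector [d * cosh (p$1) * sin (p$2) * cos (p$3), d * cosh (p$1) * sin (p$2) * sin (p$3), d * sinh (p$1) * cos (p$2)]) (\<lambda>p. vector [d * sinh (p$1) * cos (p$2) * cos (p$3), d * sinh (p$1) * cos (p$2) * sin (p$3), - (d * cosh (p$1) * sin (p$2))]) (\<lambda>p. vector [- (d * sinh (p$1) * sin (p$2) * sin (p$3)), d * sinh (p$1) * sin (p$2) * cos (p$3), 0])"])
  let ?Psi = "\<lambda>u::pt. vector [d * sinh (u$1) * sin (u$2) * cos (u$3), d * sinh (u$1) * sin (u$2) * sin (u$3), d * cosh (u$1) * cos (u$2)] :: pt"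
  let ?T = "frame (\<lambda>p. vector [d * cosh (p$1) * sin (p$2) * cos (p$3), d * cosh (p$1) * sin (p$2) * sin (p$3), d * sinh (p$1) * cos (p$2)]) (\<lambda>p. vector [d * sinh (p$1) * cos (p$2) * cos (p$3), d * sinh (p$1) * cos (p$2) * sin (p$3), - (d * cosh (p$1) * sin (p$2))]) (\<lambda>p. vector [- (d * sinh (p$1) * sin (p$2) * sin (p$3)), d * sinh (p$1) * sin (p$2) * cos (p$3), 0])"
  let ?Om = "{u. u$1 > 0 \<and> 0 < u$2 \<and> u$2 < pi}"
  show "((\<lambda>s. ?Psi (p + s *\<^sub>R axis i 1) $ k) has_real_derivative ?T i p $ k) (at 0)"
    if "p \<in> ?Om" for p :: pt and i k
  proof -
    have 1: "((\<lambda>s. ?Psi (p + s *\<^sub>R axis i 1) $ 1) has_real_derivative ?T i p $ 1) (at 0)"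
      using DERIV_product_shift[of sinh "cosh (p$1)" "p$1" sin "cos (p$2)" "p$2" cos "- sin (p$3)" "p$3" d "axis i 1 $ 1" "axis i 1 $ 2" "axis i 1 $ 3"] exhaust_3[of i]
      by (elim disjE) (simp_all add: axis_def DERIV_hyperbolic)
    have 2: "((\<lambda>s. ?Psi (p + s *\<^sub>R axis i 1) $ 2) has_real_derivative ?T i p $ 2) (at 0)"
      using DERIV_product_shift[of sinh "cosh (p$1)" "p$1" sin "cos (p$2)" "p$2" sin "cos (p$3)" "p$3" d "axis i 1 $ 1" "axis i 1 $ 2" "axis i 1 $ 3"] exhaust_3[of i]
      by (elim disjE) (simp_all add: axis_def DERIV_hyperbolic)
    have 3: "((\<lambda>s. ?Psi (p + s *\<^sub>R axis i 1) $ 3) has_real_derivative ?T i p $ 3) (at 0)"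
      using DERIV_product_shift[of cosh "sinh (p$1)" "p$1" cos "- sin (p$2)" "p$2" "\<lambda>_. 1" "0" "p$3" d "axis i 1 $ 1" "axis i 1 $ 2" "axis i 1 $ 3"] exhaust_3[of i]
      by (elim disjE) (simp_all add: axis_def DERIV_hyperbolic)
    show ?thesis using exhaust_3[of k] 1 2 3 by blast
  qed
  fix b :: "3 \<times> bool \<Rightarrow> pt" and d' N E v G
  assume sp: "separated_potential b d' N ?Psi v G ?T" and dom: "v ` N \<subseteq> ?Om"
  interpret separated_potential b d' N E ?Psi v G ?T by (rule sp)
  have Om: "p \<in> ?Om" if "p \<in> Om" for p using that dom by (auto simp: Om_def)
  have o3: "?T 1 p \<bullet> ?T 2 p = 0" "?T 1 p \<bullet> ?T 3 p = 0" "?T 2 p \<bullet> ?T 3 p = 0" for p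
    by (simp_all only: frame_simps inner_meridian) (simp_all add: algebra_simps)
  have orth: "?T i p \<bullet> ?T j p = 0" if "i \<noteq> j" for i j p
    by (rule orth_3[where T="\<lambda>i. ?T i p", OF o3 that])
  have n1: "?T 1 p \<bullet> ?T 1 p = d\<^sup>2 * ((sinh (p$1))\<^sup>2 + (sin (p$2))\<^sup>2)" for p
    using sin_cos_squared_add[of "p$2"] cosh_square_eq[of "p$1"] by (simp only: frame_simps inner_meridian) algebra
  have n2: "?T 2 p \<bullet> ?T 2 p = d\<^sup>2 * ((sinh (p$1))\<^sup>2 + (sin (p$2))\<^sup>2)" for p
    using sin_cos_squared_add[of "p$2"] cosh_square_eq[of "p$1"] by (simp only: frame_simps inner_meridian) algebra
  have n3: "?T 3 p \<bullet> ?T 3 p = d\<^sup>2 * ((sinh (p$1))\<^sup>2 * (sin (p$2))\<^sup>2)" for p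
    by (simp only: frame_simps inner_meridian) (simp only: power_mult_distrib mult.assoc)
  have cr: "\<not> (complete_form \<or> partial_form 3)"
  proof
    assume form: "complete_form \<or> partial_form 3"
    show False
    proof (rule rotational_class[OF orth _ _ form])
      show "?T 3 = (\<lambda>p. rot (?Psi p))" by (rule ext, simp add: rot_def vec_eq_iff forall_3)
      show "depends_only (- {3}) (\<lambda>p. ?T j p \<bullet> ?T j p)" for j
        using exhaust_3[of j] by (elim disjE) (rule depends_only_not_3, simp only: n1 n2 n3)+
    qed
  qed
  have p1: "\<not> partial_form 1"
  proof (rule not_partial_form[OF orth, of 2 1 3])
    fix p e assume p: "p \<in> Om" and e: "e > 0" and near: "\<And>s. \<bar>s\<bar> < e \<Longrightarrow> p + s *\<^sub>R axis 1 1 \<in> Om"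
      and r: "\<And>s. \<bar>s\<bar> < e \<Longrightarrow> (?T 2 p \<bullet> ?T 2 p) * (?T 3 (p + s *\<^sub>R axis 1 1) \<bullet> ?T 3 (p + s *\<^sub>R axis 1 1))
        = (?T 3 p \<bullet> ?T 3 p) * (?T 2 (p + s *\<^sub>R axis 1 1) \<bullet> ?T 2 (p + s *\<^sub>R axis 1 1))"
    have "d\<^sup>2 * d\<^sup>2 * ((sinh (p$1 + s))\<^sup>2 - (sinh (p$1))\<^sup>2) * ((sin (p$2))\<^sup>2 * (sin (p$2))\<^sup>2) = 0" if "\<bar>s\<bar> < e" for s
      using r[OF that] unfolding n2 n3 by (simp add: axis_def algebra_simps)
    moreover have "sin (p$2) \<noteq> 0" using Om[OF p] sin_gt_zero by force
    ultimately show False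
      by (intro sinh_sq_shift[OF e, of "p$1"]) (use Om[OF p] d in simp_all)
  qed simp_all
  have p2: "\<not> partial_form 2"
  proof (rule not_partial_form[OF orth, of 1 2 3])
    fix p e assume p: "p \<in> Om" and e: "e > 0" and near: "\<And>s. \<bar>s\<bar> < e \<Longrightarrow> p + s *\<^sub>R axis 2 1 \<in> Om"
      and r: "\<And>s. \<bar>s\<bar> < e \<Longrightarrow> (?T 1 p \<bullet> ?T 1 p) * (?T 3 (p + s *\<^sub>R axis 2 1) \<bullet> ?T 3 (p + s *\<^sub>R axis 2 1))
        = (?T 3 p \<bullet> ?T 3 p) * (?T 1 (p + s *\<^sub>R axis 2 1) \<bullet> ?T 1 (p + s *\<^sub>R axis 2 1))"
    have "d\<^sup>2 * d\<^sup>2 * ((sin (p$2 + s))\<^sup>2 - (sin (p$2))\<^sup>2) * ((sinh (p$1))\<^sup>2 * (sinh (p$1))\<^sup>2) = 0" if "\<bar>s\<bar> < e" for s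
      using r[OF that] unfolding n1 n3 by (simp add: axis_def algebra_simps)
    moreover have "sinh (p$1) \<noteq> 0" "cosh (p$1) \<noteq> 0" using Om[OF p] by simp_all
    ultimately show False
      by (intro sin_sq_not_const[OF e, of "p$2"]) (use d in simp)
  qed simp_all
  show "\<not> complete_form \<and> (\<forall>i. \<not> partial_form i)"
    using cr p1 p2 by (simp add: forall_3)
qed

lemma oblate_spheroidal_obstructed:
  assumes d: "d > 0"
  shows "obstructed {u. u$1 > 0 \<and> 0 < u$2 \<and> u$2 < pi} (\<lambda>u. vector [d * cosh (u$1) * sin (u$2) * cos (u$3), d * cosh (u$1) * sin (u$2) * sin (u$3), d * sinh (u$1) * cos (u$2)])"
proof (rule obstructedI[where T="frame (\<lambda>p. vector [d * sinh (p$1) * sin (p$2) * cos (p$3), d * sinh (p$1) * sin (p$2) * sin (p$3), d * cosh (p$1) * cos (p$2)]) (\<lambda>p. vector [d * cosh (p$1) * cos (p$2) * cos (p$3), d * cosh (p$1) * cos (p$2) * sin (p$3), - (d * sinh (p$1) * sin (p$2))]) (\<lambda>p. vector [- (d * cosh (p$1) * sin (p$2) * sin (p$3)), d * cosh (p$1) * sin (p$2) * cos (p$3), 0])"])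
  let ?Psi = "\<lambda>u::pt. vector [d * cosh (u$1) * sin (u$2) * cos (u$3), d * cosh (u$1) * sin (u$2) * sin (u$3), d * sinh (u$1) * cos (u$2)] :: pt"
  let ?T = "frame (\<lambda>p. vector [d * sinh (p$1) * sin (p$2) * cos (p$3), d * sinh (p$1) * sin (p$2) * sin (p$3), d * cosh (p$1) * cos (p$2)]) (\<lambda>p. vector [d * cosh (p$1) * cos (p$2) * cos (p$3), d * cosh (p$1) * cos (p$2) * sin (p$3), - (d * sinh (p$1) * sin (p$2))]) (\<lambda>p. vector [- (d * cosh (p$1) * sin (p$2) * sin (p$3)), d * cosh (p$1) * sin (p$2) * cos (p$3), 0])"
  let ?Om = "{u. u$1 > 0 \<and> 0 < u$2 \<and> u$2 < pi}"
  show "((\<lambda>s. ?Psi (p + s *\<^sub>R axis i 1) $ k) has_real_derivative ?T i p $ k) (at 0)"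
    if "p \<in> ?Om" for p :: pt and i k
  proof -
    have 1: "((\<lambda>s. ?Psi (p + s *\<^sub>R axis i 1) $ 1) has_real_derivative ?T i p $ 1) (at 0)"
      using DERIV_product_shift[of cosh "sinh (p$1)" "p$1" sin "cos (p$2)" "p$2" cos "- sin (p$3)" "p$3" d "axis i 1 $ 1" "axis i 1 $ 2" "axis i 1 $ 3"] exhaust_3[of i]
      by (elim disjE) (simp_all add: axis_def DERIV_hyperbolic)
    have 2: "((\<lambda>s. ?Psi (p + s *\<^sub>R axis i 1) $ 2) has_real_derivative ?T i p $ 2) (at 0)"
      using DERIV_product_shift[of cosh "sinh (p$1)" "p$1" sin "cos (p$2)" "p$2" sin "cos (p$3)" "p$3" d "axis i 1 $ 1" "axis i 1 $ 2" "axis i 1 $ 3"] exhaust_3[of i]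
      by (elim disjE) (simp_all add: axis_def DERIV_hyperbolic)
    have 3: "((\<lambda>s. ?Psi (p + s *\<^sub>R axis i 1) $ 3) has_real_derivative ?T i p $ 3) (at 0)"
      using DERIV_product_shift[of sinh "cosh (p$1)" "p$1" cos "- sin (p$2)" "p$2" "\<lambda>_. 1" "0" "p$3" d "axis i 1 $ 1" "axis i 1 $ 2" "axis i 1 $ 3"] exhaust_3[of i]
      by (elim disjE) (simp_all add: axis_def DERIV_hyperbolic)
    show ?thesis using exhaust_3[of k] 1 2 3 by blast
  qed
  fix b :: "3 \<times> bool \<Rightarrow> pt" and d' N E v G
  assume sp: "separated_potential b d' N ?Psi v G ?T" and dom: "v ` N \<subseteq> ?Om"
  interpret separated_potential b d' N E ?Psi v G ?T by (rule sp)
  have Om: "p \<in> ?Om" if "p \<in> Om" for p using that dom by (auto simp: Om_def)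
  have o3: "?T 1 p \<bullet> ?T 2 p = 0" "?T 1 p \<bullet> ?T 3 p = 0" "?T 2 p \<bullet> ?T 3 p = 0" for p
    by (simp_all only: frame_simps inner_meridian) (simp_all add: algebra_simps)
  have orth: "?T i p \<bullet> ?T j p = 0" if "i \<noteq> j" for i j p
    by (rule orth_3[where T="\<lambda>i. ?T i p", OF o3 that])
  have n1: "?T 1 p \<bullet> ?T 1 p = d\<^sup>2 * ((cosh (p$1))\<^sup>2 - (sin (p$2))\<^sup>2)" for p
    using sin_cos_squared_add[of "p$2"] cosh_square_eq[of "p$1"] by (simp only: frame_simps inner_meridian) algebra
  have n2: "?T 2 p \<bullet> ?T 2 p = d\<^sup>2 * ((cosh (p$1))\<^sup>2 - (sin (p$2))\<^sup>2)" for p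
    using sin_cos_squared_add[of "p$2"] cosh_square_eq[of "p$1"] by (simp only: frame_simps inner_meridian) algebra
  have n3: "?T 3 p \<bullet> ?T 3 p = d\<^sup>2 * ((cosh (p$1))\<^sup>2 * (sin (p$2))\<^sup>2)" for p
    by (simp only: frame_simps inner_meridian) (simp only: power_mult_distrib mult.assoc)
  have cr: "\<not> (complete_form \<or> partial_form 3)"
  proof
    assume form: "complete_form \<or> partial_form 3"
    show False
    proof (rule rotational_class[OF orth _ _ form])
      show "?T 3 = (\<lambda>p. rot (?Psi p))" by (rule ext, simp add: rot_def vec_eq_iff forall_3)
      show "depends_only (- {3}) (\<lambda>p. ?T j p \<bullet> ?T j p)" for j
        using exhaust_3[of j] by (elim disjE) (rule depends_only_not_3, simp only: n1 n2 n3)+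
    qed
  qed
  have p1: "\<not> partial_form 1"
  proof (rule not_partial_form[OF orth, of 2 1 3])
    fix p e assume p: "p \<in> Om" and e: "e > 0" and near: "\<And>s. \<bar>s\<bar> < e \<Longrightarrow> p + s *\<^sub>R axis 1 1 \<in> Om"
      and r: "\<And>s. \<bar>s\<bar> < e \<Longrightarrow> (?T 2 p \<bullet> ?T 2 p) * (?T 3 (p + s *\<^sub>R axis 1 1) \<bullet> ?T 3 (p + s *\<^sub>R axis 1 1))
        = (?T 3 p \<bullet> ?T 3 p) * (?T 2 (p + s *\<^sub>R axis 1 1) \<bullet> ?T 2 (p + s *\<^sub>R axis 1 1))"
    have "d\<^sup>2 * d\<^sup>2 * ((cosh (p$1 + s))\<^sup>2 - (cosh (p$1))\<^sup>2) * ((sin (p$2))\<^sup>2 * (sin (p$2))\<^sup>2) = 0" if "\<bar>s\<bar> < e" for s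
      using r[OF that] unfolding n2 n3 by (auto simp: axis_def algebra_simps)
    moreover have "sin (p$2) \<noteq> 0" using Om[OF p] sin_gt_zero by force
    ultimately show False
      by (intro cosh_sq_shift[OF e, of "p$1"]) (use Om[OF p] d in simp_all)
  qed simp_all
  have p2: "\<not> partial_form 2"
  proof (rule not_partial_form[OF orth, of 1 2 3])
    fix p e assume p: "p \<in> Om" and e: "e > 0" and near: "\<And>s. \<bar>s\<bar> < e \<Longrightarrow> p + s *\<^sub>R axis 2 1 \<in> Om"
      and r: "\<And>s. \<bar>s\<bar> < e \<Longrightarrow> (?T 1 p \<bullet> ?T 1 p) * (?T 3 (p + s *\<^sub>R axis 2 1) \<bullet> ?T 3 (p + s *\<^sub>R axis 2 1))
        = (?T 3 p \<bullet> ?T 3 p) * (?T 1 (p + s *\<^sub>R axis 2 1) \<bullet> ?T 1 (p + s *\<^sub>R axis 2 1))"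
    have "d\<^sup>2 * d\<^sup>2 * ((sin (p$2 + s))\<^sup>2 - (sin (p$2))\<^sup>2) * ((cosh (p$1))\<^sup>2 * (cosh (p$1))\<^sup>2) = 0" if "\<bar>s\<bar> < e" for s
      using r[OF that] unfolding n1 n3 by (simp add: axis_def algebra_simps)
    moreover have "sinh (p$1) \<noteq> 0" "cosh (p$1) \<noteq> 0" using Om[OF p] by simp_all
    ultimately show False
      by (intro sin_sq_not_const[OF e, of "p$2"]) (use d in simp)
  qed simp_all
  show "\<not> complete_form \<and> (\<forall>i. \<not> partial_form i)"
    using cr p1 p2 by (simp add: forall_3)
qed

text \<open>\<open>conf e C\<close> is a Cartesian coordinate in confocal coordinates, up to a factor.\<close>

definition conf :: "real \<Rightarrow> real \<Rightarrow> pt \<Rightarrow> real" where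
  "conf e C p = sqrt ((p$1 - e) * (p$2 - e) * (p$3 - e) / C)"

section \<open>Identities for conical and confocal coordinates\<close>

lemma prod_distinct_3:
  assumes "i \<noteq> j" "i \<noteq> k" "j \<noteq> (k :: 3)"
  shows "(p$1 - e) * (p$2 - e) * (p$3 - e) = (p$i - e) * (p$j - e) * (p$k - (e::real))"
proof -
  have "\<forall>i j k :: 3. i \<noteq> j \<longrightarrow> i \<noteq> k \<longrightarrow> j \<noteq> k \<longrightarrow>
     (p$1 - e) * (p$2 - e) * (p$3 - e) = (p$i - e) * (p$j - e) * (p$k - e)"
    by (simp add: forall_3)
  then show ?thesis using assms by blast
qed

lemma DERIV_sqrt_log:
  assumes "(g has_real_derivative g 0 / c) (at 0)" "g 0 > 0"
  shows "((\<lambda>s. sqrt (g s)) has_real_derivative sqrt (g 0) / (2 * c)) (at 0)"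
proof -
  have "((\<lambda>s. sqrt (g s)) has_real_derivative (inverse (sqrt (g 0)) / 2) * (g 0 / c)) (at 0)"
    using assms by (intro DERIV_chain2[OF DERIV_real_sqrt])
  moreover have "inverse (sqrt (g 0)) * g 0 = sqrt (g 0)"
    using assms(2) real_div_sqrt[of "g 0"] by (simp add: divide_inverse mult.commute)
  then have "(inverse (sqrt (g 0)) / 2) * (g 0 / c) = sqrt (g 0) / (2 * c)"
    by simp
  ultimately show ?thesis by (simp only:)
qed

lemma DERIV_conf:
  assumes pos: "(p$1 - e) * (p$2 - e) * (p$3 - e) / C > 0"
  shows "((\<lambda>s. conf e C (p + s *\<^sub>R axis i 1)) has_real_derivative conf e C p / (2 * (p$i - e))) (at 0)"
proof -
  define g where "g s = ((p + s *\<^sub>R axis i 1)$1 - e) * ((p + s *\<^sub>R axis i 1)$2 - e) * ((p + s *\<^sub>R axis i 1)$3 - e) / C" for s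
  have nz: "p$1 \<noteq> e" "p$2 \<noteq> e" "p$3 \<noteq> e" "C \<noteq> 0" using pos by auto
  have g0: "g 0 = (p$1 - e) * (p$2 - e) * (p$3 - e) / C" by (simp add: g_def)
  have "\<forall>i. ((\<lambda>s. ((p + s *\<^sub>R axis i 1)$1 - e) * ((p + s *\<^sub>R axis i 1)$2 - e) * ((p + s *\<^sub>R axis i 1)$3 - e) / C)
      has_real_derivative ((p$1 - e) * (p$2 - e) * (p$3 - e) / C) / (p$i - e)) (at 0)"
    unfolding forall_3 using nz by (auto simp: axis_def field_simps intro!: derivative_eq_intros)
  then have "(g has_real_derivative ((p$1 - e) * (p$2 - e) * (p$3 - e) / C) / (p$i - e)) (at 0)"
    unfolding g_def[abs_def] by blast
  then have "(g has_real_derivative g 0 / (p$i - e)) (at 0)" by (simp only: g0)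
  from DERIV_sqrt_log[OF this] pos g0 show ?thesis by (simp add: conf_def g_def)
qed

lemma conf_sq: "(p$1 - e) * (p$2 - e) * (p$3 - e) / C > 0 \<Longrightarrow> (conf e C p)\<^sup>2 = (p$1 - e) * (p$2 - e) * (p$3 - e) / C"
  by (simp add: conf_def)

text \<open>The second divided difference at \<open>a\<close>, \<open>b\<close>, \<open>c\<close> of
  the monic quadratic \<open>(t - x) (t - y)\<close>.\<close>

lemma lagrange_one:
  fixes a b c x y :: real
  assumes "a \<noteq> b" "a \<noteq> c" "b \<noteq> c"
  shows "(x - a) * (y - a) / ((b - a) * (c - a)) + (x - b) * (y - b) / ((a - b) * (c - b))
    + (x - c) * (y - c) / ((a - c) * (b - c)) = 1"
proof -
  have nz: "b - a \<noteq> 0" "c - a \<noteq> 0" "c - b \<noteq> 0" using assms by auto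
  have e: "(a - b) * (c - b) = - ((b - a) * (c - b))" "(a - c) * (b - c) = (c - a) * (c - b)"
    by (simp_all add: algebra_simps)
  have "(x - a) * (y - a) / ((b - a) * (c - a)) - (x - b) * (y - b) / ((b - a) * (c - b))
    + (x - c) * (y - c) / ((c - a) * (c - b))
    = ((x - a) * (y - a) * (c - b) - (x - b) * (y - b) * (c - a) + (x - c) * (y - c) * (b - a))
      / ((b - a) * (c - a) * (c - b))"
    using nz by (simp add: diff_divide_distrib add_divide_distrib)
  also have "(x - a) * (y - a) * (c - b) - (x - b) * (y - b) * (c - a) + (x - c) * (y - c) * (b - a)
     = (b - a) * (c - a) * (c - b)" by algebra
  finally show ?thesis unfolding e using nz by simp
qed

text \<open>Partial fractions of the right side as a function of \<open>x\<close>; the coefficients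
  are its residues at \<open>a\<close>, \<open>b\<close>, \<open>c\<close>.\<close>

lemma partial_fractions:
  fixes a b c x y z :: real
  assumes "a \<noteq> b" "a \<noteq> c" "b \<noteq> c" "x \<noteq> a" "x \<noteq> b" "x \<noteq> c"
  shows "(y - a) * (z - a) / ((x - a) * ((b - a) * (c - a))) + (y - b) * (z - b) / ((x - b) * ((a - b) * (c - b)))
    + (y - c) * (z - c) / ((x - c) * ((a - c) * (b - c))) = (x - y) * (x - z) / ((x - a) * (x - b) * (x - c))"
proof -
  have nz: "b - a \<noteq> 0" "c - a \<noteq> 0" "c - b \<noteq> 0" "x - a \<noteq> 0" "x - b \<noteq> 0" "x - c \<noteq> 0" using assms by auto
  have e: "(a - b) * (c - b) = - ((b - a) * (c - b))" "(a - c) * (b - c) = (c - a) * (c - b)"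
    by (simp_all add: algebra_simps)
  have "(y - a) * (z - a) / ((x - a) * ((b - a) * (c - a))) - (y - b) * (z - b) / ((x - b) * ((b - a) * (c - b)))
    + (y - c) * (z - c) / ((x - c) * ((c - a) * (c - b)))
    = ((y - a) * (z - a) * (c - b) * (x - b) * (x - c) - (y - b) * (z - b) * (c - a) * (x - a) * (x - c)
       + (y - c) * (z - c) * (b - a) * (x - a) * (x - b))
      / ((b - a) * (c - a) * (c - b) * ((x - a) * (x - b) * (x - c)))"
    using nz by (simp add: diff_divide_distrib add_divide_distrib ac_simps)
  also have "(y - a) * (z - a) * (c - b) * (x - b) * (x - c) - (y - b) * (z - b) * (c - a) * (x - a) * (x - c)
       + (y - c) * (z - c) * (b - a) * (x - a) * (x - b)
     = (b - a) * (c - a) * (c - b) * ((x - y) * (x - z))" by algebra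
  finally show ?thesis unfolding e using nz by simp
qed

text \<open>Numerator and denominator have equal degree in \<open>x\<close>, whence the additional
  \<open>1\<close>.\<close>

lemma partial_fractions_two:
  fixes a b x y z :: real
  assumes "a \<noteq> b" "x \<noteq> a" "x \<noteq> b"
  shows "(y - b) * (z - b) / ((x - b) * (b - a)) + (y - a) * (z - a) / ((x - a) * (a - b)) + 1
    = (x - y) * (x - z) / ((x - a) * (x - b))"
proof -
  have nz: "b - a \<noteq> 0" "x - a \<noteq> 0" "x - b \<noteq> 0" using assms by auto
  have e: "(x - a) * (a - b) = - ((x - a) * (b - a))" by (simp add: algebra_simps)
  have "(y - b) * (z - b) / ((x - b) * (b - a)) - (y - a) * (z - a) / ((x - a) * (b - a)) + 1
     = ((y - b) * (z - b) * (x - a) - (y - a) * (z - a) * (x - b) + (x - a) * (x - b) * (b - a))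
       / ((b - a) * ((x - a) * (x - b)))"
    using nz by (simp add: diff_divide_distrib add_divide_distrib ac_simps)
  also have "(y - b) * (z - b) * (x - a) - (y - a) * (z - a) * (x - b) + (x - a) * (x - b) * (b - a)
     = (b - a) * ((x - y) * (x - z))" by algebra
  finally show ?thesis unfolding e using nz by simp
qed

lemma divide_diff_flip: "x / (a - b) = - (x / (b - a))" for x a b :: real
  by (metis divide_minus_right minus_diff_eq)

lemma half_quotient_products:
  fixes x y :: real
  shows "x * (x / (2 * y)) = x\<^sup>2 / y / 2" "x / (2 * y) * (x / (2 * y)) = x\<^sup>2 / (4 * y\<^sup>2)"
  by (simp_all add: power2_eq_square)

text \<open>One component of the Euler-Poisson-Darboux relation between the frame vectors of two
  confocal coordinates.\<close>

lemma confocal_difference: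
  fixes x y z e :: real
  assumes "x \<noteq> 0" "z \<noteq> e" "y \<noteq> e"
  shows "x / (2 * (y - e)) - x / (2 * (z - e))
    = 2 * (z - y) * (1 / x * (x / (2 * (z - e))) * (x / (2 * (y - e))))"
  using assms by (simp add: field_simps)

text \<open>Second divided differences of polynomials of degree below two, obtained by differencing
  \<open>lagrange_one\<close>.\<close>

lemma lagrange_zero:
  fixes a b c x :: real
  assumes "a \<noteq> b" "a \<noteq> c" "b \<noteq> c"
  shows "(x - a) / ((b - a) * (c - a)) + (x - b) / ((a - b) * (c - b)) + (x - c) / ((a - c) * (b - c)) = 0"
    "1 / ((b - a) * (c - a)) + 1 / ((a - b) * (c - b)) + 1 / ((a - c) * (b - c)) = 0"
proof -
  define A B D where "A = 1 / ((b - a) * (c - a))" "B = 1 / ((a - b) * (c - b))" "D = 1 / ((a - c) * (b - c))"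
  have *: "(y - a) * (z - a) * A + (y - b) * (z - b) * B + (y - c) * (z - c) * D = 1" for y z
    using lagrange_one[OF assms, of y z] by (simp add: A_B_D_def)
  have 1: "(y - a) * A + (y - b) * B + (y - c) * D = 0" for y
    using *[of y 1] *[of y 0] by algebra
  show "1 / ((b - a) * (c - a)) + 1 / ((a - b) * (c - b)) + 1 / ((a - c) * (b - c)) = 0"
    using 1[of 1] 1[of 0] unfolding A_B_D_def[symmetric] by algebra
  show "(x - a) / ((b - a) * (c - a)) + (x - b) / ((a - b) * (c - b)) + (x - c) / ((a - c) * (b - c)) = 0"
    using 1[of x] by (simp add: A_B_D_def)
qed

lemma partial_fractions_linear:
  fixes a b c x y :: real
  assumes "a \<noteq> b" "a \<noteq> c" "b \<noteq> c" "x \<noteq> a" "x \<noteq> b" "x \<noteq> c"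
  shows "(y - a) / ((x - a) * ((b - a) * (c - a))) + (y - b) / ((x - b) * ((a - b) * (c - b)))
    + (y - c) / ((x - c) * ((a - c) * (b - c))) = (y - x) / ((x - a) * (x - b) * (x - c))"
proof -
  define A B D P where "A = (y - a) / ((x - a) * ((b - a) * (c - a)))" "B = (y - b) / ((x - b) * ((a - b) * (c - b)))"
    "D = (y - c) / ((x - c) * ((a - c) * (b - c)))" "P = 1 / ((x - a) * (x - b) * (x - c))"
  have *: "A * (z - a) + B * (z - b) + D * (z - c) = (x - y) * (x - z) * P" for z
    using partial_fractions[OF assms, of y z] by (simp add: A_B_D_P_def)
  have "A + B + D = (y - x) * P" using *[of 1] *[of 0] by algebra
  then show ?thesis by (simp add: A_B_D_P_def)
qed

text \<open>The divided difference identities give the unit length of the radial vector and the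
  orthogonality of the frame, and \<open>radial_class\<close> applies. Splitting off variable 2 or 3
  fails because the scale factor of the other one depends on it while the radial one is
  constant.\<close>

lemma conical_obstructed:
  assumes ab: "a < b" and bc: "b < c"
  shows "obstructed {u. u$1 > 0 \<and> a < u$2 \<and> u$2 < b \<and> b < u$3 \<and> u$3 < c}
    (\<lambda>u. vector [u$1 * sqrt ((u$2 - a) * (u$3 - a) / ((b - a) * (c - a))),
                 u$1 * sqrt ((u$2 - b) * (u$3 - b) / ((a - b) * (c - b))),
                 u$1 * sqrt ((u$2 - c) * (u$3 - c) / ((a - c) * (b - c)))])"
proof -
  define \<Omega> :: "pt set" where "\<Omega> = {u. u$1 > 0 \<and> a < u$2 \<and> u$2 < b \<and> b < u$3 \<and> u$3 < c}"
  define ev :: "3 \<Rightarrow> real" where "ev k = (if k = 1 then a else if k = 2 then b else c)" for k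
  define C :: "3 \<Rightarrow> real" where "C k = (if k = 1 then (b - a) * (c - a) else if k = 2 then (a - b) * (c - b) else (a - c) * (b - c))" for k
  define r where "r k p = sqrt ((p$2 - ev k) * (p$3 - ev k) / C k)" for k and p :: pt
  define Psi :: "pt \<Rightarrow> pt" where "Psi p = (\<chi> k. p$1 * r k p)" for p
  define T :: "3 \<Rightarrow> pt \<Rightarrow> pt" where "T i p = (if i = 1 then (1 / p$1) *\<^sub>R Psi p
      else (\<chi> k. Psi p $ k / (2 * (p$i - ev k))))" for i p
  have ev: "ev 1 = a" "ev 2 = b" "ev 3 = c" by (simp_all add: ev_def)
  have C: "C 1 = (b - a) * (c - a)" "C 2 = (a - b) * (c - b)" "C 3 = (a - c) * (b - c)" by (simp_all add: C_def)
  have pos: "(p$2 - ev k) * (p$3 - ev k) / C k > 0" if "p \<in> \<Omega>" for p k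
    using that ab bc exhaust_3[of k]
    by (auto simp: \<Omega>_def ev C zero_less_divide_iff zero_less_mult_iff mult_less_0_iff)
  have sep: "p$2 \<noteq> ev k" "p$3 \<noteq> ev k" if "p \<in> \<Omega>" for p k
    using exhaust_3[of k] that by (auto simp: \<Omega>_def ev)
  have ne: "a \<noteq> b" "a \<noteq> c" "b \<noteq> c" using ab bc by auto
  have sq: "(r k p)\<^sup>2 = (p$2 - ev k) * (p$3 - ev k) / C k" if "p \<in> \<Omega>" for p k
    using pos[OF that, of k] by (simp add: r_def)
  have dr: "((\<lambda>s. r k (p + s *\<^sub>R axis i 1)) has_real_derivative (if i = 1 then 0 else r k p / (2 * (p$i - ev k)))) (at 0)"
    if p: "p \<in> \<Omega>" for p i k
  proof (cases "i = 1")
    case True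
    then show ?thesis by (simp add: r_def axis_def)
  next
    case False
    define g where "g s = ((p + s *\<^sub>R axis i 1)$2 - ev k) * ((p + s *\<^sub>R axis i 1)$3 - ev k) / C k" for s
    have nz: "p$2 - ev k \<noteq> 0" "p$3 - ev k \<noteq> 0" "C k \<noteq> 0" using sep[OF p] pos[OF p, of k] by auto
    have i: "i = 2 \<or> i = 3" using False exhaust_3[of i] by blast
    have g0: "g 0 = (p$2 - ev k) * (p$3 - ev k) / C k" by (simp add: g_def)
    have "(g has_real_derivative g 0 / (p$i - ev k)) (at 0)"
      using i nz unfolding g0 g_def[abs_def]
      by (elim disjE) (auto simp: axis_def intro!: derivative_eq_intros)
    from DERIV_sqrt_log[OF this] pos[OF p, of k] g0 False show ?thesis by (simp add: r_def g_def)
  qed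
  have deriv: "((\<lambda>s. Psi (p + s *\<^sub>R axis i 1) $ k) has_real_derivative T i p $ k) (at 0)" if p: "p \<in> \<Omega>" for p i k
  proof -
    have p1: "p$1 \<noteq> 0" using p by (simp add: \<Omega>_def)
    have p0: "p + 0 *\<^sub>R axis i 1 = p" by simp
    have x: "((\<lambda>s. (p + s *\<^sub>R axis i 1) $ 1) has_real_derivative axis i 1 $ 1) (at 0)"
      by (auto intro!: derivative_eq_intros)
    have "((\<lambda>s. (p + s *\<^sub>R axis i 1) $ 1 * r k (p + s *\<^sub>R axis i 1)) has_real_derivative
        axis i 1 $ 1 * r k p + (if i = 1 then 0 else r k p / (2 * (p$i - ev k))) * p$1) (at 0)"
      using DERIV_mult[OF x dr[OF p, of k i]] unfolding p0 .
    moreover have "axis i 1 $ 1 * r k p + (if i = 1 then 0 else r k p / (2 * (p$i - ev k))) * p$1 = T i p $ k"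
      using p1 by (cases "i = 1") (simp_all add: T_def Psi_def axis_def)
    ultimately show ?thesis by (simp add: Psi_def)
  qed
  have one: "(r 1 p)\<^sup>2 + (r 2 p)\<^sup>2 + (r 3 p)\<^sup>2 = 1" if "p \<in> \<Omega>" for p
    unfolding sq[OF that] ev C by (rule lagrange_one[OF ne])
  have n1: "T 1 p \<bullet> T 1 p = 1" if "p \<in> \<Omega>" for p
    using one[OF that] that by (simp add: T_def Psi_def inner_vec_def sum_3 power2_eq_square \<Omega>_def)
  have w: "(r k p)\<^sup>2 / (p$2 - ev k) = (p$3 - ev k) / C k" "(r k p)\<^sup>2 / (p$3 - ev k) = (p$2 - ev k) / C k"
    if p: "p \<in> \<Omega>" for p k
    using sep[OF p, of k] unfolding sq[OF p] by simp_all
  have T23: "T i p $ k = p$1 / 2 * (r k p / (p$i - ev k))" if "i \<noteq> 1" for i k p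
    by (simp only: T_def Psi_def vec_lambda_beta that if_False times_divide_times_eq)
  have T2: "T 2 p $ k = p$1 / 2 * (r k p / (p$2 - ev k))"
    and T3: "T 3 p $ k = p$1 / 2 * (r k p / (p$3 - ev k))" for k p by (rule T23; simp)+
  have sq1: "x * (y * (x / z)) = y * (x\<^sup>2 / z)" for x y z :: real by (simp add: power2_eq_square)
  have sq2: "y * (x / z) * (y * (x / t)) = y\<^sup>2 * (x\<^sup>2 / z / t)" for x y z t :: real
    by (simp add: power2_eq_square ac_simps)
  have T1: "T 1 p $ k = r k p" if "p \<in> \<Omega>" for k p
    using that by (simp add: T_def Psi_def \<Omega>_def)
  have o12: "T 1 p \<bullet> T 2 p = 0" if p: "p \<in> \<Omega>" for p
  proof -
    have "T 1 p \<bullet> T 2 p = p$1 / 2 * ((r 1 p)\<^sup>2 / (p$2 - ev 1) + (r 2 p)\<^sup>2 / (p$2 - ev 2) + (r 3 p)\<^sup>2 / (p$2 - ev 3))"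
      by (simp only: inner_vec_def sum_3 inner_real_def T1[OF p] T2 T3 sq1 distrib_left)
    then show ?thesis unfolding w[OF p] unfolding ev C using lagrange_zero(1)[OF ne, of "p$3"] by simp
  qed
  have o13: "T 1 p \<bullet> T 3 p = 0" if p: "p \<in> \<Omega>" for p
  proof -
    have "T 1 p \<bullet> T 3 p = p$1 / 2 * ((r 1 p)\<^sup>2 / (p$3 - ev 1) + (r 2 p)\<^sup>2 / (p$3 - ev 2) + (r 3 p)\<^sup>2 / (p$3 - ev 3))"
      by (simp only: inner_vec_def sum_3 inner_real_def T1[OF p] T2 T3 sq1 distrib_left)
    then show ?thesis unfolding w[OF p] unfolding ev C using lagrange_zero(1)[OF ne, of "p$2"] by simp
  qed
  have o23: "T 2 p \<bullet> T 3 p = 0" if p: "p \<in> \<Omega>" for p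
  proof -
    have "(r k p)\<^sup>2 / (p$2 - ev k) / (p$3 - ev k) = 1 / C k" for k
      unfolding w[OF p] using sep[OF p, of k] by simp
    note * = this[of 1] this[of 2] this[of 3]
    have "T 2 p \<bullet> T 3 p = (p$1 / 2)\<^sup>2 * ((r 1 p)\<^sup>2 / (p$2 - ev 1) / (p$3 - ev 1)
        + (r 2 p)\<^sup>2 / (p$2 - ev 2) / (p$3 - ev 2) + (r 3 p)\<^sup>2 / (p$2 - ev 3) / (p$3 - ev 3))"
      by (simp only: inner_vec_def sum_3 inner_real_def T2 T3 sq2 distrib_left)
    then show ?thesis unfolding * C using lagrange_zero(2)[OF ne] by simp
  qed
  have n2: "T 2 p \<bullet> T 2 p = (p$1)\<^sup>2 * ((p$3 - p$2) / (4 * ((p$2 - a) * (p$2 - b) * (p$2 - c))))"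
    if p: "p \<in> \<Omega>" for p
  proof -
    have nz: "p$2 \<noteq> a" "p$2 \<noteq> b" "p$2 \<noteq> c" using sep(1)[OF p, of 1] sep(1)[OF p, of 2] sep(1)[OF p, of 3] by (simp_all add: ev)
    have "(r k p)\<^sup>2 / (p$2 - ev k) / (p$2 - ev k) = (p$3 - ev k) / ((p$2 - ev k) * C k)" for k
      unfolding w[OF p] by (simp add: mult.commute)
    note * = this[of 1] this[of 2] this[of 3]
    have "T 2 p \<bullet> T 2 p = (p$1 / 2)\<^sup>2 * ((r 1 p)\<^sup>2 / (p$2 - ev 1) / (p$2 - ev 1)
        + (r 2 p)\<^sup>2 / (p$2 - ev 2) / (p$2 - ev 2) + (r 3 p)\<^sup>2 / (p$2 - ev 3) / (p$2 - ev 3))"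
      by (simp only: inner_vec_def sum_3 inner_real_def T2 T3 sq2 distrib_left)
    then show ?thesis unfolding * unfolding C ev partial_fractions_linear[OF ne nz] by (simp add: power_divide)
  qed
  have n3: "T 3 p \<bullet> T 3 p = (p$1)\<^sup>2 * ((p$2 - p$3) / (4 * ((p$3 - a) * (p$3 - b) * (p$3 - c))))"
    if p: "p \<in> \<Omega>" for p
  proof -
    have nz: "p$3 \<noteq> a" "p$3 \<noteq> b" "p$3 \<noteq> c" using sep(2)[OF p, of 1] sep(2)[OF p, of 2] sep(2)[OF p, of 3] by (simp_all add: ev)
    have "(r k p)\<^sup>2 / (p$3 - ev k) / (p$3 - ev k) = (p$2 - ev k) / ((p$3 - ev k) * C k)" for k
      unfolding w[OF p] by (simp add: mult.commute)
    note * = this[of 1] this[of 2] this[of 3]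
    have "T 3 p \<bullet> T 3 p = (p$1 / 2)\<^sup>2 * ((r 1 p)\<^sup>2 / (p$3 - ev 1) / (p$3 - ev 1)
        + (r 2 p)\<^sup>2 / (p$3 - ev 2) / (p$3 - ev 2) + (r 3 p)\<^sup>2 / (p$3 - ev 3) / (p$3 - ev 3))"
      by (simp only: inner_vec_def sum_3 inner_real_def T2 T3 sq2 distrib_left)
    then show ?thesis unfolding * unfolding C ev partial_fractions_linear[OF ne nz] by (simp add: power_divide)
  qed
  have "obstructed \<Omega> Psi"
  proof (rule obstructedI[where T=T])
    fix p i k assume "p \<in> \<Omega>"
    then show "((\<lambda>s. Psi (p + s *\<^sub>R axis i 1) $ k) has_real_derivative T i p $ k) (at 0)" by (rule deriv)
  next
    fix b' :: "3 \<times> bool \<Rightarrow> pt" and d N E v G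
    assume sp: "separated_potential b' d N Psi v G T" and dom: "v ` N \<subseteq> \<Omega>"
    interpret separated_potential b' d N E Psi v G T by (rule sp)
    have Om: "p \<in> \<Omega>" if "p \<in> Om" for p using that dom by (auto simp: Om_def)
    have orth: "T i p \<bullet> T j p = 0" if "p \<in> Om" "i \<noteq> j" for p i j
      by (rule orth_3[where T="\<lambda>i. T i p", OF o12 o13 o23 that(2)]) (rule Om[OF that(1)])+
    have p1: "p$1 > 0" if "p \<in> Om" for p using Om[OF that] by (simp add: \<Omega>_def)
    have 1: "\<not> (complete_form \<or> partial_form 1)"
    proof
      assume form: "complete_form \<or> partial_form 1"
      show False
      proof (rule radial_class[OF orth _ p1 n1[OF Om] _ _ n2[OF Om] n3[OF Om] form])
        show "T 1 = (\<lambda>p. (1 / p$1) *\<^sub>R Psi p)" by (simp add: T_def fun_eq_iff)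
      qed (auto simp: depends_only_def)
    qed
    have 2: "\<not> partial_form 2"
    proof (rule not_partial_form[OF orth, of 1 2 3])
      fix p e assume p: "p \<in> Om" and e: "e > 0" and near: "\<And>s. \<bar>s\<bar> < e \<Longrightarrow> p + s *\<^sub>R axis 2 1 \<in> Om"
        and q: "\<And>s. \<bar>s\<bar> < e \<Longrightarrow> (T 1 p \<bullet> T 1 p) * (T 3 (p + s *\<^sub>R axis 2 1) \<bullet> T 3 (p + s *\<^sub>R axis 2 1))
          = (T 3 p \<bullet> T 3 p) * (T 1 (p + s *\<^sub>R axis 2 1) \<bullet> T 1 (p + s *\<^sub>R axis 2 1))"
      have s: "\<bar>e / 2\<bar> < e" using e by simp
      show False
        using q[OF s] p1[OF p] e sep(2)[OF Om[OF p], of 1] sep(2)[OF Om[OF p], of 2] sep(2)[OF Om[OF p], of 3]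
        unfolding n1[OF Om[OF p]] n1[OF Om[OF near[OF s]]] n3[OF Om[OF p]] n3[OF Om[OF near[OF s]]]
        by (simp add: axis_def ev)
    qed simp_all
    have 3: "\<not> partial_form 3"
    proof (rule not_partial_form[OF orth, of 1 3 2])
      fix p e assume p: "p \<in> Om" and e: "e > 0" and near: "\<And>s. \<bar>s\<bar> < e \<Longrightarrow> p + s *\<^sub>R axis 3 1 \<in> Om"
        and q: "\<And>s. \<bar>s\<bar> < e \<Longrightarrow> (T 1 p \<bullet> T 1 p) * (T 2 (p + s *\<^sub>R axis 3 1) \<bullet> T 2 (p + s *\<^sub>R axis 3 1))
          = (T 2 p \<bullet> T 2 p) * (T 1 (p + s *\<^sub>R axis 3 1) \<bullet> T 1 (p + s *\<^sub>R axis 3 1))"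
      have s: "\<bar>e / 2\<bar> < e" using e by simp
      show False
        using q[OF s] p1[OF p] e sep(1)[OF Om[OF p], of 1] sep(1)[OF Om[OF p], of 2] sep(1)[OF Om[OF p], of 3]
        unfolding n1[OF Om[OF p]] n1[OF Om[OF near[OF s]]] n2[OF Om[OF p]] n2[OF Om[OF near[OF s]]]
        by (simp add: axis_def ev)
    qed simp_all
    show "\<not> complete_form \<and> (\<forall>i. \<not> partial_form i)"
      using 1 2 3 by (simp add: forall_3)
  qed
  moreover have "Psi = (\<lambda>u. vector [u$1 * sqrt ((u$2 - a) * (u$3 - a) / ((b - a) * (c - a))),
                 u$1 * sqrt ((u$2 - b) * (u$3 - b) / ((a - b) * (c - b))),
                 u$1 * sqrt ((u$2 - c) * (u$3 - c) / ((a - c) * (b - c)))])"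
    by (simp add: fun_eq_iff vec_eq_iff forall_3 Psi_def r_def ev C)
  ultimately show ?thesis by (simp only: \<Omega>_def)
qed

text \<open>The matrix \<open>diag(a, b, c) + q q^T\<close> has the ellipsoidal coordinates as
  eigenvalues and the frame vectors as eigenvectors, since \<open>q . T_i = 1 / 2\<close>.\<close>

lemma ellipsoidal_obstructed:
  assumes ab: "a < b" and bc: "b < c"
  shows "obstructed {u. a < u$1 \<and> u$1 < b \<and> b < u$2 \<and> u$2 < c \<and> c < u$3}
    (\<lambda>u. vector [conf a ((b - a) * (c - a)) u, conf b ((a - b) * (c - b)) u, conf c ((a - c) * (b - c)) u])"
proof -
  define Psi :: "pt \<Rightarrow> pt" where "Psi u = vector [conf a ((b - a) * (c - a)) u, conf b ((a - b) * (c - b)) u,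
    conf c ((a - c) * (b - c)) u]" for u
  define T :: "3 \<Rightarrow> pt \<Rightarrow> pt" where "T i p = vector [Psi p $ 1 / (2 * (p$i - a)), Psi p $ 2 / (2 * (p$i - b)),
    Psi p $ 3 / (2 * (p$i - c))]" for i p
  define \<Omega> :: "pt set" where "\<Omega> = {u. a < u$1 \<and> u$1 < b \<and> b < u$2 \<and> u$2 < c \<and> c < u$3}"
  define ev :: "3 \<Rightarrow> real" where "ev k = (if k = 1 then a else if k = 2 then b else c)" for k
  have ev: "ev 1 = a" "ev 2 = b" "ev 3 = c" by (simp_all add: ev_def)
  have T_ev: "T i p $ k = Psi p $ k / (2 * (p$i - ev k))" for i p k
    using exhaust_3[of k] by (auto simp: T_def ev)
  have pos: "(p$1 - a) * (p$2 - a) * (p$3 - a) / ((b - a) * (c - a)) > 0"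
    "(p$1 - b) * (p$2 - b) * (p$3 - b) / ((a - b) * (c - b)) > 0"
    "(p$1 - c) * (p$2 - c) * (p$3 - c) / ((a - c) * (b - c)) > 0" if "p \<in> \<Omega>" for p
    using that ab bc by (simp_all add: \<Omega>_def zero_less_divide_iff zero_less_mult_iff mult_less_0_iff)
  have Psi_pos: "Psi p $ k > 0" if "p \<in> \<Omega>" for p k
    using exhaust_3[of k] pos[OF that] by (auto simp: Psi_def conf_def)
  have sep: "p$i \<noteq> ev k" if "p \<in> \<Omega>" for p i k
    using exhaust_3[of i] exhaust_3[of k] that by (auto simp: \<Omega>_def ev)
  have dist: "p$i \<noteq> p$j" if "p \<in> \<Omega>" "i \<noteq> j" for p i j
    using exhaust_3[of i] exhaust_3[of j] that by (auto simp: \<Omega>_def)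
  have ne: "a \<noteq> b" "a \<noteq> c" "b \<noteq> c" using ab bc by auto
  have sq: "(Psi p $ 1)\<^sup>2 = (p$i - a) * (p$j - a) * (p$k - a) / ((b - a) * (c - a))"
    "(Psi p $ 2)\<^sup>2 = (p$i - b) * (p$j - b) * (p$k - b) / ((a - b) * (c - b))"
    "(Psi p $ 3)\<^sup>2 = (p$i - c) * (p$j - c) * (p$k - c) / ((a - c) * (b - c))"
    if "p \<in> \<Omega>" "i \<noteq> j" "i \<noteq> k" "j \<noteq> k" for p i j k
    unfolding prod_distinct_3[OF that(2-4), symmetric]
    by (simp_all add: Psi_def conf_sq[OF pos(1)[OF that(1)]] conf_sq[OF pos(2)[OF that(1)]] conf_sq[OF pos(3)[OF that(1)]])
  have others: "\<exists>j k. i \<noteq> j \<and> i \<noteq> k \<and> j \<noteq> k" for i :: 3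
    using third_index by metis
  have Psi_T: "Psi p \<bullet> T i p = 1 / 2" if p: "p \<in> \<Omega>" for p i
  proof -
    obtain j k where jk: "i \<noteq> j" "i \<noteq> k" "j \<noteq> k" using others by blast
    have "Psi p \<bullet> T i p = ((Psi p $ 1)\<^sup>2 / (p$i - a) + (Psi p $ 2)\<^sup>2 / (p$i - b) + (Psi p $ 3)\<^sup>2 / (p$i - c)) / 2"
      by (simp only: inner_vec_def sum_3 inner_real_def T_def vector_3 half_quotient_products add_divide_distrib)
    also have "\<dots> = 1 / 2"
      using lagrange_one[OF ne, of "p$j" "p$k"] sep[OF p, of i 1] sep[OF p, of i 2] sep[OF p, of i 3]
      unfolding sq[OF p jk] by (simp add: ev mult.assoc)
    finally show ?thesis .
  qed
  have norm: "T i p \<bullet> T i p = (p$i - p$j) * (p$i - p$k) / (4 * ((p$i - a) * (p$i - b) * (p$i - c)))"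
    if p: "p \<in> \<Omega>" and jk: "i \<noteq> j" "i \<noteq> k" "j \<noteq> k" for p i j k
  proof -
    have nz: "p$i \<noteq> a" "p$i \<noteq> b" "p$i \<noteq> c" using sep[OF p, of i 1] sep[OF p, of i 2] sep[OF p, of i 3] by (simp_all add: ev)
    have N: "T i p \<bullet> T i p = ((Psi p $ 1)\<^sup>2 / (4 * (p$i - a)\<^sup>2) + (Psi p $ 2)\<^sup>2 / (4 * (p$i - b)\<^sup>2)
        + (Psi p $ 3)\<^sup>2 / (4 * (p$i - c)\<^sup>2))"
      by (simp only: inner_vec_def sum_3 inner_real_def T_def vector_3 half_quotient_products)
    have E: "x / (4 * y) = x / y / 4" for x y :: real by simp
    have F: "(Psi p $ 1)\<^sup>2 / (p$i - a)\<^sup>2 = (p$j - a) * (p$k - a) / ((p$i - a) * ((b - a) * (c - a)))"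
      "(Psi p $ 2)\<^sup>2 / (p$i - b)\<^sup>2 = (p$j - b) * (p$k - b) / ((p$i - b) * ((a - b) * (c - b)))"
      "(Psi p $ 3)\<^sup>2 / (p$i - c)\<^sup>2 = (p$j - c) * (p$k - c) / ((p$i - c) * ((a - c) * (b - c)))"
      unfolding sq[OF p jk] using nz by (simp_all add: power2_eq_square)
    show ?thesis
      unfolding N E F add_divide_distrib[symmetric] partial_fractions[OF ne nz] ..
  qed
  define K where "K q = (\<chi> k l. (if k = l then ev k else 0) + q $ k * q $ l)" for q :: pt
  have K_mult: "(K q *v w) $ k = ev k * w $ k + q $ k * (q \<bullet> w)" for q w k
    by (simp add: K_def matrix_vector_mult_def distrib_right sum.distrib inner_vec_def sum_distrib_left
        mult.assoc if_distrib[of "\<lambda>x. x * _"] cong: if_cong)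
  have eig: "K (Psi p) *v T i p = p$i *\<^sub>R T i p" if p: "p \<in> \<Omega>" for p i
  proof -
    have "ev k * T i p $ k + Psi p $ k / 2 = p$i * T i p $ k" for k
      using sep[OF p, of i k] by (simp add: T_ev field_simps)
    then show ?thesis by (simp add: vec_eq_iff K_mult Psi_T[OF p])
  qed
  have K_sym: "transpose (K q) = K q" for q
    by (simp add: K_def transpose_def vec_eq_iff mult.commute)
  have deriv: "((\<lambda>s. Psi (p + s *\<^sub>R axis i 1) $ k) has_real_derivative T i p $ k) (at 0)" if p: "p \<in> \<Omega>" for p i k
    using exhaust_3[of k] DERIV_conf[OF pos(1)[OF p], of i] DERIV_conf[OF pos(2)[OF p], of i]
      DERIV_conf[OF pos(3)[OF p], of i]
    by (elim disjE) (simp_all add: Psi_def T_def)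
  have "obstructed \<Omega> Psi"
  proof (rule obstructedI[where T=T])
    fix p i k assume "p \<in> \<Omega>"
    then show "((\<lambda>s. Psi (p + s *\<^sub>R axis i 1) $ k) has_real_derivative T i p $ k) (at 0)" by (rule deriv)
  next
    fix b' :: "3 \<times> bool \<Rightarrow> pt" and d N E v G
    assume sp: "separated_potential b' d N Psi v G T" and dom: "v ` N \<subseteq> \<Omega>"
    interpret separated_potential b' d N E Psi v G T by (rule sp)
    have Om: "p \<in> \<Omega>" if "p \<in> Om" for p using that dom by (auto simp: Om_def)
    have orth: "T i p \<bullet> T j p = 0" if "p \<in> Om" "i \<noteq> j" for p i j
      by (rule eigenvectors_orthogonal[OF K_sym eig[OF Om] eig[OF Om] dist[OF Om]]) (rule that)+
    define P where "P i p = 4 * ((p$i - a) * (p$i - b) * (p$i - c))" for i and p :: pt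
    have P: "depends_only {i} (P i)" for i by (simp add: depends_only_def P_def)
    have norms: "P i p \<noteq> 0 \<and> T i p \<bullet> T i p = (p $ i - p $ j) * (p $ i - p $ k) / P i p"
      if "p \<in> Om" "i \<noteq> j" "i \<noteq> k" "j \<noteq> k" for p i j k
      using norm[OF Om[OF that(1)] that(2-4)] sep[OF Om[OF that(1)], of i 1] sep[OF Om[OF that(1)], of i 2]
        sep[OF Om[OF that(1)], of i 3] by (simp add: P_def ev)
    have dist': "p $ i \<noteq> p $ j" if "p \<in> Om" "i \<noteq> j" for p i j by (rule dist[OF Om]) (rule that)+
    note forms = confocal_forms[OF orth P dist' norms]
    have "\<not> complete_form"
    proof
      assume cf: complete_form
      show False
      proof (rule no_confocal_separation[where K=K and de="\<lambda>q k. 1 / q $ k"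
            and L="\<lambda>q k l. (3 * q $ l) *\<^sub>R axis k 1 - (3 * q $ k) *\<^sub>R axis l 1"])
        show "real_polynomial_function (\<lambda>q. K q $ k $ l)" for k l
          by (simp add: K_def) (intro conjI impI polynomial_intros)
        show "transpose (K q) = K q" for q by (rule K_sym)
        show "K (Psi p) *v T i p = p $ i *\<^sub>R T i p" if "p \<in> Om" for p i by (rule eig[OF Om[OF that]])
        show "p $ i \<noteq> p $ j" if "p \<in> Om" "i \<noteq> j" for p i j by (rule dist'[OF that])
        show "((\<lambda>t. T i (p + t *\<^sub>R axis j 1)) has_vector_derivative
            (\<chi> k. 1 / Psi p $ k * T i p $ k * T j p $ k)) (at 0)" if p: "p \<in> Om" and ij: "i \<noteq> j" for p i j
        proof (rule has_vector_derivative_component)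
          fix k
          have "(p + t *\<^sub>R axis j 1) $ i = p $ i" for t using ij by (simp add: axis_def)
          moreover have "((\<lambda>t. Psi (p + t *\<^sub>R axis j 1) $ k / (2 * (p$i - ev k))) has_real_derivative
              T j p $ k / (2 * (p$i - ev k))) (at 0)"
            by (rule DERIV_cdivide) (rule deriv[OF Om[OF p]])
          moreover have "1 / Psi p $ k * T i p $ k * T j p $ k = T j p $ k / (2 * (p$i - ev k))"
            using Psi_pos[OF Om[OF p], of k] by (simp add: T_ev[of i])
          ultimately show "((\<lambda>t. T i (p + t *\<^sub>R axis j 1) $ k) has_real_derivative
              (\<chi> k. 1 / Psi p $ k * T i p $ k * T j p $ k) $ k) (at 0)"
            by (simp only: T_ev[of i] vec_lambda_beta)
        qed
        show "T j p - T i p = (2 * (p $ i - p $ j)) *\<^sub>R (\<chi> k. 1 / Psi p $ k * T i p $ k * T j p $ k)"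
          if p: "p \<in> Om" and ij: "i \<noteq> j" for p i j
          unfolding vec_eq_iff
        proof
          fix k
          show "(T j p - T i p) $ k = ((2 * (p $ i - p $ j)) *\<^sub>R (\<chi> k. 1 / Psi p $ k * T i p $ k * T j p $ k)) $ k"
            unfolding vector_minus_component vector_scaleR_component vec_lambda_beta T_ev real_scaleR_def
            by (rule confocal_difference[OF _ sep[OF Om[OF p]] sep[OF Om[OF p]]])
               (use Psi_pos[OF Om[OF p], of k] in simp)
        qed
        show "\<exists>al be. depends_only (- {j}) al \<and> depends_only (- {i}) be \<and>
            (\<forall>p\<in>Om. (p $ i - p $ j) * (pot (Psi p) - E) = al p + be p)" if "i \<noteq> j" for i j
          by (rule forms(2)[OF _ _ _ _ _ _ _ _ cf that])
        show "real_polynomial_function (\<lambda>q. ((3 * q $ l) *\<^sub>R axis k 1 - (3 * q $ k) *\<^sub>R (axis l 1 :: pt)) $ i)" for k l i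
          by simp (intro polynomial_intros)
        have q_nz: "q $ k \<noteq> 0" if "q \<in> N" for q k
        proof -
          have "Psi (v q) $ k > 0" using Psi_pos dom that by blast
          then show ?thesis by (simp add: Psi_v[OF that])
        qed
        \<comment> \<open>The denominators of \<open>de\<close> cancel against the off-diagonal
          entry \<open>q_k q_l\<close> of \<open>K\<close>, which makes \<open>L\<close>
          linear.\<close>
        show "((3 * q $ l) *\<^sub>R axis k 1 - (3 * q $ k) *\<^sub>R axis l 1) \<bullet> w
            = 3 * (w $ k * (1 / q $ k) - w $ l * (1 / q $ l)) * K q $ k $ l" if "q \<in> N" for q k l w
          using q_nz[OF that, of k] q_nz[OF that, of l]
          by (cases "k = l") (simp_all add: K_def inner_diff_left inner_axis' field_simps)
        show "\<exists>k l. k \<noteq> l \<and> K q $ k $ l \<noteq> 0" if "q \<in> N" for q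
          using q_nz[OF that] by (intro exI[of _ 1] exI[of _ 2]) (simp add: K_def)
      qed
    qed
    then show "\<not> complete_form \<and> (\<forall>i. \<not> partial_form i)" using forms(1) by blast
  qed
  then show ?thesis unfolding Psi_def[abs_def] \<Omega>_def .
qed

text \<open>Here the matrix with the coordinates as eigenvalues is affine in \<open>q\<close>, with
  off-diagonal entries only in the third row and column. Signs are regrouped so that
  \<open>conf\<close> can be reused.\<close>

lemma paraboloidal_obstructed:
  assumes ab: "a < b"
  shows "obstructed {u. u$1 < a \<and> a < u$2 \<and> u$2 < b \<and> b < u$3}
    (\<lambda>u. vector [2 * sqrt ((b - u$1) * (b - u$2) * (u$3 - b) / (b - a)),
                 2 * sqrt ((a - u$1) * (u$2 - a) * (u$3 - a) / (b - a)),
                 a + b - u$1 - u$2 - u$3])"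
proof -
  define Psi :: "pt \<Rightarrow> pt" where "Psi u = vector [2 * conf b (b - a) u, 2 * conf a (a - b) u,
    a + b - u$1 - u$2 - u$3]" for u
  define T :: "3 \<Rightarrow> pt \<Rightarrow> pt" where "T i p = vector [Psi p $ 1 / (2 * (p$i - b)), Psi p $ 2 / (2 * (p$i - a)), -1]" for i p
  define \<Omega> :: "pt set" where "\<Omega> = {u. u$1 < a \<and> a < u$2 \<and> u$2 < b \<and> b < u$3}"
  have pos: "(p$1 - b) * (p$2 - b) * (p$3 - b) / (b - a) > 0"
    "(p$1 - a) * (p$2 - a) * (p$3 - a) / (a - b) > 0" if "p \<in> \<Omega>" for p
    using that ab by (simp_all add: \<Omega>_def zero_less_divide_iff zero_less_mult_iff mult_less_0_iff)
  have Psi_pos: "Psi p $ 1 > 0" "Psi p $ 2 > 0" if "p \<in> \<Omega>" for p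
    using pos[OF that] by (auto simp: Psi_def conf_def)
  have sep: "p$i \<noteq> a" "p$i \<noteq> b" if "p \<in> \<Omega>" for p i
    using exhaust_3[of i] that by (auto simp: \<Omega>_def)
  have dist: "p$i \<noteq> p$j" if "p \<in> \<Omega>" "i \<noteq> j" for p i j
    using exhaust_3[of i] exhaust_3[of j] that ab by (auto simp: \<Omega>_def)
  have sq: "(Psi p $ 1)\<^sup>2 = 4 * ((p$i - b) * (p$j - b) * (p$k - b) / (b - a))"
    "(Psi p $ 2)\<^sup>2 = 4 * ((p$i - a) * (p$j - a) * (p$k - a) / (a - b))"
    if "p \<in> \<Omega>" "i \<noteq> j" "i \<noteq> k" "j \<noteq> k" for p i j k
    unfolding prod_distinct_3[OF that(2-4), symmetric]
    by (simp_all add: Psi_def power_mult_distrib conf_sq[OF pos(1)[OF that(1)]] conf_sq[OF pos(2)[OF that(1)]])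
  have others: "\<exists>j k. i \<noteq> j \<and> i \<noteq> k \<and> j \<noteq> k" for i :: 3
    using third_index by metis
  have norm: "T i p \<bullet> T i p = (p$i - p$j) * (p$i - p$k) / ((p$i - a) * (p$i - b))"
    if p: "p \<in> \<Omega>" and jk: "i \<noteq> j" "i \<noteq> k" "j \<noteq> k" for p i j k
  proof -
    have nz: "p$i - a \<noteq> 0" "p$i - b \<noteq> 0" "a \<noteq> b" using sep[OF p, of i] ab by auto
    have N: "T i p \<bullet> T i p = (Psi p $ 1)\<^sup>2 / (4 * (p$i - b)\<^sup>2) + (Psi p $ 2)\<^sup>2 / (4 * (p$i - a)\<^sup>2) + 1"
      by (simp only: inner_vec_def sum_3 inner_real_def T_def vector_3 half_quotient_products mult_minus1 minus_minus)
    have E: "4 * x / (4 * y) = x / y" for x y :: real by simp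
    have F: "(p$i - b) * (p$j - b) * (p$k - b) / (b - a) / (p$i - b)\<^sup>2 = (p$j - b) * (p$k - b) / ((p$i - b) * (b - a))"
      "(p$i - a) * (p$j - a) * (p$k - a) / (a - b) / (p$i - a)\<^sup>2 = (p$j - a) * (p$k - a) / ((p$i - a) * (a - b))"
      using nz by (simp_all add: power2_eq_square)
    show ?thesis
      unfolding N sq[OF p jk] E F by (rule partial_fractions_two) (use nz in auto)
  qed
  define K :: "pt \<Rightarrow> real^3^3" where "K q = vector [vector [b, 0, (- 1 / 2) * q$1], vector [0, a, (- 1 / 2) * q$2],
    vector [(- 1 / 2) * q$1, (- 1 / 2) * q$2, - q$3]]" for q
  have K_mult: "K q *v w = vector [b * w$1 - q$1 / 2 * w$3, a * w$2 - q$2 / 2 * w$3,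
      - q$1 / 2 * w$1 - q$2 / 2 * w$2 - q$3 * w$3]" for q w
    by (simp add: K_def vec_eq_iff forall_3 matrix_vector_mult_def sum_3)
  have eig: "K (Psi p) *v T i p = p$i *\<^sub>R T i p" if p: "p \<in> \<Omega>" for p i
  proof -
    obtain j k where jk: "i \<noteq> j" "i \<noteq> k" "j \<noteq> k" using others by blast
    have nz: "p$i - a \<noteq> 0" "p$i - b \<noteq> 0" "b - a \<noteq> 0" using sep[OF p, of i] ab by auto
    have "Psi p $ 3 = a + b - p$i - p$j - p$k"
    proof -
      have "\<forall>i j k :: 3. i \<noteq> j \<longrightarrow> i \<noteq> k \<longrightarrow> j \<noteq> k \<longrightarrow> a + b - p$1 - p$2 - p$3 = a + b - p$i - p$j - p$k"
        by (simp add: forall_3)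
      then show ?thesis using jk by (simp add: Psi_def)
    qed
    moreover have "Psi p $ 1 / 2 * (Psi p $ 1 / (2 * (p$i - b))) + Psi p $ 2 / 2 * (Psi p $ 2 / (2 * (p$i - a)))
      = a + b - p$j - p$k"
    proof -
      have "Psi p $ 1 / 2 * (Psi p $ 1 / (2 * (p$i - b))) = (Psi p $ 1)\<^sup>2 / (4 * (p$i - b))"
        "Psi p $ 2 / 2 * (Psi p $ 2 / (2 * (p$i - a))) = (Psi p $ 2)\<^sup>2 / (4 * (p$i - a))"
        by (simp_all add: power2_eq_square)
      moreover have "(Psi p $ 1)\<^sup>2 / (4 * (p$i - b)) = (p$j - b) * (p$k - b) / (b - a)"
        "(Psi p $ 2)\<^sup>2 / (4 * (p$i - a)) = - ((p$j - a) * (p$k - a) / (b - a))"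
      proof -
        have E: "4 * (x * y * z / t) / (4 * x) = y * z / t" if "x \<noteq> 0" for x y z t :: real
          using that by simp
        show "(Psi p $ 1)\<^sup>2 / (4 * (p$i - b)) = (p$j - b) * (p$k - b) / (b - a)"
          unfolding sq[OF p jk] by (rule E[OF nz(2)])
        show "(Psi p $ 2)\<^sup>2 / (4 * (p$i - a)) = - ((p$j - a) * (p$k - a) / (b - a))"
          unfolding sq[OF p jk] E[OF nz(1)] by (rule divide_diff_flip)
      qed
      moreover have "(p$j - b) * (p$k - b) / (b - a) + - ((p$j - a) * (p$k - a) / (b - a))
         = ((p$j - b) * (p$k - b) - (p$j - a) * (p$k - a)) / (b - a)" by (simp add: diff_divide_distrib)
      moreover have "(p$j - b) * (p$k - b) - (p$j - a) * (p$k - a) = (a + b - p$j - p$k) * (b - a)" by algebra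
      ultimately show ?thesis using nz by simp
    qed
    moreover have "b * (x / (2 * (p$i - b))) + x / 2 = p$i * (x / (2 * (p$i - b)))" for x
      using nz by (simp add: field_simps)
    moreover have "a * (x / (2 * (p$i - a))) + x / 2 = p$i * (x / (2 * (p$i - a)))" for x
      using nz by (simp add: field_simps)
    ultimately show ?thesis unfolding K_mult by (simp add: vec_eq_iff forall_3 T_def)
  qed
  have K_sym: "transpose (K q) = K q" for q
    by (simp add: K_def transpose_def vec_eq_iff forall_3)
  have deriv: "((\<lambda>s. Psi (p + s *\<^sub>R axis i 1) $ k) has_real_derivative T i p $ k) (at 0)" if p: "p \<in> \<Omega>" for p i k
  proof -
    have 1: "((\<lambda>s. Psi (p + s *\<^sub>R axis i 1) $ 1) has_real_derivative T i p $ 1) (at 0)"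
      using DERIV_cmult[OF DERIV_conf[OF pos(1)[OF p], of i], of 2] by (simp add: Psi_def T_def)
    have 2: "((\<lambda>s. Psi (p + s *\<^sub>R axis i 1) $ 2) has_real_derivative T i p $ 2) (at 0)"
      using DERIV_cmult[OF DERIV_conf[OF pos(2)[OF p], of i], of 2] by (simp add: Psi_def T_def)
    have "Psi (p + s *\<^sub>R axis i 1) $ 3 = Psi p $ 3 - s" for s
      using exhaust_3[of i] by (auto simp: Psi_def axis_def)
    then have 3: "((\<lambda>s. Psi (p + s *\<^sub>R axis i 1) $ 3) has_real_derivative T i p $ 3) (at 0)"
      by (auto simp: T_def intro!: derivative_eq_intros)
    show ?thesis using exhaust_3[of k] 1 2 3 by blast
  qed
  \<comment> \<open>The third component of every \<open>T i\<close> is the constant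
    \<open>-1\<close>, so its mixed derivative and the corresponding \<open>de\<close> are
    zero.\<close>
  define de :: "pt \<Rightarrow> 3 \<Rightarrow> real" where "de q k = (if k = 3 then 0 else 1 / q $ k)" for q k
  have de: "de q 1 = 1 / q $ 1" "de q 2 = 1 / q $ 2" "de q 3 = 0" for q by (simp_all add: de_def)
  define l :: "3 \<Rightarrow> 3 \<Rightarrow> pt" where "l i j = (if j = 3 \<and> i \<noteq> 3 then - axis i 1 else if i = 3 \<and> j \<noteq> 3 then axis j 1 else 0)" for i j
  have "obstructed \<Omega> Psi"
  proof (rule obstructedI[where T=T])
    fix p i k assume "p \<in> \<Omega>"
    then show "((\<lambda>s. Psi (p + s *\<^sub>R axis i 1) $ k) has_real_derivative T i p $ k) (at 0)" by (rule deriv)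
  next
    fix b' :: "3 \<times> bool \<Rightarrow> pt" and d N E v G
    assume sp: "separated_potential b' d N Psi v G T" and dom: "v ` N \<subseteq> \<Omega>"
    interpret separated_potential b' d N E Psi v G T by (rule sp)
    have Om: "p \<in> \<Omega>" if "p \<in> Om" for p using that dom by (auto simp: Om_def)
    have orth: "T i p \<bullet> T j p = 0" if "p \<in> Om" "i \<noteq> j" for p i j
      by (rule eigenvectors_orthogonal[OF K_sym eig[OF Om] eig[OF Om] dist[OF Om]]) (rule that)+
    define P where "P i p = (p$i - a) * (p$i - b)" for i and p :: pt
    have P: "depends_only {i} (P i)" for i by (simp add: depends_only_def P_def)
    have norms: "P i p \<noteq> 0 \<and> T i p \<bullet> T i p = (p $ i - p $ j) * (p $ i - p $ k) / P i p"
      if "p \<in> Om" "i \<noteq> j" "i \<noteq> k" "j \<noteq> k" for p i j k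
      using norm[OF Om[OF that(1)] that(2-4)] sep[OF Om[OF that(1)], of i] by (simp add: P_def)
    have dist': "p $ i \<noteq> p $ j" if "p \<in> Om" "i \<noteq> j" for p i j by (rule dist[OF Om]) (rule that)+
    note forms = confocal_forms[OF orth P dist' norms]
    have "\<not> complete_form"
    proof
      assume cf: complete_form
      show False
      proof (rule no_confocal_separation[where K=K and de=de and L="\<lambda>q i j. (3 / 2) *\<^sub>R l i j"])
        have "\<forall>k l. real_polynomial_function (\<lambda>q. K q $ k $ l)"
          by (simp only: forall_3 K_def vector_3) (intro conjI polynomial_intros)
        then show "real_polynomial_function (\<lambda>q. K q $ k $ l)" for k l by blast
        show "transpose (K q) = K q" for q by (rule K_sym)
        show "K (Psi p) *v T i p = p $ i *\<^sub>R T i p" if "p \<in> Om" for p i by (rule eig[OF Om[OF that]])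
        show "p $ i \<noteq> p $ j" if "p \<in> Om" "i \<noteq> j" for p i j by (rule dist'[OF that])
        show "((\<lambda>t. T i (p + t *\<^sub>R axis j 1)) has_vector_derivative
            (\<chi> k. de (Psi p) k * T i p $ k * T j p $ k)) (at 0)" if p: "p \<in> Om" and ij: "i \<noteq> j" for p i j
        proof (rule has_vector_derivative_component)
          fix k
          have c: "(p + t *\<^sub>R axis j 1) $ i = p $ i" for t using ij by (simp add: axis_def)
          have q: "Psi p $ 1 \<noteq> 0" "Psi p $ 2 \<noteq> 0" using Psi_pos[OF Om[OF p]] by simp_all
          have 1: "((\<lambda>t. Psi (p + t *\<^sub>R axis j 1) $ 1 / (2 * (p$i - b))) has_real_derivative T j p $ 1 / (2 * (p$i - b))) (at 0)"
            "((\<lambda>t. Psi (p + t *\<^sub>R axis j 1) $ 2 / (2 * (p$i - a))) has_real_derivative T j p $ 2 / (2 * (p$i - a))) (at 0)"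
            by (rule DERIV_cdivide, rule deriv[OF Om[OF p]])+
          have T_i: "T i (p + t *\<^sub>R axis j 1) $ 1 = Psi (p + t *\<^sub>R axis j 1) $ 1 / (2 * (p$i - b))"
            "T i (p + t *\<^sub>R axis j 1) $ 2 = Psi (p + t *\<^sub>R axis j 1) $ 2 / (2 * (p$i - a))"
            "T i (p + t *\<^sub>R axis j 1) $ 3 = - 1" for t unfolding T_def c by simp_all
          have e: "de (Psi p) 1 * T i p $ 1 * T j p $ 1 = T j p $ 1 / (2 * (p$i - b))"
            "de (Psi p) 2 * T i p $ 2 * T j p $ 2 = T j p $ 2 / (2 * (p$i - a))"
            "de (Psi p) 3 * T i p $ 3 * T j p $ 3 = 0"
            using q by (simp_all add: de T_def[of i])
          have "\<forall>k. ((\<lambda>t. T i (p + t *\<^sub>R axis j 1) $ k) has_real_derivative de (Psi p) k * T i p $ k * T j p $ k) (at 0)"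
            unfolding forall_3 e T_i using 1 by simp
          then show "((\<lambda>t. T i (p + t *\<^sub>R axis j 1) $ k) has_real_derivative
              (\<chi> k. de (Psi p) k * T i p $ k * T j p $ k) $ k) (at 0)" by simp
        qed
        show "T j p - T i p = (2 * (p $ i - p $ j)) *\<^sub>R (\<chi> k. de (Psi p) k * T i p $ k * T j p $ k)"
          if p: "p \<in> Om" and ij: "i \<noteq> j" for p i j
        proof -
          have q: "Psi p $ 1 \<noteq> 0" "Psi p $ 2 \<noteq> 0" using Psi_pos[OF Om[OF p]] by simp_all
          show ?thesis
            using confocal_difference[OF q(1) sep(2)[OF Om[OF p]] sep(2)[OF Om[OF p]]]
              confocal_difference[OF q(2) sep(1)[OF Om[OF p]] sep(1)[OF Om[OF p]]]
            by (simp only: vec_eq_iff forall_3 T_def vector_3 vector_minus_component vector_scaleR_component vec_lambda_beta de real_scaleR_def) simp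
        qed
        show "\<exists>al be. depends_only (- {j}) al \<and> depends_only (- {i}) be \<and>
            (\<forall>p\<in>Om. (p $ i - p $ j) * (pot (Psi p) - E) = al p + be p)" if "i \<noteq> j" for i j
          by (rule forms(2)[OF _ _ _ _ _ _ _ _ cf that])
        show "real_polynomial_function (\<lambda>q. ((3 / 2) *\<^sub>R l k m) $ i)" for k m i
          by (rule polynomial_intros)
        have q_nz: "q $ 1 \<noteq> 0" "q $ 2 \<noteq> 0" if "q \<in> N" for q
        proof -
          have "Psi (v q) $ 1 > 0" "Psi (v q) $ 2 > 0" using Psi_pos dom that by blast+
          then show "q $ 1 \<noteq> 0" "q $ 2 \<noteq> 0" by (simp_all add: Psi_v[OF that])
        qed
        show "((3 / 2) *\<^sub>R l k m) \<bullet> w = 3 * (w $ k * de q k - w $ m * de q m) * K q $ k $ m" if "q \<in> N" for q k m w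
        proof -
          have "\<forall>k m. ((3 / 2) *\<^sub>R l k m) \<bullet> w = 3 * (w $ k * de q k - w $ m * de q m) * K q $ k $ m"
            unfolding forall_3 using q_nz[OF that] by (simp add: l_def de K_def inner_axis')
          then show ?thesis by blast
        qed
        show "\<exists>k m. k \<noteq> m \<and> K q $ k $ m \<noteq> 0" if "q \<in> N" for q
          using q_nz[OF that] by (intro exI[of _ 1] exI[of _ 3]) (simp add: K_def)
      qed
    qed
    then show "\<not> complete_form \<and> (\<forall>i. \<not> partial_form i)" using forms(1) by blast
  qed
  moreover have "Psi = (\<lambda>u. vector [2 * sqrt ((b - u$1) * (b - u$2) * (u$3 - b) / (b - a)),
                 2 * sqrt ((a - u$1) * (u$2 - a) * (u$3 - a) / (b - a)), a + b - u$1 - u$2 - u$3])"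
  proof -
    have "(x - b) * (y - b) * (z - b) / (b - a) = (b - x) * (b - y) * (z - b) / (b - a)" for x y z
      by (simp add: algebra_simps)
    moreover have "(x - a) * (y - a) * (z - a) / (a - b) = (a - x) * (y - a) * (z - a) / (b - a)" for x y z
    proof -
      have "(a - x) * (y - a) * (z - a) = - ((x - a) * (y - a) * (z - a))" by algebra
      then show ?thesis by (simp only: divide_diff_flip[of _ a b] minus_divide_left)
    qed
    ultimately show ?thesis by (intro ext) (simp only: Psi_def conf_def)
  qed
  ultimately show ?thesis by (simp only: \<Omega>_def)
qed

section \<open>The half roots of D3\<close>

lemma half_root_half_integer: "\<exists>n::int. half_root r $ i = n / 2"
proof -
  have "\<forall>r. \<forall>i. half_root r $ i \<in> {0, 1 / 2, - (1 / 2)}"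
    unfolding forall_half_root[of "\<lambda>v. \<forall>i. v $ i \<in> {0, 1 / 2, - (1 / 2)}"] by (simp add: forall_3)
  then have "half_root r $ i \<in> {0, 1 / 2, - (1 / 2)}" by blast
  then consider "half_root r $ i = of_int 0 / 2" | "half_root r $ i = of_int 1 / 2"
    | "half_root r $ i = of_int (- 1) / 2" by auto
  then show ?thesis by cases blast+
qed

lemma half_root_quarter: "\<exists>m::int. half_root r \<bullet> half_root s = m / 4"
proof -
  have "\<forall>i. \<exists>n::int. half_root r $ i = n / 2" for r using half_root_half_integer by blast
  then obtain n where n: "\<And>r i. half_root r $ i = of_int (n r i) / 2" by metis
  have "half_root r \<bullet> half_root s = of_int (\<Sum>i\<in>UNIV. n r i * n s i) / 4"
    by (simp add: inner_vec_def n sum_divide_distrib)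
  then show ?thesis by blast
qed

lemma half_root_unit: "half_root r \<bullet> half_root r = 1 / 2"
proof -
  have "\<forall>r. half_root r \<bullet> half_root r = 1 / 2"
    unfolding forall_half_root[of "\<lambda>v. v \<bullet> v = 1 / 2"] by (simp add: inner_vec_def sum_3)
  then show ?thesis by blast
qed

text \<open>The right side is the orthogonal projection to the line of \<open>half_root s\<close>,
  so this says that distinct half roots are not parallel.\<close>

lemma half_root_indep:
  assumes "r \<noteq> s"
  shows "half_root r \<noteq> (2 * (half_root r \<bullet> half_root s)) *\<^sub>R half_root s"
proof -
  have "\<forall>r s. r \<noteq> s \<longrightarrow> half_root r \<noteq> (2 * (half_root r \<bullet> half_root s)) *\<^sub>R half_root s"
    unfolding split_paired_All forall_3 all_bool_eq half_root_simps
    by (simp add: inner_vec_def sum_3 vec_eq_iff forall_3)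
  then show ?thesis using assms by blast
qed

lemma half_root_star:
  assumes "w \<bullet> half_root (1, True) = 0" "w \<bullet> half_root (2, True) = 0" "w \<bullet> half_root (3, True) = 0"
  shows "w = 0"
  using assms by (simp add: half_root_simps inner_vec_def sum_3 vec_eq_iff forall_3)

text \<open>A motion preserves inner products of the half roots and only shifts the phases.\<close>

lemma trig_potential_motion:
  assumes R: "orthogonal_matrix R" and N: "open N" "N \<noteq> {}"
    and nz: "\<And>q r. q \<in> N \<Longrightarrow> sin (half_root r \<bullet> (R *v q + t)) \<noteq> 0"
  shows "trig_potential (\<lambda>r. transpose R *v half_root r) (\<lambda>r. half_root r \<bullet> t) N"
proof -
  have adj: "(transpose R *v h) \<bullet> q = h \<bullet> (R *v q)" for h q
    by (metis dot_lmul_matrix transpose_matrix_vector)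
  have RR: "R *v (transpose R *v h) = h" for h
    using R by (simp add: orthogonal_matrix_def matrix_vector_mul_assoc del: transpose_matrix_vector)
  have RR': "transpose R *v (R *v h) = h" for h
    using R by (simp add: orthogonal_matrix_def matrix_vector_mul_assoc del: transpose_matrix_vector)
  have inner: "(transpose R *v g) \<bullet> (transpose R *v h) = g \<bullet> h" for g h
    unfolding adj RR ..
  show ?thesis
  proof
    show "sin ((transpose R *v half_root r) \<bullet> q + half_root r \<bullet> t) \<noteq> 0" if "q \<in> N" for q r
      using nz[OF that, of r] unfolding adj inner_add_right .
    show "(transpose R *v half_root r) \<bullet> (transpose R *v half_root r) = 1 / 2" for r
      unfolding inner by (rule half_root_unit)
    show "\<exists>m::int. (transpose R *v half_root r) \<bullet> (transpose R *v half_root s) = m / 4" for r s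
      unfolding inner by (rule half_root_quarter)
    show "transpose R *v half_root r \<noteq> (2 * ((transpose R *v half_root r) \<bullet> (transpose R *v half_root s)))
        *\<^sub>R (transpose R *v half_root s)" if "r \<noteq> s" for r s
    proof
      assume "transpose R *v half_root r = (2 * ((transpose R *v half_root r) \<bullet> (transpose R *v half_root s)))
        *\<^sub>R (transpose R *v half_root s)"
      from arg_cong[OF this, of "\<lambda>x. R *v x"]
      have "half_root r = (2 * (half_root r \<bullet> half_root s)) *\<^sub>R half_root s"
        by (simp only: inner RR matrix_vector_mult_scaleR)
      then show False using half_root_indep[OF that] by blast
    qed
    \<comment> \<open>The three half roots with plus sign are independent, with pairwise inner
      products \<open>1/4\<close>.\<close>
    show "\<exists>J j0. j0 \<in> J \<and> (\<forall>j\<in>J. (transpose R *v half_root j0) \<bullet> (transpose R *v half_root j) \<noteq> 0) \<and>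
       (\<forall>w. (\<forall>j\<in>J. w \<bullet> (transpose R *v half_root j) = 0) \<longrightarrow> w = 0)"
    proof (intro exI[of _ "{(1, True), (2, True), (3, True)}"] exI[of _ "(1, True)"] conjI allI impI)
      show "\<forall>j\<in>{(1, True), (2, True), (3, True)}.
          (transpose R *v half_root (1, True)) \<bullet> (transpose R *v half_root j) \<noteq> 0"
        unfolding inner by (simp add: half_root_simps inner_vec_def sum_3)
      fix w assume *: "\<forall>j\<in>{(1, True), (2, True), (3, True)}. w \<bullet> (transpose R *v half_root j) = 0"
      have "w \<bullet> (transpose R *v h) = (R *v w) \<bullet> h" for h
        using adj[of h w] by (simp only: inner_commute)
      then have "R *v w = 0"
        using * by (intro half_root_star) simp_all
      then show "w = 0" using RR'[of w] by (metis matrix_vector_mult_0_right)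
    qed simp
  qed (rule N)+
qed

text \<open>On \<open>N\<close> the map \<open>X\<close>, a motion followed by
  \<open>orbit_map\<close>, inverts the Cartesian chart. The coordinates \<open>u\<close> become
  \<open>v = u o X\<close> with inverse \<open>Psi\<close>, and \<open>separation_symbol\<close>
  puts the trigonometric potential into one of the two forms that \<open>obstructed\<close>
  excludes.\<close>

theorem not_solvable_by_separation:
  assumes systems: "\<And>\<Omega> Psi. separation_system \<Omega> Psi \<Longrightarrow> obstructed \<Omega> Psi"
  shows "\<not> solvable_by_separation cometric (schroedinger_op cometric potential) E"
proof
  assume "solvable_by_separation cometric (schroedinger_op cometric potential) E"
  then obtain W u Y \<Omega> Psi where chart: "cartesian_chart cometric W Y" and sys: "separation_system \<Omega> Psi"
    and u: "smooth_map_on W u" "u ` W \<subseteq> \<Omega>" and PsiY: "\<forall>x\<in>W. Psi (u x) = Y x"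
    and sep: "separates_completely (shifted_op E) u W \<or> separates_partially (shifted_op E) u W"
    unfolding solvable_by_separation_def separation_chart_def by (elim exE conjE) (rule that; assumption)
  have W: "open W" "W \<subseteq> nondeg_region cometric"
    using chart pos_region_subset unfolding cartesian_chart_def by auto
  obtain R t N where R: "orthogonal_matrix R" and N: "open N" "N \<noteq> {}"
    and in_W0: "\<And>q. q \<in> N \<Longrightarrow> orbit_map (R *v q + t) \<in> W"
    and Y: "\<And>q. q \<in> N \<Longrightarrow> Y (orbit_map (R *v q + t)) = q"
    using cartesian_chart_inverse[OF chart] by metis
  define X where "X q = orbit_map (R *v q + t)" for q
  have in_W: "X q \<in> W" if "q \<in> N" for q using in_W0[OF that] by (simp add: X_def)
  define v where "v q = u (X q)" for q
  define b d where "b r = transpose R *v half_root r" and "d r = half_root r \<bullet> t" for r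
  have br: "b r \<bullet> q + d r = half_root r \<bullet> (R *v q + t)" for r q
    unfolding b_def d_def inner_add_right by (metis dot_lmul_matrix transpose_matrix_vector)
  have disc: "disc (orbit_map (R *v q + t)) \<noteq> 0" if "q \<in> N" for q
    using disc_nz W(2) in_W0[OF that] by blast
  have trig: "trig_potential b d N"
    unfolding b_def[abs_def] d_def[abs_def]
    by (rule trig_potential_motion[OF R N]) (rule potential_orbit_map(2)[OF disc])
  define J where "J q = orbit_jac (R *v q + t) ** R" for q
  define g where "g i x = (\<chi> a. pd a (\<lambda>z. u z $ i) x)" for i x
  \<comment> \<open>The gradient of the \<open>i\<close>-th coordinate in flat space. Its length
    equals that of \<open>u_i\<close> in the metric because \<open>J\<close> times its transpose is
    \<open>cometric\<close>.\<close>
  define G where "G i q = transpose (J q) *v g i (X q)" for i q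
  have adjJ: "(transpose A *v x) \<bullet> y = x \<bullet> (A *v y)" for A :: "real^3^3" and x y
    by (metis dot_lmul_matrix transpose_matrix_vector)
  have X_der: "(X has_derivative (\<lambda>w. J q *v w)) (at q)" for q
  proof -
    have "((\<lambda>q. R *v q + t) has_derivative (\<lambda>w. R *v w)) (at q)"
      by (auto intro!: derivative_eq_intros bounded_linear_imp_has_derivative simp: linear_conv_bounded_linear[symmetric])
    from has_derivative_compose[OF this orbit_map_has_derivative]
    show ?thesis by (simp add: X_def[abs_def] J_def matrix_vector_mul_assoc)
  qed
  have G: "((\<lambda>q. v q $ i) has_derivative (\<lambda>w. G i q \<bullet> w)) (at q)" if "q \<in> N" for q i
  proof -
    have "(\<lambda>z. u z $ i) differentiable (at (X q))"
      using u(1) in_W[OF that] by (auto simp: smooth_map_on_def intro: smooth_on_differentiable)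
    from has_derivative_compose[OF X_der has_derivative_pd[OF this]]
    have "((\<lambda>q. u (X q) $ i) has_derivative (\<lambda>w. g i (X q) \<bullet> (J q *v w))) (at q)"
      by (simp add: g_def inner_vec_def mult.commute)
    then show ?thesis by (simp only: v_def[abs_def] G_def adjJ)
  qed
  have JJ: "J q ** transpose (J q) = cometric (X q)" for q
  proof -
    have "J q ** transpose (J q) = orbit_jac (R *v q + t) ** (R ** transpose R) ** transpose (orbit_jac (R *v q + t))"
      by (simp only: J_def matrix_transpose_mul matrix_mul_assoc)
    then show ?thesis
      using R by (simp add: orthogonal_matrix_def orbit_jac_gram X_def)
  qed
  have Gsq: "G i q \<bullet> G i q = grad_sq u i (X q)" for i q
  proof -
    have "G i q \<bullet> G i q = g i (X q) \<bullet> ((J q ** transpose (J q)) *v g i (X q))"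
      unfolding G_def adjJ by (simp only: matrix_vector_mul_assoc)
    then show ?thesis
      unfolding JJ by (simp add: grad_sq_def inner_vec_def matrix_vector_mult_def g_def sum_distrib_left ac_simps)
  qed
  obtain T where T: "\<forall>p\<in>\<Omega>. \<forall>i. ((\<lambda>s. Psi (p + s *\<^sub>R axis i 1)) has_vector_derivative T i p) (at 0)"
    and obs: "\<forall>(b :: 3 \<times> bool \<Rightarrow> pt) d N E v G. separated_potential b d N Psi v G T \<longrightarrow> v ` N \<subseteq> \<Omega> \<longrightarrow>
        \<not> separated_potential.complete_form b d N E Psi v G \<and>
        (\<forall>i. \<not> separated_potential.partial_form b d N E Psi v G i)"
    using systems[OF sys] unfolding obstructed_def by (elim exE conjE) (rule that; assumption)
  have vN: "v ` N \<subseteq> \<Omega>" using u(2) in_W by (auto simp: v_def)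
  have sp: "separated_potential b d N Psi v G T"
  proof (intro separated_potential.intro separated_potential_axioms.intro trig G)
    show "Psi (v q) = q" if "q \<in> N" for q
      using PsiY in_W[OF that] Y[OF that] by (simp add: v_def X_def)
    show "((\<lambda>s. Psi (p + s *\<^sub>R axis i 1)) has_vector_derivative T i p) (at 0)" if "p \<in> v ` N" for p i
      using T vN that by blast
  qed
  interpret separated_potential b d N E Psi v G T by (rule sp)
  have pot: "pot q = potential (X q)" if "q \<in> N" for q
    unfolding pot_def br X_def potential_orbit_map(1)[OF disc[OF that]] ..
  have gam: "gam i (v q) = grad_sq u i (X q)" "gam i (v q) \<noteq> 0" if "q \<in> N" for q i
  proof -
    show 1: "gam i (v q) = grad_sq u i (X q)" by (simp add: gam_def Psi_v[OF that] Gsq)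
    have "G i q \<noteq> 0"
      using G_T[OF in_N_param[OF that], of i i] by (auto simp: Psi_v[OF that])
    then show "gam i (v q) \<noteq> 0" by (simp add: gam_def Psi_v[OF that])
  qed
  have coeff: "- c / a * y = F * c" if "y = - (F * a)" "y \<noteq> 0" for a c F y :: real
    using that by (simp add: field_simps)
  from sep show False
  proof
    assume "separates_completely (shifted_op E) u W"
    then have into: "separates_into {{1}, {2}, {3}} (shifted_op E) u W" by (simp only: separates_completely_def)
    obtain F a c where a: "\<And>B. B \<in> {{1}, {2}, {3}} \<Longrightarrow> depends_only B (a B)"
      and c: "\<And>B. B \<in> {{1}, {2}, {3}} \<Longrightarrow> depends_only B (c B)"
      and V: "\<And>x. x \<in> W \<Longrightarrow> potential x - E = (\<Sum>B\<in>{{1}, {2}, {3}}. F B x * c B (u x))"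
      and S: "\<And>x B i. x \<in> W \<Longrightarrow> B \<in> {{1}, {2}, {3}} \<Longrightarrow> i \<in> B \<Longrightarrow> grad_sq u i x = - (F B x * a B (u x) $ i $ i)"
    proof (rule separation_symbol[OF into _ W u(1)])
      show "finite {{1}, {2}, {3}}" by simp
    next
      fix F a c
      assume "\<And>B. B \<in> {{1}, {2}, {3}} \<Longrightarrow> depends_only B (a B)" "\<And>B. B \<in> {{1}, {2}, {3}} \<Longrightarrow> depends_only B (c B)"
        "\<And>x. x \<in> W \<Longrightarrow> potential x - E = (\<Sum>B\<in>{{1}, {2}, {3}}. F B x * c B (u x))"
        "\<And>x B i. x \<in> W \<Longrightarrow> B \<in> {{1}, {2}, {3}} \<Longrightarrow> i \<in> B \<Longrightarrow> grad_sq u i x = - (F B x * a B (u x) $ i $ i)"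
      then show thesis by (rule that[where F=F and a=a and c=c])
    qed
    have all3: "{i} \<in> {{1}, {2}, {3 :: 3}}" for i using exhaust_3[of i] by auto
    \<comment> \<open>The multiplier \<open>F\<close> is eliminated between \<open>V\<close> and
      \<open>S\<close>; a quotient of coefficients depending on one variable remains.\<close>
    define f where "f i p = - c {i} p / a {i} p $ i $ i" for i p
    have "complete_form"
      unfolding complete_form_def
    proof (intro exI[of _ f] conjI allI ballI)
      show "depends_only {i} (f i)" for i
        unfolding f_def[abs_def]
        by (rule depends_only_combine[where F="\<lambda>x y. - x / y $ i $ i", OF c[OF all3] a[OF all3]]) simp_all
      fix p assume "p \<in> Om"
      then obtain q where q: "q \<in> N" "p = v q" by (auto simp: Om_def)
      have nz: "grad_sq u i (X q) \<noteq> 0" for i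
        using gam(2)[OF q(1), of i] unfolding gam(1)[OF q(1)] .
      have Si: "grad_sq u i (X q) = - (F {i} (X q) * a {i} (v q) $ i $ i)" for i
        unfolding v_def by (rule S[OF in_W[OF q(1)] all3]) simp
      have fi: "f i p * gam i p = F {i} (X q) * c {i} (v q)" for i
        unfolding f_def q(2) gam(1)[OF q(1)] by (rule coeff[OF Si nz])
      have "pot (Psi p) - E = (\<Sum>B\<in>{{1}, {2}, {3}}. F B (X q) * c B (u (X q)))"
        unfolding q(2) Psi_v[OF q(1)] pot[OF q(1)] by (rule V[OF in_W[OF q(1)]])
      also have "\<dots> = (\<Sum>i\<in>UNIV. f i p * gam i p)"
        unfolding fi by (simp add: sum_3 v_def)
      finally show "pot (Psi p) - E = (\<Sum>i\<in>UNIV. f i p * gam i p)" .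
    qed
    then show False using obs[rule_format, OF sp vN, of E] by blast
  next
    assume "separates_partially (shifted_op E) u W"
    then obtain i where into: "separates_into {{i}, - {i}} (shifted_op E) u W"
      unfolding separates_partially_def by blast
    obtain F a c where a: "\<And>B. B \<in> {{i}, - {i}} \<Longrightarrow> depends_only B (a B)"
      and c: "\<And>B. B \<in> {{i}, - {i}} \<Longrightarrow> depends_only B (c B)"
      and V: "\<And>x. x \<in> W \<Longrightarrow> potential x - E = (\<Sum>B\<in>{{i}, - {i}}. F B x * c B (u x))"
      and S: "\<And>x B j. x \<in> W \<Longrightarrow> B \<in> {{i}, - {i}} \<Longrightarrow> j \<in> B \<Longrightarrow> grad_sq u j x = - (F B x * a B (u x) $ j $ j)"
    proof (rule separation_symbol[OF into _ W u(1)])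
      show "finite {{i}, - {i}}" by simp
    next
      fix F a c
      assume "\<And>B. B \<in> {{i}, - {i}} \<Longrightarrow> depends_only B (a B)" "\<And>B. B \<in> {{i}, - {i}} \<Longrightarrow> depends_only B (c B)"
        "\<And>x. x \<in> W \<Longrightarrow> potential x - E = (\<Sum>B\<in>{{i}, - {i}}. F B x * c B (u x))"
        "\<And>x B j. x \<in> W \<Longrightarrow> B \<in> {{i}, - {i}} \<Longrightarrow> j \<in> B \<Longrightarrow> grad_sq u j x = - (F B x * a B (u x) $ j $ j)"
      then show thesis by (rule that[where F=F and a=a and c=c])
    qed
    have ne: "{i} \<noteq> - {i}" by auto
    define f where "f p = - c {i} p / a {i} p $ i $ i" for p
    \<comment> \<open>Both variables of the block share the multiplier \<open>F (- {i})\<close>, so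
      either squared gradient can represent the term.\<close>
    define g' where "g' j p = - c (- {i}) p / a (- {i}) p $ j $ j" for j p
    have "partial_form i"
      unfolding partial_form_def
    proof (rule exI[of _ f], rule exI[of _ g'], rule exI[of _ "\<lambda>j p. a (- {i}) p $ j $ j"], intro conjI allI ballI impI)
      show "depends_only {i} f"
        unfolding f_def[abs_def]
        by (rule depends_only_combine[where F="\<lambda>x y. - x / y $ i $ i", OF c a]) simp_all
      show "depends_only (- {i}) (g' j)" for j
        unfolding g'_def[abs_def]
        by (rule depends_only_combine[where F="\<lambda>x y. - x / y $ j $ j", OF c a]) simp_all
      show "depends_only (- {i}) (\<lambda>p. a (- {i}) p $ j $ j)" for j
        by (rule depends_only_combine[where F="\<lambda>x y. x $ j $ j", OF a[of "- {i}"] a[of "- {i}"]]) simp_all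
      fix p assume "p \<in> Om"
      then obtain q where q: "q \<in> N" "p = v q" by (auto simp: Om_def)
      have Sj: "gam j p = - (F (- {i}) (X q) * a (- {i}) p $ j $ j)" if "j \<noteq> i" for j
        using S[OF in_W[OF q(1)], of "- {i}" j] that gam(1)[OF q(1), of j] by (simp add: q(2) v_def)
      have Si: "gam i p = - (F {i} (X q) * a {i} p $ i $ i)"
        using S[OF in_W[OF q(1)], of "{i}" i] gam(1)[OF q(1), of i] by (simp add: q(2) v_def)
      show "a (- {i}) p $ j $ j \<noteq> 0" if "j \<noteq> i" for j
        using Sj[OF that] gam(2)[OF q(1), of j] by (auto simp: q(2))
      have gnz: "gam j p \<noteq> 0" for j unfolding q(2) by (rule gam(2)[OF q(1)])
      have fi: "f p * gam i p = F {i} (X q) * c {i} p"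
        unfolding f_def by (rule coeff[OF Si gnz])
      have gj: "g' j p * gam j p = F (- {i}) (X q) * c (- {i}) p" if "j \<noteq> i" for j
        unfolding g'_def by (rule coeff[OF Sj[OF that] gnz])
      have "pot (Psi p) - E = (\<Sum>B\<in>{{i}, - {i}}. F B (X q) * c B (u (X q)))"
        unfolding q(2) Psi_v[OF q(1)] pot[OF q(1)] by (rule V[OF in_W[OF q(1)]])
      also have "\<dots> = F {i} (X q) * c {i} p + F (- {i}) (X q) * c (- {i}) p"
        using ne by (simp add: q(2) v_def)
      finally show "pot (Psi p) - E = f p * gam i p + g' j p * gam j p" if "j \<noteq> i" for j
        by (simp only: fi gj[OF that])
      show "gam j p * a (- {i}) p $ k $ k = gam k p * a (- {i}) p $ j $ j" if "j \<noteq> i" "k \<noteq> i" for j k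
        unfolding Sj[OF that(1)] Sj[OF that(2)] by simp
    qed
    then show False using obs[rule_format, OF sp vN, of E] by blast
  qed
qed

section \<open>Conclusion for all eleven systems\<close>

lemma separation_system_obstructed:
  assumes "separation_system \<Omega> Psi"
  shows "obstructed \<Omega> Psi"
  using assms
proof (cases rule: separation_system.cases)
  case cartesian
  show ?thesis unfolding cartesian(1,2) by (rule cartesian_obstructed)
next
  case circular_cylinder
  show ?thesis unfolding circular_cylinder(1,2) by (rule circular_cylinder_obstructed)
next
  case (elliptic_cylinder d)
  show ?thesis unfolding elliptic_cylinder(1,2) by (rule elliptic_cylinder_obstructed[OF elliptic_cylinder(3)])
next
  case parabolic_cylinder
  show ?thesis unfolding parabolic_cylinder(1,2) by (rule parabolic_cylinder_obstructed)
next
  case spherical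
  show ?thesis unfolding spherical(1,2) by (rule spherical_obstructed)
next
  case (conical a b c)
  show ?thesis unfolding conical(1,2) by (rule conical_obstructed[OF conical(3,4)])
next
  case parabolic
  show ?thesis unfolding parabolic(1,2) by (rule parabolic_obstructed)
next
  case (prolate_spheroidal d)
  show ?thesis unfolding prolate_spheroidal(1,2) by (rule prolate_spheroidal_obstructed[OF prolate_spheroidal(3)])
next
  case (oblate_spheroidal d)
  show ?thesis unfolding oblate_spheroidal(1,2) by (rule oblate_spheroidal_obstructed[OF oblate_spheroidal(3)])
next
  case (paraboloidal a b)
  show ?thesis unfolding paraboloidal(1,2) by (rule paraboloidal_obstructed[OF paraboloidal(3)])
next
  case (ellipsoidal a b c)
  show ?thesis
    unfolding ellipsoidal(1,2) by (rule ellipsoidal_obstructed[OF ellipsoidal(3,4), unfolded conf_def])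
qed

theorem mainTheorem2:
  "(\<exists>C L G U.
      (\<forall>i j. C i j = C j i) \<and>
      induces_metric (lie_algebraic_op (\<lambda>t. vf_op (affine_field t)) C L) G \<and>
      pos_region G \<noteq> {} \<and>
      smooth_on (nondeg_region G) U \<and>
      gauge_equivalent_on (nondeg_region G)
        (lie_algebraic_op (\<lambda>t. vf_op (affine_field t)) C L) (schroedinger_op G U) \<and>
      (\<forall>x\<in>pos_region G. \<forall>l i j k. riemann G l i j k x = 0) \<and>
      (\<forall>E. \<not> solvable_by_separation G (schroedinger_op G U) E))
   \<and> acts_primitively affine_field"
proof (intro conjI exI[of _ "sym_coeff quad_terms"] exI[of _ "lin_coeff lin_terms"]
    exI[of _ cometric] exI[of _ potential])
  show "\<forall>i j. sym_coeff quad_terms i j = sym_coeff quad_terms j i"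
    by (intro allI) (rule sym_coeff_sym)
  show "\<forall>x\<in>pos_region cometric. \<forall>l i j k. riemann cometric l i j k x = 0"
    using riemann_cometric pos_region_subset by blast
  show "\<forall>E. \<not> solvable_by_separation cometric (schroedinger_op cometric potential) E"
    using not_solvable_by_separation separation_system_obstructed by blast
qed (rule induces_metric_hamiltonian pos_region_nonempty smooth_potential gauge_hamiltonian
    acts_primitively_affine)+

end
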